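(* For each $n$ consider the logistic regression model with Gaussian design described in the context, in dimension $d_n$ and with ground truth vector $\theta_n^*\in\mathbb R^{d_n}$, where $|\theta_n^*|=\mathcal O(1)$ as $n\to\infty$. If $M_{0n}^*=\mathcal O(1)$, $\bar\delta^*_{01n}(s)=o(\sqrt n)$ for each $s\geq0$, and $d_n^2/n=o(1)$, then $\mathrm{TV}(\pi_{v_n},\gamma_n^* )\to0$ with probability tending to $1$ as $n\to\infty$; that is, for every $\epsilon>0$, the probability, with respect to the joint feature-label distribution, that the MLE exists uniquely and $\mathrm{TV}(\pi_{v_n},\gamma_n^* )\le\epsilon$ tends to $1$ as $n\to\infty$.
   Context: Model (for each $n$, with $d=d_n$, $\theta^*=\theta^*_n$; subscript $n$ suppressed on the other objects): $\psi(\omega)=\log(1+e^\omega)$, $\omega\in\mathbb R$; $X_1,\dots,X_n$ are i.i.d. $\mathcal N(0,I_d)$ and, conditionally on the $X_i$, the labels $Y_i\in\{0,1\}$ are independent with $Y_i\mid X_i\sim\mathrm{Bernoulli}(\psi'(X_i^\top\theta^* ))$. The parameter space is $\Theta=\mathbb R^d$. Normalized negative log likelihood: $\ell(\theta)=\frac1n\sum_{i=1}^n[\psi(X_i^\top\theta)-Y_iX_i^\top\theta]$. The MLE is $\hat\theta=\arg\min_{\theta\in\mathbb R^d}\ell(\theta)$ when it exists and is unique. $F^*=\frac1n\sum_{i=1}^n\psi''(X_i^\top\theta^* )X_iX_i^\top$. The prior is a probability density $\pi_0$ strictly positive on $\mathbb R^d$; the posterior is $\pi_v(\theta)\propto e^{-n\ell(\theta)}\pi_0(\theta)$;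 and $\gamma^*=\mathcal N(\hat\theta,(nF^* )^{-1})$. $\bar\delta_{01}^*(t)=\sup_{|\theta-\theta^*|\le t\sqrt{d/n}}|\nabla\log\pi_0(\theta)|$ with $|\cdot|$ the Euclidean norm, set to $\infty$ if $\pi_0$ is not $C^1$ on that ball; $M_0^*=d^{-1}\log\sup_{\theta\in\mathbb R^d}\pi_0(\theta)/\pi_0(\theta^* )$. $\mathrm{TV}(P,Q)=\sup_B|P(B)-Q(B)|$. *)

theory Defs
  imports
    "HOL-Probability.Probability"
    "HOL-Library.Landau_Symbols"
    "Jordan_Normal_Form.Determinant"
    "Jordan_Normal_Form.Gauss_Jordan_Elimination"
begin

text \<open>
  The dimension varies with the sample size, so a point of \<open>\<real>\<^sup>d\<close> is an
  extensional function on \<open>{..<d}\<close> (value \<open>undefined\<close> from index \<open>d\<close> on), i.e. an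
  element of \<open>Rd d\<close>; the Borel sets and Lebesgue measure are those of the finite product
  \<open>leb d\<close>, whose space is \<open>Rd d\<close>. Matrices are those of \<open>Jordan_Normal_Form\<close>.
\<close>

definition Rd :: "nat \<Rightarrow> (nat \<Rightarrow> real) set" where
  "Rd d = (\<Pi>\<^sub>E i\<in>{..<d}. UNIV)"

definition leb :: "nat \<Rightarrow> (nat \<Rightarrow> real) measure" where
  "leb d = (\<Pi>\<^sub>M i\<in>{..<d}. lborel)"

definition dot :: "nat \<Rightarrow> (nat \<Rightarrow> real) \<Rightarrow> (nat \<Rightarrow> real) \<Rightarrow> real" where
  "dot d x y = (\<Sum>j<d. x j * y j)"

definition enorm :: "nat \<Rightarrow> (nat \<Rightarrow> real) \<Rightarrow> real" where
  "enorm d x = L2_set x {..<d}"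

text \<open>
  \<open>gaussian d m S\<close> is \<open>N(m, S)\<close> on \<open>\<real>\<^sup>d\<close>, given by its Lebesgue density; meaningful for a
  symmetric positive definite \<open>S\<close>.
\<close>

definition gaussian :: "nat \<Rightarrow> (nat \<Rightarrow> real) \<Rightarrow> real mat \<Rightarrow> (nat \<Rightarrow> real) measure" where
  "gaussian d m S = density (leb d) (\<lambda>x. ennreal
     (1 / sqrt ((2 * pi) ^ d * Determinant.det S) *
      exp (- (\<Sum>j<d. \<Sum>k<d. (x j - m j) * (the (mat_inverse S) $$ (j, k)) * (x k - m k)) / 2)))"

definition TV :: "'a measure \<Rightarrow> 'a measure \<Rightarrow> real" where
  "TV P Q = (SUP B\<in>sets P. \<bar>measure P B - measure Q B\<bar>)"

definition psi :: "real \<Rightarrow> real" where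
  "psi w = ln (1 + exp w)"

text \<open>
  A data set is a pair \<open>(X, Y)\<close> with features \<open>X i \<in> Rd d\<close> and labels \<open>Y i\<close> for
  \<open>i < n\<close>, where \<open>True\<close> stands for the label 1. In the joint law the features are i.i.d.
  \<open>N(0, I)\<close>, and the density below, taken with respect to counting measure in \<open>Y\<close>, is
  the conditional probability mass function of the labels given the features: a product of
  Bernoulli ones.
\<close>

definition data_law ::
    "nat \<Rightarrow> nat \<Rightarrow> (nat \<Rightarrow> real) \<Rightarrow> ((nat \<Rightarrow> nat \<Rightarrow> real) \<times> (nat \<Rightarrow> bool)) measure" where
  "data_law n d \<theta>s = density
     ((\<Pi>\<^sub>M i\<in>{..<n}. gaussian d (\<lambda>_. 0) (1\<^sub>m d)) \<Otimes>\<^sub>M (\<Pi>\<^sub>M i\<in>{..<n}. count_space UNIV))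
     (\<lambda>(X, Y). \<Prod>i<n. ennreal (pmf (bernoulli_pmf (deriv psi (dot d (X i) \<theta>s))) (Y i)))"

definition nll ::
    "nat \<Rightarrow> nat \<Rightarrow> (nat \<Rightarrow> nat \<Rightarrow> real) \<times> (nat \<Rightarrow> bool) \<Rightarrow> (nat \<Rightarrow> real) \<Rightarrow> real" where
  "nll n d D \<theta> = (case D of (X, Y) \<Rightarrow>
     (\<Sum>i<n. psi (dot d (X i) \<theta>) - of_bool (Y i) * dot d (X i) \<theta>) / real n)"

definition is_mle ::
    "nat \<Rightarrow> nat \<Rightarrow> (nat \<Rightarrow> nat \<Rightarrow> real) \<times> (nat \<Rightarrow> bool) \<Rightarrow> (nat \<Rightarrow> real) \<Rightarrow> bool" where
  "is_mle n d D = is_arg_min (nll n d D) (\<lambda>\<theta>. \<theta> \<in> Rd d)"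

definition mle ::
    "nat \<Rightarrow> nat \<Rightarrow> (nat \<Rightarrow> nat \<Rightarrow> real) \<times> (nat \<Rightarrow> bool) \<Rightarrow> nat \<Rightarrow> real" where
  "mle n d D = (THE \<theta>. is_mle n d D \<theta>)"

definition fisher :: "nat \<Rightarrow> nat \<Rightarrow> (nat \<Rightarrow> real) \<Rightarrow>
    (nat \<Rightarrow> nat \<Rightarrow> real) \<times> (nat \<Rightarrow> bool) \<Rightarrow> real mat" where
  "fisher n d \<theta>s D = (case D of (X, Y) \<Rightarrow>
     Matrix.mat d d (\<lambda>(j, k).
       (\<Sum>i<n. deriv (deriv psi) (dot d (X i) \<theta>s) * X i j * X i k) / real n))"

definition posterior :: "nat \<Rightarrow> nat \<Rightarrow> ((nat \<Rightarrow> real) \<Rightarrow> real) \<Rightarrow>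
    (nat \<Rightarrow> nat \<Rightarrow> real) \<times> (nat \<Rightarrow> bool) \<Rightarrow> (nat \<Rightarrow> real) measure" where
  "posterior n d \<pi>0 D = density (leb d) (\<lambda>\<theta>.
     ennreal (exp (- real n * nll n d D \<theta>) * \<pi>0 \<theta>) /
     (\<integral>\<^sup>+\<theta>'. ennreal (exp (- real n * nll n d D \<theta>') * \<pi>0 \<theta>') \<partial>leb d))"

text \<open>
  If the MLE exists uniquely (and \<open>n > 0\<close>) the features span \<open>\<real>\<^sup>d\<close>, so \<open>fisher\<close> is
  then positive definite and the inverse below is the actual one.
\<close>

definition laplace :: "nat \<Rightarrow> nat \<Rightarrow> (nat \<Rightarrow> real) \<Rightarrow>
    (nat \<Rightarrow> nat \<Rightarrow> real) \<times> (nat \<Rightarrow> bool) \<Rightarrow> (nat \<Rightarrow> real) measure" where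
  "laplace n d \<theta>s D =
     gaussian d (mle n d D) (the (mat_inverse (real n \<cdot>\<^sub>m fisher n d \<theta>s D)))"

definition pderiv_at :: "nat \<Rightarrow> ((nat \<Rightarrow> real) \<Rightarrow> real) \<Rightarrow> (nat \<Rightarrow> real) \<Rightarrow> real" where
  "pderiv_at i f x = deriv (\<lambda>t. f (x(i := t))) (x i)"

text \<open>
  \<open>C\<^sup>1\<close> on a not necessarily open set: continuous first partial derivatives on some open
  neighbourhood of it. The topology \<open>powertop_real {..<d}\<close> is the Euclidean one on \<open>Rd d\<close>.
\<close>

definition C1_on :: "nat \<Rightarrow> ((nat \<Rightarrow> real) \<Rightarrow> real) \<Rightarrow> (nat \<Rightarrow> real) set \<Rightarrow> bool" where
  "C1_on d f S \<longleftrightarrow> (\<exists>U. openin (powertop_real {..<d}) U \<and> S \<subseteq> U \<and>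
     (\<forall>i<d. (\<forall>x\<in>U. (\<lambda>t. f (x(i := t))) differentiable (at (x i))) \<and>
            continuous_map (subtopology (powertop_real {..<d}) U) euclideanreal (pderiv_at i f)))"

definition loc_ball :: "nat \<Rightarrow> nat \<Rightarrow> (nat \<Rightarrow> real) \<Rightarrow> real \<Rightarrow> (nat \<Rightarrow> real) set" where
  "loc_ball n d \<theta>s t = {\<theta> \<in> Rd d. enorm d (\<lambda>j. \<theta> j - \<theta>s j) \<le> t * sqrt (real d / real n)}"

definition delta01 ::
    "nat \<Rightarrow> nat \<Rightarrow> (nat \<Rightarrow> real) \<Rightarrow> ((nat \<Rightarrow> real) \<Rightarrow> real) \<Rightarrow> real \<Rightarrow> ereal" where
  "delta01 n d \<theta>s \<pi>0 t =
     (if C1_on d \<pi>0 (loc_ball n d \<theta>s t)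
      then (SUP \<theta>\<in>loc_ball n d \<theta>s t.
              ereal (enorm d (\<lambda>j. pderiv_at j (\<lambda>\<theta>'. ln (\<pi>0 \<theta>')) \<theta>)))
      else \<infinity>)"

definition M0 :: "nat \<Rightarrow> (nat \<Rightarrow> real) \<Rightarrow> ((nat \<Rightarrow> real) \<Rightarrow> real) \<Rightarrow> ereal" where
  "M0 d \<theta>s \<pi>0 =
     (if bdd_above (\<pi>0 ` Rd d)
      then ereal (1 / real d * ln ((SUP \<theta>\<in>Rd d. \<pi>0 \<theta>) / \<pi>0 \<theta>s))
      else \<infinity>)"

definition positive_density :: "nat \<Rightarrow> ((nat \<Rightarrow> real) \<Rightarrow> real) \<Rightarrow> bool" where
  "positive_density d \<pi>0 \<longleftrightarrow> \<pi>0 \<in> borel_measurable (leb d) \<and> (\<forall>\<theta>\<in>Rd d. \<pi>0 \<theta> > 0) \<and>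
     (\<integral>\<^sup>+\<theta>. ennreal (\<pi>0 \<theta>) \<partial>leb d) = 1"

end

theory Submission
  imports Defs "HOL-Real_Asymp.Real_Asymp"
begin

text \<open>
  On a ball of radius \<open>O(\<surd>(d/n))\<close> around \<open>\<theta>\<^sup>*\<close> the log ratio of the posterior density and the Laplace
  density is Lipschitz with constant \<open>L = o(\<surd>n)\<close>: its gradient is bounded by the cubic form of the
  design, which contributes \<open>O(d)\<close>, and by the gradient of the log prior. The Laplace density is
  strongly log-concave there, with parameter of order \<open>n\<close>, so the midpoint Prekopa--Leindler inequality
  gives \<open>\<integral>f \<cdot> \<integral>g\<^sup>2/f \<le> exp (L\<^sup>2/(cn)) (\<integral>g)\<^sup>2\<close>. This is a bound on the chi-square divergence,
  hence on the total variation. Convexity of the likelihood makes both tails outside the ball negligible.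

  The bounds on the design hold with high probability when \<open>d\<^sup>2/n \<rightarrow> 0\<close>: Chebyshev's inequality handles the
  score and the quadratic forms, and the cubic form is controlled by a volume argument. The event in
  the conclusion is measurable because the maximum likelihood estimator, where it is unique, is the
  limit of approximate minimizers chosen in a fixed countable dense set.
\<close>

section \<open>The midpoint Prekopa--Leindler inequality\<close>

text \<open>The dimension condition shapes the comparison of the two densities. On a ball of radius
  \<open>R = t * sqrt (d / n)\<close> the likelihood part of the log ratio may vary by about
  \<open>d * R\<close>, so a uniform comparison would need d^3/n to vanish. Prekopa--Leindler costs
  only \<open>L^2 / (c * n)\<close>, of order d^2/n plus o(1), without any further factor from the
  dimension: for two points at distance \<open>r\<close> the ratio changes by at most
  \<open>exp (L * r)\<close>, the Gaussian kernel gains \<open>exp (- c * n * r^2 / 4)\<close> at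
  the midpoint, and \<open>L * r - c * n * r^2 / 4\<close> never exceeds
  \<open>L^2 / (c * n)\<close>.

  The cubic form meets the same threshold. Cubes of Gaussians have no exponential moments, so they
  are truncated at the order of the cube of \<open>sqrt n\<close>; Chernoff's bound then gives only
  \<open>exp (- sqrt n)\<close>, which beats the volume factor \<open>exp (5 * d)\<close> exactly
  because \<open>d\<close> is small against \<open>sqrt n\<close>.

  In the tails, factors of the form constant^d are harmless: the ratio of tail to core is at most
  (constant / t)^d, and \<open>t\<close> can be taken large, independently of
  \<open>n\<close>.\<close>

lemma lebesgue_measure_half_translate:
  fixes A :: "real set"
  assumes "compact A"
  shows "(\<lambda>a. (a + c) / 2) ` A \<in> lmeasurable"
    and "measure lebesgue ((\<lambda>a. (a + c) / 2) ` A) = measure lebesgue A / 2"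
proof -
  have eq: "(\<lambda>a. (a + c) / 2) ` A = (\<lambda>x. (1/2) *\<^sub>R x + c/2) ` A"
    by (intro image_cong) (auto simp: field_simps)
  show "(\<lambda>a. (a + c) / 2) ` A \<in> lmeasurable"
    by (intro lmeasurable_compact compact_continuous_image continuous_intros assms) auto
  show "measure lebesgue ((\<lambda>a. (a + c) / 2) ` A) = measure lebesgue A / 2"
    unfolding eq using measure_lebesgue_affine[of "1/2" "c/2" A] by simp
qed

text \<open>Averaging \<open>A\<close> with the least point of \<open>B\<close>, and
  \<open>B\<close> with the greatest point of \<open>A\<close>, gives two half-size copies inside
  \<open>C\<close>. They meet in at most one point, so their measures add up.\<close>

lemma brunn_minkowski_real_compact:
  fixes A B C :: "real set"
  assumes A: "compact A" "A \<noteq> {}" and B: "compact B" "B \<noteq> {}" and C: "C \<in> lmeasurable"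
    and mid: "\<And>a b. a \<in> A \<Longrightarrow> b \<in> B \<Longrightarrow> (a + b) / 2 \<in> C"
  shows "measure lebesgue A + measure lebesgue B \<le> 2 * measure lebesgue C"
proof -
  obtain a1 where a1: "a1 \<in> A" "\<And>a. a \<in> A \<Longrightarrow> a \<le> a1" using compact_attains_sup[OF A] by blast
  obtain b0 where b0: "b0 \<in> B" "\<And>b. b \<in> B \<Longrightarrow> b0 \<le> b" using compact_attains_inf[OF B] by blast
  let ?A = "(\<lambda>a. (a + b0) / 2) ` A" and ?B = "(\<lambda>b. (b + a1) / 2) ` B"
  note hA = lebesgue_measure_half_translate[OF A(1), of b0]
  note hB = lebesgue_measure_half_translate[OF B(1), of a1]
  have "?A \<inter> ?B \<subseteq> {(a1 + b0) / 2}"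
  proof
    fix x assume "x \<in> ?A \<inter> ?B"
    then obtain a b where ab: "a \<in> A" "b \<in> B" "x = (a + b0)/2" "x = (b + a1)/2" by auto
    with a1(2)[OF ab(1)] b0(2)[OF ab(2)] show "x \<in> {(a1 + b0) / 2}" by auto
  qed
  then have "negligible (?A \<inter> ?B)" by (rule negligible_subset[OF negligible_sing])
  then have "measure lebesgue (?A \<union> ?B) = measure lebesgue ?A + measure lebesgue ?B"
    using hA(1) hB(1) by (simp add: measure_Un3 negligible_imp_measure0)
  moreover have "measure lebesgue (?A \<union> ?B) \<le> measure lebesgue C"
  proof (rule measure_mono_fmeasurable[OF _ _ C])
    have "(b + a1) / 2 \<in> C" if "b \<in> B" for b using mid[OF a1(1) that] by (simp add: add.commute)
    then show "?A \<union> ?B \<subseteq> C" using mid b0(1) by auto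
    show "?A \<union> ?B \<in> sets lebesgue" using hA(1) hB(1) by auto
  qed
  ultimately show ?thesis using hA(2) hB(2) by simp
qed

text \<open>Inner approximation reduces this to compact sets: half of each error \<open>e/2\<close>
  is lost to a closed subset, half to cutting with a bounded interval. A chosen point is put back
  into the approximating set, which keeps it nonempty even when the set is null.\<close>

lemma brunn_minkowski_real_lmeasurable:
  fixes A B C :: "real set"
  assumes A: "A \<in> lmeasurable" "A \<noteq> {}" and B: "B \<in> lmeasurable" "B \<noteq> {}" and C: "C \<in> lmeasurable"
    and mid: "\<And>a b. a \<in> A \<Longrightarrow> b \<in> B \<Longrightarrow> (a + b) / 2 \<in> C"
  shows "measure lebesgue A + measure lebesgue B \<le> 2 * measure lebesgue C"
proof (rule field_le_epsilon)
  fix e :: real assume "e > 0"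
  obtain a0 b0 where ab0: "a0 \<in> A" "b0 \<in> B" using A B by auto
  have approx: "\<exists>K. compact K \<and> K \<subseteq> S \<and> s \<in> K \<and> measure lebesgue S \<le> measure lebesgue K + e/2"
    if S: "S \<in> lmeasurable" and s: "s \<in> S" for S :: "real set" and s
  proof -
    obtain T0 where T0: "closed T0" "T0 \<subseteq> S" "S - T0 \<in> lmeasurable" "emeasure lebesgue (S - T0) < ennreal (e/4)"
      using sets_lebesgue_inner_closed[of S "e/4"] S \<open>e > 0\<close> by (auto simp: fmeasurableD)
    have T0m: "T0 \<in> lmeasurable"
      using S T0(1,2) by (intro fmeasurableI2[OF S]) auto
    obtain b where b: "\<And>x y. ball 0 b \<subseteq> cbox x y \<Longrightarrow> \<bar>measure lebesgue (T0 \<inter> cbox x y) - measure lebesgue T0\<bar> < e/4"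
      using has_measure_limit[OF T0m, of "e/4"] \<open>e > 0\<close> by (metis divide_pos_pos zero_less_numeral)
    define T where "T = T0 \<inter> cbox (-b) b"
    have T: "compact T" "T \<subseteq> S" unfolding T_def using T0 by auto
    have m1: "measure lebesgue T0 \<le> measure lebesgue T + e/4"
    proof -
      have "ball 0 b \<subseteq> cbox (-b) b" by (auto simp: ball_def dist_real_def)
      from b[OF this] have "\<bar>measure lebesgue T - measure lebesgue T0\<bar> < e/4" unfolding T_def .
      then show ?thesis by linarith
    qed
    have "measure lebesgue (S - T0) < e/4"
      using T0(3,4) \<open>e > 0\<close> by (simp add: emeasure_eq_measure2 ennreal_less_iff)
    moreover have "measure lebesgue S = measure lebesgue T0 + measure lebesgue (S - T0)"
      using measurable_measure_Diff[OF S, of T0] T0m T0(2) by (auto simp: fmeasurableD)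
    ultimately have m2: "measure lebesgue S \<le> measure lebesgue T + e/2" using m1 by simp
    let ?K = "insert s T"
    have Tm: "T \<in> lmeasurable" and Km: "?K \<in> lmeasurable"
      using T(1) by (auto simp: lmeasurable_compact)
    have "measure lebesgue T \<le> measure lebesgue ?K"
      by (rule measure_mono_fmeasurable) (use Km Tm in auto)
    then show ?thesis using T s m2 by (intro exI[of _ ?K]) auto
  qed
  obtain K L where K: "compact K" "K \<subseteq> A" "a0 \<in> K" "measure lebesgue A \<le> measure lebesgue K + e/2"
    and L: "compact L" "L \<subseteq> B" "b0 \<in> L" "measure lebesgue B \<le> measure lebesgue L + e/2"
    using approx[OF A(1) ab0(1)] approx[OF B(1) ab0(2)] by blast
  have "measure lebesgue K + measure lebesgue L \<le> 2 * measure lebesgue C"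
    by (rule brunn_minkowski_real_compact[OF K(1) _ L(1) _ C]) (use K L mid in auto)
  with K L show "measure lebesgue A + measure lebesgue B \<le> 2 * measure lebesgue C + e" by simp
qed

text \<open>Finite measure of \<open>A\<close> and \<open>B\<close> need not be assumed: averaging
  either set with one point of the other gives a half-size copy inside \<open>C\<close>, so both are
  finite once \<open>C\<close> is.\<close>

lemma brunn_minkowski_real:
  fixes A B C :: "real set"
  assumes A: "A \<in> sets borel" "A \<noteq> {}" and B: "B \<in> sets borel" "B \<noteq> {}" and C: "C \<in> sets borel"
    and mid: "\<And>a b. a \<in> A \<Longrightarrow> b \<in> B \<Longrightarrow> (a + b) / 2 \<in> C"
  shows "emeasure lborel A + emeasure lborel B \<le> 2 * emeasure lborel C"
proof (cases "emeasure lborel C = \<infinity>")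
  case False
  have L: "emeasure lebesgue X = emeasure lborel X" "X \<in> sets lebesgue" if "X \<in> sets borel" for X :: "real set"
    using that by (auto intro: emeasure_completion)
  have Cm: "C \<in> lmeasurable" using False C L by (simp add: fmeasurable_def top.not_eq_extremum)
  have fin: "X \<in> lmeasurable" if X: "X \<in> sets borel" and sub: "(\<lambda>a. (a + c) / 2) ` X \<subseteq> C" for X c
  proof -
    have eq: "(\<lambda>a. (a + c) / 2) ` X = (\<lambda>x. (1/2) *\<^sub>R x + c/2) ` X"
      by (intro image_cong) (auto simp: field_simps)
    have "emeasure lebesgue ((\<lambda>a. (a + c) / 2) ` X) = ennreal (1/2) * emeasure lebesgue X"
      unfolding eq using emeasure_lebesgue_affine[of "1/2" "c/2" X] by simp
    moreover have "emeasure lebesgue ((\<lambda>a. (a + c) / 2) ` X) \<le> emeasure lebesgue C"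
      using Cm sub by (intro emeasure_mono) auto
    moreover have "emeasure lebesgue C < \<infinity>" using Cm by (auto simp: fmeasurable_def simp del: emeasure_completion)
    ultimately have "ennreal (1/2) * emeasure lebesgue X < \<infinity>" by (metis le_less_trans)
    then have "emeasure lebesgue X < \<infinity>" by (auto simp: ennreal_mult_less_top)
    then show ?thesis using L(2)[OF X] by (auto simp: fmeasurable_def simp del: emeasure_completion)
  qed
  obtain a0 b0 where ab0: "a0 \<in> A" "b0 \<in> B" using A B by auto
  have Am: "A \<in> lmeasurable" by (rule fin[OF A(1), of b0]) (use mid ab0 in auto)
  have Bm: "B \<in> lmeasurable" by (rule fin[OF B(1), of a0]) (use mid[OF ab0(1)] in \<open>simp add: image_subset_iff, metis add.commute\<close>)
  have "measure lebesgue A + measure lebesgue B \<le> 2 * measure lebesgue C"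
    by (rule brunn_minkowski_real_lmeasurable[OF Am A(2) Bm B(2) Cm mid])
  then have "ennreal (measure lebesgue A + measure lebesgue B) \<le> ennreal (2 * measure lebesgue C)"
    by (rule ennreal_leI)
  then show ?thesis
    using emeasure_eq_measure2[OF Am] emeasure_eq_measure2[OF Bm] emeasure_eq_measure2[OF Cm]
    unfolding L(1)[OF A(1)] L(1)[OF B(1)] L(1)[OF C] by (simp add: ennreal_mult)
qed (simp add: ennreal_mult_top)

text \<open>Fubini, after writing \<open>ennreal (u x)\<close> as the length of
  \<open>{0..<u x}\<close>. Negative values of \<open>u\<close> are covered: \<open>ennreal\<close>
  sends them to 0 and the interval is empty.\<close>

lemma nn_integral_layer_cake:
  fixes u :: "'a \<Rightarrow> real"
  assumes "sigma_finite_measure M" and u[measurable]: "u \<in> borel_measurable M"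
  shows "(\<integral>\<^sup>+x. ennreal (u x) \<partial>M) = (\<integral>\<^sup>+t. emeasure M {x\<in>space M. t < u x} * indicator {0..} t \<partial>lborel)"
proof -
  interpret sigma_finite_measure M by fact
  interpret pair_sigma_finite M "lborel :: real measure" ..
  have "(\<integral>\<^sup>+x. ennreal (u x) \<partial>M) = (\<integral>\<^sup>+x. \<integral>\<^sup>+t. indicator {0..<u x} t \<partial>lborel \<partial>M)"
  proof (intro nn_integral_cong)
    fix x
    show "ennreal (u x) = (\<integral>\<^sup>+t. indicator {0..<u x} t \<partial>lborel)"
      by (cases "0 \<le> u x") (simp_all add: ennreal_neg)
  qed
  also have "\<dots> = (\<integral>\<^sup>+x. \<integral>\<^sup>+t. (if 0 \<le> t \<and> t < u x then 1 else 0) \<partial>lborel \<partial>M)"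
    by (intro nn_integral_cong) (auto simp: indicator_def)
  also have "\<dots> = (\<integral>\<^sup>+t. \<integral>\<^sup>+x. (if 0 \<le> t \<and> t < u x then 1 else 0) \<partial>M \<partial>lborel)"
    by (rule Fubini'[symmetric]) measurable
  also have "\<dots> = (\<integral>\<^sup>+t. emeasure M {x\<in>space M. t < u x} * indicator {0..} t \<partial>lborel)"
  proof (intro nn_integral_cong)
    fix t :: real
    have "(\<integral>\<^sup>+x. (if 0 \<le> t \<and> t < u x then 1 else 0) \<partial>M)
        = (\<integral>\<^sup>+x. indicator {0..} t * indicator {x\<in>space M. t < u x} x \<partial>M)"
      by (intro nn_integral_cong) (auto simp: indicator_def)
    also have "\<dots> = indicator {0..} t * emeasure M {x\<in>space M. t < u x}"
      by (subst nn_integral_cmult) auto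
    finally show "(\<integral>\<^sup>+x. (if 0 \<le> t \<and> t < u x then 1 else 0) \<partial>M)
      = emeasure M {x\<in>space M. t < u x} * indicator {0..} t" by (simp add: mult.commute)
  qed
  finally show ?thesis .
qed

lemma ennreal_prod_le_square_of_sum_le:
  fixes x y z :: ennreal
  assumes "x + y \<le> 2 * z" shows "x * y \<le> z * z"
proof (cases z)
  case top then show ?thesis by (auto simp: ennreal_mult_top)
next
  case (real c)
  then have "x + y \<noteq> \<infinity>" using assms by (auto simp: ennreal_mult_eq_top_iff top_unique)
  then obtain a b where ab: "x = ennreal a" "y = ennreal b" "a \<ge> 0" "b \<ge> 0"
    by (cases x; cases y) auto
  have "ennreal (a + b) \<le> ennreal (2 * c)" using assms ab real by (simp add: ennreal_mult)
  then have le: "a + b \<le> 2 * c" using real by (simp add: ennreal_le_iff)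
  have "4 * (a * b) \<le> (a + b)^2" using sum_squares_ge_zero[of "a - b" 0] by (simp add: power2_eq_square algebra_simps)
  also have "\<dots> \<le> (2 * c)^2" using le ab by (intro power_mono) auto
  finally have "a * b \<le> c * c" by (simp add: power2_eq_square)
  then show ?thesis using ab real by (simp add: ennreal_mult[symmetric])
qed

text \<open>Dividing \<open>u\<close> and \<open>v\<close> by their suprema \<open>a\<close> and
  \<open>b\<close>, and \<open>w\<close> by \<open>sqrt (a * b)\<close>, makes the superlevel sets
  of both factors nonempty for exactly the same levels, those below 1. There the one-dimensional
  Brunn--Minkowski inequality applies; integrating over levels bounds a sum of integrals, and the
  arithmetic-geometric mean inequality turns it into the product. Boundedness is what makes the
  normalization possible.\<close>

lemma prekopa_leindler_real_bounded:
  fixes u v w :: "real \<Rightarrow> real"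
  assumes [measurable]: "u \<in> borel_measurable borel" "v \<in> borel_measurable borel" "w \<in> borel_measurable borel"
    and pos: "\<And>x. 0 \<le> u x" "\<And>x. 0 \<le> v x" "\<And>x. 0 \<le> w x"
    and bdd: "\<And>x. u x \<le> k" "\<And>x. v x \<le> k"
    and mid: "\<And>s t. u s * v t \<le> (w ((s + t) / 2))\<^sup>2"
  shows "(\<integral>\<^sup>+x. ennreal (u x) \<partial>lborel) * (\<integral>\<^sup>+x. ennreal (v x) \<partial>lborel)
    \<le> (\<integral>\<^sup>+x. ennreal (w x) \<partial>lborel) * (\<integral>\<^sup>+x. ennreal (w x) \<partial>lborel)"
proof -
  define a where "a = (SUP x. u x)"
  define b where "b = (SUP x. v x)"
  have bu: "bdd_above (range u)" and bv: "bdd_above (range v)" using bdd by (auto intro!: bdd_aboveI2)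
  have ua: "u x \<le> a" and vb: "v x \<le> b" for x
    unfolding a_def b_def using bu bv by (auto intro!: cSUP_upper)
  have "0 \<le> a" "0 \<le> b" using ua vb pos by (meson order_trans)+
  show ?thesis
  proof (cases "a = 0 \<or> b = 0")
    case True
    then have "(\<forall>x. u x = 0) \<or> (\<forall>x. v x = 0)" using ua vb pos by (metis order_antisym)
    then show ?thesis by auto
  next
    case False
    then have ab: "a > 0" "b > 0" using \<open>0 \<le> a\<close> \<open>0 \<le> b\<close> by auto
    define c where "c = sqrt (a * b)"
    have c: "c > 0" "c^2 = a * b" using ab by (auto simp: c_def)
    define lev where "lev = (\<lambda>(f::real\<Rightarrow>real) m t. {x. t < f x / m})"
    have [measurable]: "lev f m t \<in> sets borel" if "f \<in> borel_measurable borel" for f m t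
      unfolding lev_def using that by measurable
    have cake: "(\<integral>\<^sup>+x. ennreal (f x / m) \<partial>lborel) = (\<integral>\<^sup>+t. emeasure lborel (lev f m t) * indicator {0..} t \<partial>lborel)"
      if "f \<in> borel_measurable borel" for f m
      using nn_integral_layer_cake[of lborel "\<lambda>x. f x / m"] that sigma_finite_lborel by (simp add: lev_def)
    have lev_mono: "emeasure lborel (lev u a t) * indicator {0..} t + emeasure lborel (lev v b t) * indicator {0..} t
      \<le> 2 * (emeasure lborel (lev w c t) * indicator {0..} t)" for t
    proof (cases "0 \<le> t \<and> t < 1")
      case True
      have "t * a < (SUP x. u x)" using True ab unfolding a_def[symmetric] by simp
      then have nu: "lev u a t \<noteq> {}" using ab less_cSUP_iff[OF _ bu] by (auto simp: lev_def field_simps)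
      have "t * b < (SUP x. v x)" using True ab unfolding b_def[symmetric] by simp
      then have nv: "lev v b t \<noteq> {}" using ab less_cSUP_iff[OF _ bv] by (auto simp: lev_def field_simps)
      have "emeasure lborel (lev u a t) + emeasure lborel (lev v b t) \<le> 2 * emeasure lborel (lev w c t)"
      proof (rule brunn_minkowski_real[OF _ nu _ nv])
        fix x y assume "x \<in> lev u a t" "y \<in> lev v b t"
        then have "t * a < u x" "t * b < v y" using ab by (auto simp: lev_def field_simps)
        then have "(t * a) * (t * b) < u x * v y"
          using True ab pos
          by (intro mult_strict_mono) (auto intro: le_less_trans[of 0 "t * a"])
        then have "(t * c)^2 < (w ((x + y) / 2))^2"
          using mid[of x y] by (simp add: power_mult_distrib c(2)) (simp add: power2_eq_square mult_ac)
        then have "t * c < w ((x + y) / 2)" using pos by (metis power2_less_imp_less)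
        then show "(x + y) / 2 \<in> lev w c t" using c by (simp add: lev_def field_simps)
      qed auto
      then show ?thesis using True by simp
    next
      case False
      show ?thesis
      proof (cases "0 \<le> t")
        case True
        then have "t \<ge> 1" using False by auto
        then have "lev u a t = {}" "lev v b t = {}"
          using order_trans[OF ua, of "a * t"] order_trans[OF vb, of "b * t"] ab
          by (auto simp: lev_def not_less field_simps)
        then show ?thesis by simp
      qed simp
    qed
    let ?U = "\<integral>\<^sup>+x. ennreal (u x / a) \<partial>lborel" and ?V = "\<integral>\<^sup>+x. ennreal (v x / b) \<partial>lborel"
    let ?W = "\<integral>\<^sup>+x. ennreal (w x / c) \<partial>lborel"
    have levi: "(\<lambda>t. emeasure lborel (lev f m t)) \<in> borel_measurable borel" if [measurable]: "f \<in> borel_measurable borel" for f m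
    proof -
      have "(\<lambda>t. \<integral>\<^sup>+x. (if t < f x / m then 1 else 0) \<partial>lborel) \<in> borel_measurable borel"
        by measurable
      moreover have "(\<integral>\<^sup>+x. (if t < f x / m then 1 else 0) \<partial>lborel) = emeasure lborel (lev f m t)" for t
        by (subst nn_integral_indicator[symmetric], simp, intro nn_integral_cong) (auto simp: lev_def indicator_def)
      ultimately show ?thesis by simp
    qed
    note [measurable] = levi
    have "?U + ?V \<le> 2 * ?W"
      unfolding cake[OF assms(1)] cake[OF assms(2)] cake[OF assms(3)]
      by (subst nn_integral_add[symmetric], measurable, subst nn_integral_cmult[symmetric], measurable)
         (intro nn_integral_mono lev_mono)
    then have UV: "?U * ?V \<le> ?W * ?W" by (rule ennreal_prod_le_square_of_sum_le)
    have sc: "(\<integral>\<^sup>+x. ennreal (f x) \<partial>lborel) = ennreal m * (\<integral>\<^sup>+x. ennreal (f x / m) \<partial>lborel)"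
      if "m > 0" "\<And>x. f x \<ge> 0" and [measurable]: "f \<in> borel_measurable borel" for f :: "real\<Rightarrow>real" and m
      using that by (subst nn_integral_cmult[symmetric]) (auto simp: ennreal_mult[symmetric] intro!: nn_integral_cong)
    have "ennreal a * ennreal b = ennreal c * ennreal c"
      using c ab by (simp add: ennreal_mult[symmetric] power2_eq_square)
    then have "(ennreal a * ennreal b) * (?U * ?V) \<le> (ennreal c * ennreal c) * (?W * ?W)"
      using UV by (simp add: mult_left_mono)
    then have "(ennreal a * ?U) * (ennreal b * ?V) \<le> (ennreal c * ?W) * (ennreal c * ?W)"
      by (simp only: mult_ac)
    then show ?thesis
      using sc[OF ab(1) pos(1)] sc[OF ab(2) pos(2)] sc[OF c(1) pos(3)] by simp
  qed
qed

text \<open>Cutting all three functions at the same height \<open>k\<close> preserves the midpoint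
  hypothesis: either \<open>w\<close> is not cut at the midpoint, or the right-hand side becomes
  \<open>k^2\<close>, which dominates a product of two factors at most \<open>k\<close>. Monotone
  convergence removes the cut.\<close>

lemma prekopa_leindler_real:
  fixes u v w :: "real \<Rightarrow> ennreal"
  assumes [measurable]: "u \<in> borel_measurable borel" "v \<in> borel_measurable borel" "w \<in> borel_measurable borel"
    and mid: "\<And>s t. u s * v t \<le> (w ((s + t) / 2))\<^sup>2"
  shows "(\<integral>\<^sup>+x. u x \<partial>lborel) * (\<integral>\<^sup>+x. v x \<partial>lborel) \<le> (\<integral>\<^sup>+x. w x \<partial>lborel)\<^sup>2"
proof -
  define cut where "cut = (\<lambda>(f::real\<Rightarrow>ennreal) (k::nat) x. min (f x) (of_nat k))"
  have [measurable]: "cut f k \<in> borel_measurable borel" if [measurable]: "f \<in> borel_measurable borel" for f k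
    unfolding cut_def by measurable
  have cut_fin: "cut f k x < \<infinity>" for f k x
    unfolding cut_def by (simp add: min_less_iff_disj of_nat_less_top)
  have cut_real: "ennreal (enn2real (cut f k x)) = cut f k x" for f k x
    using cut_fin[of f k x] by simp
  have conv: "(\<integral>\<^sup>+x. f x \<partial>lborel) = (SUP k. \<integral>\<^sup>+x. cut f k x \<partial>lborel)" if [measurable]: "f \<in> borel_measurable borel" for f
  proof -
    have "f x = (SUP k. cut f k x)" for x
    proof (rule antisym)
      show "f x \<le> (SUP k. cut f k x)"
      proof (cases "f x")
        case (real r)
        obtain k :: nat where "r \<le> real k" using real_arch_simple by blast
        then have "f x \<le> of_nat k" using real by (simp add: ennreal_of_nat_eq_real_of_nat)
        then have "f x = cut f k x" by (simp add: cut_def min_def)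
        then show ?thesis by (metis SUP_upper UNIV_I)
      next
        case top
        then have "cut f k x = of_nat k" for k by (simp add: cut_def)
        then show ?thesis using top by (simp add: ennreal_SUP_of_nat_eq_top)
      qed
    qed (auto simp: cut_def intro!: SUP_least)
    then have "(\<integral>\<^sup>+x. f x \<partial>lborel) = (\<integral>\<^sup>+x. (SUP k. cut f k x) \<partial>lborel)" by simp
    also have "\<dots> = (SUP k. \<integral>\<^sup>+x. cut f k x \<partial>lborel)"
      by (intro nn_integral_monotone_convergence_SUP)
         (auto simp: incseq_def le_fun_def cut_def intro: min.coboundedI2 min.mono)
    finally show ?thesis .
  qed
  have cut_mono: "(\<integral>\<^sup>+x. cut f k x \<partial>lborel) \<le> (\<integral>\<^sup>+x. cut f m x \<partial>lborel)" if "k \<le> m" for f k m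
    unfolding cut_def using that by (intro nn_integral_mono min.mono) auto
  have diag: "(\<integral>\<^sup>+x. cut u k x \<partial>lborel) * (\<integral>\<^sup>+x. cut v k x \<partial>lborel) \<le> (\<integral>\<^sup>+x. w x \<partial>lborel)\<^sup>2" for k
  proof -
    let ?r = "\<lambda>f x. enn2real (cut f k x)"
    have "(\<integral>\<^sup>+x. ennreal (?r u x) \<partial>lborel) * (\<integral>\<^sup>+x. ennreal (?r v x) \<partial>lborel)
        \<le> (\<integral>\<^sup>+x. ennreal (?r w x) \<partial>lborel) * (\<integral>\<^sup>+x. ennreal (?r w x) \<partial>lborel)"
    proof (rule prekopa_leindler_real_bounded)
      have "?r f x \<le> real k" for f x
        by (rule enn2real_leI) (auto simp: cut_def ennreal_of_nat_eq_real_of_nat)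
      then show "?r u x \<le> real k" "?r v x \<le> real k" for x by auto
      fix s t
      have "cut u k s * cut v k t \<le> (cut w k ((s + t) / 2))\<^sup>2"
      proof (cases "w ((s + t) / 2) \<le> of_nat k")
        case True
        have "cut u k s * cut v k t \<le> u s * v t" by (intro mult_mono) (auto simp: cut_def)
        also note mid[of s t]
        finally show ?thesis using True by (simp add: cut_def min_def)
      next
        case False
        then have "(cut w k ((s + t) / 2))\<^sup>2 = of_nat k * of_nat k" by (simp add: cut_def min_def power2_eq_square)
        then show ?thesis by (auto simp: cut_def intro!: mult_mono)
      qed
      then have "ennreal (?r u s * ?r v t) \<le> ennreal ((?r w ((s + t) / 2))\<^sup>2)"
        by (simp add: ennreal_mult cut_real power2_eq_square)
      then show "?r u s * ?r v t \<le> (?r w ((s + t) / 2))\<^sup>2" by (simp add: ennreal_le_iff)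
    qed auto
    then have "(\<integral>\<^sup>+x. cut u k x \<partial>lborel) * (\<integral>\<^sup>+x. cut v k x \<partial>lborel)
        \<le> (\<integral>\<^sup>+x. cut w k x \<partial>lborel) * (\<integral>\<^sup>+x. cut w k x \<partial>lborel)"
      by (simp only: cut_real)
    also have "\<dots> \<le> (\<integral>\<^sup>+x. w x \<partial>lborel) * (\<integral>\<^sup>+x. w x \<partial>lborel)"
      by (intro mult_mono nn_integral_mono) (auto simp: cut_def)
    finally show ?thesis by (simp add: power2_eq_square)
  qed
  \<comment> \<open>The product of two suprema has two independent indices; monotonicity in the cut
    reduces the pair to the diagonal index \<open>max k m\<close>.\<close>
  have off: "(\<integral>\<^sup>+x. cut u k x \<partial>lborel) * (\<integral>\<^sup>+x. cut v m x \<partial>lborel) \<le> (\<integral>\<^sup>+x. w x \<partial>lborel)\<^sup>2" for k m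
    by (rule order_trans[OF mult_mono[OF cut_mono[of k "max k m"] cut_mono[of m "max k m"]] diag]) auto
  show ?thesis
    unfolding conv[OF assms(1)] conv[OF assms(2)] SUP_mult_left_ennreal SUP_mult_right_ennreal
    by (intro SUP_least off)
qed

section \<open>From the line to the product space\<close>

definition midpt :: "nat \<Rightarrow> (nat \<Rightarrow> real) \<Rightarrow> (nat \<Rightarrow> real) \<Rightarrow> nat \<Rightarrow> real" where
  "midpt d x y = (\<lambda>j\<in>{..<d}. (x j + y j) / 2)"

lemma midpt_Suc: "midpt (Suc d) (x(d := s)) (y(d := t)) = (midpt d x y)(d := (s + t) / 2)"
  by (auto simp: midpt_def fun_eq_iff restrict_def)

interpretation lborel_product: product_sigma_finite "\<lambda>_::nat. lborel :: real measure"
  by standard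

lemma space_leb: "space (leb d) = Rd d"
  by (simp add: leb_def Rd_def space_PiM)

lemma leb_Suc: "leb (Suc d) = (\<Pi>\<^sub>M i\<in>insert d {..<d}. lborel)"
  by (simp add: leb_def lessThan_Suc)

lemma sigma_finite_leb: "sigma_finite_measure (leb d)"
  unfolding leb_def by (intro lborel_product.sigma_finite) auto

lemma measurable_leb_update[measurable]:
  "(\<lambda>(x, y). x(d := y)) \<in> leb d \<Otimes>\<^sub>M borel \<rightarrow>\<^sub>M leb (Suc d)"
proof -
  have "(\<lambda>(x, y). x(d := y)) \<in> leb d \<Otimes>\<^sub>M lborel \<rightarrow>\<^sub>M leb (Suc d)"
    unfolding leb_Suc unfolding leb_def by (rule measurable_add_dim)
  then show ?thesis by (simp cong: measurable_cong_sets)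
qed

text \<open>The inequality tensorizes. For fixed last coordinates \<open>s\<close>, \<open>t\<close>
  and \<open>(s + t) / 2\<close> the slices satisfy the hypothesis in dimension \<open>d\<close>, so
  by induction the integrals over the slices, as functions of the last coordinate, satisfy the
  hypothesis on the line. In dimension 0 the space is a single point of mass 1.\<close>

theorem prekopa_leindler_midpoint:
  fixes u v w :: "(nat \<Rightarrow> real) \<Rightarrow> ennreal"
  assumes "u \<in> borel_measurable (leb d)" "v \<in> borel_measurable (leb d)" "w \<in> borel_measurable (leb d)"
    and "\<And>x y. x \<in> Rd d \<Longrightarrow> y \<in> Rd d \<Longrightarrow> u x * v y \<le> (w (midpt d x y))\<^sup>2"
  shows "(\<integral>\<^sup>+x. u x \<partial>leb d) * (\<integral>\<^sup>+x. v x \<partial>leb d) \<le> (\<integral>\<^sup>+x. w x \<partial>leb d)\<^sup>2"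
  using assms
proof (induction d arbitrary: u v w)
  case 0
  have "midpt 0 (\<lambda>_. undefined) (\<lambda>_. undefined) = (\<lambda>_. undefined)" by (auto simp: midpt_def)
  then show ?case using 0(4)[of "\<lambda>_. undefined" "\<lambda>_. undefined"]
    by (simp add: leb_def Rd_def lborel_product.nn_integral_empty)
next
  case (Suc d)
  note [measurable] = Suc.prems(1-3)
  interpret sigma_finite_measure "leb d" by (rule sigma_finite_leb)
  have slice: "(\<lambda>x. f (x(d := s))) \<in> borel_measurable (leb d)" if [measurable]: "f \<in> borel_measurable (leb (Suc d))"
    for f :: "_ \<Rightarrow> ennreal" and s :: real
  proof -
    have "(\<lambda>x. (\<lambda>(x, y). x(d := y)) (x, s)) \<in> leb d \<rightarrow>\<^sub>M leb (Suc d)" by measurable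
    from measurable_compose[OF this that] show ?thesis by simp
  qed
  have marg: "(\<lambda>s. \<integral>\<^sup>+x. f (x(d := s)) \<partial>leb d) \<in> borel_measurable borel"
    if [measurable]: "f \<in> borel_measurable (leb (Suc d))" for f :: "_ \<Rightarrow> ennreal"
  proof -
    have "(\<lambda>p. f ((\<lambda>(x, y). x(d := y)) (snd p, fst p))) \<in> borel_measurable (borel \<Otimes>\<^sub>M leb d)" by measurable
    then have "(\<lambda>(s, x). f (x(d := s))) \<in> borel_measurable (borel \<Otimes>\<^sub>M leb d)" by (simp add: case_prod_beta')
    then show ?thesis by (rule borel_measurable_nn_integral)
  qed
  have split: "(\<integral>\<^sup>+x. f x \<partial>leb (Suc d)) = (\<integral>\<^sup>+s. \<integral>\<^sup>+x. f (x(d := s)) \<partial>leb d \<partial>lborel)"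
    if f: "f \<in> borel_measurable (leb (Suc d))" for f :: "_ \<Rightarrow> ennreal"
    using lborel_product.product_nn_integral_insert_rev[of "{..<d}" d f] f
    unfolding leb_Suc unfolding leb_def by simp
  show ?case
    unfolding split[OF Suc.prems(1)] split[OF Suc.prems(2)] split[OF Suc.prems(3)]
  proof (intro prekopa_leindler_real marg Suc.prems(1-3))
    fix s t :: real
    show "(\<integral>\<^sup>+x. u (x(d := s)) \<partial>leb d) * (\<integral>\<^sup>+x. v (x(d := t)) \<partial>leb d)
      \<le> (\<integral>\<^sup>+x. w (x(d := (s + t) / 2)) \<partial>leb d)\<^sup>2"
    proof (intro Suc.IH slice Suc.prems(1-3))
      fix x y assume "x \<in> Rd d" "y \<in> Rd d"
      then have "x(d := s) \<in> Rd (Suc d)" "y(d := t) \<in> Rd (Suc d)"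
        by (auto simp: Rd_def PiE_iff extensional_def)
      from Suc.prems(4)[OF this] show "u (x(d := s)) * v (y(d := t)) \<le> (w ((midpt d x y)(d := (s + t) / 2)))\<^sup>2"
        by (simp only: midpt_Suc)
    qed
  qed
qed

section \<open>Gaussian measures\<close>

definition quad_form :: "nat \<Rightarrow> real mat \<Rightarrow> (nat \<Rightarrow> real) \<Rightarrow> real" where
  "quad_form d A x = (\<Sum>j<d. \<Sum>k<d. x j * A $$ (j, k) * x k)"

definition pos_def_mat :: "nat \<Rightarrow> real mat \<Rightarrow> bool" where
  "pos_def_mat d A \<longleftrightarrow> A \<in> carrier_mat d d \<and> (\<forall>j<d. \<forall>k<d. A $$ (j, k) = A $$ (k, j)) \<and>
     (\<forall>x. (\<exists>j<d. x j \<noteq> 0) \<longrightarrow> quad_form d A x > 0)"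

lemma quad_form_cong: "(\<And>j. j < d \<Longrightarrow> x j = y j) \<Longrightarrow> quad_form d A x = quad_form d A y"
  by (simp add: quad_form_def)

lemma nn_integral_exp_square:
  fixes a c :: real
  assumes "a > 0"
  shows "(\<integral>\<^sup>+s. ennreal (exp (- (a * (s + c)\<^sup>2) / 2)) \<partial>lborel) = ennreal (sqrt (2 * pi / a))"
proof -
  define \<sigma> where "\<sigma> = 1 / sqrt a"
  have \<sigma>: "\<sigma> > 0" "\<sigma>\<^sup>2 = 1 / a" using assms by (auto simp: \<sigma>_def power_divide)
  have eq: "exp (- (a * (s + c)\<^sup>2) / 2) = sqrt (2 * pi / a) * normal_density (- c) \<sigma> s" for s
  proof -
    have "sqrt (2 * pi / a) > 0" using assms by simp
    then show ?thesis unfolding normal_density_def \<sigma>(2) using assms by (simp add: mult.commute)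
  qed
  have "(\<integral>\<^sup>+s. ennreal (exp (- (a * (s + c)\<^sup>2) / 2)) \<partial>lborel)
    = ennreal (sqrt (2 * pi / a)) * (\<integral>\<^sup>+s. ennreal (normal_density (- c) \<sigma> s) \<partial>lborel)"
    unfolding eq by (subst nn_integral_cmult[symmetric]) (auto simp: ennreal_mult assms less_imp_le)
  also have "(\<integral>\<^sup>+s. ennreal (normal_density (- c) \<sigma> s) \<partial>lborel) = 1"
    using \<sigma> integral_normal_density[of \<sigma> "-c"] by (subst nn_integral_eq_integral) (auto)
  finally show ?thesis by simp
qed

text \<open>\<open>B\<close> is the Schur complement of the corner entry. The first claim completes
  the square in the last coordinate; the second follows from the factorization of \<open>A\<close>
  into a block upper triangular matrix with diagonal blocks \<open>B\<close> and the corner entry,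
  and a block lower triangular one with unit diagonal.\<close>

lemma gaussian_elimination_step:
  fixes A :: "real mat"
  assumes A: "A \<in> carrier_mat (Suc d) (Suc d)" and sym: "\<forall>j<Suc d. \<forall>k<Suc d. A $$ (j, k) = A $$ (k, j)"
    and a: "A $$ (d, d) \<noteq> 0"
  defines "B \<equiv> Matrix.mat d d (\<lambda>(j, k). A $$ (j, k) - A $$ (j, d) * A $$ (k, d) / A $$ (d, d))"
  shows "quad_form (Suc d) A x = A $$ (d, d) * (x d + (\<Sum>j<d. A $$ (j, d) * x j) / A $$ (d, d))\<^sup>2 + quad_form d B x"
    and "Determinant.det A = A $$ (d, d) * Determinant.det B"
proof -
  let ?a = "A $$ (d, d)"
  let ?b = "\<Sum>j<d. A $$ (j, d) * x j"
  have sq: "?b\<^sup>2 = (\<Sum>j<d. \<Sum>k<d. A $$ (j, d) * x j * (A $$ (k, d) * x k))"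
    by (simp add: power2_eq_square sum_product)
  have "quad_form d B x = (\<Sum>j<d. \<Sum>k<d. x j * A $$ (j, k) * x k - A $$ (j, d) * x j * (A $$ (k, d) * x k) / ?a)"
    unfolding quad_form_def B_def by (intro sum.cong refl) (simp add: algebra_simps)
  then have B: "quad_form d B x = quad_form d A x - ?b\<^sup>2 / ?a"
    by (simp add: sq quad_form_def sum_subtractf sum_divide_distrib)
  have row: "(\<Sum>k<d. x d * A $$ (d, k) * x k) = x d * ?b"
    unfolding sum_distrib_left using sym by (intro sum.cong refl) auto
  have col: "(\<Sum>j<d. x j * A $$ (j, d) * x d) = x d * ?b"
    unfolding sum_distrib_left by (intro sum.cong refl) auto
  have "quad_form (Suc d) A x = quad_form d A x + 2 * (x d * ?b) + ?a * (x d)\<^sup>2"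
    unfolding quad_form_def by (simp add: sum.distrib row col power2_eq_square)
  then show "quad_form (Suc d) A x = ?a * (x d + ?b / ?a)\<^sup>2 + quad_form d B x"
    unfolding B using a by (simp add: power2_eq_square field_simps)
next
  let ?a = "A $$ (d, d)"
  define bc where "bc = Matrix.mat d 1 (\<lambda>(j, _). A $$ (j, d))"
  define br where "br = Matrix.mat 1 d (\<lambda>(_, k). A $$ (k, d) / ?a)"
  define aa where "aa = Matrix.mat 1 1 (\<lambda>_. ?a)"
  have c: "B \<in> carrier_mat d d" "bc \<in> carrier_mat d 1" "br \<in> carrier_mat 1 d" "aa \<in> carrier_mat 1 1"
    by (auto simp: B_def bc_def br_def aa_def)
  have "four_block_mat B bc (0\<^sub>m 1 d) aa * four_block_mat (1\<^sub>m d) (0\<^sub>m d 1) br (1\<^sub>m 1)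
      = four_block_mat (B * 1\<^sub>m d + bc * br) (B * 0\<^sub>m d 1 + bc * 1\<^sub>m 1) (0\<^sub>m 1 d * 1\<^sub>m d + aa * br) (0\<^sub>m 1 d * 0\<^sub>m d 1 + aa * 1\<^sub>m 1)"
    by (rule mult_four_block_mat) (use c in auto)
  also have "\<dots> = A"
  proof (rule eq_matI)
    fix i j assume "i < dim_row A" "j < dim_col A"
    then have ij: "i < Suc d" "j < Suc d" using A by auto
    show "four_block_mat (B * 1\<^sub>m d + bc * br) (B * 0\<^sub>m d 1 + bc * 1\<^sub>m 1) (0\<^sub>m 1 d * 1\<^sub>m d + aa * br)
       (0\<^sub>m 1 d * 0\<^sub>m d 1 + aa * 1\<^sub>m 1) $$ (i, j) = A $$ (i, j)"
    proof (cases "i < d"; cases "j < d")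
      assume "i < d" "j < d"
      then show ?thesis using a c by (simp add: scalar_prod_def) (simp add: B_def bc_def br_def)
    next
      assume "i < d" "\<not> j < d"
      moreover then have "j = d" using ij by simp
      ultimately show ?thesis using c by (simp add: scalar_prod_def) (simp add: bc_def)
    next
      assume "\<not> i < d" "j < d"
      moreover then have "i = d" using ij by simp
      moreover have "A $$ (d, j) = A $$ (j, d)" using sym ij by auto
      ultimately show ?thesis using a c by (simp add: scalar_prod_def) (simp add: br_def aa_def)
    next
      assume "\<not> i < d" "\<not> j < d"
      then have "i = d" "j = d" using ij by auto
      then show ?thesis using c by (simp add: scalar_prod_def) (simp add: aa_def)
    qed
  qed (use A c in auto)
  finally have "Determinant.det A = Determinant.det (four_block_mat B bc (0\<^sub>m 1 d) aa)
      * Determinant.det (four_block_mat (1\<^sub>m d) (0\<^sub>m d 1) br (1\<^sub>m 1))"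
    using det_mult[of "four_block_mat B bc (0\<^sub>m 1 d) aa" "d + 1" "four_block_mat (1\<^sub>m d) (0\<^sub>m d 1) br (1\<^sub>m 1)"] c
    by (metis four_block_carrier_mat one_carrier_mat)
  also have "Determinant.det (four_block_mat B bc (0\<^sub>m 1 d) aa) = Determinant.det B * Determinant.det aa"
    by (rule det_four_block_mat_lower_left_zero) (use c in auto)
  also have "Determinant.det aa = ?a" using c(4) by (simp add: det_single aa_def)
  also have "Determinant.det (four_block_mat (1\<^sub>m d) (0\<^sub>m d 1) br (1\<^sub>m 1)) = 1"
    by (subst det_four_block_mat_upper_right_zero_col) (use c in auto)
  finally show "Determinant.det A = ?a * Determinant.det B" by simp
qed

text \<open>The last coordinate is integrated out and the Schur complement remains. Positivity of
  the determinant is carried along in the induction, as the determinant is a product of positive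
  pivots.\<close>

lemma nn_integral_gaussian:
  assumes "pos_def_mat d A"
  shows "Determinant.det A > 0 \<and>
    (\<integral>\<^sup>+x. ennreal (exp (- quad_form d A (\<lambda>j. x j - m j) / 2)) \<partial>leb d) = ennreal (sqrt ((2 * pi) ^ d / Determinant.det A))"
  using assms
proof (induction d arbitrary: A)
  case 0
  then have "A \<in> carrier_mat 0 0" by (simp add: pos_def_mat_def)
  then have "Determinant.det A = 1" by (simp add: det_dim_zero)
  moreover have "(\<integral>\<^sup>+x. ennreal (exp (- quad_form 0 A (\<lambda>j. x j - m j) / 2)) \<partial>leb 0) = 1"
    unfolding leb_def lessThan_0 by (subst lborel_product.nn_integral_empty) (simp_all add: quad_form_def)
  ultimately show ?case by simp
next
  case (Suc d)
  let ?a = "A $$ (d, d)"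
  define B where "B = Matrix.mat d d (\<lambda>(j, k). A $$ (j, k) - A $$ (j, d) * A $$ (k, d) / ?a)"
  have A: "A \<in> carrier_mat (Suc d) (Suc d)" "\<forall>j<Suc d. \<forall>k<Suc d. A $$ (j, k) = A $$ (k, j)"
    and pos: "\<And>x. \<exists>j<Suc d. x j \<noteq> 0 \<Longrightarrow> quad_form (Suc d) A x > 0"
    using Suc.prems by (auto simp: pos_def_mat_def)
  let ?e = "\<lambda>j. if j = d then 1 else (0::real)"
  have "(\<Sum>j<d. \<Sum>k<Suc d. ?e j * A $$ (j, k) * ?e k) = 0" "(\<Sum>k<d. ?e d * A $$ (d, k) * ?e k) = 0"
    by (auto intro!: sum.neutral)
  then have "quad_form (Suc d) A ?e = ?a" unfolding quad_form_def sum.lessThan_Suc[of "\<lambda>j. \<Sum>k<Suc d. ?e j * A $$ (j, k) * ?e k"] by simp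
  then have a: "?a > 0" using pos[of "\<lambda>j. if j = d then 1 else 0"] by auto
  note step = gaussian_elimination_step[OF A less_imp_neq[OF a, symmetric], folded B_def]
  have pdB: "pos_def_mat d B"
    unfolding pos_def_mat_def
  proof (intro conjI allI impI)
    show "B \<in> carrier_mat d d" by (simp add: B_def)
    fix j k assume "j < d" "k < d"
    then show "B $$ (j, k) = B $$ (k, j)" using A(2) by (simp add: B_def)
  next
    fix x :: "nat \<Rightarrow> real" assume x: "\<exists>j<d. x j \<noteq> 0"
    \<comment> \<open>This last coordinate makes the completed square vanish, so \<open>A\<close> at
      \<open>?y\<close> has the value of \<open>B\<close> at \<open>x\<close>.\<close>
    let ?y = "x(d := - (\<Sum>j<d. A $$ (j, d) * x j) / ?a)"
    have "quad_form (Suc d) A ?y > 0" using x by (intro pos) auto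
    then have "quad_form d B ?y > 0" unfolding step(1)[of ?y] by simp
    then show "quad_form d B x > 0" using quad_form_cong[of d x ?y B] by simp
  qed
  note IH = Suc.IH[OF pdB]
  let ?g = "\<lambda>x. ennreal (exp (- quad_form (Suc d) A (\<lambda>j. x j - m j) / 2))"
  let ?gB = "\<lambda>x. ennreal (exp (- quad_form d B (\<lambda>j. x j - m j) / 2))"
  have meas: "?g \<in> borel_measurable (\<Pi>\<^sub>M i\<in>insert d {..<d}. lborel)"
    unfolding quad_form_def by measurable (auto simp: lessThan_Suc)
  have measB: "?gB \<in> borel_measurable (\<Pi>\<^sub>M i\<in>{..<d}. lborel)"
    unfolding quad_form_def by measurable
  have "(\<integral>\<^sup>+x. ?g x \<partial>leb (Suc d)) = (\<integral>\<^sup>+x. (\<integral>\<^sup>+s. ?g (x(d := s)) \<partial>lborel) \<partial>leb d)"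
    unfolding leb_Suc unfolding leb_def
    by (rule lborel_product.product_nn_integral_insert) (use meas in auto)
  also have "\<dots> = (\<integral>\<^sup>+x. ennreal (sqrt (2 * pi / ?a)) * ?gB x \<partial>leb d)"
  proof (intro nn_integral_cong)
    fix x :: "nat \<Rightarrow> real"
    let ?c = "(\<Sum>j<d. A $$ (j, d) * (x j - m j)) / ?a - m d"
    have "quad_form (Suc d) A (\<lambda>j. (x(d := s)) j - m j) = ?a * (s + ?c)\<^sup>2 + quad_form d B (\<lambda>j. x j - m j)" for s
    proof -
      have "quad_form d B (\<lambda>j. (x(d := s)) j - m j) = quad_form d B (\<lambda>j. x j - m j)"
        by (rule quad_form_cong) auto
      then show ?thesis unfolding step(1) by (simp add: algebra_simps)
    qed
    then have "?g (x(d := s)) = ?gB x * ennreal (exp (- (?a * (s + ?c)\<^sup>2) / 2))" for s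
      by (simp add: ennreal_mult[symmetric] mult_exp_exp diff_divide_distrib add_divide_distrib algebra_simps)
    then have "(\<integral>\<^sup>+s. ?g (x(d := s)) \<partial>lborel) = ?gB x * (\<integral>\<^sup>+s. ennreal (exp (- (?a * (s + ?c)\<^sup>2) / 2)) \<partial>lborel)"
      by (simp add: nn_integral_cmult)
    then show "(\<integral>\<^sup>+s. ?g (x(d := s)) \<partial>lborel) = ennreal (sqrt (2 * pi / ?a)) * ?gB x"
      unfolding nn_integral_exp_square[OF a] by (simp add: mult.commute)
  qed
  also have "\<dots> = ennreal (sqrt (2 * pi / ?a)) * ennreal (sqrt ((2 * pi) ^ d / Determinant.det B))"
    using IH measB unfolding leb_def by (subst nn_integral_cmult) auto
  also have "\<dots> = ennreal (sqrt ((2 * pi) ^ Suc d / Determinant.det A))"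
    unfolding step(2) using a IH by (simp add: ennreal_mult[symmetric] real_sqrt_mult[symmetric])
  finally show ?case using IH a step(2) by simp
qed

text \<open>\<open>gaussian\<close> inverts the covariance it is given, while \<open>laplace\<close>
  passes an inverse to it; the double inversion has to return the precision matrix itself.\<close>

lemma mat_inverse_twice:
  assumes "A \<in> carrier_mat d d" "Determinant.det A \<noteq> (0::real)"
  shows "the (mat_inverse (the (mat_inverse A))) = A"
    and "Determinant.det (the (mat_inverse A)) = 1 / Determinant.det A"
    and "the (mat_inverse A) \<in> carrier_mat d d"
proof -
  have inv: "\<exists>B. mat_inverse A = Some B \<and> A * B = 1\<^sub>m d \<and> B * A = 1\<^sub>m d \<and> B \<in> carrier_mat d d"
    if "A \<in> carrier_mat d d" "Determinant.det A \<noteq> 0" for A :: "real mat"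
  proof -
    have "mat_inverse A \<noteq> None" using mat_inverse(1)[OF that(1)] det_non_zero_imp_unit[OF that, of undefined] by metis
    then show ?thesis using mat_inverse(2)[OF that(1)] by auto
  qed
  obtain B where B: "mat_inverse A = Some B" "A * B = 1\<^sub>m d" "B * A = 1\<^sub>m d" "B \<in> carrier_mat d d"
    using inv[OF assms] by blast
  have dB: "Determinant.det A * Determinant.det B = 1"
    using det_mult[OF assms(1) B(4)] B(2) by simp
  then have "Determinant.det B \<noteq> 0" by auto
  then obtain C where C: "mat_inverse B = Some C" "B * C = 1\<^sub>m d" "C \<in> carrier_mat d d" using inv[OF B(4)] by blast
  have "C = (A * B) * C" using B C by simp
  also have "\<dots> = A * (B * C)" using assms(1) B(4) C(3) by (intro assoc_mult_mat)
  finally have "C = A" using C assms(1) by simp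
  then show "the (mat_inverse (the (mat_inverse A))) = A" using B C by simp
  show "Determinant.det (the (mat_inverse A)) = 1 / Determinant.det A"
    using dB B(1) assms(2) by (simp add: field_simps)
  show "the (mat_inverse A) \<in> carrier_mat d d" using B by simp
qed

lemma gaussian_precision:
  assumes "pos_def_mat d A"
  shows "gaussian d m (the (mat_inverse A)) = density (leb d) (\<lambda>x. ennreal
      (sqrt (Determinant.det A / (2 * pi) ^ d) * exp (- quad_form d A (\<lambda>j. x j - m j) / 2)))"
proof -
  have d: "Determinant.det A > 0" using nn_integral_gaussian[OF assms] by blast
  have A: "A \<in> carrier_mat d d" using assms by (simp add: pos_def_mat_def)
  note inv = mat_inverse_twice[OF A less_imp_neq[OF d, symmetric]]
  have "1 / sqrt ((2 * pi) ^ d * (1 / Determinant.det A)) = sqrt (Determinant.det A / (2 * pi) ^ d)"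
    by (simp add: real_sqrt_divide)
  then show ?thesis unfolding gaussian_def inv quad_form_def by simp
qed

lemma prob_space_gaussian_precision:
  assumes "pos_def_mat d A"
  shows "(\<integral>\<^sup>+x. ennreal (sqrt (Determinant.det A / (2 * pi) ^ d) * exp (- quad_form d A (\<lambda>j. x j - m j) / 2)) \<partial>leb d) = 1"
proof -
  have meas: "(\<lambda>x. ennreal (exp (- quad_form d A (\<lambda>j. x j - m j) / 2))) \<in> borel_measurable (leb d)"
    unfolding quad_form_def leb_def by measurable
  note g = nn_integral_gaussian[OF assms, of m]
  have "sqrt (Determinant.det A / (2 * pi) ^ d) * sqrt ((2 * pi) ^ d / Determinant.det A) = 1"
    using g by (simp add: real_sqrt_mult[symmetric])
  then show ?thesis
    using g meas by (simp add: ennreal_mult nn_integral_cmult) (simp add: ennreal_mult[symmetric])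
qed

text \<open>Both sides agree on boxes. The factors may differ, as needed for labels, whose
  conditional laws vary with the observation.\<close>

lemma density_PiM:
  assumes "finite I" "product_sigma_finite M" "product_sigma_finite (\<lambda>i. density (M i) (f i))"
    and [measurable]: "\<And>i. i \<in> I \<Longrightarrow> f i \<in> borel_measurable (M i)"
  shows "density (PiM I M) (\<lambda>x. \<Prod>i\<in>I. f i (x i)) = PiM I (\<lambda>i. density (M i) (f i))"
proof -
  interpret M: product_sigma_finite M by fact
  interpret D: product_sigma_finite "\<lambda>i. density (M i) (f i)" by fact
  show ?thesis
  proof (rule D.PiM_eqI[OF assms(1)])
    show "sets (density (PiM I M) (\<lambda>x. \<Prod>i\<in>I. f i (x i))) = PiM I (\<lambda>i. density (M i) (f i))"
      by (simp cong: sets_PiM_cong)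
    fix A assume "\<And>i. i \<in> I \<Longrightarrow> A i \<in> sets (density (M i) (f i))"
    then have [measurable]: "\<And>i. i \<in> I \<Longrightarrow> A i \<in> sets (M i)" by simp
    have "emeasure (density (PiM I M) (\<lambda>x. \<Prod>i\<in>I. f i (x i))) (Pi\<^sub>E I A)
      = (\<integral>\<^sup>+x. (\<Prod>i\<in>I. f i (x i)) * indicator (Pi\<^sub>E I A) x \<partial>PiM I M)"
      by (subst emeasure_density) (auto intro!: sets_PiM_I_finite assms(1))
    also have "\<dots> = (\<integral>\<^sup>+x. (\<Prod>i\<in>I. f i (x i) * indicator (A i) (x i)) \<partial>PiM I M)"
    proof (intro nn_integral_cong)
      fix x assume "x \<in> space (PiM I M)"
      then have "indicator (Pi\<^sub>E I A) x = (\<Prod>i\<in>I. indicator (A i) (x i) :: ennreal)"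
        using assms(1) by (auto simp: indicator_def space_PiM PiE_iff intro!: prod_zero)
      then show "(\<Prod>i\<in>I. f i (x i)) * indicator (Pi\<^sub>E I A) x = (\<Prod>i\<in>I. f i (x i) * indicator (A i) (x i))"
        by (simp add: prod.distrib)
    qed
    also have "\<dots> = (\<Prod>i\<in>I. \<integral>\<^sup>+x. f i x * indicator (A i) x \<partial>M i)"
      by (rule M.product_nn_integral_prod[OF assms(1)]) measurable
    also have "\<dots> = (\<Prod>i\<in>I. emeasure (density (M i) (f i)) (A i))"
      by (intro prod.cong refl) (simp add: emeasure_density)
    finally show "emeasure (density (PiM I M) (\<lambda>x. \<Prod>i\<in>I. f i (x i))) (Pi\<^sub>E I A) = \<dots>" .
  qed
qed

section \<open>The standard Gaussian as a product measure, and moments of its linear forms\<close>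

definition std_normal :: "real measure" where
  "std_normal = density lborel std_normal_density"

definition std_gauss :: "nat \<Rightarrow> (nat \<Rightarrow> real) measure" where
  "std_gauss d = (\<Pi>\<^sub>M i\<in>{..<d}. std_normal)"

lemma prob_space_std_normal: "prob_space std_normal"
  unfolding std_normal_def by (rule prob_space_normal_density) simp

interpretation std_normal: prob_space std_normal by (rule prob_space_std_normal)

interpretation std_normal_product: product_prob_space "\<lambda>_::nat. std_normal" "{..<d}" for d
  by unfold_locales

lemma sets_std_normal[measurable_cong, simp]: "sets std_normal = sets borel"
  by (simp add: std_normal_def)

lemma space_std_normal[simp]: "space std_normal = UNIV"
  by (simp add: std_normal_def)

lemma prob_space_std_gauss: "prob_space (std_gauss d)"
  unfolding std_gauss_def by (intro prob_space_PiM prob_space_std_normal)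

interpretation std_gauss: prob_space "std_gauss d" for d by (rule prob_space_std_gauss)

lemma sets_std_gauss[measurable_cong]: "sets (std_gauss d) = sets (leb d)"
  unfolding std_gauss_def leb_def by (intro sets_PiM_cong) auto

lemma measurable_leb_component[measurable]: "j < d \<Longrightarrow> (\<lambda>x. x j) \<in> borel_measurable (leb d)"
  unfolding leb_def by measurable

lemma measurable_std_gauss_component[measurable]: "j < d \<Longrightarrow> (\<lambda>x. x j) \<in> borel_measurable (std_gauss d)"
  by (subst measurable_cong_sets[OF sets_std_gauss refl]) (rule measurable_leb_component)

lemma quad_form_one: "quad_form d (1\<^sub>m d) x = (\<Sum>j<d. (x j)\<^sup>2)"
proof -
  have "quad_form d (1\<^sub>m d) x = (\<Sum>j<d. \<Sum>k<d. if k = j then (x j)\<^sup>2 else 0)"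
    unfolding quad_form_def by (intro sum.cong refl) (auto simp: power2_eq_square)
  then show ?thesis by simp
qed

lemma gaussian_standard: "gaussian d (\<lambda>_. 0) (1\<^sub>m d) = std_gauss d"
proof -
  have pd: "pos_def_mat d (1\<^sub>m d)"
    unfolding pos_def_mat_def quad_form_one by (auto intro!: sum_pos2)
  have "the (mat_inverse (1\<^sub>m d)) = (1\<^sub>m d :: real mat)"
  proof -
    have "mat_inverse (1\<^sub>m d :: real mat) \<noteq> None"
      using mat_inverse(1)[of "1\<^sub>m d :: real mat" d] det_non_zero_imp_unit[of "1\<^sub>m d :: real mat" d undefined]
      by (metis det_one one_carrier_mat zero_neq_one)
    then show ?thesis using mat_inverse(2)[of "1\<^sub>m d :: real mat" d] by fastforce
  qed
  then have "gaussian d (\<lambda>_. 0) (1\<^sub>m d) = density (leb d) (\<lambda>x. ennreal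
      (sqrt (1 / (2 * pi) ^ d) * exp (- (\<Sum>j<d. (x j)\<^sup>2) / 2)))"
    using gaussian_precision[OF pd, of "\<lambda>_. 0"] by (simp add: quad_form_one)
  also have "(\<lambda>x. ennreal (sqrt (1 / (2 * pi) ^ d) * exp (- (\<Sum>j<d. (x j)\<^sup>2) / 2)))
    = (\<lambda>x. \<Prod>j<d. ennreal (std_normal_density (x j)))"
  proof
    fix x :: "nat \<Rightarrow> real"
    have "(\<Prod>j<d. ennreal (std_normal_density (x j))) = ennreal (\<Prod>j<d. std_normal_density (x j))"
      by (rule prod_ennreal) auto
    also have "(\<Prod>j<d. std_normal_density (x j)) = (1 / sqrt (2 * pi)) ^ d * exp (\<Sum>j<d. - (x j)\<^sup>2 / 2)"
      by (simp add: std_normal_density_def prod.distrib exp_sum prod_dividef power_one_over)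
    finally show "ennreal (sqrt (1 / (2 * pi) ^ d) * exp (- (\<Sum>j<d. (x j)\<^sup>2) / 2)) = (\<Prod>j<d. ennreal (std_normal_density (x j)))"
      by (simp add: real_sqrt_divide real_sqrt_power real_sqrt_mult power_mult_distrib power_one_over sum_negf sum_divide_distrib)
  qed
  also have "density (leb d) \<dots> = std_gauss d"
    unfolding leb_def std_gauss_def std_normal_def
    by (rule density_PiM)
       (auto intro!: product_sigma_finite.intro lborel_product.sigma_finite_measures
         prob_space_imp_sigma_finite prob_space_normal_density)
  finally show ?thesis .
qed

lemma indep_vars_std_gauss:
  assumes "d > 0" shows "std_gauss.indep_vars d (\<lambda>_. borel) (\<lambda>j x. x j) {..<d}"
proof (subst std_gauss.indep_vars_iff_distr_eq_PiM')
  have "distr (std_gauss d) (\<Pi>\<^sub>M i\<in>{..<d}. borel) (\<lambda>x. \<lambda>i\<in>{..<d}. x i) = distr (std_gauss d) (std_gauss d) (\<lambda>x. x)"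
    by (intro distr_cong) (auto simp: std_gauss_def space_PiM PiE_iff extensional_def restrict_def intro!: sets_PiM_cong)
  also have "\<dots> = std_gauss d" by simp
  also have "\<dots> = (\<Pi>\<^sub>M i\<in>{..<d}. distr (std_gauss d) borel (\<lambda>x. x i))"
  proof -
    have "distr (std_gauss d) borel (\<lambda>x. x i) = std_normal" if "i < d" for i
    proof -
      have "distr (std_gauss d) borel (\<lambda>x. x i) = distr (std_gauss d) std_normal (\<lambda>x. x i)"
        by (intro distr_cong) auto
      then show ?thesis unfolding std_gauss_def using distr_PiM_component[of "{..<d}" "\<lambda>_. std_normal" i] prob_space_std_normal that by simp
    qed
    then show ?thesis unfolding std_gauss_def[of d] by (intro PiM_cong) (auto simp: std_gauss_def)
  qed
  finally show "distr (std_gauss d) (\<Pi>\<^sub>M i\<in>{..<d}. borel) (\<lambda>x. \<lambda>i\<in>{..<d}. x i) = (\<Pi>\<^sub>M i\<in>{..<d}. distr (std_gauss d) borel (\<lambda>x. x i))" .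
qed (use assms in auto)

lemma distributed_std_gauss_component:
  assumes "j < d" shows "distributed (std_gauss d) lborel (\<lambda>x. x j) std_normal_density"
proof -
  have "distr (std_gauss d) lborel (\<lambda>x. x j) = distr (std_gauss d) std_normal (\<lambda>x. x j)"
    by (intro distr_cong) auto
  also have "\<dots> = std_normal"
    unfolding std_gauss_def using distr_PiM_component[of "{..<d}" "\<lambda>_. std_normal" j] prob_space_std_normal assms by simp
  finally show ?thesis using assms by (simp add: distributed_def std_normal_def)
qed

lemma enorm_square: "(enorm d v)\<^sup>2 = (\<Sum>j<d. (v j)\<^sup>2)"
  by (simp add: enorm_def L2_set_def sum_nonneg)

lemma enorm_nonneg[simp]: "0 \<le> enorm d v"
  by (simp add: enorm_def)

lemma enorm_eq_0_iff: "enorm d v = 0 \<longleftrightarrow> (\<forall>j<d. v j = 0)"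
  by (auto simp: enorm_def L2_set_eq_0_iff)

lemma distributed_dot:
  assumes "enorm d v \<noteq> 0"
  shows "distributed (std_gauss d) lborel (\<lambda>x. dot d x v) (normal_density 0 (enorm d v))"
proof -
  \<comment> \<open>The rule for sums of independent normal variables needs positive standard
    deviations, so coordinates with coefficient 0 are left out of the sum.\<close>
  define I where "I = {j. j < d \<and> v j \<noteq> 0}"
  have I: "finite I" "I \<subseteq> {..<d}" by (auto simp: I_def)
  have ne: "I \<noteq> {}" using assms by (auto simp: I_def enorm_eq_0_iff)
  then have d: "d > 0" using I by auto
  have ind: "std_gauss.indep_vars d (\<lambda>_. borel) (\<lambda>j x. v j * x j) I"
    using std_gauss.indep_vars_compose2[OF std_gauss.indep_vars_subset[OF indep_vars_std_gauss[OF d] I(2)], of "\<lambda>j y. v j * y" "\<lambda>_. borel"]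
    by simp
  have "distributed (std_gauss d) lborel (\<lambda>x. \<Sum>j\<in>I. v j * x j)
      (normal_density (\<Sum>j\<in>I. 0) (sqrt (\<Sum>j\<in>I. \<bar>v j\<bar>\<^sup>2)))"
  proof (rule std_gauss.sum_indep_normal[OF I(1) ne ind])
    fix j assume j: "j \<in> I"
    then show "0 < \<bar>v j\<bar>" by (simp add: I_def)
    have "distributed (std_gauss d) lborel (\<lambda>x. 0 + v j * x j) (normal_density (0 + v j * 0) (\<bar>v j\<bar> * 1))"
      using j by (intro std_gauss.normal_density_affine distributed_std_gauss_component) (auto simp: I_def)
    then show "distributed (std_gauss d) lborel (\<lambda>x. v j * x j) (normal_density 0 \<bar>v j\<bar>)" by simp
  qed
  moreover have "(\<Sum>j\<in>I. v j * x j) = dot d x v" for x :: "nat \<Rightarrow> real"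
    unfolding dot_def by (subst mult.commute) (intro sum.mono_neutral_left, auto simp: I_def)
  moreover have "(\<Sum>j\<in>I. \<bar>v j\<bar>\<^sup>2) = (\<Sum>j<d. (v j)\<^sup>2)"
    by (simp, intro sum.mono_neutral_left) (auto simp: I_def)
  ultimately show ?thesis by (simp add: enorm_def L2_set_def)
qed

lemma measurable_dot[measurable]: "(\<lambda>x. dot d x v) \<in> borel_measurable (leb d)"
  unfolding dot_def by measurable

lemma dot_eq_0: "enorm d v = 0 \<Longrightarrow> dot d x v = 0"
  by (simp add: dot_def enorm_eq_0_iff)

lemma dot_even_moment:
  shows "integrable (std_gauss d) (\<lambda>x. (dot d x v) ^ (2 * k))"
    and "(\<integral>x. (dot d x v) ^ (2 * k) \<partial>std_gauss d) = fact (2 * k) / (2 ^ k * fact k) * enorm d v ^ (2 * k)"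
proof -
  show "integrable (std_gauss d) (\<lambda>x. (dot d x v) ^ (2 * k))"
  proof (cases "enorm d v = 0")
    case False
    then have pos: "enorm d v > 0" by (simp add: less_le)
    have "integrable lborel (\<lambda>y. normal_density 0 (enorm d v) y * y ^ (2 * k))"
      using integrable_normal_moment[OF pos, of 0 "2 * k"] by simp
    then show ?thesis using distributed_integrable[OF distributed_dot[OF False], of "\<lambda>y. y ^ (2 * k)"] by simp
  qed (simp add: dot_eq_0)
  show "(\<integral>x. (dot d x v) ^ (2 * k) \<partial>std_gauss d) = fact (2 * k) / (2 ^ k * fact k) * enorm d v ^ (2 * k)"
  proof (cases "enorm d v = 0")
    case True then show ?thesis
      using std_gauss.prob_space by (cases k) (simp_all add: dot_eq_0)
  next
    case False
    then have pos: "enorm d v > 0" by (simp add: less_le)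
    have "(\<integral>y. normal_density 0 (enorm d v) y * y ^ (2 * k) \<partial>lborel) = fact (2 * k) / ((2 / (enorm d v)\<^sup>2) ^ k * fact k)"
      using normal_moment_even[OF pos, of 0 k] by (simp add: has_bochner_integral_integral_eq)
    moreover have "\<dots> = fact (2 * k) / (2 ^ k * fact k) * enorm d v ^ (2 * k)"
      using pos by (simp add: power_divide power_mult)
    ultimately show ?thesis
      using distributed_integral[OF distributed_dot[OF False], of "\<lambda>y. y ^ (2 * k)"] by simp
  qed
qed

lemma dot_moment2: "integrable (std_gauss d) (\<lambda>x. (dot d x v)\<^sup>2)" "(\<integral>x. (dot d x v)\<^sup>2 \<partial>std_gauss d) = (enorm d v)\<^sup>2"
  using dot_even_moment[of d v 1] by simp_all

lemma dot_moment4: "integrable (std_gauss d) (\<lambda>x. (dot d x v) ^ 4)" "(\<integral>x. (dot d x v) ^ 4 \<partial>std_gauss d) = 3 * enorm d v ^ 4"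
  using dot_even_moment[of d v 2] by (simp_all add: fact_numeral)

lemma dot_unit: "j < d \<Longrightarrow> dot d x (\<lambda>k. of_bool (k = j)) = x j"
  by (simp add: dot_def)

lemma enorm_unit: "j < d \<Longrightarrow> enorm d (\<lambda>k. of_bool (k = j)) = 1"
  by (simp add: enorm_def L2_set_def of_bool_def if_distrib[of "\<lambda>x. x\<^sup>2"] cong: if_cong)

lemma component_moments:
  assumes "j < d"
  shows "integrable (std_gauss d) (\<lambda>x. (x j)\<^sup>2)" "(\<integral>x. (x j)\<^sup>2 \<partial>std_gauss d) = 1"
    "integrable (std_gauss d) (\<lambda>x. (x j) ^ 4)" "(\<integral>x. (x j) ^ 4 \<partial>std_gauss d) = 3"
  using dot_moment2[of d "\<lambda>k. of_bool (k = j)"] dot_moment4[of d "\<lambda>k. of_bool (k = j)"] assms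
  by (simp_all add: dot_unit enorm_unit)

lemma component_moment22:
  assumes "j < d" "k < d"
  shows "integrable (std_gauss d) (\<lambda>x. (x j * x k)\<^sup>2)" "(\<integral>x. (x j * x k)\<^sup>2 \<partial>std_gauss d) \<le> 3"
proof -
  have le: "(a * b)\<^sup>2 \<le> (a ^ 4 + b ^ 4) / 2" for a b :: real
    using sum_squares_bound[of "a\<^sup>2" "b\<^sup>2"] by (simp add: power_mult_distrib)
  have int: "integrable (std_gauss d) (\<lambda>x. (x j ^ 4 + x k ^ 4) / 2)"
    using component_moments(3) assms by auto
  show i: "integrable (std_gauss d) (\<lambda>x. (x j * x k)\<^sup>2)"
    by (rule Bochner_Integration.integrable_bound[OF int]) (use assms le in \<open>auto simp: abs_of_nonneg\<close>)
  have "(\<integral>x. (x j * x k)\<^sup>2 \<partial>std_gauss d) \<le> (\<integral>x. (x j ^ 4 + x k ^ 4) / 2 \<partial>std_gauss d)"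
    by (rule integral_mono[OF i int le])
  also have "\<dots> = 3" using component_moments(3,4) assms by simp
  finally show "(\<integral>x. (x j * x k)\<^sup>2 \<partial>std_gauss d) \<le> 3" .
qed

lemma dot_moment22:
  shows "integrable (std_gauss d) (\<lambda>x. (dot d x u)\<^sup>2 * (dot d x v)\<^sup>2)"
    and "(\<integral>x. (dot d x u)\<^sup>2 * (dot d x v)\<^sup>2 \<partial>std_gauss d) \<le> 3 * (enorm d u)\<^sup>2 * (enorm d v)\<^sup>2"
proof -
  let ?a = "enorm d u" and ?b = "enorm d v"
  show i: "integrable (std_gauss d) (\<lambda>x. (dot d x u)\<^sup>2 * (dot d x v)\<^sup>2)"
  proof (rule Bochner_Integration.integrable_bound)
    show "integrable (std_gauss d) (\<lambda>x. (dot d x u) ^ 4 + (dot d x v) ^ 4)"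
      using dot_moment4(1) by auto
    have "s\<^sup>2 * t\<^sup>2 \<le> s ^ 4 + t ^ 4" for s t :: real
    proof -
      have "0 \<le> s\<^sup>2 * t\<^sup>2" by simp
      moreover have "2 * s\<^sup>2 * t\<^sup>2 \<le> s ^ 4 + t ^ 4" using sum_squares_bound[of "s\<^sup>2" "t\<^sup>2"] by simp
      ultimately show ?thesis by linarith
    qed
    then show "AE x in std_gauss d. norm ((dot d x u)\<^sup>2 * (dot d x v)\<^sup>2) \<le> norm ((dot d x u) ^ 4 + (dot d x v) ^ 4)"
      by (auto simp: abs_of_nonneg)
  qed measurable
  show "(\<integral>x. (dot d x u)\<^sup>2 * (dot d x v)\<^sup>2 \<partial>std_gauss d) \<le> 3 * ?a\<^sup>2 * ?b\<^sup>2"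
  proof (cases "?a = 0 \<or> ?b = 0")
    case True
    then show ?thesis by (auto simp: dot_eq_0)
  next
    case False
    then have ab: "?a > 0" "?b > 0" by (auto simp: less_le)
    \<comment> \<open>The weights balance the two fourth moments, so that the arithmetic-geometric
      mean inequality yields the product \<open>3 * ?a^2 * ?b^2\<close> instead of a sum of fourth
      powers.\<close>
    let ?g = "\<lambda>x. (?b\<^sup>2 / ?a\<^sup>2 * (dot d x u) ^ 4 + ?a\<^sup>2 / ?b\<^sup>2 * (dot d x v) ^ 4) / 2"
    have g: "integrable (std_gauss d) ?g" using dot_moment4(1) by auto
    have "(dot d x u)\<^sup>2 * (dot d x v)\<^sup>2 \<le> ?g x" for x
      using sum_squares_bound[of "?b / ?a * (dot d x u)\<^sup>2" "?a / ?b * (dot d x v)\<^sup>2"] ab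
      by (simp add: power_mult_distrib power_divide)
    then have "(\<integral>x. (dot d x u)\<^sup>2 * (dot d x v)\<^sup>2 \<partial>std_gauss d) \<le> (\<integral>x. ?g x \<partial>std_gauss d)"
      by (intro integral_mono i g)
    also have "\<dots> = (?b\<^sup>2 / ?a\<^sup>2 * (3 * ?a ^ 4) + ?a\<^sup>2 / ?b\<^sup>2 * (3 * ?b ^ 4)) / 2"
      using dot_moment4 by simp
    also have "\<dots> = 3 * ?a\<^sup>2 * ?b\<^sup>2" using ab by (simp add: field_simps power4_eq_xxxx power2_eq_square)
    finally show ?thesis .
  qed
qed

section \<open>Concentration of weighted Gram matrices\<close>

lemma integral_double_sum:
  fixes f :: "'i \<Rightarrow> 'j \<Rightarrow> 'a \<Rightarrow> real"
  assumes "\<And>i k. i \<in> I \<Longrightarrow> k \<in> K \<Longrightarrow> integrable M (f i k)"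
  shows "(\<integral>x. (\<Sum>i\<in>I. \<Sum>k\<in>K. f i k x) \<partial>M) = (\<Sum>i\<in>I. \<Sum>k\<in>K. \<integral>x. f i k x \<partial>M)"
proof -
  have "(\<integral>x. (\<Sum>i\<in>I. \<Sum>k\<in>K. f i k x) \<partial>M) = (\<Sum>i\<in>I. \<integral>x. (\<Sum>k\<in>K. f i k x) \<partial>M)"
    by (rule Bochner_Integration.integral_sum) (auto intro!: Bochner_Integration.integrable_sum assms)
  also have "\<dots> = (\<Sum>i\<in>I. \<Sum>k\<in>K. \<integral>x. f i k x \<partial>M)"
    by (intro sum.cong refl Bochner_Integration.integral_sum) (auto intro!: assms)
  finally show ?thesis .
qed

text \<open>Independence and mean zero remove the cross terms. The factors are allowed to differ
  because the lemma serves both the i.i.d. features and the labels conditionally on the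
  features.\<close>

lemma PiM_sum_square:
  fixes M :: "nat \<Rightarrow> 'a measure" and g :: "nat \<Rightarrow> 'a \<Rightarrow> real"
  assumes prob: "\<And>i. prob_space (M i)" and [measurable]: "\<And>i. g i \<in> borel_measurable (M i)"
    and sq: "\<And>i. i < n \<Longrightarrow> integrable (M i) (\<lambda>x. (g i x)\<^sup>2)"
    and mean: "\<And>i. i < n \<Longrightarrow> (\<integral>x. g i x \<partial>M i) = 0"
  shows "integrable (PiM {..<n} M) (\<lambda>x. (\<Sum>i<n. g i (x i))\<^sup>2)"
    and "(\<integral>x. (\<Sum>i<n. g i (x i))\<^sup>2 \<partial>PiM {..<n} M) = (\<Sum>i<n. \<integral>x. (g i x)\<^sup>2 \<partial>M i)"
proof -
  interpret product_prob_space M "{..<n}" by (rule product_prob_spaceI[OF prob])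
  have int: "integrable (M i) (g i)" if "i < n" for i
    by (rule finite_measure.square_integrable_imp_integrable[OF prob_space.finite_measure[OF prob] _ sq[OF that]]) auto
  \<comment> \<open>\<open>h i k\<close> writes the product of two coordinates as a product over all
    coordinates, with factor 1 elsewhere, so that the integral factorizes.\<close>
  define h where "h = (\<lambda>i k l x. if l = i then (g i x :: real) else if l = k then g k x else 1)"
  have prod: "(\<Prod>l<n. h i k l (x l)) = g i (x i) * g k (x k)" if "i < n" "k < n" "i \<noteq> k" for i k x
  proof -
    have "(\<Prod>l<n. h i k l (x l)) = (\<Prod>l\<in>{i, k}. h i k l (x l))"
      using that by (intro prod.mono_neutral_right) (auto simp: h_def)
    then show ?thesis using that by (simp add: h_def)
  qed
  have hint: "integrable (M l) (h i k l)" if "i < n" "k < n" "i \<noteq> k" "l < n" for i k l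
    using that int prob_space.finite_measure[OF prob]
    by (cases "l = i"; cases "l = k") (auto simp: h_def[abs_def] finite_measure.integrable_const)
  have off: "integrable (PiM {..<n} M) (\<lambda>x. g i (x i) * g k (x k)) \<and> (\<integral>x. g i (x i) * g k (x k) \<partial>PiM {..<n} M) = 0"
    if ik: "i < n" "k < n" "i \<noteq> k" for i k
  proof
    show "integrable (PiM {..<n} M) (\<lambda>x. g i (x i) * g k (x k))"
      using product_integrable_prod[of "{..<n}" "h i k"] hint ik by (simp add: prod[OF ik])
    have "(\<integral>x. g i (x i) * g k (x k) \<partial>PiM {..<n} M) = (\<Prod>l<n. integral\<^sup>L (M l) (h i k l))"
      using product_integral_prod[of "{..<n}" "h i k"] hint ik by (simp add: prod[OF ik])
    also have "integral\<^sup>L (M i) (h i k i) = 0" using mean ik by (simp add: h_def[abs_def])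
    then have "(\<Prod>l<n. integral\<^sup>L (M l) (h i k l)) = 0" using ik by (intro prod_zero) auto
    finally show "(\<integral>x. g i (x i) * g k (x k) \<partial>PiM {..<n} M) = 0" .
  qed
  have diag: "integrable (PiM {..<n} M) (\<lambda>x. g i (x i) * g i (x i)) \<and> (\<integral>x. g i (x i) * g i (x i) \<partial>PiM {..<n} M) = (\<integral>x. (g i x)\<^sup>2 \<partial>M i)"
    if i: "i < n" for i
  proof -
    have d: "distr (PiM {..<n} M) (M i) (\<lambda>\<omega>. \<omega> i) = M i" using i by (intro distr_PiM_component prob) auto
    have "integrable (distr (PiM {..<n} M) (M i) (\<lambda>\<omega>. \<omega> i)) (\<lambda>x. (g i x)\<^sup>2)" unfolding d by (rule sq[OF i])
    then have 1: "integrable (PiM {..<n} M) (\<lambda>x. (g i (x i))\<^sup>2)"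
      using i by (subst (asm) integrable_distr_eq) auto
    have "(\<integral>x. (g i x)\<^sup>2 \<partial>distr (PiM {..<n} M) (M i) (\<lambda>\<omega>. \<omega> i)) = (\<integral>x. (g i (x i))\<^sup>2 \<partial>PiM {..<n} M)"
      using i by (subst integral_distr) auto
    then show ?thesis using 1 unfolding d by (simp add: power2_eq_square)
  qed
  have all: "integrable (PiM {..<n} M) (\<lambda>x. g i (x i) * g k (x k))" if "i < n" "k < n" for i k
    using off[of i k] diag[of i] that by (cases "i = k") auto
  have sq_eq: "(\<Sum>i<n. g i (x i))\<^sup>2 = (\<Sum>i<n. \<Sum>k<n. g i (x i) * g k (x k))" for x
    by (simp add: power2_eq_square sum_product)
  show "integrable (PiM {..<n} M) (\<lambda>x. (\<Sum>i<n. g i (x i))\<^sup>2)"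
    unfolding sq_eq by (intro Bochner_Integration.integrable_sum all) auto
  have "(\<integral>x. (\<Sum>i<n. g i (x i))\<^sup>2 \<partial>PiM {..<n} M) = (\<Sum>i<n. \<Sum>k<n. \<integral>x. g i (x i) * g k (x k) \<partial>PiM {..<n} M)"
    unfolding sq_eq by (rule integral_double_sum) (auto intro: all)
  also have "\<dots> = (\<Sum>i<n. \<Sum>k<n. if k = i then \<integral>x. (g i x)\<^sup>2 \<partial>M i else 0)"
    using off diag by (intro sum.cong refl) auto
  finally show "(\<integral>x. (\<Sum>i<n. g i (x i))\<^sup>2 \<partial>PiM {..<n} M) = (\<Sum>i<n. \<integral>x. (g i x)\<^sup>2 \<partial>M i)"
    by simp
qed

definition design :: "nat \<Rightarrow> nat \<Rightarrow> (nat \<Rightarrow> nat \<Rightarrow> real) measure" where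
  "design n d = (\<Pi>\<^sub>M i\<in>{..<n}. std_gauss d)"

lemma prob_space_design: "prob_space (design n d)"
  unfolding design_def by (intro prob_space_PiM prob_space_std_gauss)

interpretation design: prob_space "design n d" for n d by (rule prob_space_design)

lemma measurable_design_row[measurable]: "i < n \<Longrightarrow> (\<lambda>X. X i) \<in> design n d \<rightarrow>\<^sub>M leb d"
proof -
  assume "i < n"
  then have "(\<lambda>X. X i) \<in> design n d \<rightarrow>\<^sub>M std_gauss d"
    unfolding design_def by (intro measurable_component_singleton) auto
  then show ?thesis by (simp cong: measurable_cong_sets add: measurable_cong_sets[OF refl sets_std_gauss])
qed

lemma distr_design_row: "i < n \<Longrightarrow> distr (design n d) (std_gauss d) (\<lambda>X. X i) = std_gauss d"
  unfolding design_def by (intro distr_PiM_component prob_space_std_gauss) auto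

lemma double_sum_Cauchy_Schwarz:
  fixes G :: "nat \<Rightarrow> nat \<Rightarrow> real"
  shows "(\<Sum>j<d. \<Sum>k<d. u j * u k * G j k)\<^sup>2 \<le> (\<Sum>j<d. (u j)\<^sup>2)\<^sup>2 * (\<Sum>j<d. \<Sum>k<d. (G j k)\<^sup>2)"
proof -
  let ?P = "{..<d} \<times> {..<d}"
  have "(\<Sum>p\<in>?P. (u (fst p) * u (snd p)) * G (fst p) (snd p))\<^sup>2
      \<le> (\<Sum>p\<in>?P. (u (fst p) * u (snd p))\<^sup>2) * (\<Sum>p\<in>?P. (G (fst p) (snd p))\<^sup>2)"
    by (rule Cauchy_Schwarz_ineq_sum)
  moreover have "(\<Sum>p\<in>?P. (u (fst p) * u (snd p))\<^sup>2) = (\<Sum>j<d. (u j)\<^sup>2)\<^sup>2"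
    by (simp add: power2_eq_square[of "sum _ _"] sum_product sum.cartesian_product power_mult_distrib case_prod_beta)
  ultimately show ?thesis by (simp add: sum.cartesian_product case_prod_beta)
qed

lemma dot_square: "(dot d x u)\<^sup>2 = (\<Sum>j<d. \<Sum>k<d. u j * u k * (x j * x k))"
  by (simp add: dot_def power2_eq_square sum_product mult_ac)

text \<open>The Frobenius norm dominates the quadratic form at all \<open>u\<close> simultaneously.
  Each of the \<open>d^2\<close> entries is a centred sum of variance at most \<open>3 * n\<close>,
  so the expected squared Frobenius norm is at most \<open>3 * d^2 * n\<close>, and Markov's
  inequality at \<open>(n * c)^2\<close> gives the stated probability. The weight covers both the
  Gram matrix (\<open>a\<close> constant 1) and the Fisher matrix.\<close>

lemma weighted_gram_concentration:
  fixes a :: "(nat \<Rightarrow> real) \<Rightarrow> real"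
  assumes [measurable]: "a \<in> borel_measurable (leb d)" and a: "\<And>x. 0 \<le> a x" "\<And>x. a x \<le> 1"
    and c: "c > 0" and n: "n > 0"
  obtains A where "A \<in> sets (design n d)" "measure (design n d) A \<le> 3 * (real d)\<^sup>2 / (real n * c\<^sup>2)"
    "\<And>X u. X \<in> space (design n d) - A \<Longrightarrow>
       \<bar>(\<Sum>i<n. a (X i) * (dot d (X i) u)\<^sup>2) / n - (\<integral>x. a x * (dot d x u)\<^sup>2 \<partial>std_gauss d)\<bar> \<le> c * (enorm d u)\<^sup>2"
proof -
  define m where "m = (\<lambda>j k. \<integral>x. a x * (x j * x k) \<partial>std_gauss d)"
  define g where "g = (\<lambda>j k x. a x * (x j * x k) - m j k)"
  have asq: "(a x * t)\<^sup>2 \<le> t\<^sup>2" for x t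
    using a[of x] by (simp add: power_mult_distrib mult_left_le_one_le power_le_one)
  have meas[measurable]: "(\<lambda>x. a x * (x j * x k)) \<in> borel_measurable (std_gauss d)" if "j < d" "k < d" for j k
  proof -
    have "a \<in> borel_measurable (std_gauss d)" by (simp cong: measurable_cong_sets add: measurable_cong_sets[OF sets_std_gauss refl])
    then show ?thesis
      by (intro borel_measurable_times measurable_std_gauss_component that)
  qed
  have sqi: "integrable (std_gauss d) (\<lambda>x. (a x * (x j * x k))\<^sup>2)" if jk: "j < d" "k < d" for j k
    by (rule Bochner_Integration.integrable_bound[OF component_moment22(1)[OF jk]]) (use jk asq meas[OF jk] in \<open>auto intro!: borel_measurable_power\<close>)
  have ii: "integrable (std_gauss d) (\<lambda>x. a x * (x j * x k))" if jk: "j < d" "k < d" for j k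
    by (rule std_gauss.square_integrable_imp_integrable[OF meas[OF jk] sqi[OF jk]])
  have gi: "integrable (std_gauss d) (\<lambda>x. (g j k x)\<^sup>2)" if jk: "j < d" "k < d" for j k
    unfolding g_def power2_diff using sqi[OF jk] ii[OF jk] by auto
  have gm: "(\<integral>x. g j k x \<partial>std_gauss d) = 0" if jk: "j < d" "k < d" for j k
    unfolding g_def using ii[OF jk] by (simp add: m_def std_gauss.prob_space)
  have gv: "(\<integral>x. (g j k x)\<^sup>2 \<partial>std_gauss d) \<le> 3" if jk: "j < d" "k < d" for j k
  proof -
    have "(\<integral>x. (g j k x)\<^sup>2 \<partial>std_gauss d) = (\<integral>x. (a x * (x j * x k))\<^sup>2 \<partial>std_gauss d) - (m j k)\<^sup>2"
      using std_gauss.variance_eq[OF ii[OF jk] sqi[OF jk]] by (simp add: g_def m_def)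
    also have "\<dots> \<le> (\<integral>x. (a x * (x j * x k))\<^sup>2 \<partial>std_gauss d)" by simp
    also have "\<dots> \<le> (\<integral>x. (x j * x k)\<^sup>2 \<partial>std_gauss d)"
      by (rule integral_mono[OF sqi[OF jk] component_moment22(1)[OF jk] asq])
    finally show ?thesis using component_moment22(2)[OF jk] by linarith
  qed
  have gmeas[measurable]: "g j k \<in> borel_measurable (std_gauss d)" if "j < d" "k < d" for j k
    unfolding g_def using meas[OF that] by measurable
  define S where "S = (\<lambda>X. \<Sum>j<d. \<Sum>k<d. (\<Sum>i<n. g j k (X i))\<^sup>2)"
  have each: "integrable (design n d) (\<lambda>X. (\<Sum>i<n. g j k (X i))\<^sup>2)"
    "(\<integral>X. (\<Sum>i<n. g j k (X i))\<^sup>2 \<partial>design n d) \<le> 3 * real n" if jk: "j < d" "k < d" for j k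
  proof -
    note P = PiM_sum_square[of "\<lambda>_. std_gauss d" "\<lambda>_. g j k" n, OF prob_space_std_gauss gmeas[OF jk] gi[OF jk] gm[OF jk]]
    show "integrable (design n d) (\<lambda>X. (\<Sum>i<n. g j k (X i))\<^sup>2)" unfolding design_def by (rule P(1))
    show "(\<integral>X. (\<Sum>i<n. g j k (X i))\<^sup>2 \<partial>design n d) \<le> 3 * real n"
      unfolding design_def P(2) using gv[OF jk] by (simp add: mult.commute mult_left_mono)
  qed
  have Si: "integrable (design n d) S"
    unfolding S_def by (intro Bochner_Integration.integrable_sum each) auto
  have "(\<integral>X. S X \<partial>design n d) = (\<Sum>j<d. \<Sum>k<d. \<integral>X. (\<Sum>i<n. g j k (X i))\<^sup>2 \<partial>design n d)"
    unfolding S_def by (rule integral_double_sum) (auto intro: each)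
  also have "\<dots> \<le> (\<Sum>j<d. \<Sum>k<d. 3 * real n)"
    by (intro sum_mono each) auto
  also have "\<dots> = 3 * (real d)\<^sup>2 * real n" by (simp add: power2_eq_square)
  finally have SE: "(\<integral>X. S X \<partial>design n d) \<le> 3 * (real d)\<^sup>2 * real n" .
  let ?A = "{X \<in> space (design n d). S X \<ge> (n * c)\<^sup>2}"
  show ?thesis
  proof (rule that[of ?A])
    show "?A \<in> sets (design n d)" using borel_measurable_integrable[OF Si] by measurable
    have "measure (design n d) ?A \<le> (\<integral>X. S X \<partial>design n d) / (n * c)\<^sup>2"
      using n c by (intro integral_Markov_inequality_measure[OF Si, of "{}"]) (auto simp: S_def intro!: sum_nonneg)
    also have "\<dots> \<le> 3 * (real d)\<^sup>2 * real n / (n * c)\<^sup>2"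
      by (intro divide_right_mono SE) auto
    also have "\<dots> = 3 * (real d)\<^sup>2 / (real n * c\<^sup>2)" using n by (simp add: power2_eq_square)
    finally show "measure (design n d) ?A \<le> 3 * (real d)\<^sup>2 / (real n * c\<^sup>2)" .
    fix X u assume "X \<in> space (design n d) - ?A"
    then have SX: "S X < (n * c)\<^sup>2" by auto
    have Em: "(\<integral>x. a x * (dot d x u)\<^sup>2 \<partial>std_gauss d) = (\<Sum>j<d. \<Sum>k<d. u j * u k * m j k)"
    proof -
      have "(\<integral>x. a x * (dot d x u)\<^sup>2 \<partial>std_gauss d) = (\<integral>x. (\<Sum>j<d. \<Sum>k<d. u j * u k * (a x * (x j * x k))) \<partial>std_gauss d)"
        by (simp add: dot_square sum_distrib_left mult_ac)
      also have "\<dots> = (\<Sum>j<d. \<Sum>k<d. u j * u k * m j k)"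
        unfolding m_def by (subst integral_double_sum) (auto intro: ii)
      finally show ?thesis .
    qed
    have "(\<Sum>i<n. a (X i) * (dot d (X i) u)\<^sup>2) - n * (\<Sum>j<d. \<Sum>k<d. u j * u k * m j k)
        = (\<Sum>j<d. \<Sum>k<d. u j * u k * (\<Sum>i<n. g j k (X i)))"
    proof -
      have "(\<Sum>i<n. a (X i) * (dot d (X i) u)\<^sup>2) = (\<Sum>i<n. \<Sum>j<d. \<Sum>k<d. u j * u k * (a (X i) * (X i j * X i k)))"
        by (simp add: dot_square sum_distrib_left mult_ac)
      also have "\<dots> = (\<Sum>j<d. \<Sum>i<n. \<Sum>k<d. u j * u k * (a (X i) * (X i j * X i k)))" by (rule sum.swap)
      also have "\<dots> = (\<Sum>j<d. \<Sum>k<d. \<Sum>i<n. u j * u k * (a (X i) * (X i j * X i k)))"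
        by (intro sum.cong refl sum.swap)
      finally show ?thesis
        by (simp add: g_def sum_subtractf right_diff_distrib sum_distrib_left mult_ac)
    qed
    then have "((\<Sum>i<n. a (X i) * (dot d (X i) u)\<^sup>2) - n * (\<integral>x. a x * (dot d x u)\<^sup>2 \<partial>std_gauss d))\<^sup>2
        \<le> ((enorm d u)\<^sup>2)\<^sup>2 * S X"
      unfolding Em using double_sum_Cauchy_Schwarz[of u "\<lambda>j k. \<Sum>i<n. g j k (X i)" d]
      by (simp add: S_def enorm_square)
    also have "\<dots> \<le> ((enorm d u)\<^sup>2)\<^sup>2 * (n * c)\<^sup>2" using SX by (intro mult_left_mono) auto
    also have "\<dots> = (n * (c * (enorm d u)\<^sup>2))\<^sup>2" by (simp add: power_mult_distrib)
    finally have "\<bar>(\<Sum>i<n. a (X i) * (dot d (X i) u)\<^sup>2) - n * (\<integral>x. a x * (dot d x u)\<^sup>2 \<partial>std_gauss d)\<bar> \<le> n * (c * (enorm d u)\<^sup>2)"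
      using c by (subst (asm) abs_le_square_iff[symmetric]) (simp add: abs_mult abs_of_nonneg)
    moreover have "(\<Sum>i<n. a (X i) * (dot d (X i) u)\<^sup>2) / n - (\<integral>x. a x * (dot d x u)\<^sup>2 \<partial>std_gauss d)
        = ((\<Sum>i<n. a (X i) * (dot d (X i) u)\<^sup>2) - n * (\<integral>x. a x * (dot d x u)\<^sup>2 \<partial>std_gauss d)) / n"
      using n by (simp add: diff_divide_distrib)
    ultimately show "\<bar>(\<Sum>i<n. a (X i) * (dot d (X i) u)\<^sup>2) / n - (\<integral>x. a x * (dot d x u)\<^sup>2 \<partial>std_gauss d)\<bar> \<le> c * (enorm d u)\<^sup>2"
      using n by (simp add: abs_divide divide_le_eq mult.commute)
  qed
qed

section \<open>The logistic link\<close>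

definition sigm :: "real \<Rightarrow> real" where "sigm w = exp w / (1 + exp w)"

definition dsigm :: "real \<Rightarrow> real" where "dsigm w = sigm w * (1 - sigm w)"

lemma one_plus_exp_pos: "0 < 1 + exp (w::real)" using exp_gt_zero[of w] by linarith

lemma one_plus_exp_neq_0[simp]: "1 + exp (w::real) \<noteq> 0" using one_plus_exp_pos[of w] by linarith

lemma sigm_range: "0 < sigm w" "sigm w < 1"
  by (simp_all add: sigm_def one_plus_exp_pos)

lemma psi_deriv: "(psi has_real_derivative sigm w) (at w)"
  unfolding psi_def[abs_def] sigm_def using one_plus_exp_pos[of w] by (auto intro!: derivative_eq_intros)

lemma sigm_deriv: "(sigm has_real_derivative dsigm w) (at w)"
proof -
  have "(sigm has_real_derivative (exp w * (1 + exp w) - exp w * exp w) / ((1 + exp w) * (1 + exp w))) (at w)"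
    unfolding sigm_def[abs_def] by (auto intro!: derivative_eq_intros)
  moreover have "(exp w * (1 + exp w) - exp w * exp w) / ((1 + exp w) * (1 + exp w)) = dsigm w"
    unfolding dsigm_def sigm_def by (simp add: divide_simps) (simp add: algebra_simps)
  ultimately show ?thesis by simp
qed

lemma dsigm_deriv: "(dsigm has_real_derivative dsigm w * (1 - 2 * sigm w)) (at w)"
proof -
  have "((\<lambda>w. sigm w * (1 - sigm w)) has_real_derivative dsigm w * (1 - 2 * sigm w)) (at w)"
    by (auto intro!: derivative_eq_intros sigm_deriv simp: algebra_simps)
  then show ?thesis by (simp add: dsigm_def[abs_def])
qed

lemma dsigm_range: "0 < dsigm w" "dsigm w \<le> 1/4"
proof -
  show "0 < dsigm w" using sigm_range[of w] by (simp add: dsigm_def)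
  show "dsigm w \<le> 1/4" using zero_le_power2[of "sigm w - 1/2"] by (simp add: dsigm_def power2_eq_square algebra_simps)
qed

lemma deriv_psi: "deriv psi = sigm"
  using DERIV_imp_deriv[OF psi_deriv] by auto

lemma deriv_deriv_psi: "deriv (deriv psi) = dsigm"
  unfolding deriv_psi using DERIV_imp_deriv[OF sigm_deriv] by auto

lemma continuous_on_sigm: "continuous_on UNIV sigm"
  by (rule DERIV_continuous_on[OF DERIV_subset[OF sigm_deriv]]) auto

lemma continuous_on_dsigm: "continuous_on UNIV dsigm"
  by (rule DERIV_continuous_on[OF DERIV_subset[OF dsigm_deriv]]) auto

lemma continuous_on_psi: "continuous_on UNIV psi"
  by (rule DERIV_continuous_on[OF DERIV_subset[OF psi_deriv]]) auto

lemma measurable_sigm[measurable]: "sigm \<in> borel_measurable borel"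
  by (rule borel_measurable_continuous_onI[OF continuous_on_sigm])

lemma measurable_dsigm[measurable]: "dsigm \<in> borel_measurable borel"
  by (rule borel_measurable_continuous_onI[OF continuous_on_dsigm])

lemma measurable_psi[measurable]: "psi \<in> borel_measurable borel"
  by (rule borel_measurable_continuous_onI[OF continuous_on_psi])

lemma dsigm_even: "dsigm (- w) = dsigm w"
  by (simp add: dsigm_def sigm_def exp_minus field_simps)

text \<open>\<open>dsigm\<close> is even, and decreasing on the nonnegative half-line because
  \<open>sigm\<close> is at least 1/2 there.\<close>

lemma dsigm_lower: "\<bar>w\<bar> \<le> R \<Longrightarrow> dsigm w \<ge> dsigm R"
proof -
  have mono: "dsigm R \<le> dsigm w" if "0 \<le> w" "w \<le> R" for w
  proof (rule DERIV_nonpos_imp_nonincreasing[OF that(2)])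
    fix x assume "w \<le> x"
    then have "1 \<le> exp x" using that by simp
    then have "1 \<le> 2 * sigm x" by (simp add: sigm_def le_divide_eq one_plus_exp_pos)
    then have "dsigm x * (1 - 2 * sigm x) \<le> 0" using dsigm_range[of x] by (simp add: mult_le_0_iff)
    then show "\<exists>y. (dsigm has_real_derivative y) (at x) \<and> y \<le> 0" using dsigm_deriv by blast
  qed
  assume "\<bar>w\<bar> \<le> R"
  then show ?thesis using mono[of w] mono[of "- w"] dsigm_even[of w] by (cases "w \<ge> 0") auto
qed

text \<open>Truncating at \<open>\<bar>x \<bullet> \<theta>\<bar> \<le> R\<close> with \<open>R\<close> proportional to \<open>\<bar>\<theta>\<bar>\<close> loses at most
  half of the second moment.\<close>

lemma population_fisher_lower:
  assumes R: "R > 0" "6 * (enorm d \<theta>)\<^sup>2 \<le> R\<^sup>2"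
  shows "(\<integral>x. dsigm (dot d x \<theta>) * (dot d x u)\<^sup>2 \<partial>std_gauss d) \<ge> dsigm R / 2 * (enorm d u)\<^sup>2"
proof -
  have meas: "(\<lambda>x. dot d x v) \<in> borel_measurable (std_gauss d)" for v
    by (simp cong: measurable_cong_sets add: measurable_cong_sets[OF sets_std_gauss refl])
  note [measurable] = meas
  have i1: "integrable (std_gauss d) (\<lambda>x. dsigm (dot d x \<theta>) * (dot d x u)\<^sup>2)"
  proof (rule Bochner_Integration.integrable_bound[OF dot_moment2(1)[of d u]])
    have "\<bar>dsigm w\<bar> * t\<^sup>2 \<le> t\<^sup>2" for w t
      using dsigm_range[of w] by (intro mult_left_le_one_le) auto
    then show "AE x in std_gauss d. norm (dsigm (dot d x \<theta>) * (dot d x u)\<^sup>2) \<le> norm ((dot d x u)\<^sup>2)"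
      by (simp add: abs_mult)
  qed measurable
  \<comment> \<open>The factor 1 - (x . theta)^2 / R^2 replaces the indicator of |x . theta| \<le>
    R: it lies below it, and its integral against (x . u)^2 needs only mixed moments.\<close>
  have i2: "integrable (std_gauss d) (\<lambda>x. dsigm R * ((dot d x u)\<^sup>2 - (dot d x u)\<^sup>2 * (dot d x \<theta>)\<^sup>2 / R\<^sup>2))"
    using dot_moment2(1)[of d u] dot_moment22(1)[of d u \<theta>] by auto
  \<comment> \<open>The mixed moment is at most 3 |u|^2 |theta|^2; the factor 6 in the hypothesis
    makes the loss at most half of |u|^2.\<close>
  have "dsigm R / 2 * (enorm d u)\<^sup>2 \<le> dsigm R * ((enorm d u)\<^sup>2 - 3 * (enorm d u)\<^sup>2 * (enorm d \<theta>)\<^sup>2 / R\<^sup>2)"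
  proof -
    have "(enorm d u)\<^sup>2 * (6 * (enorm d \<theta>)\<^sup>2) \<le> (enorm d u)\<^sup>2 * R\<^sup>2" by (rule mult_left_mono[OF R(2)]) simp
    then have "(enorm d u)\<^sup>2 / 2 \<le> (enorm d u)\<^sup>2 - 3 * (enorm d u)\<^sup>2 * (enorm d \<theta>)\<^sup>2 / R\<^sup>2"
      using R(1) by (simp add: field_simps)
    from mult_left_mono[OF this, of "dsigm R"] show ?thesis using dsigm_range(1)[of R] by simp
  qed
  also have "\<dots> \<le> dsigm R * ((enorm d u)\<^sup>2 - (\<integral>x. (dot d x u)\<^sup>2 * (dot d x \<theta>)\<^sup>2 \<partial>std_gauss d) / R\<^sup>2)"
    using dot_moment22(2)[of d u \<theta>] dsigm_range(1)[of R] by (intro mult_left_mono diff_left_mono divide_right_mono) auto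
  also have "\<dots> = (\<integral>x. dsigm R * ((dot d x u)\<^sup>2 - (dot d x u)\<^sup>2 * (dot d x \<theta>)\<^sup>2 / R\<^sup>2) \<partial>std_gauss d)"
    using dot_moment2[of d u] dot_moment22(1)[of d u \<theta>] by simp
  also have "\<dots> \<le> (\<integral>x. dsigm (dot d x \<theta>) * (dot d x u)\<^sup>2 \<partial>std_gauss d)"
  proof (rule integral_mono[OF i2 i1])
    fix x
    let ?t = "dot d x \<theta>" and ?s = "dot d x u"
    show "dsigm R * (?s\<^sup>2 - ?s\<^sup>2 * ?t\<^sup>2 / R\<^sup>2) \<le> dsigm ?t * ?s\<^sup>2"
    proof (cases "\<bar>?t\<bar> \<le> R")
      case True
      have "dsigm R * (?s\<^sup>2 - ?s\<^sup>2 * ?t\<^sup>2 / R\<^sup>2) \<le> dsigm R * ?s\<^sup>2"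
        using dsigm_range(1)[of R] by (intro mult_left_mono) auto
      also have "\<dots> \<le> dsigm ?t * ?s\<^sup>2" using dsigm_lower[OF True] by (intro mult_right_mono) auto
      finally show ?thesis .
    next
      case False
      then have "R\<^sup>2 \<le> ?t\<^sup>2" using R(1) by (simp add: abs_le_square_iff[symmetric])
      then have "?s\<^sup>2 * R\<^sup>2 \<le> ?s\<^sup>2 * ?t\<^sup>2" by (intro mult_left_mono) auto
      then have "?s\<^sup>2 - ?s\<^sup>2 * ?t\<^sup>2 / R\<^sup>2 \<le> 0" using R(1) by (simp add: field_simps)
      then have "dsigm R * (?s\<^sup>2 - ?s\<^sup>2 * ?t\<^sup>2 / R\<^sup>2) \<le> 0"
        using dsigm_range(1)[of R] by (simp add: mult_le_0_iff)
      also have "\<dots> \<le> dsigm ?t * ?s\<^sup>2" using dsigm_range(1)[of ?t] by simp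
      finally show ?thesis .
    qed
  qed
  finally show ?thesis .
qed

section \<open>The law of the data and the score\<close>

definition labels :: "nat \<Rightarrow> (nat \<Rightarrow> bool) measure" where
  "labels n = (\<Pi>\<^sub>M i\<in>{..<n}. count_space UNIV)"

lemma data_law_alt:
  "data_law n d \<theta> = density (design n d \<Otimes>\<^sub>M labels n)
     (\<lambda>(X, Y). \<Prod>i<n. ennreal (pmf (bernoulli_pmf (sigm (dot d (X i) \<theta>))) (Y i)))"
  unfolding data_law_def gaussian_standard design_def labels_def deriv_psi ..

lemma sets_data_law[measurable_cong]: "sets (data_law n d \<theta>) = sets (design n d \<Otimes>\<^sub>M labels n)"
  by (simp add: data_law_alt)

lemma space_data_law: "space (data_law n d \<theta>) = space (design n d) \<times> space (labels n)"
  by (simp add: data_law_alt space_pair_measure)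

lemma measurable_label[measurable]: "i < n \<Longrightarrow> Measurable.pred (labels n) (\<lambda>Y. Y i)"
  unfolding labels_def by measurable

lemma measurable_feature_dot[measurable]:
  "i < n \<Longrightarrow> (\<lambda>D. dot d (fst D i) \<theta>) \<in> borel_measurable (design n d \<Otimes>\<^sub>M labels n)"
  by (rule measurable_compose[OF measurable_compose[OF measurable_fst measurable_design_row] measurable_dot])

lemma measurable_label_snd[measurable]:
  "i < n \<Longrightarrow> Measurable.pred (design n d \<Otimes>\<^sub>M labels n) (\<lambda>D. snd D i)"
  by (rule measurable_compose[OF measurable_snd measurable_label])

lemma pmf_sigm: "pmf (bernoulli_pmf (sigm w)) b = (if b then sigm w else 1 - sigm w)"
  using sigm_range[of w] by (cases b) auto

lemma measurable_label_density[measurable]: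
  "(\<lambda>D. \<Prod>i<n. ennreal (pmf (bernoulli_pmf (sigm (dot d (fst D i) \<theta>))) (snd D i))) \<in> borel_measurable (design n d \<Otimes>\<^sub>M labels n)"
  unfolding pmf_sigm by (intro borel_measurable_prod_ennreal) measurable

lemma sigma_finite_labels: "sigma_finite_measure (labels n)"
  unfolding labels_def
  by (intro product_sigma_finite.sigma_finite product_sigma_finite.intro sigma_finite_measure_count_space_finite) auto

lemma density_labels:
  "density (labels n) (\<lambda>Y. \<Prod>i<n. ennreal (pmf (p i) (Y i))) = (\<Pi>\<^sub>M i\<in>{..<n}. measure_pmf (p i))"
proof -
  have eq: "measure_pmf (p i) = density (count_space UNIV) (\<lambda>b. ennreal (pmf (p i) b))" for i
    by (rule measure_pmf_eq_density)
  have "sigma_finite_measure (density (count_space UNIV) (\<lambda>b. ennreal (pmf (p i) b)))" for i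
    unfolding eq[symmetric] by (rule prob_space_imp_sigma_finite[OF measure_pmf.prob_space_axioms])
  then show ?thesis
    unfolding labels_def eq
    by (intro density_PiM product_sigma_finite.intro sigma_finite_measure_count_space_finite) auto
qed

lemma nn_integral_data_law:
  assumes [measurable]: "f \<in> borel_measurable (design n d \<Otimes>\<^sub>M labels n)"
  shows "(\<integral>\<^sup>+D. f D \<partial>data_law n d \<theta>)
    = (\<integral>\<^sup>+X. \<integral>\<^sup>+Y. f (X, Y) \<partial>(\<Pi>\<^sub>M i\<in>{..<n}. measure_pmf (bernoulli_pmf (sigm (dot d (X i) \<theta>)))) \<partial>design n d)"
proof -
  interpret sigma_finite_measure "labels n" by (rule sigma_finite_labels)
  let ?w = "\<lambda>D. \<Prod>i<n. ennreal (pmf (bernoulli_pmf (sigm (dot d (fst D i) \<theta>))) (snd D i))"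
  have "(\<integral>\<^sup>+D. f D \<partial>data_law n d \<theta>) = (\<integral>\<^sup>+D. ?w D * f D \<partial>(design n d \<Otimes>\<^sub>M labels n))"
    unfolding data_law_alt case_prod_beta by (rule nn_integral_density) measurable
  also have "\<dots> = (\<integral>\<^sup>+X. \<integral>\<^sup>+Y. ?w (X, Y) * f (X, Y) \<partial>labels n \<partial>design n d)"
    by (rule nn_integral_fst[symmetric]) measurable
  also have "\<dots> = (\<integral>\<^sup>+X. \<integral>\<^sup>+Y. f (X, Y) \<partial>(\<Pi>\<^sub>M i\<in>{..<n}. measure_pmf (bernoulli_pmf (sigm (dot d (X i) \<theta>)))) \<partial>design n d)"
  proof (intro nn_integral_cong)
    fix X assume X: "X \<in> space (design n d)"
    have [measurable]: "(\<lambda>Y. ?w (X, Y)) \<in> borel_measurable (labels n)"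
      using measurable_compose[OF measurable_Pair1'[OF X] measurable_label_density] by simp
    have [measurable]: "(\<lambda>Y. f (X, Y)) \<in> borel_measurable (labels n)"
      using measurable_compose[OF measurable_Pair1'[OF X] assms] by simp
    have "(\<integral>\<^sup>+Y. ?w (X, Y) * f (X, Y) \<partial>labels n) = (\<integral>\<^sup>+Y. f (X, Y) \<partial>density (labels n) (\<lambda>Y. ?w (X, Y)))"
      by (rule nn_integral_density[symmetric]) measurable
    then show "(\<integral>\<^sup>+Y. ?w (X, Y) * f (X, Y) \<partial>labels n) = (\<integral>\<^sup>+Y. f (X, Y) \<partial>(\<Pi>\<^sub>M i\<in>{..<n}. measure_pmf (bernoulli_pmf (sigm (dot d (X i) \<theta>)))))"
      by (simp add: density_labels)
  qed
  finally show ?thesis .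
qed

lemma prob_space_data_law: "prob_space (data_law n d \<theta>)"
proof
  have "emeasure (data_law n d \<theta>) (space (data_law n d \<theta>)) = (\<integral>\<^sup>+D. 1 \<partial>data_law n d \<theta>)" by simp
  also have "\<dots> = 1"
    by (subst nn_integral_data_law)
      (simp_all add: prob_space.emeasure_space_1[OF prob_space_PiM] measure_pmf.prob_space_axioms design.emeasure_space_1)
  finally show "emeasure (data_law n d \<theta>) (space (data_law n d \<theta>)) = 1" .
qed

text \<open>The conditional label laws have total mass 1, so an event on the features alone keeps
  its probability under the design.\<close>

lemma design_event:
  assumes A[measurable]: "A \<in> sets (design n d)"
  shows "A \<times> space (labels n) \<in> sets (data_law n d \<theta>)"
    and "measure (data_law n d \<theta>) (A \<times> space (labels n)) = measure (design n d) A"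
proof -
  show s: "A \<times> space (labels n) \<in> sets (data_law n d \<theta>)" by (simp add: sets_data_law)
  have "emeasure (data_law n d \<theta>) (A \<times> space (labels n)) = (\<integral>\<^sup>+D. indicator (A \<times> space (labels n)) D \<partial>data_law n d \<theta>)"
    using s by simp
  also have "\<dots> = (\<integral>\<^sup>+X. \<integral>\<^sup>+Y. indicator (A \<times> space (labels n)) (X, Y) \<partial>(\<Pi>\<^sub>M i\<in>{..<n}. measure_pmf (bernoulli_pmf (sigm (dot d (X i) \<theta>)))) \<partial>design n d)"
    by (rule nn_integral_data_law) measurable
  also have "\<dots> = (\<integral>\<^sup>+X. indicator A X \<partial>design n d)"
  proof (intro nn_integral_cong)
    fix X
    let ?M = "\<Pi>\<^sub>M i\<in>{..<n}. measure_pmf (bernoulli_pmf (sigm (dot d (X i) \<theta>)))"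
    have "(\<integral>\<^sup>+Y. indicator (A \<times> space (labels n)) (X, Y) \<partial>?M) = (\<integral>\<^sup>+Y. indicator A X \<partial>?M)"
      by (intro nn_integral_cong) (auto simp: indicator_def labels_def space_PiM)
    then show "(\<integral>\<^sup>+Y. indicator (A \<times> space (labels n)) (X, Y) \<partial>?M) = indicator A X"
      by (simp add: prob_space.emeasure_space_1[OF prob_space_PiM] measure_pmf.prob_space_axioms)
  qed
  finally show "measure (data_law n d \<theta>) (A \<times> space (labels n)) = measure (design n d) A"
    by (simp add: measure_def)
qed

lemma measurable_feature_component[measurable]:
  "i < n \<Longrightarrow> j < d \<Longrightarrow> (\<lambda>D. fst D i j) \<in> borel_measurable (design n d \<Otimes>\<^sub>M M)"
  by (rule measurable_compose[OF measurable_compose[OF measurable_fst measurable_design_row] measurable_leb_component])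

lemma nn_integral_design_row:
  assumes "i < n" and [measurable]: "f \<in> borel_measurable (leb d)"
  shows "(\<integral>\<^sup>+X. f (X i) \<partial>design n d) = (\<integral>\<^sup>+x. f x \<partial>std_gauss d)"
proof -
  have "(\<integral>\<^sup>+x. f x \<partial>std_gauss d) = (\<integral>\<^sup>+x. f x \<partial>distr (design n d) (std_gauss d) (\<lambda>X. X i))"
    by (simp only: distr_design_row[OF assms(1)])
  also have "\<dots> = (\<integral>\<^sup>+X. f (X i) \<partial>design n d)"
  proof (rule nn_integral_distr)
    show "(\<lambda>X. X i) \<in> design n d \<rightarrow>\<^sub>M std_gauss d"
      using measurable_design_row[OF assms(1)] by (simp cong: measurable_cong_sets add: measurable_cong_sets[OF refl sets_std_gauss])
    show "f \<in> borel_measurable (distr (design n d) (std_gauss d) (\<lambda>X. X i))"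
      using assms(2) by (simp add: measurable_cong_sets[OF sets_std_gauss refl])
  qed
  finally show ?thesis by simp
qed

lemma sum_dot_swap: "(\<Sum>i<n. c i * dot d (X i) u) = (\<Sum>j<d. u j * (\<Sum>i<n. c i * X i j))"
proof -
  have "(\<Sum>i<n. c i * dot d (X i) u) = (\<Sum>i<n. \<Sum>j<d. u j * (c i * X i j))"
    by (simp add: dot_def sum_distrib_left mult_ac)
  also have "\<dots> = (\<Sum>j<d. \<Sum>i<n. u j * (c i * X i j))" by (rule sum.swap)
  finally show ?thesis by (simp add: sum_distrib_left)
qed

text \<open>Given the features, every coordinate of the score is a centred sum whose
  \<open>i\<close>-th term has variance at most \<open>(X i j)^2 / 4\<close>, the largest Bernoulli
  variance being 1/4. The expected squared norm is therefore at most \<open>n * d / 4\<close>;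
  Markov's inequality at \<open>K^2 * n * d\<close> gives \<open>1 / (4 * K^2)\<close>, and
  Cauchy--Schwarz extends the bound to all directions \<open>u\<close> at once.\<close>

lemma score_bound:
  assumes n: "n > 0" and d: "d > 0" and K: "K > 0"
  obtains A where "A \<in> sets (data_law n d \<theta>)" "measure (data_law n d \<theta>) A \<le> 1 / (4 * K\<^sup>2)"
    "\<And>X Y u. (X, Y) \<in> space (data_law n d \<theta>) - A \<Longrightarrow>
       \<bar>\<Sum>i<n. (sigm (dot d (X i) \<theta>) - of_bool (Y i)) * dot d (X i) u\<bar> \<le> K * sqrt (real n * real d) * enorm d u"
proof -
  interpret D: prob_space "data_law n d \<theta>" by (rule prob_space_data_law)
  define G where "G = (\<lambda>j D. \<Sum>i<n. (sigm (dot d (fst D i) \<theta>) - of_bool (snd D i)) * fst D i j)"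
  define S where "S = (\<lambda>D. \<Sum>j<d. (G j D)\<^sup>2)"
  have [measurable]: "G j \<in> borel_measurable (design n d \<Otimes>\<^sub>M labels n)" if "j < d" for j
    unfolding G_def using that by measurable
  have Sm[measurable]: "S \<in> borel_measurable (design n d \<Otimes>\<^sub>M labels n)"
    unfolding S_def by measurable
  have S0: "0 \<le> S D" for D by (simp add: S_def sum_nonneg)
  have inner: "(\<integral>\<^sup>+Y. ennreal (S (X, Y)) \<partial>(\<Pi>\<^sub>M i\<in>{..<n}. measure_pmf (bernoulli_pmf (sigm (dot d (X i) \<theta>)))))
      \<le> (\<Sum>i<n. \<Sum>j<d. ennreal ((X i j)\<^sup>2) / 4)" (is "?I \<le> _") for X
  proof -
    let ?M = "\<lambda>i. measure_pmf (bernoulli_pmf (sigm (dot d (X i) \<theta>)))"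
    define g where "g = (\<lambda>j i y. (sigm (dot d (X i) \<theta>) - of_bool y) * X i j)"
    have mean: "(\<integral>y. g j i y \<partial>?M i) = 0" for i j
      using sigm_range[of "dot d (X i) \<theta>"] by (simp add: g_def algebra_simps)
    have var: "(\<integral>y. (g j i y)\<^sup>2 \<partial>?M i) \<le> (X i j)\<^sup>2 / 4" for i j
    proof -
      let ?p = "sigm (dot d (X i) \<theta>)"
      have "(\<integral>y. (g j i y)\<^sup>2 \<partial>?M i) = dsigm (dot d (X i) \<theta>) * (X i j)\<^sup>2"
        using sigm_range[of "dot d (X i) \<theta>"] by (simp add: g_def dsigm_def power2_eq_square algebra_simps)
      then show ?thesis using mult_right_mono[OF dsigm_range(2)[of "dot d (X i) \<theta>"], of "(X i j)\<^sup>2"] by simp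
    qed
    have P: "integrable (PiM {..<n} ?M) (\<lambda>Y. (\<Sum>i<n. g j i (Y i))\<^sup>2)"
      "(\<integral>Y. (\<Sum>i<n. g j i (Y i))\<^sup>2 \<partial>PiM {..<n} ?M) = (\<Sum>i<n. \<integral>y. (g j i y)\<^sup>2 \<partial>?M i)" for j
      by (rule PiM_sum_square; (simp add: mean measure_pmf.prob_space_axioms integrable_measure_pmf_finite))+
    have "?I = (\<integral>\<^sup>+Y. ennreal (\<Sum>j<d. (\<Sum>i<n. g j i (Y i))\<^sup>2) \<partial>PiM {..<n} ?M)"
      by (simp add: S_def G_def g_def)
    also have "\<dots> = ennreal (\<integral>Y. (\<Sum>j<d. (\<Sum>i<n. g j i (Y i))\<^sup>2) \<partial>PiM {..<n} ?M)"
      by (rule nn_integral_eq_integral) (auto intro!: Bochner_Integration.integrable_sum P sum_nonneg)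
    also have "(\<integral>Y. (\<Sum>j<d. (\<Sum>i<n. g j i (Y i))\<^sup>2) \<partial>PiM {..<n} ?M) = (\<Sum>j<d. \<Sum>i<n. \<integral>y. (g j i y)\<^sup>2 \<partial>?M i)"
      by (subst Bochner_Integration.integral_sum) (auto simp: P)
    also have "ennreal \<dots> \<le> ennreal (\<Sum>j<d. \<Sum>i<n. (X i j)\<^sup>2 / 4)"
      by (intro ennreal_leI sum_mono var)
    also have "\<dots> = (\<Sum>i<n. \<Sum>j<d. ennreal ((X i j)\<^sup>2 / 4))"
      by (subst sum.swap) (simp add: sum_nonneg sum_ennreal)
    finally show ?thesis by (simp add: ennreal_divide_numeral)
  qed
  have one: "(\<integral>\<^sup>+X. ennreal ((X i j)\<^sup>2) / 4 \<partial>design n d) = ennreal (1 / 4)" if "i < n" "j < d" for i j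
  proof -
    have "(\<integral>\<^sup>+X. ennreal ((X i j)\<^sup>2) \<partial>design n d) = (\<integral>\<^sup>+x. ennreal ((x j)\<^sup>2) \<partial>std_gauss d)"
      using that by (intro nn_integral_design_row) auto
    also have "\<dots> = ennreal 1" using component_moments[OF that(2)] by (subst nn_integral_eq_integral) auto
    finally show ?thesis using that by (simp add: nn_integral_divide ennreal_divide_numeral[symmetric])
  qed
  have "(\<integral>\<^sup>+D. ennreal (S D) \<partial>data_law n d \<theta>) \<le> (\<integral>\<^sup>+X. (\<Sum>i<n. \<Sum>j<d. ennreal ((X i j)\<^sup>2) / 4) \<partial>design n d)"
    by (subst nn_integral_data_law) (auto intro!: nn_integral_mono inner)
  also have "\<dots> = (\<Sum>i<n. \<Sum>j<d. \<integral>\<^sup>+X. ennreal ((X i j)\<^sup>2) / 4 \<partial>design n d)"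
    by (subst nn_integral_sum, measurable, intro sum.cong refl, subst nn_integral_sum, measurable)
  also have "\<dots> = (\<Sum>i<n. \<Sum>j<d. ennreal (1 / 4))"
    by (intro sum.cong refl) (simp only: one lessThan_iff)
  also have "\<dots> = ennreal (n * d / 4)"
    by (simp add: ennreal_of_nat_eq_real_of_nat ennreal_mult[symmetric] del: ennreal_divide_numeral)
  finally have E: "(\<integral>\<^sup>+D. ennreal (S D) \<partial>data_law n d \<theta>) \<le> ennreal (n * d / 4)" .
  have Sint: "integrable (data_law n d \<theta>) S"
    using E S0 by (intro integrableI_nonneg) (auto simp: measurable_cong_sets[OF sets_data_law refl] intro: le_less_trans)
  have Si: "(\<integral>D. S D \<partial>data_law n d \<theta>) \<le> n * d / 4"
    using E by (subst (asm) nn_integral_eq_integral[OF Sint]) (auto simp: S0)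
  let ?A = "{D \<in> space (data_law n d \<theta>). S D \<ge> K\<^sup>2 * (n * d)}"
  show ?thesis
  proof (rule that[of ?A])
    show "?A \<in> sets (data_law n d \<theta>)" using borel_measurable_integrable[OF Sint] by measurable
    have pos: "K\<^sup>2 * (real n * real d) > 0" using n d K by simp
    have "measure (data_law n d \<theta>) ?A \<le> (\<integral>D. S D \<partial>data_law n d \<theta>) / (K\<^sup>2 * (n * d))"
      using pos by (intro integral_Markov_inequality_measure[OF Sint, of "{}"]) (auto simp: S0)
    also have "\<dots> \<le> (n * d / 4) / (K\<^sup>2 * (n * d))"
      using pos by (intro divide_right_mono Si) simp
    also have "\<dots> = 1 / (4 * K\<^sup>2)" using n d by simp
    finally show "measure (data_law n d \<theta>) ?A \<le> 1 / (4 * K\<^sup>2)" .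
    fix X Y u assume "(X, Y) \<in> space (data_law n d \<theta>) - ?A"
    then have SX: "S (X, Y) < K\<^sup>2 * (n * d)" by auto
    have "(\<Sum>i<n. (sigm (dot d (X i) \<theta>) - of_bool (Y i)) * dot d (X i) u)\<^sup>2 = (\<Sum>j<d. u j * G j (X, Y))\<^sup>2"
      by (simp add: sum_dot_swap G_def)
    also have "\<dots> \<le> (\<Sum>j<d. (u j)\<^sup>2) * S (X, Y)"
      unfolding S_def by (rule Cauchy_Schwarz_ineq_sum)
    also have "\<dots> \<le> (enorm d u)\<^sup>2 * (K\<^sup>2 * (n * d))"
      using SX by (simp add: enorm_square mult_left_mono sum_nonneg)
    also have "\<dots> = (K * sqrt (real n * real d) * enorm d u)\<^sup>2"
      by (simp add: power_mult_distrib)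
    finally show "\<bar>\<Sum>i<n. (sigm (dot d (X i) \<theta>) - of_bool (Y i)) * dot d (X i) u\<bar> \<le> K * sqrt (real n * real d) * enorm d u"
      using K by (subst (asm) abs_le_square_iff[symmetric]) (simp add: abs_mult)
  qed
qed

section \<open>The cubic form of the design\<close>

text \<open>The constant is 1 + 128: the cube is at most 1 + g^4, and x^2 / 2 \<le> exp x at x = g^2
  / 8 gives g^4 \<le> 128 exp x.\<close>

lemma abs_cube_le_exp: "\<bar>g::real\<bar> ^ 3 \<le> 129 * exp (g\<^sup>2 / 8)"
proof -
  let ?x = "g\<^sup>2 / 8"
  have x: "?x \<ge> 0" by simp
  have "?x\<^sup>2 / 2 \<le> exp ?x" using exp_lower_Taylor_quadratic[OF x] x by linarith
  then have g4: "g ^ 4 \<le> 128 * exp ?x" by (simp add: power_divide power2_eq_square power4_eq_xxxx)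
  have "\<bar>g\<bar> ^ 3 \<le> 1 + g ^ 4"
  proof (cases "\<bar>g\<bar> \<le> 1")
    case True then have "\<bar>g\<bar> ^ 3 \<le> 1" by (simp add: power_le_one)
    then show ?thesis by (simp add: add_increasing2)
  next
    case False then have "\<bar>g\<bar> ^ 3 \<le> \<bar>g\<bar> ^ 4" by (intro power_increasing) auto
    then show ?thesis by (simp add: power_even_abs)
  qed
  moreover have "1 \<le> exp ?x" using x by simp
  ultimately show ?thesis using g4 by linarith
qed

text \<open>The tilt lowers the precision from 1 to 1/4, so the integrand is twice the density of a
  centred normal law with standard deviation 2.\<close>

lemma nn_integral_std_normal_exp_quarter:
  "(\<integral>\<^sup>+y. ennreal (std_normal_density y) * ennreal (exp (3 * y\<^sup>2 / 8)) \<partial>lborel) = 2"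
proof -
  have eq: "std_normal_density y * exp (3 * y\<^sup>2 / 8) = 2 * normal_density 0 2 y" for y
  proof -
    have "sqrt (2 * pi * 2\<^sup>2) = sqrt (2 * pi) * 2" by (simp only: real_sqrt_mult[of "2 * pi"] real_sqrt_abs)
    moreover have "- y\<^sup>2 / 2 + 3 * y\<^sup>2 / 8 = - y\<^sup>2 / 8" by simp
    ultimately show ?thesis
      by (simp add: normal_density_def std_normal_density_def mult_exp_exp field_simps)
  qed
  have "(\<integral>\<^sup>+y. ennreal (std_normal_density y) * ennreal (exp (3 * y\<^sup>2 / 8)) \<partial>lborel)
      = (\<integral>\<^sup>+y. 2 * ennreal (normal_density 0 2 y) \<partial>lborel)"
    by (intro nn_integral_cong) (simp add: ennreal_mult[symmetric] eq, simp add: ennreal_mult)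
  also have "\<dots> = 2 * (\<integral>\<^sup>+y. ennreal (normal_density 0 2 y) \<partial>lborel)" by (rule nn_integral_cmult) auto
  also have "(\<integral>\<^sup>+y. ennreal (normal_density 0 2 y) \<partial>lborel) = 1"
    using integral_normal_density[of 2 0] by (subst nn_integral_eq_integral) auto
  finally show ?thesis by simp
qed

text \<open>The truncation supplies exponential moments. With \<open>B = sqrt n\<close> it is
  inactive for vectors of norm at most 2 as soon as all rows of the design have norm at most
  \<open>sqrt n\<close>.\<close>

definition trunc_cube :: "real \<Rightarrow> real \<Rightarrow> real" where
  "trunc_cube B y = (if \<bar>y\<bar> \<le> 2 * B then \<bar>y\<bar> ^ 3 else 0)"

lemma measurable_trunc_cube[measurable]: "trunc_cube B \<in> borel_measurable borel"
  unfolding trunc_cube_def[abs_def] by measurable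

lemma enorm_scale: "enorm d (\<lambda>j. c * v j) = \<bar>c\<bar> * enorm d v"
  by (simp add: enorm_def L2_set_right_distrib[symmetric] L2_set_def power_mult_distrib sum_distrib_left[symmetric] real_sqrt_mult)

lemma dot_scale: "dot d x (\<lambda>j. c * v j) = c * dot d x v"
  by (simp add: dot_def sum_distrib_left mult_ac)

text \<open>With \<open>g\<close> standard normal and \<open>\<tau>\<close> the norm of
  \<open>v\<close>, the choice of \<open>s\<close> gives an exponent z \<le> s (2 B) (4 g^2) = g^2 /
  4 wherever the truncation is inactive. Then exp z \<le> 1 + z exp z, and bounding the prefactor by
  \<open>abs_cube_le_exp\<close> leaves 1032 s exp (3 g^2 / 8), where 1032 = 8 * 129. The remaining
  Gaussian expectation is 2, whence 2064.\<close>

lemma trunc_cube_mgf: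
  assumes B: "B > 0" and v: "enorm d v \<le> 2" and s: "s = 1 / (32 * B)"
  shows "(\<integral>\<^sup>+x. ennreal (exp (s * trunc_cube B (dot d x v))) \<partial>std_gauss d) \<le> ennreal (exp (2064 * s))"
proof (cases "enorm d v = 0")
  case True
  then have "(\<integral>\<^sup>+x. ennreal (exp (s * trunc_cube B (dot d x v))) \<partial>std_gauss d) = 1"
    using B by (simp add: dot_eq_0 trunc_cube_def std_gauss.emeasure_space_1)
  then show ?thesis using s B by simp
next
  case False
  define \<tau> where "\<tau> = enorm d v"
  define w where "w = (\<lambda>j. v j / \<tau>)"
  have \<tau>: "0 < \<tau>" "\<tau> \<le> 2" using False v by (auto simp: \<tau>_def less_le)
  have sp: "s > 0" using s B by simp
  have w: "enorm d w = 1" using enorm_scale[of d "1 / \<tau>" v] \<tau> by (simp add: w_def \<tau>_def)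
  have dv: "dot d x v = \<tau> * dot d x w" for x
    using dot_scale[of d x \<tau> w] \<tau> by (simp add: w_def)
  have bound: "exp (s * trunc_cube B (\<tau> * g)) \<le> 1 + 1032 * s * exp (3 * g\<^sup>2 / 8)" for g
  proof (cases "\<bar>\<tau> * g\<bar> \<le> 2 * B")
    case True
    let ?z = "s * \<bar>\<tau> * g\<bar> ^ 3"
    have g2: "\<bar>\<tau> * g\<bar>\<^sup>2 \<le> 4 * g\<^sup>2"
      using \<tau> power_mono[of \<tau> 2 2] by (simp add: power_mult_distrib mult_right_mono)
    have "?z = s * \<bar>\<tau> * g\<bar> * \<bar>\<tau> * g\<bar>\<^sup>2" by (simp add: power3_eq_cube power2_eq_square)
    also have "\<dots> \<le> s * (2 * B) * (4 * g\<^sup>2)" using True sp g2 by (intro mult_mono) auto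
    also have "\<dots> = g\<^sup>2 / 4" using s B by simp
    finally have z: "?z \<le> g\<^sup>2 / 4" .
    have "exp ?z \<le> 1 + ?z * exp ?z"
    proof -
      have "1 - ?z \<le> exp (- ?z)" using exp_ge_add_one_self[of "- ?z"] by simp
      then have "(1 - ?z) * exp ?z \<le> exp (- ?z) * exp ?z" by (intro mult_right_mono) auto
      then show ?thesis by (simp add: mult_exp_exp algebra_simps)
    qed
    also have "?z * exp ?z \<le> (s * (8 * (129 * exp (g\<^sup>2 / 8)))) * exp (g\<^sup>2 / 4)"
    proof (rule mult_mono)
      have "\<bar>\<tau> * g\<bar> ^ 3 = \<tau> ^ 3 * \<bar>g\<bar> ^ 3" using \<tau> by (simp add: abs_mult power_mult_distrib)
      also have "\<dots> \<le> 8 * (129 * exp (g\<^sup>2 / 8))"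
        using power_mono[OF \<tau>(2), of 3] \<tau> by (intro mult_mono[OF _ abs_cube_le_exp]) auto
      finally show "s * \<bar>\<tau> * g\<bar> ^ 3 \<le> s * (8 * (129 * exp (g\<^sup>2 / 8)))" using sp by simp
    qed (use z sp in auto)
    also have "\<dots> = 1032 * s * exp (3 * g\<^sup>2 / 8)"
      by (simp add: mult_exp_exp field_simps)
    finally show ?thesis using True by (simp add: trunc_cube_def)
  qed (use sp in \<open>simp add: trunc_cube_def\<close>)
  have "(\<integral>\<^sup>+x. ennreal (exp (s * trunc_cube B (dot d x v))) \<partial>std_gauss d)
    = (\<integral>\<^sup>+y. ennreal (std_normal_density y) * ennreal (exp (s * trunc_cube B (\<tau> * y))) \<partial>lborel)"
    unfolding dv using distributed_dot[of d w] w
    by (subst distributed_nn_integral[symmetric, of "std_gauss d" lborel "\<lambda>x. dot d x w" "\<lambda>x. ennreal (std_normal_density x)"]) auto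
  also have "\<dots> \<le> (\<integral>\<^sup>+y. ennreal (std_normal_density y) + ennreal (1032 * s) * (ennreal (std_normal_density y) * ennreal (exp (3 * y\<^sup>2 / 8))) \<partial>lborel)"
  proof (rule nn_integral_mono)
    fix y
    have "ennreal (std_normal_density y) * ennreal (exp (s * trunc_cube B (\<tau> * y)))
        \<le> ennreal (std_normal_density y) * ennreal (1 + 1032 * s * exp (3 * y\<^sup>2 / 8))"
      by (intro mult_left_mono ennreal_leI bound) auto
    also have "ennreal (1 + 1032 * s * exp (3 * y\<^sup>2 / 8)) = 1 + ennreal (1032 * s) * ennreal (exp (3 * y\<^sup>2 / 8))"
      using sp by (simp add: ennreal_mult[symmetric])
    finally show "ennreal (std_normal_density y) * ennreal (exp (s * trunc_cube B (\<tau> * y)))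
        \<le> ennreal (std_normal_density y) + ennreal (1032 * s) * (ennreal (std_normal_density y) * ennreal (exp (3 * y\<^sup>2 / 8)))"
      by (simp add: distrib_left mult_ac)
  qed
  also have "\<dots> = (\<integral>\<^sup>+y. ennreal (std_normal_density y) \<partial>lborel) + ennreal (1032 * s) * 2"
    by (subst nn_integral_add, simp, simp, subst nn_integral_cmult) (simp_all add: nn_integral_std_normal_exp_quarter)
  also have "(\<integral>\<^sup>+y. ennreal (std_normal_density y) \<partial>lborel) = 1"
    using integral_normal_density[of 1 0] by (subst nn_integral_eq_integral) auto
  also have "1 + ennreal (1032 * s) * 2 = ennreal (1 + 2064 * s)"
  proof -
    have "ennreal (1032 * s) * 2 = ennreal (1032 * s) * ennreal 2" by simp
    also have "\<dots> = ennreal (2064 * s)" using sp by (subst ennreal_mult[symmetric]) auto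
    finally show ?thesis using sp by simp
  qed
  also have "\<dots> \<le> ennreal (exp (2064 * s))" by (intro ennreal_leI exp_ge_add_one_self)
  finally show ?thesis .
qed

text \<open>The threshold 2096 is 2064 + 32: the excess over the moment bound contributes
  \<open>32 * s * n\<close>, which is \<open>sqrt n\<close> for this \<open>s\<close>.\<close>

lemma trunc_cube_chernoff:
  assumes n: "n > 0" and v: "enorm d v \<le> 2"
  defines "B \<equiv> sqrt n"
  shows "emeasure (design n d) {X \<in> space (design n d). 2096 * real n \<le> (\<Sum>i<n. trunc_cube B (dot d (X i) v))} \<le> ennreal (exp (- sqrt n))"
    (is "emeasure _ ?E \<le> _")
proof -
  have B: "B > 0" using n by (simp add: B_def)
  define s where "s = 1 / (32 * B)"
  have sp: "s > 0" using B by (simp add: s_def)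
  let ?f = "\<lambda>x. ennreal (exp (s * trunc_cube B (dot d x v)))"
  have fm: "?f \<in> borel_measurable (leb d)" by measurable
  have prodm: "(\<lambda>X. \<Prod>i<n. ?f (X i)) \<in> borel_measurable (design n d)"
    by (intro borel_measurable_prod_ennreal measurable_compose[OF measurable_design_row fm]) auto
  have sm[measurable]: "(\<lambda>X. \<Sum>i<n. trunc_cube B (dot d (X i) v)) \<in> borel_measurable (design n d)"
    by (intro borel_measurable_sum measurable_compose[OF measurable_design_row]) auto
  have "emeasure (design n d) ?E = (\<integral>\<^sup>+X. indicator ?E X \<partial>design n d)" by simp
  also have "\<dots> \<le> (\<integral>\<^sup>+X. ennreal (exp (- (s * (2096 * real n)))) * (\<Prod>i<n. ?f (X i)) \<partial>design n d)"
  proof (rule nn_integral_mono)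
    fix X
    have "(\<Prod>i<n. ?f (X i)) = ennreal (exp (s * (\<Sum>i<n. trunc_cube B (dot d (X i) v))))"
      by (simp add: prod_ennreal exp_sum sum_distrib_left)
    then have "ennreal (exp (- (s * (2096 * real n)))) * (\<Prod>i<n. ?f (X i))
        = ennreal (exp (s * ((\<Sum>i<n. trunc_cube B (dot d (X i) v)) - 2096 * real n)))"
      by (simp add: ennreal_mult[symmetric] mult_exp_exp algebra_simps)
    moreover have "X \<in> ?E \<Longrightarrow> 1 \<le> exp (s * ((\<Sum>i<n. trunc_cube B (dot d (X i) v)) - 2096 * real n))"
      using sp by simp
    ultimately show "indicator ?E X \<le> ennreal (exp (- (s * (2096 * real n)))) * (\<Prod>i<n. ?f (X i))"
      by (cases "X \<in> ?E") (simp_all only: indicator_simps, auto)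
  qed
  also have "\<dots> = ennreal (exp (- (s * (2096 * real n)))) * (\<integral>\<^sup>+X. (\<Prod>i<n. ?f (X i)) \<partial>design n d)"
    by (rule nn_integral_cmult[OF prodm])
  finally have E: "emeasure (design n d) ?E \<le> ennreal (exp (- (s * (2096 * real n)))) * (\<integral>\<^sup>+X. (\<Prod>i<n. ?f (X i)) \<partial>design n d)" .
  have "(\<integral>\<^sup>+X. (\<Prod>i<n. ?f (X i)) \<partial>design n d) \<le> ennreal (exp (2064 * s * n))"
  proof -
    have "(\<integral>\<^sup>+X. (\<Prod>i<n. ?f (X i)) \<partial>design n d) = (\<Prod>i<n. \<integral>\<^sup>+x. ?f x \<partial>std_gauss d)"
      unfolding design_def
      by (rule product_sigma_finite.product_nn_integral_prod)
        (auto intro!: product_sigma_finite.intro prob_space_imp_sigma_finite prob_space_std_gauss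
          simp: measurable_cong_sets[OF sets_std_gauss refl])
    also have "\<dots> \<le> (\<Prod>i<n. ennreal (exp (2064 * s)))"
      by (intro prod_mono_ennreal trunc_cube_mgf[OF B v s_def])
    also have "\<dots> = ennreal (exp (2064 * s * n))"
      by (simp add: ennreal_power exp_of_nat2_mult)
    finally show ?thesis .
  qed
  then have le: "ennreal (exp (- (s * (2096 * real n)))) * (\<integral>\<^sup>+X. (\<Prod>i<n. ?f (X i)) \<partial>design n d)
      \<le> ennreal (exp (- (s * (2096 * real n)))) * ennreal (exp (2064 * s * n))"
    by (rule mult_left_mono) simp
  note order_trans[OF E le]
  also have "\<dots> = ennreal (exp (- (32 * s * n)))"
    by (simp add: ennreal_mult[symmetric] mult_exp_exp algebra_simps)
  also have "32 * s * n = sqrt n" using n by (simp add: s_def B_def real_div_sqrt)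
  finally show ?thesis .
qed

text \<open>The maximum is dominated by the sum of the fourth powers of the row norms, whose mean is
  at most \<open>3 * n * d^2\<close>; Markov's inequality at level \<open>n^2\<close> suffices under
  d^2/n small.\<close>

lemma max_feature_norm:
  assumes n: "n > 0"
  obtains A where "A \<in> sets (design n d)" "measure (design n d) A \<le> 3 * (real d)\<^sup>2 / n"
    "\<And>X i. X \<in> space (design n d) - A \<Longrightarrow> i < n \<Longrightarrow> enorm d (X i) \<le> sqrt n"
proof -
  define S where "S = (\<lambda>X::nat \<Rightarrow> nat \<Rightarrow> real. \<Sum>i<n. (\<Sum>j<d. (X i j)\<^sup>2)\<^sup>2)"
  have S0: "0 \<le> S X" for X by (simp add: S_def sum_nonneg)
  have Sm[measurable]: "S \<in> borel_measurable (design n d)" unfolding S_def by measurable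
  have sq: "(\<Sum>j<d. (x j)\<^sup>2)\<^sup>2 = (\<Sum>j<d. \<Sum>k<d. (x j * x k)\<^sup>2)" for x :: "nat \<Rightarrow> real"
    by (simp add: power2_eq_square[of "sum _ _"] sum_product power_mult_distrib)
  have one: "(\<integral>\<^sup>+x. ennreal ((\<Sum>j<d. (x j)\<^sup>2)\<^sup>2) \<partial>std_gauss d) \<le> ennreal (3 * (real d)\<^sup>2)"
  proof -
    have "(\<integral>\<^sup>+x. ennreal ((\<Sum>j<d. (x j)\<^sup>2)\<^sup>2) \<partial>std_gauss d)
      = ennreal (\<integral>x. (\<Sum>j<d. \<Sum>k<d. (x j * x k)\<^sup>2) \<partial>std_gauss d)"
      unfolding sq by (rule nn_integral_eq_integral)
        (auto intro!: Bochner_Integration.integrable_sum component_moment22 sum_nonneg)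
    also have "(\<integral>x. (\<Sum>j<d. \<Sum>k<d. (x j * x k)\<^sup>2) \<partial>std_gauss d) = (\<Sum>j<d. \<Sum>k<d. \<integral>x. (x j * x k)\<^sup>2 \<partial>std_gauss d)"
      by (rule integral_double_sum) (auto intro: component_moment22)
    also have "\<dots> \<le> (\<Sum>j<d. \<Sum>k<d. 3)" by (intro sum_mono component_moment22(2)) auto
    also have "\<dots> = 3 * (real d)\<^sup>2" by (simp add: power2_eq_square)
    finally show ?thesis by (simp add: ennreal_leI)
  qed
  have "(\<integral>\<^sup>+X. ennreal (S X) \<partial>design n d) = (\<integral>\<^sup>+X. (\<Sum>i<n. ennreal ((\<Sum>j<d. (X i j)\<^sup>2)\<^sup>2)) \<partial>design n d)"
    by (simp add: S_def)
  also have "\<dots> = (\<Sum>i<n. \<integral>\<^sup>+X. ennreal ((\<Sum>j<d. (X i j)\<^sup>2)\<^sup>2) \<partial>design n d)"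
    by (rule nn_integral_sum) measurable
  also have "\<dots> \<le> (\<Sum>i<n. ennreal (3 * (real d)\<^sup>2))"
  proof (rule sum_mono)
    fix i assume "i \<in> {..<n}"
    then show "(\<integral>\<^sup>+X. ennreal ((\<Sum>j<d. (X i j)\<^sup>2)\<^sup>2) \<partial>design n d) \<le> ennreal (3 * (real d)\<^sup>2)"
      using nn_integral_design_row[of i n "\<lambda>x. ennreal ((\<Sum>j<d. (x j)\<^sup>2)\<^sup>2)" d] one by simp
  qed
  also have "\<dots> = ennreal (real n * (3 * (real d)\<^sup>2))"
    by (simp add: ennreal_of_nat_eq_real_of_nat ennreal_mult[symmetric])
  finally have E: "(\<integral>\<^sup>+X. ennreal (S X) \<partial>design n d) \<le> ennreal (real n * (3 * (real d)\<^sup>2))" .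
  have Sint: "integrable (design n d) S"
    using E S0 by (intro integrableI_nonneg) (auto intro: le_less_trans)
  have Si: "(\<integral>X. S X \<partial>design n d) \<le> real n * (3 * (real d)\<^sup>2)"
    using E by (subst (asm) nn_integral_eq_integral[OF Sint]) (auto simp: S0)
  let ?A = "{X \<in> space (design n d). S X \<ge> (real n)\<^sup>2}"
  show ?thesis
  proof (rule that[of ?A])
    show "?A \<in> sets (design n d)" by measurable
    have "measure (design n d) ?A \<le> (\<integral>X. S X \<partial>design n d) / (real n)\<^sup>2"
      using n by (intro integral_Markov_inequality_measure[OF Sint, of "{}"]) (auto simp: S0)
    also have "\<dots> \<le> real n * (3 * (real d)\<^sup>2) / (real n)\<^sup>2" by (intro divide_right_mono Si) simp
    also have "\<dots> = 3 * (real d)\<^sup>2 / n" using n by (simp add: power2_eq_square)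
    finally show "measure (design n d) ?A \<le> 3 * (real d)\<^sup>2 / n" .
    fix X i assume "X \<in> space (design n d) - ?A" and i: "i < n"
    then have lt: "S X < (real n)\<^sup>2" by auto
    have "((enorm d (X i))\<^sup>2)\<^sup>2 \<le> S X"
      unfolding S_def enorm_square using i by (intro member_le_sum) auto
    with lt have "((enorm d (X i))\<^sup>2)\<^sup>2 \<le> (real n)\<^sup>2" by linarith
    then have "(enorm d (X i))\<^sup>2 \<le> real n" by (rule power2_le_imp_le) simp
    then show "enorm d (X i) \<le> sqrt n" by (rule real_le_rsqrt)
  qed
qed

lemma measurable_enorm[measurable]: "enorm d \<in> borel_measurable (leb d)"
  unfolding enorm_def[abs_def] L2_set_def by measurable

lemma abs_dot_le: "\<bar>dot d x y\<bar> \<le> enorm d x * enorm d y"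
proof -
  have "(dot d x y)\<^sup>2 \<le> (enorm d x * enorm d y)\<^sup>2"
    unfolding dot_def power_mult_distrib enorm_square by (rule Cauchy_Schwarz_ineq_sum)
  then show ?thesis by (simp add: abs_le_square_iff[symmetric] abs_mult)
qed

lemma enorm_add: "enorm d (\<lambda>j. x j + y j) \<le> enorm d x + enorm d y"
  unfolding enorm_def by (rule L2_set_triangle_ineq)

lemma dot_add: "dot d x (\<lambda>j. y j + z j) = dot d x y + dot d x z"
  by (simp add: dot_def sum.distrib algebra_simps)

lemma dot_cong: "(\<And>j. j < d \<Longrightarrow> y j = z j) \<Longrightarrow> dot d x y = dot d x z"
  by (simp add: dot_def)

lemma enorm_cong: "(\<And>j. j < d \<Longrightarrow> y j = z j) \<Longrightarrow> enorm d y = enorm d z"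
  by (simp add: enorm_def L2_set_def)

lemma abs_cube_add: "\<bar>a + b :: real\<bar> ^ 3 \<le> 4 * \<bar>a\<bar> ^ 3 + 4 * \<bar>b\<bar> ^ 3"
proof -
  have "\<bar>a + b\<bar> ^ 3 \<le> (\<bar>a\<bar> + \<bar>b\<bar>) ^ 3" by (intro power_mono) auto
  also have "\<dots> \<le> 4 * \<bar>a\<bar> ^ 3 + 4 * \<bar>b\<bar> ^ 3"
  proof -
    have "(p + q) ^ 3 \<le> 4 * p ^ 3 + 4 * q ^ 3" if "p \<ge> 0" "q \<ge> 0" for p q :: real
    proof -
      have "0 \<le> 3 * ((p + q) * (p - q)\<^sup>2)" using that by simp
      then show ?thesis by (simp add: power3_eq_cube power2_eq_square algebra_simps)
    qed
    then show ?thesis by simp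
  qed
  finally show ?thesis .
qed

text \<open>No net is needed: if the cubic form is large at a unit vector \<open>u\<close>, it is large on a
  whole cube around \<open>u\<close>, and the expected weighted volume of the set where it is large is
  exponentially small by Chernoff's bound at each fixed point.\<close>

lemma cubic_bound:
  assumes n: "n > 0" and d: "d > 0"
  obtains A where "A \<in> sets (design n d)"
    "measure (design n d) A \<le> 3 * (real d)\<^sup>2 / n + exp (5 * real d - sqrt n)"
    "\<And>X u. X \<in> space (design n d) - A \<Longrightarrow> (\<Sum>i<n. \<bar>dot d (X i) u\<bar> ^ 3) \<le> 16768 * real n * enorm d u ^ 3"
proof -
  obtain A1 where A1: "A1 \<in> sets (design n d)" "measure (design n d) A1 \<le> 3 * (real d)\<^sup>2 / n"
    "\<And>X i. X \<in> space (design n d) - A1 \<Longrightarrow> i < n \<Longrightarrow> enorm d (X i) \<le> sqrt n"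
    using max_feature_norm[OF n, of d] by blast
  \<comment> \<open>A Gaussian weight instead of the uniform volume of a ball: its total mass is
    explicit, and it is at least \<open>exp (- 2 * d)\<close> on vectors of norm at most 2.\<close>
  define W where "W = (\<lambda>v. exp (- (real d * (enorm d v)\<^sup>2) / 2))"
  define T where "T = (\<lambda>X v. \<Sum>i<n. trunc_cube (sqrt n) (dot d (X i) v))"
  define V where "V = (\<lambda>X. \<integral>\<^sup>+v. (if enorm d v \<le> 2 \<and> 2096 * real n \<le> T X v then ennreal (W v) else 0) \<partial>leb d)"
  have Wm[measurable]: "W \<in> borel_measurable (leb d)" unfolding W_def by measurable
  have [measurable]: "(\<lambda>p. snd p j) \<in> borel_measurable (design n d \<Otimes>\<^sub>M leb d)" if "j < d" for j
    using that by (intro measurable_compose[OF measurable_snd measurable_leb_component])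
  have Tm[measurable]: "(\<lambda>p. T (fst p) (snd p)) \<in> borel_measurable (design n d \<Otimes>\<^sub>M leb d)"
    unfolding T_def dot_def by measurable
  have em[measurable]: "(\<lambda>p. enorm d (snd p)) \<in> borel_measurable (design n d \<Otimes>\<^sub>M leb d)"
    by (rule measurable_compose[OF measurable_snd measurable_enorm])
  have Wm2[measurable]: "(\<lambda>p. W (snd p)) \<in> borel_measurable (design n d \<Otimes>\<^sub>M leb d)"
    by (rule measurable_compose[OF measurable_snd Wm])
  have joint: "(\<lambda>(X, v). if enorm d v \<le> 2 \<and> 2096 * real n \<le> T X v then ennreal (W v) else 0)
      \<in> borel_measurable (design n d \<Otimes>\<^sub>M leb d)"
    unfolding case_prod_beta by measurable
  interpret L: sigma_finite_measure "leb d" by (rule sigma_finite_leb)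
  interpret PL: pair_sigma_finite "design n d" "leb d" ..
  have Vm[measurable]: "V \<in> borel_measurable (design n d)"
    unfolding V_def by (rule L.borel_measurable_nn_integral[OF joint])
  have W_int: "(\<integral>\<^sup>+v. ennreal (W v) \<partial>leb d) = ennreal (sqrt (2 * pi / d) ^ d)"
  proof -
    have "(\<integral>\<^sup>+v. ennreal (W v) \<partial>leb d) = (\<integral>\<^sup>+v. (\<Prod>j<d. ennreal (exp (- (real d * (v j + 0)\<^sup>2) / 2))) \<partial>leb d)"
      unfolding W_def enorm_square
      by (intro nn_integral_cong) (simp add: prod_ennreal exp_sum[symmetric] sum_distrib_left sum_divide_distrib sum_negf)
    also have "\<dots> = (\<Prod>j<d. \<integral>\<^sup>+y. ennreal (exp (- (real d * (y + 0)\<^sup>2) / 2)) \<partial>lborel)"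
      unfolding leb_def by (rule lborel_product.product_nn_integral_prod) auto
    also have "\<dots> = (\<Prod>j<d. ennreal (sqrt (2 * pi / d)))"
      using d by (intro prod.cong refl nn_integral_exp_square) auto
    finally show ?thesis by (simp add: ennreal_power)
  qed
  have EV: "(\<integral>\<^sup>+X. V X \<partial>design n d) \<le> ennreal (exp (- sqrt n)) * ennreal (sqrt (2 * pi / d) ^ d)"
  proof -
    have "(\<integral>\<^sup>+X. V X \<partial>design n d) = (\<integral>\<^sup>+v. \<integral>\<^sup>+X. (if enorm d v \<le> 2 \<and> 2096 * real n \<le> T X v then ennreal (W v) else 0) \<partial>design n d \<partial>leb d)"
      unfolding V_def by (rule PL.Fubini'[OF joint, symmetric])
    also have "\<dots> \<le> (\<integral>\<^sup>+v. ennreal (W v) * ennreal (exp (- sqrt n)) \<partial>leb d)"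
    proof (rule nn_integral_mono)
      fix v assume v: "v \<in> space (leb d)"
      show "(\<integral>\<^sup>+X. (if enorm d v \<le> 2 \<and> 2096 * real n \<le> T X v then ennreal (W v) else 0) \<partial>design n d)
          \<le> ennreal (W v) * ennreal (exp (- sqrt n))"
      proof (cases "enorm d v \<le> 2")
        case True
        let ?E = "{X \<in> space (design n d). 2096 * real n \<le> T X v}"
        have TXm[measurable]: "(\<lambda>X. T X v) \<in> borel_measurable (design n d)"
          unfolding T_def by (intro borel_measurable_sum measurable_compose[OF measurable_design_row]) auto
        have "(\<integral>\<^sup>+X. (if enorm d v \<le> 2 \<and> 2096 * real n \<le> T X v then ennreal (W v) else 0) \<partial>design n d)
            = (\<integral>\<^sup>+X. ennreal (W v) * indicator ?E X \<partial>design n d)"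
          using True by (intro nn_integral_cong) (auto simp: indicator_def)
        also have "\<dots> = ennreal (W v) * emeasure (design n d) ?E" by (rule nn_integral_cmult_indicator) measurable
        also have "\<dots> \<le> ennreal (W v) * ennreal (exp (- sqrt n))"
          unfolding T_def by (intro mult_left_mono trunc_cube_chernoff[OF n True]) auto
        finally show ?thesis .
      qed simp
    qed
    also have "\<dots> = (\<integral>\<^sup>+v. ennreal (W v) \<partial>leb d) * ennreal (exp (- sqrt n))" by (rule nn_integral_multc) measurable
    finally show ?thesis by (simp add: W_int mult.commute)
  qed
  \<comment> \<open>Half the side of the cube, chosen so that every point of the cube is within
    Euclidean distance 1/4 of its centre.\<close>
  define h where "h = 1 / (4 * sqrt d)"
  have h: "h > 0" using d by (simp add: h_def)
  \<comment> \<open>The weighted volume that the cube is guaranteed to have: the least weight times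
    \<open>(2 * h) ^ d\<close>.\<close>
  define \<kappa> where "\<kappa> = exp (- 2 * real d) * (2 * h) ^ d"
  have \<kappa>: "\<kappa> > 0" using h by (simp add: \<kappa>_def)
  let ?A2 = "{X \<in> space (design n d). ennreal \<kappa> \<le> V X}"
  have A2m: "?A2 \<in> sets (design n d)" by measurable
  have A2: "measure (design n d) ?A2 \<le> exp (5 * real d - sqrt n)"
  proof -
    have "ennreal \<kappa> * emeasure (design n d) ?A2 = (\<integral>\<^sup>+X. ennreal \<kappa> * indicator ?A2 X \<partial>design n d)"
      by (rule nn_integral_cmult_indicator[OF A2m, symmetric])
    also have "\<dots> \<le> (\<integral>\<^sup>+X. V X \<partial>design n d)"
      by (intro nn_integral_mono) (auto simp: indicator_def)
    also note EV
    finally have "ennreal (\<kappa> * measure (design n d) ?A2) \<le> ennreal (exp (- sqrt n) * sqrt (2 * pi / d) ^ d)"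
      using \<kappa> by (simp add: design.emeasure_eq_measure ennreal_mult)
    then have "\<kappa> * measure (design n d) ?A2 \<le> exp (- sqrt n) * sqrt (2 * pi / d) ^ d"
      by (simp add: ennreal_le_iff)
    also have "\<dots> \<le> \<kappa> * exp (5 * real d - sqrt n)"
    proof -
      \<comment> \<open>Per dimension, total mass and cube side differ by a factor of at most 8,
        hence at most \<open>exp 3\<close>. With the \<open>exp (2 * d)\<close> contained in
        \<open>\<kappa>\<close> this produces the \<open>exp (5 * d)\<close> of the
        statement.\<close>
      have "sqrt (2 * pi / d) \<le> 8 * (2 * h)"
      proof -
        have "sqrt (2 * pi) \<le> sqrt 16" using pi_less_4 by (intro real_sqrt_le_mono) simp
        also have "sqrt 16 = 4" using real_sqrt_abs[of 4] by simp
        finally show ?thesis using d by (simp add: h_def real_sqrt_divide divide_right_mono)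
      qed
      also have "8 * (2 * h) \<le> exp 3 * (2 * h)"
      proof -
        have "(2::real) ^ 3 \<le> exp 1 ^ 3" using exp_ge_add_one_self[of 1] by (intro power_mono) auto
        then have "8 \<le> exp (3::real)" by (simp add: exp_of_nat_mult[symmetric])
        then show ?thesis using h by (intro mult_right_mono) auto
      qed
      finally have "sqrt (2 * pi / d) ^ d \<le> (exp 3 * (2 * h)) ^ d" by (intro power_mono) auto
      also have "\<dots> = exp (3 * real d) * (2 * h) ^ d" by (simp add: power_mult_distrib exp_of_nat2_mult)
      also have "\<dots> = \<kappa> * exp (5 * real d)" by (simp add: \<kappa>_def mult_exp_exp)
      finally have "exp (- sqrt n) * sqrt (2 * pi / d) ^ d \<le> exp (- sqrt n) * (\<kappa> * exp (5 * real d))"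
        by (intro mult_left_mono) auto
      then show ?thesis by (simp add: exp_diff exp_minus field_simps)
    qed
    finally show ?thesis using \<kappa> by simp
  qed
  have main: "(\<Sum>i<n. \<bar>dot d (X i) u\<bar> ^ 3) \<le> 16768 * real n * enorm d u ^ 3"
    if X: "X \<in> space (design n d)" "X \<notin> A1" "X \<notin> ?A2" for X u
  proof -
    define Q where "Q = (\<lambda>u. \<Sum>i<n. \<bar>dot d (X i) u\<bar> ^ 3)"
    have Xn: "enorm d (X i) \<le> sqrt n" if "i < n" for i using A1(3)[of X i] X that by auto
    define S where "S = Sup (Q ` {u. enorm d u \<le> 1})"
    have bdd: "bdd_above (Q ` {u. enorm d u \<le> 1})"
    proof (rule bdd_aboveI2)
      fix u assume "u \<in> {u. enorm d u \<le> 1}"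
      then have u: "enorm d u \<le> 1" by simp
      have "\<bar>dot d (X i) u\<bar> \<le> enorm d (X i)" for i
        using abs_dot_le[of d "X i" u] mult_left_mono[OF u, of "enorm d (X i)"] by simp
      then show "Q u \<le> (\<Sum>i<n. enorm d (X i) ^ 3)"
        unfolding Q_def by (intro sum_mono power_mono) auto
    qed
    have QS: "Q u \<le> S" if "enorm d u \<le> 1" for u unfolding S_def using bdd that by (intro cSUP_upper) auto
    have Qscale: "Q (\<lambda>j. c * v j) = \<bar>c\<bar> ^ 3 * Q v" for c v
      by (simp add: Q_def dot_scale abs_mult power_mult_distrib sum_distrib_left)
    have Qhom: "Q v \<le> S * enorm d v ^ 3" for v
    proof (cases "enorm d v = 0")
      case True then show ?thesis by (simp add: Q_def dot_eq_0)
    next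
      case False
      let ?t = "enorm d v"
      have t: "?t > 0" using False by (simp add: less_le)
      have "enorm d (\<lambda>j. (1 / ?t) * v j) = 1" using t by (simp only: enorm_scale) simp
      then have "Q (\<lambda>j. (1 / ?t) * v j) \<le> S" by (intro QS) simp
      then show ?thesis unfolding Qscale using t by (simp add: power_divide field_simps)
    qed
    have "S \<le> 16768 * real n"
    proof (rule ccontr)
      assume "\<not> S \<le> 16768 * real n"
      then have S: "S > 8 * (2096 * real n)" by simp
      then have Spos: "S > 0" using n by (smt (verit) of_nat_0_less_iff)
      have ne: "Q ` {u. enorm d u \<le> 1} \<noteq> {}"
      proof -
        have "enorm d (\<lambda>_. 0) \<le> 1" using enorm_eq_0_iff[of d "\<lambda>_. 0"] by simp
        then show ?thesis by blast
      qed
      \<comment> \<open>Self-bounding of the supremum \<open>S\<close>, which is finite by the row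
        norms. At a near maximizer \<open>u\<close>, \<open>Q u\<close> is at most
        \<open>4 * Q v + 4 * Q z\<close>, and homogeneity gives \<open>Q z\<close> at most
        \<open>S / 64\<close>. Hence \<open>Q v\<close> is at least \<open>11 * S / 64\<close>,
        which exceeds \<open>2096 * n\<close> when \<open>S > 8 * 2096 * n\<close>; this is the
        origin of 16768.\<close>
      have "3 / 4 * S < Sup (Q ` {u. enorm d u \<le> 1})" using Spos unfolding S_def[symmetric] by simp
      then obtain u where u: "enorm d u \<le> 1" "3 / 4 * S < Q u"
        using less_cSup_iff[OF ne bdd] by auto
      let ?C = "PiE {..<d} (\<lambda>j. {u j - h..u j + h})"
      have C: "emeasure (leb d) ?C = ennreal ((2 * h) ^ d)" "?C \<in> sets (leb d)"
      proof -
        have "emeasure (leb d) ?C = (\<Prod>j<d. emeasure lborel {u j - h..u j + h})"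
          unfolding leb_def by (rule lborel_product.emeasure_PiM) auto
        also have "\<dots> = ennreal ((2 * h) ^ d)" using h by (simp add: ennreal_power)
        finally show "emeasure (leb d) ?C = ennreal ((2 * h) ^ d)" .
        show "?C \<in> sets (leb d)" unfolding leb_def by (rule sets_PiM_I_finite) auto
      qed
      have inC: "enorm d v \<le> 2 \<and> 2096 * real n \<le> T X v \<and> exp (- 2 * real d) \<le> W v" if v: "v \<in> ?C" for v
      proof -
        define z where "z = (\<lambda>j. v j - u j)"
        have "(enorm d z)\<^sup>2 \<le> (\<Sum>j<d. h\<^sup>2)"
          unfolding enorm_square
        proof (rule sum_mono)
          fix j assume "j \<in> {..<d}"
          then have "v j \<in> {u j - h..u j + h}" using v by (auto simp: PiE_iff)
          then have "\<bar>z j\<bar> \<le> \<bar>h\<bar>" using h by (auto simp: z_def)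
          then show "(z j)\<^sup>2 \<le> h\<^sup>2" by (simp add: abs_le_square_iff)
        qed
        also have "\<dots> = (1 / 4)\<^sup>2" using d by (simp add: h_def power_divide power_mult_distrib)
        finally have z: "enorm d z \<le> 1 / 4" by (rule power2_le_imp_le) simp
        have vz: "v = (\<lambda>j. u j + z j)" by (simp add: z_def)
        have v2: "enorm d v \<le> 2" using enorm_add[of d u z] u(1) z unfolding vz by linarith
        have "\<bar>dot d (X i) u\<bar> ^ 3 \<le> 4 * \<bar>dot d (X i) v\<bar> ^ 3 + 4 * \<bar>dot d (X i) z\<bar> ^ 3" for i
          using abs_cube_add[of "dot d (X i) v" "- dot d (X i) z"] unfolding vz dot_add by simp
        then have "Q u \<le> (\<Sum>i<n. 4 * \<bar>dot d (X i) v\<bar> ^ 3 + 4 * \<bar>dot d (X i) z\<bar> ^ 3)"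
          unfolding Q_def by (intro sum_mono) auto
        then have "Q u \<le> 4 * Q v + 4 * Q z" by (simp add: Q_def sum.distrib sum_distrib_left)
        moreover have "Q z \<le> S * (1 / 4) ^ 3"
        proof -
          have "S * enorm d z ^ 3 \<le> S * (1 / 4) ^ 3" using z Spos by (intro mult_left_mono power_mono) auto
          with Qhom[of z] show ?thesis by linarith
        qed
        ultimately have Qv: "2096 * real n \<le> Q v" using u(2) S by (simp add: power_divide)
        have "T X v = Q v"
          unfolding T_def Q_def
        proof (intro sum.cong refl)
          fix i assume "i \<in> {..<n}"
          then have "\<bar>dot d (X i) v\<bar> \<le> sqrt n * 2"
            using abs_dot_le[of d "X i" v] mult_mono[OF Xn[of i] v2] by simp
          then show "trunc_cube (sqrt n) (dot d (X i) v) = \<bar>dot d (X i) v\<bar> ^ 3"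
            by (simp add: trunc_cube_def mult.commute)
        qed
        moreover have "exp (- 2 * real d) \<le> W v"
        proof -
          have "(enorm d v)\<^sup>2 \<le> 2\<^sup>2" using v2 by (intro power_mono) auto
          then have "real d * (enorm d v)\<^sup>2 \<le> real d * 4" by (intro mult_left_mono) auto
          then show ?thesis by (simp add: W_def)
        qed
        ultimately show ?thesis using v2 Qv by simp
      qed
      have "ennreal \<kappa> = ennreal (exp (- 2 * real d)) * emeasure (leb d) ?C"
        unfolding C(1) \<kappa>_def using h by (simp add: ennreal_mult)
      also have "\<dots> = (\<integral>\<^sup>+v. ennreal (exp (- 2 * real d)) * indicator ?C v \<partial>leb d)"
        by (rule nn_integral_cmult_indicator[OF C(2), symmetric])
      also have "\<dots> \<le> V X"
        unfolding V_def
      proof (rule nn_integral_mono)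
        fix v
        show "ennreal (exp (- 2 * real d)) * indicator ?C v \<le> (if enorm d v \<le> 2 \<and> 2096 * real n \<le> T X v then ennreal (W v) else 0)"
        proof (cases "v \<in> ?C")
          case True
          then show ?thesis using inC[OF True] by (simp add: ennreal_leI)
        qed simp
      qed
      finally show False using X by simp
    qed
    then have "S * enorm d u ^ 3 \<le> 16768 * real n * enorm d u ^ 3" by (intro mult_right_mono) auto
    with Qhom[of u] show ?thesis by (simp add: Q_def)
  qed
  show ?thesis
  proof (rule that[of "A1 \<union> ?A2"])
    show "A1 \<union> ?A2 \<in> sets (design n d)" using A1(1) A2m by auto
    show "measure (design n d) (A1 \<union> ?A2) \<le> 3 * (real d)\<^sup>2 / n + exp (5 * real d - sqrt n)"
      using measure_Un_le[OF A1(1) A2m] A1(2) A2 by linarith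
    show "(\<Sum>i<n. \<bar>dot d (X i) u\<bar> ^ 3) \<le> 16768 * real n * enorm d u ^ 3"
      if "X \<in> space (design n d) - (A1 \<union> ?A2)" for X u
      using that by (intro main) auto
  qed
qed

section \<open>The likelihood of a well-behaved sample\<close>

text \<open>The third derivative of \<open>psi\<close>.\<close>

definition d3sigm :: "real \<Rightarrow> real" where "d3sigm w = dsigm w * (1 - 2 * sigm w)"

lemma abs_d3sigm: "\<bar>d3sigm w\<bar> \<le> 1"
proof -
  have "\<bar>1 - 2 * sigm w\<bar> \<le> 1" using sigm_range[of w] by auto
  then have "\<bar>dsigm w\<bar> * \<bar>1 - 2 * sigm w\<bar> \<le> 1 * 1"
    using dsigm_range[of w] by (intro mult_mono) auto
  then show ?thesis by (simp add: d3sigm_def abs_mult)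
qed

lemma dsigm_lipschitz: "\<bar>dsigm b - dsigm a\<bar> \<le> \<bar>b - a\<bar>"
proof -
  have "norm (dsigm b - dsigm a) \<le> 1 * norm (b - a)"
  proof (rule field_differentiable_bound[of UNIV dsigm d3sigm])
    show "(dsigm has_field_derivative d3sigm z) (at z within UNIV)" for z
      using dsigm_deriv[of z] by (simp add: d3sigm_def)
  qed (use abs_d3sigm in auto)
  then show ?thesis by simp
qed

text \<open>The mean value theorem for \<open>sigm x - dsigm a * x\<close> between \<open>c\<close>
  and \<open>b\<close>. The slope is frozen at a third point because the Laplace covariance uses the
  Fisher matrix at the truth \<open>a\<close>, not at the maximum likelihood estimator
  \<open>c\<close>.\<close>

lemma sigm_remainder: "\<bar>sigm b - sigm c - dsigm a * (b - c)\<bar> \<le> (\<bar>b - a\<bar> + \<bar>c - a\<bar>) * \<bar>b - c\<bar>"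
proof -
  let ?f = "\<lambda>x. sigm x - dsigm a * x"
  have "norm (?f b - ?f c) \<le> (\<bar>b - a\<bar> + \<bar>c - a\<bar>) * norm (b - c)"
  proof (rule field_differentiable_bound[of "closed_segment b c" ?f "\<lambda>x. dsigm x - dsigm a"])
    fix z assume z: "z \<in> closed_segment b c"
    show "(?f has_field_derivative dsigm z - dsigm a) (at z within closed_segment b c)"
      by (auto intro!: derivative_eq_intros DERIV_subset[OF sigm_deriv])
    have "\<bar>z - a\<bar> \<le> \<bar>b - a\<bar> + \<bar>c - a\<bar>"
      using z by (auto simp: closed_segment_eq_real_ivl split: if_splits)
    then show "norm (dsigm z - dsigm a) \<le> \<bar>b - a\<bar> + \<bar>c - a\<bar>"
      using dsigm_lipschitz[of z a] by simp
  qed auto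
  then show ?thesis by (simp add: algebra_simps)
qed

lemma psi_taylor3: "psi (a + z) \<ge> psi a + sigm a * z + dsigm a * z\<^sup>2 / 2 - \<bar>z\<bar> ^ 3 / 6"
proof (cases "z = 0")
  case False
  define D where "D = (\<lambda>m::nat. if m = 0 then psi else if m = 1 then sigm else if m = 2 then dsigm else d3sigm)"
  have "\<exists>t. (if a + z < a then a + z < t \<and> t < a else a < t \<and> t < a + z) \<and>
     psi (a + z) = (\<Sum>m<3. D m a / fact m * ((a + z) - a) ^ m) + D 3 t / fact 3 * ((a + z) - a) ^ 3"
  proof (rule Taylor[of 3 D psi "min a (a + z)" "max a (a + z)" a "a + z"])
    show "\<forall>m t. m < 3 \<and> min a (a + z) \<le> t \<and> t \<le> max a (a + z) \<longrightarrow> DERIV (D m) t :> D (Suc m) t"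
      using psi_deriv sigm_deriv dsigm_deriv
      by (auto simp: D_def numeral_3_eq_3 less_Suc_eq d3sigm_def)
  qed (use False in \<open>auto simp: D_def\<close>)
  then obtain t where t: "psi (a + z) = (\<Sum>m<3. D m a / fact m * z ^ m) + d3sigm t / 6 * z ^ 3"
    by (auto simp: D_def fact_numeral)
  have "(\<Sum>m<3. D m a / fact m * z ^ m) = psi a + sigm a * z + dsigm a / 2 * z\<^sup>2"
    by (simp add: numeral_3_eq_3 D_def power2_eq_square)
  moreover have "\<bar>d3sigm t / 6 * z ^ 3\<bar> \<le> \<bar>z\<bar> ^ 3 / 6"
    using mult_right_mono[OF abs_d3sigm[of t], of "\<bar>z\<bar> ^ 3"] by (simp add: abs_mult power_abs)
  ultimately show ?thesis using t by (simp add: abs_le_iff)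
qed simp

lemma psi_taylor2: "psi (a + z) \<le> psi a + sigm a * z + z\<^sup>2 / 8"
proof (cases "z = 0")
  case False
  define D where "D = (\<lambda>m::nat. if m = 0 then psi else if m = 1 then sigm else dsigm)"
  have "\<exists>t. (if a + z < a then a + z < t \<and> t < a else a < t \<and> t < a + z) \<and>
     psi (a + z) = (\<Sum>m<2. D m a / fact m * ((a + z) - a) ^ m) + D 2 t / fact 2 * ((a + z) - a) ^ 2"
  proof (rule Taylor[of 2 D psi "min a (a + z)" "max a (a + z)" a "a + z"])
    show "\<forall>m t. m < 2 \<and> min a (a + z) \<le> t \<and> t \<le> max a (a + z) \<longrightarrow> DERIV (D m) t :> D (Suc m) t"
      using psi_deriv sigm_deriv by (auto simp: D_def numeral_2_eq_2 less_Suc_eq)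
  qed (use False in \<open>auto simp: D_def\<close>)
  then obtain t where t: "psi (a + z) = (\<Sum>m<2. D m a / fact m * z ^ m) + dsigm t / 2 * z\<^sup>2"
    by (auto simp: D_def)
  have "dsigm t / 2 * z\<^sup>2 \<le> z\<^sup>2 / 8"
    using mult_right_mono[OF dsigm_range(2)[of t], of "z\<^sup>2"] by simp
  then show ?thesis using t by (simp add: numeral_2_eq_2 D_def)
qed simp

lemma convex_psi: "convex_on UNIV psi"
  by (rule f''_ge0_imp_convex[of UNIV psi sigm dsigm])
    (use psi_deriv sigm_deriv dsigm_range in \<open>auto simp: less_imp_le\<close>)

lemma psi_strict: "a \<noteq> b \<Longrightarrow> psi ((a + b) / 2) < (psi a + psi b) / 2"
proof -
  have lt: "psi ((a + b) / 2) < (psi a + psi b) / 2" if ab: "a < b" for a b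
  proof -
    let ?m = "(a + b) / 2"
    obtain x where x: "a < x" "x < ?m" "psi ?m - psi a = (?m - a) * sigm x"
      using MVT2[of a ?m psi sigm] psi_deriv ab by auto
    obtain y where y: "?m < y" "y < b" "psi b - psi ?m = (b - ?m) * sigm y"
      using MVT2[of ?m b psi sigm] psi_deriv ab by auto
    have "sigm x < sigm y"
      by (rule DERIV_pos_imp_increasing[of x y]) (use x y sigm_deriv dsigm_range in auto)
    then have "(b - a) / 2 * sigm x < (b - a) / 2 * sigm y" using ab by (intro mult_strict_left_mono) auto
    moreover have m: "?m - a = (b - a) / 2" "b - ?m = (b - a) / 2" by (auto simp: field_simps)
    ultimately have "psi ?m - psi a < psi b - psi ?m" unfolding x(3) y(3) m by simp
    then show ?thesis by simp
  qed
  assume "a \<noteq> b"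
  then show ?thesis using lt[of a b] lt[of b a] by (cases "a < b") (auto simp: add.commute)
qed

lemma young_cubic: "0 \<le> x \<Longrightarrow> 0 \<le> y \<Longrightarrow> x\<^sup>2 * y \<le> (2 * x ^ 3 + y ^ 3) / (3::real)"
proof -
  assume "0 \<le> x" "0 \<le> y"
  then have "0 \<le> (2 * x + y) * (x - y)\<^sup>2" by simp
  then show ?thesis by (simp add: power2_eq_square power3_eq_cube algebra_simps)
qed

lemma enorm_minus_commute: "enorm d (\<lambda>j. x j - y j) = enorm d (\<lambda>j. y j - x j)"
  using enorm_scale[of d "-1" "\<lambda>j. x j - y j"] by simp

lemma enorm_triangle: "enorm d (\<lambda>j. x j - z j) \<le> enorm d (\<lambda>j. x j - y j) + enorm d (\<lambda>j. y j - z j)"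
  using enorm_add[of d "\<lambda>j. x j - y j" "\<lambda>j. y j - z j"] by simp

lemma dot_diff: "dot d x (\<lambda>j. y j - z j) = dot d x y - dot d x z"
  by (simp add: dot_def sum_subtractf algebra_simps)

lemma dot_line: "dot d x (\<lambda>j. p j + s * v j) = dot d x p + s * dot d x v"
  by (simp add: dot_add dot_scale)

section \<open>The negative log likelihood and deterministic conditions on the sample\<close>

definition neg_loglik :: "nat \<Rightarrow> nat \<Rightarrow> (nat \<Rightarrow> nat \<Rightarrow> real) \<Rightarrow> (nat \<Rightarrow> bool) \<Rightarrow> (nat \<Rightarrow> real) \<Rightarrow> real" where
  "neg_loglik n d X Y \<theta> = (\<Sum>i<n. psi (dot d (X i) \<theta>) - of_bool (Y i) * dot d (X i) \<theta>)"

lemma nll_eq: "n > 0 \<Longrightarrow> nll n d (X, Y) \<theta> = neg_loglik n d X Y \<theta> / n"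
  by (simp add: nll_def neg_loglik_def)

lemma psi_nonneg: "0 \<le> psi w - of_bool b * w"
proof (cases b)
  case True
  have "w = ln (exp w)" by simp
  also have "\<dots> \<le> psi w" unfolding psi_def by (subst ln_le_cancel_iff) (auto simp: one_plus_exp_pos)
  finally show ?thesis using True by simp
qed (simp add: psi_def)

lemma neg_loglik_nonneg: "0 \<le> neg_loglik n d X Y \<theta>"
  unfolding neg_loglik_def by (intro sum_nonneg psi_nonneg)

lemma neg_loglik_cong: "(\<And>j. j < d \<Longrightarrow> x j = y j) \<Longrightarrow> neg_loglik n d X Y x = neg_loglik n d X Y y"
  using dot_cong[of d x y] by (simp add: neg_loglik_def)

lemma neg_loglik_convex:
  assumes "0 \<le> s" "s \<le> 1"
  shows "neg_loglik n d X Y (\<lambda>j. p j + s * v j) \<le> (1 - s) * neg_loglik n d X Y p + s * neg_loglik n d X Y (\<lambda>j. p j + v j)"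
proof -
  have "psi (dot d (X i) p + s * dot d (X i) v) \<le> (1 - s) * psi (dot d (X i) p) + s * psi (dot d (X i) p + dot d (X i) v)" for i
    using convex_onD[OF convex_psi assms, of "dot d (X i) p" "dot d (X i) p + dot d (X i) v"] by (simp add: algebra_simps)
  then have "neg_loglik n d X Y (\<lambda>j. p j + s * v j)
      \<le> (\<Sum>i<n. ((1 - s) * psi (dot d (X i) p) + s * psi (dot d (X i) p + dot d (X i) v)) - of_bool (Y i) * (dot d (X i) p + s * dot d (X i) v))"
    unfolding neg_loglik_def dot_line by (intro sum_mono diff_right_mono)
  also have "\<dots> = (\<Sum>i<n. (1 - s) * (psi (dot d (X i) p) - of_bool (Y i) * dot d (X i) p)
      + s * (psi (dot d (X i) p + dot d (X i) v) - of_bool (Y i) * (dot d (X i) p + dot d (X i) v)))"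
    by (intro sum.cong refl) (simp add: algebra_simps)
  also have "\<dots> = (1 - s) * neg_loglik n d X Y p + s * neg_loglik n d X Y (\<lambda>j. p j + v j)"
    by (simp add: neg_loglik_def dot_add sum.distrib sum_distrib_left)
  finally show ?thesis .
qed

lemma neg_loglik_line_deriv:
  "((\<lambda>s. neg_loglik n d X Y (\<lambda>j. p j + s * v j)) has_real_derivative
    (\<Sum>i<n. (sigm (dot d (X i) p + s * dot d (X i) v) - of_bool (Y i)) * dot d (X i) v)) (at s)"
proof -
  have "((\<lambda>s. psi (dot d (X i) p + s * dot d (X i) v) - of_bool (Y i) * (dot d (X i) p + s * dot d (X i) v)) has_real_derivative
      (sigm (dot d (X i) p + s * dot d (X i) v) - of_bool (Y i)) * dot d (X i) v) (at s)" for i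
  proof -
    have "((\<lambda>s. psi (dot d (X i) p + s * dot d (X i) v)) has_real_derivative
        sigm (dot d (X i) p + s * dot d (X i) v) * dot d (X i) v) (at s)"
      by (rule DERIV_chain2[OF psi_deriv]) (auto intro!: derivative_eq_intros)
    then show ?thesis by (auto intro!: derivative_eq_intros simp: algebra_simps)
  qed
  then show ?thesis unfolding neg_loglik_def dot_line by (intro DERIV_sum) auto
qed

locale logistic_sample =
  fixes n d :: nat and X :: "nat \<Rightarrow> nat \<Rightarrow> real" and Y :: "nat \<Rightarrow> bool" and \<theta>s :: "nat \<Rightarrow> real"
    and K lam Lam T :: real
  assumes n: "0 < n" and d: "0 < d" and K: "0 < K" and lam: "0 < lam" and Lam: "0 < Lam" and T: "0 < T"
    and \<theta>s: "\<theta>s \<in> Rd d"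
    and score: "\<And>u. \<bar>\<Sum>i<n. (sigm (dot d (X i) \<theta>s) - of_bool (Y i)) * dot d (X i) u\<bar> \<le> K * sqrt (real n * real d) * enorm d u"
    and fisher_lower: "\<And>u. lam * n * (enorm d u)\<^sup>2 \<le> (\<Sum>i<n. dsigm (dot d (X i) \<theta>s) * (dot d (X i) u)\<^sup>2)"
    and gram_upper: "\<And>u. (\<Sum>i<n. (dot d (X i) u)\<^sup>2) \<le> Lam * n * (enorm d u)\<^sup>2"
    and cubic: "\<And>u. (\<Sum>i<n. \<bar>dot d (X i) u\<bar> ^ 3) \<le> T * n * enorm d u ^ 3"
begin

abbreviation L where "L \<equiv> neg_loglik n d X Y"

definition Fq :: "(nat \<Rightarrow> real) \<Rightarrow> real" where
  "Fq u = (\<Sum>i<n. dsigm (dot d (X i) \<theta>s) * (dot d (X i) u)\<^sup>2)"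

definition rho :: real where "rho = sqrt (real d / real n)"

text \<open>The radius, in units of \<open>rho\<close>, from which the curvature dominates the
  score: for \<open>t \<ge> t0\<close> the score contributes at most
  \<open>lam / 8 * n * (t * rho)^2\<close>.\<close>

definition t0 :: real where "t0 = 8 * K / lam"

lemma rho_pos: "rho > 0" using n d by (simp add: rho_def)

lemma sqrt_nd: "sqrt (real n * real d) = n * rho"
  using n by (simp add: rho_def real_sqrt_divide real_sqrt_mult field_simps)

lemma n_rho_sq: "n * rho\<^sup>2 = d" using n by (simp add: rho_def)

lemma t0_pos: "t0 > 0" using K lam by (simp add: t0_def)

text \<open>Young's inequality, applied to the linear forms divided by the norms of \<open>p\<close>
  and \<open>v\<close>, passes from pure to mixed cubes without loss in the constant
  \<open>T\<close>.\<close>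

lemma cubic_mixed: "(\<Sum>i<n. (dot d (X i) p)\<^sup>2 * \<bar>dot d (X i) v\<bar>) \<le> T * n * (enorm d p)\<^sup>2 * enorm d v"
proof (cases "enorm d p = 0 \<or> enorm d v = 0")
  case True
  then show ?thesis by (auto simp: dot_eq_0)
next
  case False
  then have pos: "enorm d p > 0" "enorm d v > 0" by (auto simp: less_le)
  let ?p = "enorm d p" and ?v = "enorm d v"
  have "(dot d (X i) p)\<^sup>2 * \<bar>dot d (X i) v\<bar>
      \<le> ?p\<^sup>2 * ?v * ((2 * \<bar>dot d (X i) p\<bar> ^ 3 / ?p ^ 3 + \<bar>dot d (X i) v\<bar> ^ 3 / ?v ^ 3) / 3)" for i
  proof -
    have "(\<bar>dot d (X i) p\<bar> / ?p)\<^sup>2 * (\<bar>dot d (X i) v\<bar> / ?v) \<le> (2 * (\<bar>dot d (X i) p\<bar> / ?p) ^ 3 + (\<bar>dot d (X i) v\<bar> / ?v) ^ 3) / 3"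
      using pos by (intro young_cubic) auto
    then have "?p\<^sup>2 * ?v * ((\<bar>dot d (X i) p\<bar> / ?p)\<^sup>2 * (\<bar>dot d (X i) v\<bar> / ?v))
        \<le> ?p\<^sup>2 * ?v * ((2 * (\<bar>dot d (X i) p\<bar> / ?p) ^ 3 + (\<bar>dot d (X i) v\<bar> / ?v) ^ 3) / 3)"
      by (rule mult_left_mono) auto
    moreover have "?p\<^sup>2 * ?v * ((\<bar>dot d (X i) p\<bar> / ?p)\<^sup>2 * (\<bar>dot d (X i) v\<bar> / ?v)) = (dot d (X i) p)\<^sup>2 * \<bar>dot d (X i) v\<bar>"
      using pos by (simp add: power_divide)
    ultimately show ?thesis by (simp add: power_divide)
  qed
  then have "(\<Sum>i<n. (dot d (X i) p)\<^sup>2 * \<bar>dot d (X i) v\<bar>)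
      \<le> (\<Sum>i<n. ?p\<^sup>2 * ?v * ((2 * \<bar>dot d (X i) p\<bar> ^ 3 / ?p ^ 3 + \<bar>dot d (X i) v\<bar> ^ 3 / ?v ^ 3) / 3))"
    by (intro sum_mono)
  also have "\<dots> = ?p\<^sup>2 * ?v * ((2 * (\<Sum>i<n. \<bar>dot d (X i) p\<bar> ^ 3) / ?p ^ 3 + (\<Sum>i<n. \<bar>dot d (X i) v\<bar> ^ 3) / ?v ^ 3) / 3)"
    by (simp add: sum_distrib_left[symmetric] sum.distrib sum_divide_distrib[symmetric])
  also have "\<dots> \<le> ?p\<^sup>2 * ?v * ((2 * (T * n) + T * n) / 3)"
  proof -
    have "(\<Sum>i<n. \<bar>dot d (X i) p\<bar> ^ 3) / ?p ^ 3 \<le> T * n" "(\<Sum>i<n. \<bar>dot d (X i) v\<bar> ^ 3) / ?v ^ 3 \<le> T * n"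
      using cubic[of p] cubic[of v] pos by (simp_all add: divide_le_eq)
    then show ?thesis by (intro mult_left_mono) auto
  qed
  also have "\<dots> = T * n * ?p\<^sup>2 * ?v" by simp
  finally show ?thesis .
qed

lemma L_lower_local:
  "L (\<lambda>j. \<theta>s j + w j) \<ge> L \<theta>s - K * (n * rho) * enorm d w + lam * n / 2 * (enorm d w)\<^sup>2 - T * n / 6 * enorm d w ^ 3"
proof -
  have "(\<Sum>i<n. (psi (dot d (X i) \<theta>s) - of_bool (Y i) * dot d (X i) \<theta>s) + (sigm (dot d (X i) \<theta>s) - of_bool (Y i)) * dot d (X i) w
      + dsigm (dot d (X i) \<theta>s) * (dot d (X i) w)\<^sup>2 / 2 - \<bar>dot d (X i) w\<bar> ^ 3 / 6) \<le> L (\<lambda>j. \<theta>s j + w j)"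
    unfolding neg_loglik_def dot_add
  proof (rule sum_mono)
    fix i
    show "(psi (dot d (X i) \<theta>s) - of_bool (Y i) * dot d (X i) \<theta>s) + (sigm (dot d (X i) \<theta>s) - of_bool (Y i)) * dot d (X i) w
      + dsigm (dot d (X i) \<theta>s) * (dot d (X i) w)\<^sup>2 / 2 - \<bar>dot d (X i) w\<bar> ^ 3 / 6
      \<le> psi (dot d (X i) \<theta>s + dot d (X i) w) - of_bool (Y i) * (dot d (X i) \<theta>s + dot d (X i) w)"
      using psi_taylor3[of "dot d (X i) \<theta>s" "dot d (X i) w"] by (simp add: algebra_simps)
  qed
  then have "L \<theta>s + (\<Sum>i<n. (sigm (dot d (X i) \<theta>s) - of_bool (Y i)) * dot d (X i) w) + Fq w / 2 - (\<Sum>i<n. \<bar>dot d (X i) w\<bar> ^ 3) / 6 \<le> L (\<lambda>j. \<theta>s j + w j)"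
    by (simp add: neg_loglik_def Fq_def sum.distrib sum_subtractf sum_divide_distrib)
  then show ?thesis using score[of w] fisher_lower[of w] cubic[of w] unfolding sqrt_nd Fq_def[symmetric]
    by (simp add: abs_le_iff)
qed

lemma L_upper: "L (\<lambda>j. \<theta>s j + w j) \<le> L \<theta>s + K * (n * rho) * enorm d w + Lam * n / 8 * (enorm d w)\<^sup>2"
proof -
  have "L (\<lambda>j. \<theta>s j + w j) \<le> (\<Sum>i<n. (psi (dot d (X i) \<theta>s) - of_bool (Y i) * dot d (X i) \<theta>s) + (sigm (dot d (X i) \<theta>s) - of_bool (Y i)) * dot d (X i) w
      + (dot d (X i) w)\<^sup>2 / 8)"
    unfolding neg_loglik_def dot_add
  proof (rule sum_mono)
    fix i
    show "psi (dot d (X i) \<theta>s + dot d (X i) w) - of_bool (Y i) * (dot d (X i) \<theta>s + dot d (X i) w)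
      \<le> (psi (dot d (X i) \<theta>s) - of_bool (Y i) * dot d (X i) \<theta>s) + (sigm (dot d (X i) \<theta>s) - of_bool (Y i)) * dot d (X i) w + (dot d (X i) w)\<^sup>2 / 8"
      using psi_taylor2[of "dot d (X i) \<theta>s" "dot d (X i) w"] by (simp add: algebra_simps)
  qed
  also have "\<dots> = L \<theta>s + (\<Sum>i<n. (sigm (dot d (X i) \<theta>s) - of_bool (Y i)) * dot d (X i) w) + (\<Sum>i<n. (dot d (X i) w)\<^sup>2) / 8"
    by (simp add: neg_loglik_def sum.distrib sum_divide_distrib)
  finally show ?thesis using score[of w] gram_upper[of w] unfolding sqrt_nd by (simp add: abs_le_iff)
qed

lemma Fq_lower: "lam * n * (enorm d u)\<^sup>2 \<le> Fq u"
  using fisher_lower by (simp add: Fq_def)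

lemma Fq_upper: "Fq u \<le> Lam * n / 4 * (enorm d u)\<^sup>2"
proof -
  have "Fq u \<le> (\<Sum>i<n. 1 / 4 * (dot d (X i) u)\<^sup>2)"
    unfolding Fq_def by (intro sum_mono mult_right_mono dsigm_range) auto
  also have "\<dots> = (\<Sum>i<n. (dot d (X i) u)\<^sup>2) / 4" by (simp add: sum_divide_distrib)
  finally show ?thesis using gram_upper[of u] by simp
qed

text \<open>On the sphere of radius R = \<open>t * rho\<close> the quadratic term is at least lam n
  R^2 / 2. The score takes at most lam n R^2 / 8 since \<open>t \<ge> t0\<close>, and the cubic
  remainder as much since T R / 6 \<le> lam / 8. The remaining quarter propagates outwards along
  rays by convexity, as linear growth.\<close>

lemma L_growth:
  assumes t: "t \<ge> t0" and small: "T * (t * rho) \<le> 3 * lam / 4" and w: "enorm d w \<ge> t * rho"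
  shows "L (\<lambda>j. \<theta>s j + w j) - L \<theta>s \<ge> lam / 4 * n * (t * rho) * enorm d w"
proof -
  let ?R = "t * rho"
  have tp: "t > 0" using t t0_pos by simp
  have R: "?R > 0" using tp rho_pos by simp
  have wp: "enorm d w > 0" using w R by simp
  define s where "s = ?R / enorm d w"
  have s: "0 < s" "s \<le> 1" using w R wp by (auto simp: s_def)
  have nw: "enorm d (\<lambda>j. s * w j) = ?R" unfolding enorm_scale using s wp R by (simp add: s_def abs_of_pos)
  have "K * (n * rho) * ?R = n * (K / t) * ?R\<^sup>2" using tp by (simp add: power2_eq_square)
  also have "\<dots> \<le> n * (lam / 8) * ?R\<^sup>2"
  proof -
    have "K / t \<le> lam / 8" using t tp lam by (simp add: t0_def field_simps)
    then show ?thesis by (intro mult_right_mono mult_left_mono) auto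
  qed
  finally have a: "K * (n * rho) * ?R \<le> n * (lam / 8) * ?R\<^sup>2" .
  have "T * n / 6 * ?R ^ 3 = n / 6 * (T * ?R) * ?R\<^sup>2" by (simp add: power2_eq_square power3_eq_cube)
  also have "\<dots> \<le> n / 6 * (3 * lam / 4) * ?R\<^sup>2" using small by (intro mult_right_mono mult_left_mono) auto
  finally have b: "T * n / 6 * ?R ^ 3 \<le> n / 6 * (3 * lam / 4) * ?R\<^sup>2" .
  have "L (\<lambda>j. \<theta>s j + s * w j) - L \<theta>s \<ge> lam / 4 * n * ?R\<^sup>2"
    using L_lower_local[of "\<lambda>j. s * w j"] a b unfolding nw by (simp add: field_simps)
  moreover have "L (\<lambda>j. \<theta>s j + s * w j) \<le> (1 - s) * L \<theta>s + s * L (\<lambda>j. \<theta>s j + w j)"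
    using s by (intro neg_loglik_convex) auto
  ultimately have "lam / 4 * n * ?R\<^sup>2 \<le> s * (L (\<lambda>j. \<theta>s j + w j) - L \<theta>s)" by (simp add: algebra_simps)
  then have "lam / 4 * n * ?R\<^sup>2 * enorm d w \<le> ?R * (L (\<lambda>j. \<theta>s j + w j) - L \<theta>s)"
    using wp by (simp add: s_def field_simps)
  then have "?R * (lam / 4 * n * ?R * enorm d w) \<le> ?R * (L (\<lambda>j. \<theta>s j + w j) - L \<theta>s)"
    by (simp add: power2_eq_square mult_ac)
  then show ?thesis using R by (simp only: mult_le_cancel_left_pos)
qed

end

section \<open>Compactness, and existence and uniqueness of the maximum likelihood estimator\<close>

lemma abs_component_le_enorm: "j < d \<Longrightarrow> \<bar>x j\<bar> \<le> enorm d x"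
proof -
  assume "j < d"
  then have "(x j)\<^sup>2 \<le> (enorm d x)\<^sup>2" unfolding enorm_square by (intro member_le_sum) auto
  then show ?thesis by (simp add: abs_le_square_iff[symmetric])
qed

lemma Rd_eqI: "x \<in> Rd d \<Longrightarrow> y \<in> Rd d \<Longrightarrow> (\<And>j. j < d \<Longrightarrow> x j = y j) \<Longrightarrow> x = y"
  unfolding Rd_def by (rule PiE_ext) auto

lemma restrict_in_Rd: "restrict x {..<d} \<in> Rd d"
  by (simp add: Rd_def)

lemma midpt_in_Rd: "midpt d x y \<in> Rd d"
  by (simp add: Rd_def midpt_def)

text \<open>As a set of functions on all naturals, the box is a product of intervals below
  \<open>d\<close> and of singletons containing \<open>undefined\<close> from \<open>d\<close> on,
  so Tychonoff's theorem applies. This lets the standard topology of the function type serve for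
  every \<open>d\<close>.\<close>

lemma compact_Rd_box: "compact {x \<in> Rd d. \<forall>j<d. \<bar>x j\<bar> \<le> B}"
proof -
  have "compactin (product_topology (\<lambda>_. euclidean) (UNIV::nat set)) (PiE UNIV (\<lambda>j. if j < d then {-B..B} else {undefined :: real}))"
    by (subst compactin_PiE) auto
  then have "compact (PiE UNIV (\<lambda>j. if j < d then {-B..B} else {undefined :: real}))"
    by (simp add: euclidean_product_topology)
  also have "PiE UNIV (\<lambda>j. if j < d then {-B..B} else {undefined :: real}) = {x \<in> Rd d. \<forall>j<d. \<bar>x j\<bar> \<le> B}"
    by (auto simp: Rd_def PiE_iff extensional_def abs_le_iff split: if_splits)
       (metis abs_le_iff neg_le_iff_le minus_minus)+
  finally show ?thesis .
qed

lemma compact_Rd_bounded: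
  assumes "closed C" "\<And>x j. x \<in> C \<Longrightarrow> j < d \<Longrightarrow> \<bar>x j\<bar> \<le> B"
  shows "compact (Rd d \<inter> C)"
proof -
  have "Rd d \<inter> C = {x \<in> Rd d. \<forall>j<d. \<bar>x j\<bar> \<le> B} \<inter> C" using assms(2) by auto
  then show ?thesis using compact_Int_closed[OF compact_Rd_box assms(1)] by simp
qed

lemma continuous_on_dot: "continuous_on S (\<lambda>\<theta>. dot d x \<theta>)"
  unfolding dot_def by (intro continuous_intros continuous_on_subset[OF continuous_on_product_coordinates]) auto

lemma continuous_on_enorm_diff: "continuous_on S (\<lambda>\<theta>. enorm d (\<lambda>j. \<theta> j - c j))"
  unfolding enorm_def L2_set_def
  by (intro continuous_intros continuous_on_subset[OF continuous_on_product_coordinates]) auto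

lemma continuous_on_neg_loglik: "continuous_on S (neg_loglik n d X Y)"
  unfolding neg_loglik_def[abs_def]
  by (intro continuous_intros continuous_on_compose2[OF continuous_on_psi] continuous_on_dot) auto

lemma compact_Rd_cball: "compact (Rd d \<inter> {\<theta>. enorm d (\<lambda>j. \<theta> j - c j) \<le> R})"
proof (rule compact_Rd_bounded[of _ _ "R + enorm d c"])
  show "closed {\<theta>. enorm d (\<lambda>j. \<theta> j - c j) \<le> R}"
    by (intro closed_Collect_le continuous_on_enorm_diff continuous_on_const)
  fix x j assume x: "x \<in> {\<theta>. enorm d (\<lambda>j. \<theta> j - c j) \<le> R}" and j: "j < d"
  have "\<bar>x j\<bar> \<le> \<bar>x j - c j\<bar> + \<bar>c j\<bar>" by simp
  also have "\<dots> \<le> R + enorm d c"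
    using abs_component_le_enorm[OF j, of "\<lambda>j. x j - c j"] abs_component_le_enorm[OF j, of c] x by simp
  finally show "\<bar>x j\<bar> \<le> R + enorm d c" .
qed

lemma is_mle_iff:
  assumes "n > 0"
  shows "is_mle n d (X, Y) \<theta> \<longleftrightarrow> \<theta> \<in> Rd d \<and> (\<forall>\<theta>'\<in>Rd d. neg_loglik n d X Y \<theta> \<le> neg_loglik n d X Y \<theta>')"
  using assms by (auto simp: is_mle_def is_arg_min_def nll_eq divide_less_cancel not_less)

text \<open>Two distinct minimizers are separated by some row; strict convexity of
  \<open>psi\<close> there would make their midpoint strictly better.\<close>

lemma mle_unique_of_spanning:
  assumes n: "n > 0" and span: "\<And>u. (\<And>i. i < n \<Longrightarrow> dot d (X i) u = 0) \<Longrightarrow> enorm d u = 0"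
    and p: "is_mle n d (X, Y) p" and q: "is_mle n d (X, Y) q"
  shows "p = q"
proof (rule ccontr)
  assume ne: "p \<noteq> q"
  let ?L = "neg_loglik n d X Y"
  have pR: "p \<in> Rd d" "q \<in> Rd d" and min: "\<And>\<theta>. \<theta> \<in> Rd d \<Longrightarrow> ?L p \<le> ?L \<theta>" "\<And>\<theta>. \<theta> \<in> Rd d \<Longrightarrow> ?L q \<le> ?L \<theta>"
    using p q by (auto simp: is_mle_iff[OF n])
  have "\<exists>i<n. dot d (X i) p \<noteq> dot d (X i) q"
  proof (rule ccontr)
    assume "\<not> ?thesis"
    then have "enorm d (\<lambda>j. p j - q j) = 0" by (intro span) (auto simp: dot_diff)
    then show False using ne Rd_eqI[OF pR] by (auto simp: enorm_eq_0_iff)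
  qed
  then obtain i where i: "i < n" "dot d (X i) p \<noteq> dot d (X i) q" by auto
  have mid: "dot d x (midpt d p q) = (dot d x p + dot d x q) / 2" for x
  proof -
    have "dot d x (midpt d p q) = dot d x (\<lambda>j. (1/2) * (p j + q j))"
      by (rule dot_cong) (simp add: midpt_def)
    then show ?thesis by (simp only: dot_scale dot_add)
  qed
  let ?t = "\<lambda>\<theta> i. psi (dot d (X i) \<theta>) - of_bool (Y i) * dot d (X i) \<theta>"
  have "?L (midpt d p q) < (\<Sum>i<n. (?t p i + ?t q i) / 2)"
    unfolding neg_loglik_def
  proof (rule sum_strict_mono_ex1)
    show "\<forall>i\<in>{..<n}. ?t (midpt d p q) i \<le> (?t p i + ?t q i) / 2"
    proof
      fix i
      show "?t (midpt d p q) i \<le> (?t p i + ?t q i) / 2"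
        unfolding mid using psi_strict[of "dot d (X i) p" "dot d (X i) q"]
        by (cases "dot d (X i) p = dot d (X i) q") (simp_all add: field_simps)
    qed
    show "\<exists>i\<in>{..<n}. ?t (midpt d p q) i < (?t p i + ?t q i) / 2"
      unfolding mid using psi_strict[OF i(2)] i(1)
      by (intro bexI[of _ i]) (simp_all add: field_simps)
  qed simp
  also have "\<dots> = (?L p + ?L q) / 2"
    by (simp add: neg_loglik_def sum.distrib[symmetric] sum_divide_distrib[symmetric])
  also have "\<dots> \<le> ?L (midpt d p q)"
    using min(1)[OF midpt_in_Rd, of p q] min(2)[OF midpt_in_Rd, of p q] by simp
  finally show False by simp
qed

context logistic_sample
begin

lemma spanning: "(\<And>i. i < n \<Longrightarrow> dot d (X i) u = 0) \<Longrightarrow> enorm d u = 0"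
  using fisher_lower[of u] lam n by (simp add: mult_le_0_iff)

text \<open>A minimizer over the compact ball of radius \<open>t0 * rho\<close> is global, because
  by \<open>L_growth\<close> every point outside is worse than the truth, which lies inside.
  Uniqueness comes from positive curvature, which forces the rows to span.\<close>

lemma mle_ex1:
  assumes small: "T * (t0 * rho) \<le> 3 * lam / 4"
  shows "\<exists>!\<theta>. is_mle n d (X, Y) \<theta>"
    and "enorm d (\<lambda>j. mle n d (X, Y) j - \<theta>s j) \<le> t0 * rho"
    and "is_mle n d (X, Y) (mle n d (X, Y))"
proof -
  let ?S = "Rd d \<inter> {\<theta>. enorm d (\<lambda>j. \<theta> j - \<theta>s j) \<le> t0 * rho}"
  have "\<theta>s \<in> ?S" using \<theta>s t0_pos rho_pos by (simp add: enorm_def L2_set_def)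
  then obtain \<theta>h where h: "\<theta>h \<in> ?S" "\<And>\<theta>. \<theta> \<in> ?S \<Longrightarrow> L \<theta>h \<le> L \<theta>"
    using continuous_attains_inf[OF compact_Rd_cball _ continuous_on_neg_loglik[of _ n d X Y]] by blast
  have far: "L \<theta>s < L \<theta>" if "enorm d (\<lambda>j. \<theta> j - \<theta>s j) > t0 * rho" for \<theta>
  proof -
    have "0 < lam / 4 * n * (t0 * rho) * enorm d (\<lambda>j. \<theta> j - \<theta>s j)"
      using lam n t0_pos rho_pos that by (intro mult_pos_pos) (auto intro: le_less_trans[OF _ that] mult_nonneg_nonneg)
    then show ?thesis using L_growth[of t0 "\<lambda>j. \<theta> j - \<theta>s j"] small that by simp
  qed
  have mh: "is_mle n d (X, Y) \<theta>h"
    unfolding is_mle_iff[OF n]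
  proof (intro conjI ballI)
    show "\<theta>h \<in> Rd d" using h by simp
    fix \<theta> assume "\<theta> \<in> Rd d"
    then show "L \<theta>h \<le> L \<theta>"
      using h(2)[of \<theta>] h(2)[OF \<open>\<theta>s \<in> ?S\<close>] far[of \<theta>] by (cases "\<theta> \<in> ?S") auto
  qed
  have uniq: "p = q" if "is_mle n d (X, Y) p" "is_mle n d (X, Y) q" for p q
    using mle_unique_of_spanning[OF n spanning that] .
  show ex1: "\<exists>!\<theta>. is_mle n d (X, Y) \<theta>" using mh uniq by blast
  then show m: "is_mle n d (X, Y) (mle n d (X, Y))" unfolding mle_def by (rule theI')
  have "mle n d (X, Y) = \<theta>h" using uniq[OF m mh] .
  then show "enorm d (\<lambda>j. mle n d (X, Y) j - \<theta>s j) \<le> t0 * rho" using h by simp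
qed

lemma mle_score_zero:
  assumes m: "is_mle n d (X, Y) \<theta>h"
  shows "(\<Sum>i<n. (sigm (dot d (X i) \<theta>h) - of_bool (Y i)) * dot d (X i) u) = 0"
proof -
  have "((\<lambda>s. L (\<lambda>j. \<theta>h j + s * u j)) has_real_derivative
    (\<Sum>i<n. (sigm (dot d (X i) \<theta>h + 0 * dot d (X i) u) - of_bool (Y i)) * dot d (X i) u)) (at 0)"
    by (rule neg_loglik_line_deriv)
  moreover have "L (\<lambda>j. \<theta>h j + 0 * u j) \<le> L (\<lambda>j. \<theta>h j + s * u j)" for s
  proof -
    have "L \<theta>h \<le> L (restrict (\<lambda>j. \<theta>h j + s * u j) {..<d})"
      using m restrict_in_Rd by (simp add: is_mle_iff[OF n])
    also have "\<dots> = L (\<lambda>j. \<theta>h j + s * u j)" by (rule neg_loglik_cong) simp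
    finally show ?thesis by simp
  qed
  ultimately have "(\<Sum>i<n. (sigm (dot d (X i) \<theta>h + 0 * dot d (X i) u) - of_bool (Y i)) * dot d (X i) u) = 0"
    by (intro DERIV_local_min[of _ _ 0 1]) auto
  then show ?thesis by simp
qed

lemma Fq_line_deriv:
  "((\<lambda>s. Fq (\<lambda>j. p j + s * v j) / 2) has_real_derivative
    (\<Sum>i<n. dsigm (dot d (X i) \<theta>s) * (dot d (X i) p + s * dot d (X i) v) * dot d (X i) v)) (at s)"
proof -
  have "((\<lambda>s. dsigm (dot d (X i) \<theta>s) * (dot d (X i) p + s * dot d (X i) v)\<^sup>2 / 2) has_real_derivative
      dsigm (dot d (X i) \<theta>s) * (dot d (X i) p + s * dot d (X i) v) * dot d (X i) v) (at s)" for i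
    by (auto intro!: derivative_eq_intros)
  then show ?thesis
    unfolding Fq_def dot_line sum_divide_distrib by (intro DERIV_sum)
qed

lemma enorm_segment:
  assumes "enorm d (\<lambda>j. p j - c j) \<le> R" "enorm d (\<lambda>j. q j - c j) \<le> R" "0 \<le> s" "s \<le> 1"
  shows "enorm d (\<lambda>j. (p j + s * (q j - p j)) - c j) \<le> R"
proof -
  have eq: "(\<lambda>j. (p j + s * (q j - p j)) - c j) = (\<lambda>j. (1 - s) * (p j - c j) + s * (q j - c j))"
    by (auto simp: algebra_simps)
  have "enorm d (\<lambda>j. (1 - s) * (p j - c j) + s * (q j - c j)) \<le> (1 - s) * enorm d (\<lambda>j. p j - c j) + s * enorm d (\<lambda>j. q j - c j)"
    using enorm_add[of d "\<lambda>j. (1 - s) * (p j - c j)" "\<lambda>j. s * (q j - c j)"] assms(3,4) by (simp only: enorm_scale abs_of_nonneg diff_ge_0_iff_ge)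
  also have "\<dots> \<le> (1 - s) * R + s * R" using assms by (intro add_mono mult_left_mono) auto
  finally show ?thesis unfolding eq by (simp add: algebra_simps)
qed

text \<open>\<open>h\<close> is, up to constants, the log ratio of likelihood and Laplace kernel.
  Its derivative along a segment is a sum of second-order remainders of \<open>sigm\<close> times a
  linear form; each remainder is at most twice the sum of two squares, and each square sum is
  controlled by \<open>cubic_mixed\<close>, which gives 2 + 2 = 4. For \<open>R = t * rho\<close>
  the constant becomes \<open>4 * T * t^2 * d\<close>.\<close>

lemma laplace_error_lipschitz:
  assumes m: "is_mle n d (X, Y) \<theta>h" and mR: "enorm d (\<lambda>j. \<theta>h j - \<theta>s j) \<le> R"
    and p: "enorm d (\<lambda>j. p j - \<theta>s j) \<le> R" and q: "enorm d (\<lambda>j. q j - \<theta>s j) \<le> R"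
  defines "h \<equiv> \<lambda>\<theta>. Fq (\<lambda>j. \<theta> j - \<theta>h j) / 2 - L \<theta>"
  shows "\<bar>h q - h p\<bar> \<le> 4 * T * n * R\<^sup>2 * enorm d (\<lambda>j. q j - p j)"
proof -
  define v where "v = (\<lambda>j. q j - p j)"
  define D where "D = (\<lambda>s. (\<Sum>i<n. dsigm (dot d (X i) \<theta>s) * (dot d (X i) (\<lambda>j. p j - \<theta>h j) + s * dot d (X i) v) * dot d (X i) v)
      - (\<Sum>i<n. (sigm (dot d (X i) p + s * dot d (X i) v) - of_bool (Y i)) * dot d (X i) v))"
  define \<phi> where "\<phi> = (\<lambda>s. Fq (\<lambda>j. (p j - \<theta>h j) + s * v j) / 2 - L (\<lambda>j. p j + s * v j))"
  have der: "(\<phi> has_real_derivative D s) (at s)" for s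
    unfolding \<phi>_def D_def by (intro DERIV_diff Fq_line_deriv neg_loglik_line_deriv)
  have Dbound: "\<bar>D s\<bar> \<le> 4 * T * n * R\<^sup>2 * enorm d v" if s: "0 \<le> s" "s \<le> 1" for s
  proof -
    define b where "b = (\<lambda>j. p j + s * v j)"
    have bR: "enorm d (\<lambda>j. b j - \<theta>s j) \<le> R" unfolding b_def v_def by (rule enorm_segment[OF p q s])
    \<comment> \<open>The last sum is zero by the score equation at \<open>\<theta>h\<close>; adding
      it cancels the labels and leaves only differences of \<open>sigm\<close>.\<close>
    have "D s = (\<Sum>i<n. dsigm (dot d (X i) \<theta>s) * (dot d (X i) b - dot d (X i) \<theta>h) * dot d (X i) v)
        - (\<Sum>i<n. (sigm (dot d (X i) b) - of_bool (Y i)) * dot d (X i) v)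
        + (\<Sum>i<n. (sigm (dot d (X i) \<theta>h) - of_bool (Y i)) * dot d (X i) v)"
      unfolding mle_score_zero[OF m] D_def b_def dot_line dot_diff by (simp add: algebra_simps)
    also have "\<dots> = - (\<Sum>i<n. (sigm (dot d (X i) b) - sigm (dot d (X i) \<theta>h) - dsigm (dot d (X i) \<theta>s) * (dot d (X i) b - dot d (X i) \<theta>h)) * dot d (X i) v)"
      by (simp add: sum_subtractf[symmetric] sum.distrib[symmetric] sum_negf[symmetric] algebra_simps)
    finally have "\<bar>D s\<bar> \<le> (\<Sum>i<n. \<bar>(sigm (dot d (X i) b) - sigm (dot d (X i) \<theta>h) - dsigm (dot d (X i) \<theta>s) * (dot d (X i) b - dot d (X i) \<theta>h)) * dot d (X i) v\<bar>)"
      using sum_abs by (simp add: abs_minus_cancel)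
    also have "\<dots> \<le> (\<Sum>i<n. 2 * ((dot d (X i) (\<lambda>j. b j - \<theta>s j))\<^sup>2 * \<bar>dot d (X i) v\<bar>)
        + 2 * ((dot d (X i) (\<lambda>j. \<theta>h j - \<theta>s j))\<^sup>2 * \<bar>dot d (X i) v\<bar>))"
    proof (rule sum_mono)
      fix i
      let ?x = "dot d (X i) (\<lambda>j. b j - \<theta>s j)" and ?y = "dot d (X i) (\<lambda>j. \<theta>h j - \<theta>s j)"
      have "\<bar>sigm (dot d (X i) b) - sigm (dot d (X i) \<theta>h) - dsigm (dot d (X i) \<theta>s) * (dot d (X i) b - dot d (X i) \<theta>h)\<bar>
          \<le> (\<bar>?x\<bar> + \<bar>?y\<bar>) * \<bar>?x - ?y\<bar>"
        using sigm_remainder[of "dot d (X i) b" "dot d (X i) \<theta>h" "dot d (X i) \<theta>s"] by (simp add: dot_diff)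
      also have "\<dots> \<le> (\<bar>?x\<bar> + \<bar>?y\<bar>) * (\<bar>?x\<bar> + \<bar>?y\<bar>)" by (intro mult_left_mono) auto
      also have "\<dots> \<le> 2 * ?x\<^sup>2 + 2 * ?y\<^sup>2"
        using zero_le_power2[of "\<bar>?x\<bar> - \<bar>?y\<bar>"] by (simp add: power2_eq_square algebra_simps)
      finally have le: "\<bar>sigm (dot d (X i) b) - sigm (dot d (X i) \<theta>h) - dsigm (dot d (X i) \<theta>s) * (dot d (X i) b - dot d (X i) \<theta>h)\<bar>
          \<le> 2 * ?x\<^sup>2 + 2 * ?y\<^sup>2" .
      from mult_right_mono[OF le, of "\<bar>dot d (X i) v\<bar>"]
      show "\<bar>(sigm (dot d (X i) b) - sigm (dot d (X i) \<theta>h) - dsigm (dot d (X i) \<theta>s) * (dot d (X i) b - dot d (X i) \<theta>h)) * dot d (X i) v\<bar>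
          \<le> 2 * (?x\<^sup>2 * \<bar>dot d (X i) v\<bar>) + 2 * (?y\<^sup>2 * \<bar>dot d (X i) v\<bar>)"
        by (simp only: abs_mult distrib_right mult.assoc)
    qed
    also have "\<dots> = 2 * (\<Sum>i<n. (dot d (X i) (\<lambda>j. b j - \<theta>s j))\<^sup>2 * \<bar>dot d (X i) v\<bar>)
        + 2 * (\<Sum>i<n. (dot d (X i) (\<lambda>j. \<theta>h j - \<theta>s j))\<^sup>2 * \<bar>dot d (X i) v\<bar>)"
      by (simp add: sum.distrib sum_distrib_left)
    also have "\<dots> \<le> 2 * (T * n * R\<^sup>2 * enorm d v) + 2 * (T * n * R\<^sup>2 * enorm d v)"
    proof -
      have "(\<Sum>i<n. (dot d (X i) z)\<^sup>2 * \<bar>dot d (X i) v\<bar>) \<le> T * n * R\<^sup>2 * enorm d v" if "enorm d z \<le> R" for z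
      proof -
        have "T * n * (enorm d z)\<^sup>2 * enorm d v \<le> T * n * R\<^sup>2 * enorm d v"
          using that T by (intro mult_right_mono mult_left_mono power_mono) auto
        with cubic_mixed[of z v] show ?thesis by linarith
      qed
      from this[OF bR] this[OF mR] show ?thesis by (intro add_mono mult_left_mono) auto
    qed
    also have "\<dots> = 4 * T * n * R\<^sup>2 * enorm d v" by simp
    finally show ?thesis .
  qed
  have "norm (\<phi> 1 - \<phi> 0) \<le> 4 * T * n * R\<^sup>2 * enorm d v * norm (1 - 0 :: real)"
  proof (rule field_differentiable_bound[of "{0..1}" \<phi> D])
    show "(\<phi> has_field_derivative D z) (at z within {0..1})" for z by (rule DERIV_subset[OF der]) simp
    show "norm (D z) \<le> 4 * T * n * R\<^sup>2 * enorm d v" if "z \<in> {0..1}" for z using Dbound[of z] that by simp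
  qed auto
  moreover have "\<phi> 1 = h q" "\<phi> 0 = h p" by (simp_all add: \<phi>_def h_def v_def)
  ultimately show ?thesis by (simp add: v_def)
qed

end

section \<open>Total variation of nearly proportional densities\<close>

lemma nn_integral_exp_abs_le:
  assumes b: "b > 0"
  shows "(\<integral>\<^sup>+y. ennreal (exp (- b * \<bar>y - m\<bar>)) \<partial>lborel) \<le> ennreal (2 / b)"
proof -
  have one: "(\<integral>\<^sup>+y. ennreal (exponential_density b y) \<partial>lborel) = 1"
    using prob_space.emeasure_space_1[OF prob_space_exponential_density[OF b]]
    by (simp add: emeasure_density)
  have shift: "(\<integral>\<^sup>+y. ennreal (exponential_density b (s * (y - m))) \<partial>lborel) = 1" if s: "s = 1 \<or> s = -1" for s
  proof -
    have "(\<integral>\<^sup>+y. ennreal (exponential_density b y) \<partial>lborel)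
        = ennreal \<bar>s\<bar> * (\<integral>\<^sup>+y. ennreal (exponential_density b ((- s * m) + s * y)) \<partial>lborel)"
      using s by (intro nn_integral_real_affine) auto
    then show ?thesis using one s by (auto simp: algebra_simps)
  qed
  have "(\<integral>\<^sup>+y. ennreal (exp (- b * \<bar>y - m\<bar>)) \<partial>lborel)
      \<le> (\<integral>\<^sup>+y. ennreal (1 / b) * (ennreal (exponential_density b (1 * (y - m))) + ennreal (exponential_density b (-1 * (y - m)))) \<partial>lborel)"
  proof (rule nn_integral_mono)
    fix y
    have "exp (- b * \<bar>y - m\<bar>) \<le> 1 / b * (exponential_density b (1 * (y - m)) + exponential_density b (-1 * (y - m)))"
      using b by (auto simp: exponential_density_def abs_if field_simps)
    then have "ennreal (exp (- b * \<bar>y - m\<bar>)) \<le> ennreal (1 / b * (exponential_density b (1 * (y - m)) + exponential_density b (-1 * (y - m))))"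
      by (rule ennreal_leI)
    also have "\<dots> = ennreal (1 / b) * (ennreal (exponential_density b (1 * (y - m))) + ennreal (exponential_density b (-1 * (y - m))))"
    proof -
      have "0 \<le> exponential_density b z" for z using b by (auto simp: exponential_density_def)
      then show ?thesis using b by (subst ennreal_mult) auto
    qed
    finally show "ennreal (exp (- b * \<bar>y - m\<bar>)) \<le> ennreal (1 / b) * (ennreal (exponential_density b (1 * (y - m))) + ennreal (exponential_density b (-1 * (y - m))))" .
  qed
  also have "\<dots> = ennreal (1 / b) * ((\<integral>\<^sup>+y. ennreal (exponential_density b (1 * (y - m))) \<partial>lborel)
      + (\<integral>\<^sup>+y. ennreal (exponential_density b (-1 * (y - m))) \<partial>lborel))"
  proof -
    have m: "(\<lambda>y. ennreal (exponential_density b (s * (y - m)))) \<in> borel_measurable lborel" for s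
    proof -
      have "(\<lambda>y. s * (y - m)) \<in> borel_measurable lborel" by (intro borel_measurable_times borel_measurable_diff) auto
      then show ?thesis by (intro measurable_compose[OF _ measurable_ennreal] measurable_compose[OF _ borel_measurable_erlang_density])
    qed
    show ?thesis using m[of 1] m[of "-1"] by (simp add: nn_integral_cmult nn_integral_add)
  qed
  also have "\<dots> = ennreal (1 / b) * 2" using shift[of 1] shift[of "-1"] by (simp add: one_add_one)
  also have "\<dots> = ennreal (1 / b) * ennreal 2" by simp
  also have "\<dots> = ennreal (2 / b)" using b by (subst ennreal_mult[symmetric]) auto
  finally show ?thesis .
qed

lemma sum_abs_le_enorm: "(\<Sum>j<d. \<bar>x j\<bar>) \<le> sqrt d * enorm d x"
proof -
  have "(\<Sum>j<d. 1 * \<bar>x j\<bar>)\<^sup>2 \<le> (\<Sum>j<d. 1\<^sup>2) * (\<Sum>j<d. \<bar>x j\<bar>\<^sup>2)" by (rule Cauchy_Schwarz_ineq_sum)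
  then have "(\<Sum>j<d. \<bar>x j\<bar>)\<^sup>2 \<le> (sqrt d * enorm d x)\<^sup>2" by (simp add: power_mult_distrib enorm_square)
  then show ?thesis by (rule power2_le_imp_le) simp
qed

text \<open>Comparing a tail that decays like \<open>exp (- a \<surd>(nd) \<bar>\<theta> - c\<bar>)\<close> with the mass of a cube of
  side \<open>2 / \<surd>n\<close>, through \<open>\<surd>d \<bar>w\<bar> \<ge> \<Sum>\<^sub>j \<bar>w\<^sub>j\<bar>\<close>, avoids volumes of balls.\<close>

lemma tail_comparison:
  fixes F :: "(nat \<Rightarrow> real) \<Rightarrow> ennreal"
  assumes n: "n > 0" and d: "d > 0" and a: "a > 0" and [measurable]: "F \<in> borel_measurable (leb d)"
    and outside: "\<And>\<theta>. \<theta> \<in> Rd d \<Longrightarrow> \<not> enorm d (\<lambda>j. \<theta> j - c j) \<le> R \<Longrightarrow>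
      F \<theta> \<le> ennreal (exp (A * d - a * sqrt (real n * real d) * enorm d (\<lambda>j. \<theta> j - c j)))"
    and inside: "\<And>\<theta>. \<theta> \<in> Rd d \<Longrightarrow> enorm d (\<lambda>j. \<theta> j - c j) \<le> sqrt (real d / real n) \<Longrightarrow> ennreal (exp (- A * d)) \<le> F \<theta>"
    and R: "sqrt (real d / real n) \<le> R"
  defines "U \<equiv> {\<theta> \<in> Rd d. enorm d (\<lambda>j. \<theta> j - c j) \<le> R}"
  shows "(\<integral>\<^sup>+\<theta>. F \<theta> * indicator (Rd d - U) \<theta> \<partial>leb d) \<le> ennreal ((exp (2 * A) / a) ^ d) * (\<integral>\<^sup>+\<theta>. F \<theta> * indicator U \<theta> \<partial>leb d)"
    and "(\<integral>\<^sup>+\<theta>. F \<theta> * indicator U \<theta> \<partial>leb d) > 0"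
proof -
  let ?s = "sqrt (real n)"
  have s: "?s > 0" using n by simp
  have "(\<integral>\<^sup>+\<theta>. F \<theta> * indicator (Rd d - U) \<theta> \<partial>leb d)
      \<le> (\<integral>\<^sup>+\<theta>. ennreal (exp (A * d)) * (\<Prod>j<d. ennreal (exp (- (a * ?s) * \<bar>\<theta> j - c j\<bar>))) \<partial>leb d)"
  proof (rule nn_integral_mono)
    fix \<theta> assume "\<theta> \<in> space (leb d)"
    then have \<theta>: "\<theta> \<in> Rd d" by (simp add: space_leb)
    show "F \<theta> * indicator (Rd d - U) \<theta> \<le> ennreal (exp (A * d)) * (\<Prod>j<d. ennreal (exp (- (a * ?s) * \<bar>\<theta> j - c j\<bar>)))"
    proof (cases "\<theta> \<in> U")
      case False
      then have "F \<theta> \<le> ennreal (exp (A * d - a * sqrt (real n * real d) * enorm d (\<lambda>j. \<theta> j - c j)))"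
        using \<theta> by (intro outside) (auto simp: U_def)
      also have "\<dots> \<le> ennreal (exp (A * d - a * ?s * (\<Sum>j<d. \<bar>\<theta> j - c j\<bar>)))"
      proof -
        have "a * ?s * (\<Sum>j<d. \<bar>\<theta> j - c j\<bar>) \<le> a * ?s * (sqrt d * enorm d (\<lambda>j. \<theta> j - c j))"
          using a by (intro mult_left_mono sum_abs_le_enorm) auto
        then show ?thesis by (intro ennreal_leI) (simp add: real_sqrt_mult mult_ac)
      qed
      also have "exp (A * d - a * ?s * (\<Sum>j<d. \<bar>\<theta> j - c j\<bar>)) = exp (A * d) * (\<Prod>j<d. exp (- (a * ?s) * \<bar>\<theta> j - c j\<bar>))"
      proof -
        have "(\<Prod>j<d. exp (- (a * ?s) * \<bar>\<theta> j - c j\<bar>)) = exp (- (a * ?s * (\<Sum>j<d. \<bar>\<theta> j - c j\<bar>)))"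
          by (simp add: exp_sum[symmetric] sum_distrib_left sum_negf)
        then show ?thesis by (simp add: mult_exp_exp)
      qed
      finally show ?thesis using False \<theta> by (simp add: ennreal_mult prod_ennreal prod_nonneg)
    qed simp
  qed
  also have "\<dots> = ennreal (exp (A * d)) * (\<integral>\<^sup>+\<theta>. (\<Prod>j<d. ennreal (exp (- (a * ?s) * \<bar>\<theta> j - c j\<bar>))) \<partial>leb d)"
    by (rule nn_integral_cmult) measurable
  also have "(\<integral>\<^sup>+\<theta>. (\<Prod>j<d. ennreal (exp (- (a * ?s) * \<bar>\<theta> j - c j\<bar>))) \<partial>leb d)
      = (\<Prod>j<d. \<integral>\<^sup>+y. ennreal (exp (- (a * ?s) * \<bar>y - c j\<bar>)) \<partial>lborel)"
    unfolding leb_def by (rule lborel_product.product_nn_integral_prod) auto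
  finally have up: "(\<integral>\<^sup>+\<theta>. F \<theta> * indicator (Rd d - U) \<theta> \<partial>leb d)
      \<le> ennreal (exp (A * d)) * (\<Prod>j<d. \<integral>\<^sup>+y. ennreal (exp (- (a * ?s) * \<bar>y - c j\<bar>)) \<partial>lborel)" .
  have "(\<Prod>j<d. \<integral>\<^sup>+y. ennreal (exp (- (a * ?s) * \<bar>y - c j\<bar>)) \<partial>lborel) \<le> (\<Prod>j<d. ennreal (2 / (a * ?s)))"
    using a s by (intro prod_mono_ennreal nn_integral_exp_abs_le) auto
  also have "\<dots> = ennreal ((2 / (a * ?s)) ^ d)" using a by (simp add: ennreal_power)
  finally have up2: "(\<integral>\<^sup>+\<theta>. F \<theta> * indicator (Rd d - U) \<theta> \<partial>leb d) \<le> ennreal (exp (A * d)) * ennreal ((2 / (a * ?s)) ^ d)"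
    by (rule order_trans[OF up mult_left_mono]) simp
  \<comment> \<open>The cube with half side \<open>1 / ?s\<close> is contained in the ball of radius
    \<open>sqrt (d / n)\<close>, where the lower bound on \<open>F\<close> is available.\<close>
  let ?C = "PiE {..<d} (\<lambda>j. {c j - 1 / ?s..c j + 1 / ?s})"
  have Cm: "?C \<in> sets (leb d)" unfolding leb_def by (rule sets_PiM_I_finite) auto
  have "emeasure (leb d) ?C = (\<Prod>j<d. emeasure lborel {c j - 1 / ?s..c j + 1 / ?s})"
    unfolding leb_def by (rule lborel_product.emeasure_PiM) auto
  also have "\<dots> = ennreal ((2 / ?s) ^ d)" using s by (simp add: ennreal_power)
  finally have C: "emeasure (leb d) ?C = ennreal ((2 / ?s) ^ d)" .
  have inC: "\<theta> \<in> Rd d \<and> enorm d (\<lambda>j. \<theta> j - c j) \<le> sqrt (real d / real n)" if \<theta>: "\<theta> \<in> ?C" for \<theta>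
  proof
    show "\<theta> \<in> Rd d" using \<theta> by (auto simp: Rd_def PiE_iff)
    have "(enorm d (\<lambda>j. \<theta> j - c j))\<^sup>2 \<le> (\<Sum>j<d. (1 / ?s)\<^sup>2)"
      unfolding enorm_square
    proof (rule sum_mono)
      fix j assume "j \<in> {..<d}"
      then have "\<theta> j \<in> {c j - 1 / ?s..c j + 1 / ?s}" using \<theta> by (auto simp: PiE_iff)
      then have "\<bar>\<theta> j - c j\<bar> \<le> \<bar>1 / ?s\<bar>" using s by auto
      then show "(\<theta> j - c j)\<^sup>2 \<le> (1 / ?s)\<^sup>2" by (simp only: abs_le_square_iff)
    qed
    also have "\<dots> = (sqrt (real d / real n))\<^sup>2" by (simp add: power_divide)
    finally show "enorm d (\<lambda>j. \<theta> j - c j) \<le> sqrt (real d / real n)" by (rule power2_le_imp_le) simp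
  qed
  have "ennreal (exp (- A * d)) * ennreal ((2 / ?s) ^ d) = (\<integral>\<^sup>+\<theta>. ennreal (exp (- A * d)) * indicator ?C \<theta> \<partial>leb d)"
    unfolding C[symmetric] by (rule nn_integral_cmult_indicator[OF Cm, symmetric])
  also have "\<dots> \<le> (\<integral>\<^sup>+\<theta>. F \<theta> * indicator U \<theta> \<partial>leb d)"
  proof (rule nn_integral_mono)
    fix \<theta>
    show "ennreal (exp (- A * d)) * indicator ?C \<theta> \<le> F \<theta> * indicator U \<theta>"
      using inC[of \<theta>] inside[of \<theta>] R by (cases "\<theta> \<in> ?C") (auto simp: U_def)
  qed
  finally have low: "ennreal (exp (- A * d)) * ennreal ((2 / ?s) ^ d) \<le> (\<integral>\<^sup>+\<theta>. F \<theta> * indicator U \<theta> \<partial>leb d)" .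
  have "0 < ennreal (exp (- A * d)) * ennreal ((2 / ?s) ^ d)" using s by (simp add: ennreal_zero_less_mult_iff)
  with low show "(\<integral>\<^sup>+\<theta>. F \<theta> * indicator U \<theta> \<partial>leb d) > 0" by simp
  \<comment> \<open>The scale \<open>(2 / ?s) ^ d\<close> occurs in both the tail bound and the
    volume of the cube and cancels; only a constant to the power \<open>d\<close> is left.\<close>
  have "exp (A * d) * (2 / (a * ?s)) ^ d = (exp (2 * A) / a) ^ d * (exp (- A * d) * (2 / ?s) ^ d)"
  proof -
    have "exp (2 * A) ^ d * exp (- A * d) = exp (A * d)"
      by (simp add: exp_of_nat2_mult[symmetric] mult_exp_exp algebra_simps)
    then show ?thesis using a s by (simp add: power_divide power_mult_distrib field_simps)
  qed
  then have "ennreal (exp (A * d)) * ennreal ((2 / (a * ?s)) ^ d)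
      = ennreal ((exp (2 * A) / a) ^ d) * (ennreal (exp (- A * d)) * ennreal ((2 / ?s) ^ d))"
    using a s by (simp add: ennreal_mult[symmetric])
  also have "\<dots> \<le> ennreal ((exp (2 * A) / a) ^ d) * (\<integral>\<^sup>+\<theta>. F \<theta> * indicator U \<theta> \<partial>leb d)"
    by (rule mult_left_mono[OF low]) simp
  finally show "(\<integral>\<^sup>+\<theta>. F \<theta> * indicator (Rd d - U) \<theta> \<partial>leb d) \<le> ennreal ((exp (2 * A) / a) ^ d) * (\<integral>\<^sup>+\<theta>. F \<theta> * indicator U \<theta> \<partial>leb d)"
    by (rule order_trans[OF up2])
qed

text \<open>Conditioning on a set whose complement has relative mass at most \<open>\<tau>\<close>
  changes every probability by at most \<open>\<tau>\<close>. Here \<open>a\<close> and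
  \<open>x\<close> are masses inside that set, \<open>e\<close> and \<open>y\<close> masses
  outside.\<close>

lemma restricted_ratio_close:
  fixes a e x y \<tau> :: real
  assumes "a > 0" "0 \<le> y" "y \<le> e" "0 \<le> x" "x \<le> a" "e \<le> \<tau> * a"
  shows "\<bar>(x + y) / (a + e) - x / a\<bar> \<le> \<tau>"
proof -
  have e: "0 \<le> e" using assms by simp
  have eq: "(x + y) / (a + e) - x / a = (y * a - x * e) / ((a + e) * a)"
    using assms(1) e by (simp add: field_simps)
  have "\<bar>y * a - x * e\<bar> \<le> e * a"
  proof -
    have "0 \<le> y * a" "0 \<le> x * e" "y * a \<le> e * a" "x * e \<le> a * e"
      using assms e by (auto intro: mult_right_mono)
    then show ?thesis by (simp add: abs_le_iff mult.commute)
  qed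
  also have "\<dots> \<le> \<tau> * a * (a + e)"
  proof -
    have "e * a \<le> (\<tau> * a) * (a + e)" using assms e by (intro mult_mono) auto
    then show ?thesis .
  qed
  finally have "\<bar>y * a - x * e\<bar> / ((a + e) * a) \<le> \<tau>"
    using assms(1) e by (simp add: divide_le_eq mult_ac)
  then show ?thesis unfolding eq using assms(1) e by (simp add: abs_divide abs_mult)
qed

text \<open>The last hypothesis bounds the chi-square divergence of \<open>g\<close> from \<open>f\<close> on \<open>U\<close>, which
  controls the total variation through \<open>2 \<bar>p - q\<bar> \<le> (p - q)\<^sup>2 / (s p) + s p\<close>.\<close>

lemma normalized_measure_close:
  fixes f g :: "'a \<Rightarrow> real"
  assumes [measurable]: "f \<in> borel_measurable M" "g \<in> borel_measurable M" "U \<in> sets M" "B \<in> sets M"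
    and pos: "\<And>x. x \<in> space M \<Longrightarrow> 0 < f x" "\<And>x. x \<in> space M \<Longrightarrow> 0 < g x"
    and int: "integrable M f" "integrable M g"
    and \<zeta>: "\<zeta> > 0" and \<tau>: "\<tau> \<ge> 0"
    and posU: "(\<integral>\<^sup>+x. ennreal (f x) * indicator U x \<partial>M) > 0" "(\<integral>\<^sup>+x. ennreal (g x) * indicator U x \<partial>M) > 0"
    and tail: "(\<integral>\<^sup>+x. ennreal (f x) * indicator (space M - U) x \<partial>M) \<le> ennreal \<tau> * (\<integral>\<^sup>+x. ennreal (f x) * indicator U x \<partial>M)"
      "(\<integral>\<^sup>+x. ennreal (g x) * indicator (space M - U) x \<partial>M) \<le> ennreal \<tau> * (\<integral>\<^sup>+x. ennreal (g x) * indicator U x \<partial>M)"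
    and pl: "(\<integral>\<^sup>+x. ennreal (f x) * indicator U x \<partial>M) * (\<integral>\<^sup>+x. ennreal ((g x)\<^sup>2 / f x) * indicator U x \<partial>M)
      \<le> ennreal (1 + \<zeta>) * (\<integral>\<^sup>+x. ennreal (g x) * indicator U x \<partial>M)\<^sup>2"
  shows "\<bar>(\<integral>x. indicator B x * f x \<partial>M) / (\<integral>x. f x \<partial>M) - (\<integral>x. indicator B x * g x \<partial>M) / (\<integral>x. g x \<partial>M)\<bar> \<le> sqrt \<zeta> + 2 * \<tau>"
proof -
  define I where "I = (\<lambda>(h::'a \<Rightarrow> real) S. \<integral>x. indicator S x * h x \<partial>M)"
  have restr: "integrable M (\<lambda>x. indicator S x * h x)" if "integrable M h" "S \<in> sets M" for h :: "'a \<Rightarrow> real" and S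
    using integrable_mult_indicator[OF that(2,1)] by simp
  have toI: "(\<integral>\<^sup>+x. ennreal (h x) * indicator S x \<partial>M) = ennreal (I h S)"
    if "integrable M h" "S \<in> sets M" "\<And>x. x \<in> space M \<Longrightarrow> 0 \<le> h x" for h :: "'a \<Rightarrow> real" and S
  proof -
    have "(\<integral>\<^sup>+x. ennreal (h x) * indicator S x \<partial>M) = (\<integral>\<^sup>+x. ennreal (indicator S x * h x) \<partial>M)"
      by (intro nn_integral_cong) (auto simp: indicator_def)
    also have "\<dots> = ennreal (I h S)" unfolding I_def
      using that by (intro nn_integral_eq_integral restr AE_I2) auto
    finally show ?thesis .
  qed
  have I0: "0 \<le> I h S" if "\<And>x. x \<in> space M \<Longrightarrow> 0 \<le> h x" for h S
    unfolding I_def using that by (intro Bochner_Integration.integral_nonneg) auto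
  have fnn: "\<And>x. x \<in> space M \<Longrightarrow> 0 \<le> f x" and gnn: "\<And>x. x \<in> space M \<Longrightarrow> 0 \<le> g x" using pos less_imp_le by blast+
  define a where "a = I f U"
  define b where "b = I g U"
  have ab: "a > 0" "b > 0"
    using posU toI[OF int(1) _ fnn, of U] toI[OF int(2) _ gnn, of U] by (simp_all add: a_def b_def)
  have split: "I h S = I h (S \<inter> U) + I h (S \<inter> (space M - U))" if h: "integrable M h" and S: "S \<in> sets M" for h S
  proof -
    have "I h S = (\<integral>x. indicator (S \<inter> U) x * h x + indicator (S \<inter> (space M - U)) x * h x \<partial>M)"
      unfolding I_def using sets.sets_into_space[OF S] by (intro Bochner_Integration.integral_cong) (auto simp: indicator_def)
    also have "\<dots> = I h (S \<inter> U) + I h (S \<inter> (space M - U))"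
      unfolding I_def using h S by (intro Bochner_Integration.integral_add restr) auto
    finally show ?thesis .
  qed
  have mono: "I h S \<le> I h S'" if "integrable M h" "\<And>x. x \<in> space M \<Longrightarrow> 0 \<le> h x" "S \<subseteq> S'" "S \<in> sets M" "S' \<in> sets M" for h S S'
    unfolding I_def using that by (intro integral_mono restr) (auto simp: indicator_def)
  have whole: "(\<integral>x. h x \<partial>M) = I h (space M)" for h
    unfolding I_def by (intro Bochner_Integration.integral_cong) auto
  have ratio: "\<bar>I h B / I h (space M) - I h (B \<inter> U) / I h U\<bar> \<le> \<tau>"
    if h: "integrable M h" "\<And>x. x \<in> space M \<Longrightarrow> 0 \<le> h x" "I h U > 0"
      and t: "(\<integral>\<^sup>+x. ennreal (h x) * indicator (space M - U) x \<partial>M) \<le> ennreal \<tau> * (\<integral>\<^sup>+x. ennreal (h x) * indicator U x \<partial>M)" for h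
  proof -
    have UM: "U \<subseteq> space M" by (rule sets.sets_into_space) simp
    have "I h (space M - U) \<le> \<tau> * I h U"
      using t toI[OF h(1) _ h(2), of "space M - U"] toI[OF h(1) _ h(2), of U] I0[OF h(2)] \<tau>
      by (simp add: ennreal_mult[symmetric] ennreal_le_iff)
    moreover have "I h B = I h (B \<inter> U) + I h (B \<inter> (space M - U))" by (rule split[OF h(1)]) simp
    moreover have "I h (space M) = I h U + I h (space M - U)"
      using split[OF h(1), of "space M"] UM by (simp add: Int_absorb1 Int_absorb2)
    ultimately show ?thesis
      using restricted_ratio_close[of "I h U" "I h (B \<inter> (space M - U))" "I h (space M - U)" "I h (B \<inter> U)" \<tau>] h(3)
        I0[OF h(2)] mono[OF h(1,2), of "B \<inter> (space M - U)" "space M - U"] mono[OF h(1,2), of "B \<inter> U" U]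
      by simp
  qed
  have qm[measurable]: "(\<lambda>x. (g x)\<^sup>2 / f x) \<in> borel_measurable M" by measurable
  let ?Q = "\<integral>\<^sup>+x. ennreal ((g x)\<^sup>2 / f x) * indicator U x \<partial>M"
  have fU: "(\<integral>\<^sup>+x. ennreal (f x) * indicator U x \<partial>M) = ennreal a"
    unfolding a_def by (rule toI[OF int(1) assms(3) fnn])
  have gU: "(\<integral>\<^sup>+x. ennreal (g x) * indicator U x \<partial>M) = ennreal b"
    unfolding b_def by (rule toI[OF int(2) assms(3) gnn])
  have pl': "ennreal a * ?Q \<le> ennreal ((1 + \<zeta>) * b\<^sup>2)"
    using pl \<zeta> ab unfolding fU gU by (simp add: ennreal_mult ennreal_power)
  have "?Q \<noteq> \<infinity>"
  proof
    assume "?Q = \<infinity>"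
    then have "ennreal a * ?Q = \<infinity>" using ab by (simp add: ennreal_mult_top)
    then show False using pl' by (simp add: top_unique)
  qed
  then have Qint: "integrable M (\<lambda>x. indicator U x * ((g x)\<^sup>2 / f x))"
  proof (intro integrableI_nonneg)
    show "AE x in M. 0 \<le> indicator U x * ((g x)\<^sup>2 / f x)" using fnn by (intro AE_I2) auto
    assume "?Q \<noteq> \<infinity>"
    moreover have "(\<integral>\<^sup>+x. ennreal (indicator U x * ((g x)\<^sup>2 / f x)) \<partial>M) = ?Q"
      by (intro nn_integral_cong) (auto simp: indicator_def)
    ultimately show "(\<integral>\<^sup>+x. ennreal (indicator U x * ((g x)\<^sup>2 / f x)) \<partial>M) < \<infinity>" by (simp add: top.not_eq_extremum)
  qed simp
  define q2 where "q2 = (\<integral>x. indicator U x * ((g x)\<^sup>2 / f x) \<partial>M)"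
  have "?Q = ennreal q2"
  proof -
    have "?Q = (\<integral>\<^sup>+x. ennreal (indicator U x * ((g x)\<^sup>2 / f x)) \<partial>M)"
      by (intro nn_integral_cong) (auto simp: indicator_def)
    also have "\<dots> = ennreal q2" unfolding q2_def
      by (rule nn_integral_eq_integral[OF Qint]) (use fnn in \<open>intro AE_I2, auto\<close>)
    finally show ?thesis .
  qed
  then have q2: "a * q2 \<le> (1 + \<zeta>) * b\<^sup>2"
    using pl' ab \<zeta> by (simp add: ennreal_mult'[symmetric] ennreal_le_iff)
  let ?p = "\<lambda>x. indicator U x * f x / a" and ?q = "\<lambda>x. indicator U x * g x / b"
  \<comment> \<open>This value minimizes \<open>\<zeta> / (2 * s) + s / 2\<close>, with minimum
    \<open>sqrt \<zeta>\<close>.\<close>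
  define s where "s = sqrt \<zeta>"
  have s: "s > 0" "s\<^sup>2 = \<zeta>" using \<zeta> by (auto simp: s_def)
  \<comment> \<open>(p - q)^2 / p is expanded as p - 2 q + q^2 / p, so the integral of
    \<open>?G\<close> involves only two total masses equal to 1 and the second moment
    \<open>q2\<close> bounded through \<open>pl\<close>.\<close>
  let ?G = "\<lambda>x. (?p x - 2 * ?q x + a / b\<^sup>2 * (indicator U x * ((g x)\<^sup>2 / f x))) / (2 * s) + s / 2 * ?p x"
  have pint: "integrable M ?p" and qint: "integrable M ?q"
    using restr[OF int(1) assms(3)] restr[OF int(2) assms(3)] by auto
  have lin: "integrable M (\<lambda>x. (p x - 2 * q x + c * r x) / (2 * s) + s / 2 * p x)"
    "(\<integral>x. (p x - 2 * q x + c * r x) / (2 * s) + s / 2 * p x \<partial>M)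
      = ((\<integral>x. p x \<partial>M) - 2 * (\<integral>x. q x \<partial>M) + c * (\<integral>x. r x \<partial>M)) / (2 * s) + s / 2 * (\<integral>x. p x \<partial>M)"
    if "integrable M p" "integrable M q" "integrable M r" for p q r :: "'a \<Rightarrow> real" and c
    using that by simp_all
  note Gint = lin(1)[OF pint qint Qint, of "a / b\<^sup>2"]
  have Gbound: "\<bar>?p x - ?q x\<bar> \<le> ?G x" if x: "x \<in> space M" for x
  proof (cases "x \<in> U")
    case True
    define p where "p = f x / a"
    define q where "q = g x / b"
    have p: "p > 0" using pos(1)[OF x] ab by (simp add: p_def)
    have "\<bar>p - q\<bar> * (2 * s * p) \<le> (p - q)\<^sup>2 + (s * p)\<^sup>2"
      using zero_le_power2[of "\<bar>p - q\<bar> - s * p"] by (simp add: power2_eq_square algebra_simps)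
    then have "\<bar>p - q\<bar> \<le> ((p - q)\<^sup>2 + (s * p)\<^sup>2) / (2 * s * p)" using p s by (simp add: le_divide_eq)
    also have "\<dots> = (p - 2 * q + q\<^sup>2 / p) / (2 * s) + s / 2 * p"
      using p s(1) by (simp add: field_simps power2_eq_square)
    also have "q\<^sup>2 / p = a / b\<^sup>2 * ((g x)\<^sup>2 / f x)" by (simp add: p_def q_def power_divide)
    finally show ?thesis using True by (simp add: p_def q_def)
  qed simp
  have "\<bar>I f (B \<inter> U) / a - I g (B \<inter> U) / b\<bar> = \<bar>\<integral>x. indicator B x * (?p x - ?q x) \<partial>M\<bar>"
  proof -
    have "(\<integral>x. indicator B x * (?p x - ?q x) \<partial>M) = (\<integral>x. indicator (B \<inter> U) x * f x / a - indicator (B \<inter> U) x * g x / b \<partial>M)"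
      by (intro Bochner_Integration.integral_cong) (auto simp: indicator_def)
    also have "\<dots> = I f (B \<inter> U) / a - I g (B \<inter> U) / b"
      unfolding I_def using restr[OF int(1), of "B \<inter> U"] restr[OF int(2), of "B \<inter> U"]
      by (subst Bochner_Integration.integral_diff) auto
    finally show ?thesis by simp
  qed
  also have "\<dots> \<le> (\<integral>x. \<bar>indicator B x * (?p x - ?q x)\<bar> \<partial>M)" by (rule integral_abs_bound)
  also have "\<dots> \<le> (\<integral>x. ?G x \<partial>M)"
  proof (rule integral_mono)
    show "integrable M (\<lambda>x. \<bar>indicator B x * (?p x - ?q x)\<bar>)"
      using restr[of "\<lambda>x. ?p x - ?q x" B] pint qint by auto
    show "\<bar>indicator B x * (?p x - ?q x)\<bar> \<le> ?G x" if "x \<in> space M" for x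
      using Gbound[OF that] by (auto simp: indicator_def intro: order_trans[OF abs_ge_zero])
  qed (rule Gint)
  also have "\<dots> = (1 - 2 * 1 + a / b\<^sup>2 * q2) / (2 * s) + s / 2 * 1"
  proof -
    have P: "(\<integral>x. ?p x \<partial>M) = 1" "(\<integral>x. ?q x \<partial>M) = 1"
      using ab by (simp_all add: a_def b_def I_def)
    show ?thesis unfolding lin(2)[OF pint qint Qint] P q2_def[symmetric] ..
  qed
  also have "\<dots> \<le> \<zeta> / (2 * s) + s / 2"
  proof -
    have "a / b\<^sup>2 * q2 \<le> 1 + \<zeta>" using q2 ab by (simp add: divide_le_eq)
    then have "(1 - 2 * 1 + a / b\<^sup>2 * q2) / (2 * s) \<le> \<zeta> / (2 * s)" using s by (intro divide_right_mono) auto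
    then show ?thesis by simp
  qed
  also have "\<dots> = s" using s by (simp add: power2_eq_square[symmetric] field_simps)
  finally have core: "\<bar>I f (B \<inter> U) / a - I g (B \<inter> U) / b\<bar> \<le> sqrt \<zeta>" by (simp add: s_def)
  have "\<bar>I f B / I f (space M) - I f (B \<inter> U) / a\<bar> \<le> \<tau>"
    unfolding a_def by (intro ratio int fnn tail ab(1)[unfolded a_def])
  moreover have "\<bar>I g B / I g (space M) - I g (B \<inter> U) / b\<bar> \<le> \<tau>"
    unfolding b_def by (intro ratio int gnn tail ab(2)[unfolded b_def])
  ultimately have "\<bar>I f B / I f (space M) - I g B / I g (space M)\<bar> \<le> sqrt \<zeta> + 2 * \<tau>" using core by linarith
  then show ?thesis unfolding whole[of f] whole[of g] unfolding I_def .
qed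

section \<open>The prior near the truth\<close>

lemma openin_powertop_box:
  assumes W: "openin (powertop_real {..<d}) W" and x: "x \<in> W"
  obtains \<eta> where "\<eta> > 0" "\<And>y. y \<in> Rd d \<Longrightarrow> (\<And>k. k < d \<Longrightarrow> \<bar>y k - x k\<bar> < \<eta>) \<Longrightarrow> y \<in> W"
proof -
  obtain S where S: "\<And>i. i < d \<Longrightarrow> open (S i)" "x \<in> PiE {..<d} S" "PiE {..<d} S \<subseteq> W"
  proof -
    have "\<forall>x\<in>W. \<exists>S. (\<forall>i\<in>{..<d}. open (S i)) \<and> x \<in> PiE {..<d} S \<and> PiE {..<d} S \<subseteq> W"
      using W[unfolded openin_product_topology_alt] by simp
    then have "\<exists>S. (\<forall>i\<in>{..<d}. open (S i)) \<and> x \<in> PiE {..<d} S \<and> PiE {..<d} S \<subseteq> W" using x by blast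
    then show ?thesis using that by (auto simp del: PiE_iff)
  qed
  have "\<exists>e. \<forall>i<d. e i > 0 \<and> (\<forall>z. \<bar>z - x i\<bar> < e i \<longrightarrow> z \<in> S i)"
  proof (rule choice_iff[THEN iffD1], rule allI)
    fix i
    show "\<exists>e. i < d \<longrightarrow> e > 0 \<and> (\<forall>z. \<bar>z - x i\<bar> < e \<longrightarrow> z \<in> S i)"
    proof (cases "i < d")
      case True
      then have "x i \<in> S i" using S(2) by (auto simp: PiE_iff)
      then show ?thesis using S(1)[OF True] unfolding open_dist by (auto simp: dist_real_def)
    qed auto
  qed
  then obtain e where e: "\<And>i. i < d \<Longrightarrow> e i > 0" "\<And>i z. i < d \<Longrightarrow> \<bar>z - x i\<bar> < e i \<Longrightarrow> z \<in> S i" by blast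
  define \<eta> where "\<eta> = Min (insert 1 (e ` {..<d}))"
  show ?thesis
  proof (rule that[of \<eta>])
    show "\<eta> > 0" using e(1) by (auto simp: \<eta>_def)
    fix y assume y: "y \<in> Rd d" "\<And>k. k < d \<Longrightarrow> \<bar>y k - x k\<bar> < \<eta>"
    have "y k \<in> S k" if k: "k < d" for k
    proof -
      have "\<eta> \<le> e k" unfolding \<eta>_def using k by (intro Min_le) auto
      then show ?thesis using y(2)[OF k] by (intro e(2)[OF k]) simp
    qed
    then have "y \<in> PiE {..<d} S" using y(1) by (auto simp: Rd_def PiE_iff)
    then show "y \<in> W" using S(3) by auto
  qed
qed

text \<open>Continuous partial derivatives give directional derivatives: the increment is telescoped
  by moving one coordinate at a time, and the mean value theorem is applied to each move inside a
  box on which all partials are within \<open>e\<close> of their values at \<open>x\<close>. The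
  choice of \<open>e\<close> makes the total error at most half of \<open>r\<close>.\<close>

lemma line_derivative_of_partials:
  fixes f :: "(nat \<Rightarrow> real) \<Rightarrow> real"
  assumes U: "openin (powertop_real {..<d}) U" and x: "x \<in> U"
    and diff: "\<And>i x. i < d \<Longrightarrow> x \<in> U \<Longrightarrow> (\<lambda>t. f (x(i := t))) differentiable (at (x i))"
    and cont: "\<And>i. i < d \<Longrightarrow> continuous_map (subtopology (powertop_real {..<d}) U) euclideanreal (pderiv_at i f)"
  shows "((\<lambda>h. f (\<lambda>j\<in>{..<d}. x j + h * v j)) has_real_derivative (\<Sum>j<d. pderiv_at j f x * v j)) (at 0)"
proof -
  have UR: "U \<subseteq> Rd d" using openin_subset[OF U] by (simp add: Rd_def)
  have xR: "x \<in> Rd d" using x UR by auto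
  define V where "V = (\<Sum>j<d. \<bar>v j\<bar>) + 1"
  have V: "V > 0" by (simp add: V_def add_nonneg_pos sum_nonneg)
  have vV: "\<bar>v k\<bar> \<le> V" if "k < d" for k
  proof -
    have "\<bar>v k\<bar> \<le> (\<Sum>j<d. \<bar>v j\<bar>)" using that by (intro member_le_sum) auto
    then show ?thesis by (simp add: V_def)
  qed
  let ?\<gamma> = "\<lambda>h. \<lambda>j\<in>{..<d}. x j + h * v j"
  let ?D = "\<Sum>j<d. pderiv_at j f x * v j"
  have \<gamma>0: "?\<gamma> 0 = x" using xR by (auto simp: Rd_def PiE_iff extensional_def restrict_def fun_eq_iff)
  have "(\<lambda>h. (f (?\<gamma> (0 + h)) - f (?\<gamma> 0)) / h) \<midarrow>0\<rightarrow> ?D"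
  proof (rule LIM_I)
    fix r :: real assume r: "r > 0"
    define e where "e = r / (2 * V)"
    have e: "e > 0" using r V by (simp add: e_def)
    define W where "W = U \<inter> {y \<in> Rd d. \<forall>j<d. y \<in> U \<longrightarrow> \<bar>pderiv_at j f y - pderiv_at j f x\<bar> < e}"
    have "openin (powertop_real {..<d}) (U \<inter> (\<Inter>j\<in>{..<d}. {y \<in> U. pderiv_at j f y \<in> ball (pderiv_at j f x) e}))"
    proof (cases "d = 0")
      case False
      have "openin (powertop_real {..<d}) {y \<in> U. pderiv_at j f y \<in> ball (pderiv_at j f x) e}" if j: "j < d" for j
      proof -
        have "openin (subtopology (powertop_real {..<d}) U)
            {y \<in> topspace (subtopology (powertop_real {..<d}) U). pderiv_at j f y \<in> ball (pderiv_at j f x) e}"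
          by (rule openin_continuous_map_preimage[OF cont[OF j]]) auto
        moreover have "topspace (subtopology (powertop_real {..<d}) U) = U" using openin_subset[OF U] by auto
        ultimately have "openin (subtopology (powertop_real {..<d}) U) {y \<in> U. pderiv_at j f y \<in> ball (pderiv_at j f x) e}"
          by (simp only:)
        then show ?thesis by (rule openin_trans_full[OF _ U])
      qed
      then show ?thesis using U False by (intro openin_Int openin_Inter) auto
    qed (use U in simp)
    moreover have "U \<inter> (\<Inter>j\<in>{..<d}. {y \<in> U. pderiv_at j f y \<in> ball (pderiv_at j f x) e}) = W"
      using UR by (auto simp: W_def dist_real_def abs_minus_commute)
    ultimately have W: "openin (powertop_real {..<d}) W" by simp
    have xW: "x \<in> W" using x xR e by (simp add: W_def)
    obtain \<eta> where \<eta>: "\<eta> > 0" "\<And>y. y \<in> Rd d \<Longrightarrow> (\<And>k. k < d \<Longrightarrow> \<bar>y k - x k\<bar> < \<eta>) \<Longrightarrow> y \<in> W"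
      using openin_powertop_box[OF W xW] by blast
    show "\<exists>s>0. \<forall>h. h \<noteq> 0 \<and> norm (h - 0) < s \<longrightarrow> norm ((f (?\<gamma> (0 + h)) - f (?\<gamma> 0)) / h - ?D) < r"
    proof (intro exI[of _ "\<eta> / V"] conjI allI impI)
      show "\<eta> / V > 0" using \<eta> V by simp
      fix h :: real assume h: "h \<noteq> 0 \<and> norm (h - 0) < \<eta> / V"
      have hv: "\<bar>h * v k\<bar> < \<eta>" if "k < d" for k
      proof -
        have "\<bar>h * v k\<bar> \<le> \<bar>h\<bar> * V" using vV[OF that] by (simp add: abs_mult mult_left_mono)
        also have "\<dots> < \<eta>" using h V by (simp add: less_divide_eq)
        finally show ?thesis .
      qed
      define z where "z = (\<lambda>m. \<lambda>j\<in>{..<d}. if j < m then x j + h * v j else x j)"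
      have step: "\<bar>f (z (Suc m)) - f (z m) - pderiv_at m f x * (h * v m)\<bar> \<le> e * \<bar>h * v m\<bar>" if m: "m < d" for m
      proof -
        let ?\<phi> = "\<lambda>t. f ((z m)(m := t)) - pderiv_at m f x * t"
        have zm: "(z m)(m := x m) = z m" "(z m)(m := x m + h * v m) = z (Suc m)"
          using m by (auto simp: z_def fun_eq_iff less_Suc_eq)
        have box: "(z m)(m := t) \<in> W" if t: "t \<in> closed_segment (x m) (x m + h * v m)" for t
        proof (rule \<eta>(2))
          show "(z m)(m := t) \<in> Rd d" using m by (auto simp: z_def Rd_def PiE_iff extensional_def)
          have tm: "\<bar>t - x m\<bar> < \<eta>" using t hv[OF m] by (auto simp: closed_segment_eq_real_ivl split: if_splits)
          show "\<bar>((z m)(m := t)) k - x k\<bar> < \<eta>" if "k < d" for k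
            using that tm hv[OF that] \<eta>(1) by (auto simp: z_def)
        qed
        have "norm (?\<phi> (x m + h * v m) - ?\<phi> (x m)) \<le> e * norm (x m + h * v m - x m)"
        proof (rule field_differentiable_bound[of "closed_segment (x m) (x m + h * v m)" ?\<phi> "\<lambda>t. pderiv_at m f ((z m)(m := t)) - pderiv_at m f x"])
          fix t assume t: "t \<in> closed_segment (x m) (x m + h * v m)"
          have bW: "(z m)(m := t) \<in> U" using box[OF t] by (simp add: W_def)
          have "(\<lambda>s. f (((z m)(m := t))(m := s))) differentiable (at (((z m)(m := t)) m))"
            by (rule diff[OF m bW])
          then have "((\<lambda>s. f ((z m)(m := s))) has_real_derivative pderiv_at m f ((z m)(m := t))) (at t)"
            unfolding pderiv_at_def by (simp add: DERIV_deriv_iff_real_differentiable)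
          then show "(?\<phi> has_field_derivative pderiv_at m f ((z m)(m := t)) - pderiv_at m f x) (at t within closed_segment (x m) (x m + h * v m))"
            by (intro DERIV_subset[OF DERIV_diff[OF _ DERIV_cmult_Id] subset_UNIV])
          show "norm (pderiv_at m f ((z m)(m := t)) - pderiv_at m f x) \<le> e"
            using box[OF t] m by (auto simp: W_def intro: less_imp_le)
        qed auto
        then show ?thesis unfolding zm by (simp add: algebra_simps)
      qed
      have "f (?\<gamma> h) - f x = (\<Sum>m<d. f (z (Suc m)) - f (z m))"
      proof -
        have "z 0 = ?\<gamma> 0" "z d = ?\<gamma> h" by (auto simp: z_def fun_eq_iff)
        then show ?thesis using sum_lessThan_telescope[of "\<lambda>m. f (z m)" d] unfolding \<gamma>0 by simp
      qed
      then have "f (?\<gamma> h) - f x - h * ?D = (\<Sum>m<d. f (z (Suc m)) - f (z m) - pderiv_at m f x * (h * v m))"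
        by (simp add: sum_subtractf sum_distrib_left mult_ac)
      then have "\<bar>f (?\<gamma> h) - f x - h * ?D\<bar> \<le> (\<Sum>m<d. \<bar>f (z (Suc m)) - f (z m) - pderiv_at m f x * (h * v m)\<bar>)"
        by (simp add: sum_abs)
      also have "\<dots> \<le> (\<Sum>m<d. e * \<bar>h * v m\<bar>)" by (intro sum_mono step) auto
      also have "\<dots> = e * \<bar>h\<bar> * (\<Sum>m<d. \<bar>v m\<bar>)" by (simp add: abs_mult sum_distrib_left mult_ac)
      also have "\<dots> \<le> e * \<bar>h\<bar> * V" using e by (intro mult_left_mono) (auto simp: V_def)
      also have "\<dots> = \<bar>h\<bar> * (r / 2)" using V by (simp add: e_def)
      also have "\<dots> < \<bar>h\<bar> * r" using h r by simp
      finally have "\<bar>f (?\<gamma> h) - f x - h * ?D\<bar> / \<bar>h\<bar> < r" using h by (simp add: divide_less_eq mult.commute)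
      moreover have "(f (?\<gamma> (0 + h)) - f (?\<gamma> 0)) / h - ?D = (f (?\<gamma> h) - f x - h * ?D) / h"
        unfolding \<gamma>0 using h by (simp add: diff_divide_distrib)
      ultimately show "norm ((f (?\<gamma> (0 + h)) - f (?\<gamma> 0)) / h - ?D) < r" by (simp add: abs_divide)
    qed
  qed
  then show ?thesis by (simp add: DERIV_def)
qed

text \<open>The gradient bound is integrated along the segment, which stays in the convex ball.
  Smoothness is known for the prior and the bound concerns its logarithm; the chain rule connects
  them. The one-sided form suffices, since \<open>p\<close> and \<open>q\<close> can be
  exchanged.\<close>

lemma log_prior_lipschitz:
  fixes \<pi> :: "(nat \<Rightarrow> real) \<Rightarrow> real"
  assumes \<delta>: "delta01 n d \<theta>s \<pi> t \<le> ereal \<delta>" and pos: "\<And>\<theta>. \<theta> \<in> Rd d \<Longrightarrow> \<pi> \<theta> > 0"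
    and p: "p \<in> loc_ball n d \<theta>s t" and q: "q \<in> loc_ball n d \<theta>s t"
  shows "ln (\<pi> q) - ln (\<pi> p) \<le> \<delta> * enorm d (\<lambda>j. q j - p j)"
proof -
  have C1: "C1_on d \<pi> (loc_ball n d \<theta>s t)" using \<delta> by (auto simp: delta01_def split: if_splits)
  have bound: "enorm d (\<lambda>j. pderiv_at j (\<lambda>\<theta>'. ln (\<pi> \<theta>')) \<theta>) \<le> \<delta>" if "\<theta> \<in> loc_ball n d \<theta>s t" for \<theta>
  proof -
    have "ereal (enorm d (\<lambda>j. pderiv_at j (\<lambda>\<theta>'. ln (\<pi> \<theta>')) \<theta>)) \<le> delta01 n d \<theta>s \<pi> t"
      using C1 that by (auto simp: delta01_def intro: SUP_upper)
    with \<delta> show ?thesis by (metis ereal_less_eq(3) order_trans)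
  qed
  obtain U where U: "openin (powertop_real {..<d}) U" "loc_ball n d \<theta>s t \<subseteq> U"
    and diff: "\<And>i x. i < d \<Longrightarrow> x \<in> U \<Longrightarrow> (\<lambda>t. \<pi> (x(i := t))) differentiable (at (x i))"
    and cont: "\<And>i. i < d \<Longrightarrow> continuous_map (subtopology (powertop_real {..<d}) U) euclideanreal (pderiv_at i \<pi>)"
    using C1 unfolding C1_on_def by blast
  define v where "v = (\<lambda>j. q j - p j)"
  define \<gamma> where "\<gamma> = (\<lambda>s. \<lambda>j\<in>{..<d}. p j + s * v j)"
  have ball: "\<gamma> s \<in> loc_ball n d \<theta>s t" if s: "0 \<le> s" "s \<le> 1" for s
  proof -
    have "enorm d (\<lambda>j. \<gamma> s j - \<theta>s j) = enorm d (\<lambda>j. (1 - s) * (p j - \<theta>s j) + s * (q j - \<theta>s j))"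
      by (rule enorm_cong) (simp add: \<gamma>_def v_def algebra_simps)
    also have "\<dots> \<le> (1 - s) * enorm d (\<lambda>j. p j - \<theta>s j) + s * enorm d (\<lambda>j. q j - \<theta>s j)"
      using enorm_add[of d "\<lambda>j. (1 - s) * (p j - \<theta>s j)" "\<lambda>j. s * (q j - \<theta>s j)"] s
      by (simp only: enorm_scale abs_of_nonneg diff_ge_0_iff_ge)
    also have "\<dots> \<le> (1 - s) * (t * sqrt (real d / real n)) + s * (t * sqrt (real d / real n))"
      using p q s by (intro add_mono mult_left_mono) (auto simp: loc_ball_def)
    finally show ?thesis by (simp add: loc_ball_def \<gamma>_def Rd_def algebra_simps)
  qed
  have deriv: "((\<lambda>s. ln (\<pi> (\<gamma> s))) has_real_derivative (\<Sum>j<d. pderiv_at j (\<lambda>\<theta>'. ln (\<pi> \<theta>')) (\<gamma> s) * v j)) (at s)"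
    if s: "0 \<le> s" "s \<le> 1" for s
  proof -
    have gU: "\<gamma> s \<in> U" using ball[OF s] U(2) by auto
    have gpos: "\<pi> (\<gamma> s) > 0" by (intro pos) (simp add: \<gamma>_def Rd_def)
    have "((\<lambda>h. \<pi> (\<lambda>j\<in>{..<d}. \<gamma> s j + h * v j)) has_real_derivative (\<Sum>j<d. pderiv_at j \<pi> (\<gamma> s) * v j)) (at 0)"
      by (rule line_derivative_of_partials[OF U(1) gU diff cont])
    moreover have "(\<lambda>j\<in>{..<d}. \<gamma> s j + h * v j) = \<gamma> (h + s)" for h
      by (auto simp: \<gamma>_def fun_eq_iff restrict_def algebra_simps)
    ultimately have "((\<lambda>h. \<pi> (\<gamma> (h + s))) has_real_derivative (\<Sum>j<d. pderiv_at j \<pi> (\<gamma> s) * v j)) (at 0)" by simp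
    then have "((\<lambda>s. \<pi> (\<gamma> s)) has_real_derivative (\<Sum>j<d. pderiv_at j \<pi> (\<gamma> s) * v j)) (at s)"
      using DERIV_at_within_shift[of "\<lambda>s. \<pi> (\<gamma> s)" _ s 0 UNIV] by (simp add: add.commute)
    then have "((\<lambda>s. ln (\<pi> (\<gamma> s))) has_real_derivative 1 / \<pi> (\<gamma> s) * (\<Sum>j<d. pderiv_at j \<pi> (\<gamma> s) * v j)) (at s)"
      using gpos by (intro DERIV_chain2[OF DERIV_ln_divide]) auto
    moreover have "pderiv_at j (\<lambda>\<theta>'. ln (\<pi> \<theta>')) (\<gamma> s) = 1 / \<pi> (\<gamma> s) * pderiv_at j \<pi> (\<gamma> s)" if j: "j < d" for j
    proof -
      have "((\<lambda>t. \<pi> ((\<gamma> s)(j := t))) has_real_derivative pderiv_at j \<pi> (\<gamma> s)) (at (\<gamma> s j))"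
        unfolding pderiv_at_def using diff[OF j gU] by (simp add: DERIV_deriv_iff_real_differentiable)
      then have "((\<lambda>t. ln (\<pi> ((\<gamma> s)(j := t)))) has_real_derivative 1 / \<pi> (\<gamma> s) * pderiv_at j \<pi> (\<gamma> s)) (at (\<gamma> s j))"
        using gpos DERIV_chain2[OF DERIV_ln_divide, of "\<lambda>t. \<pi> ((\<gamma> s)(j := t))" "\<gamma> s j"] by simp
      then show ?thesis unfolding pderiv_at_def[of j "\<lambda>\<theta>'. ln (\<pi> \<theta>')"] by (rule DERIV_imp_deriv)
    qed
    ultimately show ?thesis by (simp add: sum_distrib_left sum_divide_distrib)
  qed
  have "norm (ln (\<pi> (\<gamma> 1)) - ln (\<pi> (\<gamma> 0))) \<le> (\<delta> * enorm d v) * norm (1 - 0 :: real)"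
  proof (rule field_differentiable_bound[of "{0..1}" "\<lambda>s. ln (\<pi> (\<gamma> s))" "\<lambda>s. \<Sum>j<d. pderiv_at j (\<lambda>\<theta>'. ln (\<pi> \<theta>')) (\<gamma> s) * v j"])
    fix s :: real assume "s \<in> {0..1}"
    then have s: "0 \<le> s" "s \<le> 1" by auto
    show "((\<lambda>s. ln (\<pi> (\<gamma> s))) has_field_derivative (\<Sum>j<d. pderiv_at j (\<lambda>\<theta>'. ln (\<pi> \<theta>')) (\<gamma> s) * v j)) (at s within {0..1})"
      by (rule DERIV_subset[OF deriv[OF s]]) simp
    have "\<bar>dot d (\<lambda>j. pderiv_at j (\<lambda>\<theta>'. ln (\<pi> \<theta>')) (\<gamma> s)) v\<bar> \<le> enorm d (\<lambda>j. pderiv_at j (\<lambda>\<theta>'. ln (\<pi> \<theta>')) (\<gamma> s)) * enorm d v"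
      by (rule abs_dot_le)
    also have "\<dots> \<le> \<delta> * enorm d v" by (intro mult_right_mono bound ball s) auto
    finally show "norm (\<Sum>j<d. pderiv_at j (\<lambda>\<theta>'. ln (\<pi> \<theta>')) (\<gamma> s) * v j) \<le> \<delta> * enorm d v" by (simp add: dot_def)
  qed auto
  moreover have "\<gamma> 1 = q" "\<gamma> 0 = p"
    using p q by (auto simp: \<gamma>_def v_def loc_ball_def intro!: Rd_eqI[of _ d] restrict_in_Rd)
  ultimately show ?thesis by (simp add: v_def)
qed

section \<open>The Laplace approximation of a well-behaved sample\<close>

declare measurable_leb_component[measurable del] measurable_std_gauss_component[measurable del]
  measurable_design_row[measurable del]
  measurable_feature_component[measurable del]

lemma measurable_dot_right[measurable]: "dot d v \<in> borel_measurable (leb d)"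
proof -
  have "dot d v = (\<lambda>x. dot d x v)" by (simp add: dot_def mult.commute fun_eq_iff)
  then show ?thesis by simp
qed

lemma measurable_enorm_diff[measurable]: "(\<lambda>\<theta>. enorm d (\<lambda>j. \<theta> j - c j)) \<in> borel_measurable (leb d)"
proof -
  have [measurable]: "(\<lambda>\<theta>. \<Sum>j<d. (\<theta> j - c j)\<^sup>2) \<in> borel_measurable (leb d)"
    by (intro borel_measurable_sum borel_measurable_power borel_measurable_diff measurable_leb_component) auto
  show ?thesis unfolding enorm_def L2_set_def by measurable
qed

lemma measurable_neg_loglik[measurable]: "neg_loglik n d X Y \<in> borel_measurable (leb d)"
  unfolding neg_loglik_def[abs_def] by measurable

lemma measure_density_normalized:
  fixes h :: "'a \<Rightarrow> real"
  assumes h: "integrable M h" "\<And>x. x \<in> space M \<Longrightarrow> 0 \<le> h x" "(\<integral>x. h x \<partial>M) > 0" and B: "B \<in> sets M"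
  shows "measure (density M (\<lambda>x. ennreal (h x) / (\<integral>\<^sup>+x. ennreal (h x) \<partial>M))) B = (\<integral>x. indicator B x * h x \<partial>M) / (\<integral>x. h x \<partial>M)"
proof -
  let ?Z = "\<integral>x. h x \<partial>M"
  have Z: "(\<integral>\<^sup>+x. ennreal (h x) \<partial>M) = ennreal ?Z"
    using h(2) by (intro nn_integral_eq_integral h(1) AE_I2) auto
  have [measurable]: "h \<in> borel_measurable M" using h(1) by auto
  have i: "integrable M (\<lambda>x. indicator B x * h x)" using integrable_mult_indicator[OF B h(1)] by simp
  have "emeasure (density M (\<lambda>x. ennreal (h x) / ennreal ?Z)) B = (\<integral>\<^sup>+x. ennreal (h x) / ennreal ?Z * indicator B x \<partial>M)"
    using B by (intro emeasure_density) auto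
  also have "\<dots> = (\<integral>\<^sup>+x. ennreal (indicator B x * h x / ?Z) \<partial>M)"
    using h by (intro nn_integral_cong) (auto simp: indicator_def divide_ennreal)
  also have "\<dots> = ennreal (\<integral>x. indicator B x * h x / ?Z \<partial>M)"
    using i h by (intro nn_integral_eq_integral AE_I2) auto
  also have "(\<integral>x. indicator B x * h x / ?Z \<partial>M) = (\<integral>x. indicator B x * h x \<partial>M) / ?Z" by simp
  finally have "emeasure (density M (\<lambda>x. ennreal (h x) / ennreal ?Z)) B = ennreal ((\<integral>x. indicator B x * h x \<partial>M) / ?Z)" .
  moreover have "0 \<le> (\<integral>x. indicator B x * h x \<partial>M)"
    using h(2) by (intro Bochner_Integration.integral_nonneg) auto
  ultimately show ?thesis unfolding Z using h(3) by (simp add: measure_def)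
qed

lemma fisher_quad_form:
  assumes "n > 0"
  shows "quad_form d (real n \<cdot>\<^sub>m fisher n d \<theta>s (X, Y)) u = (\<Sum>i<n. dsigm (dot d (X i) \<theta>s) * (dot d (X i) u)\<^sup>2)"
proof -
  have "quad_form d (real n \<cdot>\<^sub>m fisher n d \<theta>s (X, Y)) u
      = (\<Sum>j<d. \<Sum>k<d. \<Sum>i<n. dsigm (dot d (X i) \<theta>s) * (u j * u k * (X i j * X i k)))"
    unfolding quad_form_def
  proof (intro sum.cong refl)
    fix j k assume "j \<in> {..<d}" "k \<in> {..<d}"
    then have "(real n \<cdot>\<^sub>m fisher n d \<theta>s (X, Y)) $$ (j, k) = (\<Sum>i<n. dsigm (dot d (X i) \<theta>s) * X i j * X i k)"
      using assms by (simp add: fisher_def deriv_deriv_psi)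
    then show "u j * (real n \<cdot>\<^sub>m fisher n d \<theta>s (X, Y)) $$ (j, k) * u k
        = (\<Sum>i<n. dsigm (dot d (X i) \<theta>s) * (u j * u k * (X i j * X i k)))"
      by (simp add: sum_distrib_left sum_distrib_right mult_ac)
  qed
  also have "\<dots> = (\<Sum>j<d. \<Sum>i<n. \<Sum>k<d. dsigm (dot d (X i) \<theta>s) * (u j * u k * (X i j * X i k)))"
    by (intro sum.cong refl sum.swap)
  also have "\<dots> = (\<Sum>i<n. \<Sum>j<d. \<Sum>k<d. dsigm (dot d (X i) \<theta>s) * (u j * u k * (X i j * X i k)))"
    by (rule sum.swap)
  also have "\<dots> = (\<Sum>i<n. dsigm (dot d (X i) \<theta>s) * (dot d (X i) u)\<^sup>2)"
    by (simp add: dot_square sum_distrib_left)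
  finally show ?thesis .
qed

lemma fisher_pos_def:
  assumes n: "n > 0" and span: "\<And>u. (\<And>i. i < n \<Longrightarrow> dot d (X i) u = 0) \<Longrightarrow> enorm d u = 0"
  shows "pos_def_mat d (real n \<cdot>\<^sub>m fisher n d \<theta>s (X, Y))"
  unfolding pos_def_mat_def
proof (intro conjI allI impI)
  show "real n \<cdot>\<^sub>m fisher n d \<theta>s (X, Y) \<in> carrier_mat d d" by (simp add: fisher_def)
  show "(real n \<cdot>\<^sub>m fisher n d \<theta>s (X, Y)) $$ (j, k) = (real n \<cdot>\<^sub>m fisher n d \<theta>s (X, Y)) $$ (k, j)" if "j < d" "k < d" for j k
    using that by (simp add: fisher_def mult_ac)
  fix u :: "nat \<Rightarrow> real" assume "\<exists>j<d. u j \<noteq> 0"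
  then have "enorm d u \<noteq> 0" by (auto simp: enorm_eq_0_iff)
  then obtain i where i: "i < n" "dot d (X i) u \<noteq> 0" using span by blast
  show "quad_form d (real n \<cdot>\<^sub>m fisher n d \<theta>s (X, Y)) u > 0"
    unfolding fisher_quad_form[OF n]
    by (rule sum_pos2[of _ i]) (use i dsigm_range in \<open>auto intro!: mult_pos_pos mult_nonneg_nonneg simp: less_imp_le\<close>)
qed

context logistic_sample
begin

text \<open>The parallelogram law for the Fisher form. The last term is the gain at the midpoint
  that pays for the variation of the log ratio.\<close>

lemma Fq_parallelogram:
  "Fq (\<lambda>j. x j - c j) / 2 + Fq (\<lambda>j. y j - c j) / 2 = Fq (\<lambda>j. midpt d x y j - c j) + Fq (\<lambda>j. x j - y j) / 4"
proof -
  have m: "dot d (X i) (midpt d x y) = (dot d (X i) x + dot d (X i) y) / 2" for i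
  proof -
    have "dot d (X i) (midpt d x y) = dot d (X i) (\<lambda>j. (1/2) * (x j + y j))"
      by (rule dot_cong) (simp add: midpt_def)
    then show ?thesis by (simp only: dot_scale dot_add)
  qed
  have eq: "(a - e)\<^sup>2 / 2 + (b - e)\<^sup>2 / 2 = ((a + b) / 2 - e)\<^sup>2 + (a - b)\<^sup>2 / 4" for a b e :: real
    by (simp add: power2_eq_square field_simps)
  show ?thesis
    unfolding Fq_def dot_diff m sum_divide_distrib sum.distrib[symmetric]
  proof (intro sum.cong refl)
    fix i
    show "dsigm (dot d (X i) \<theta>s) * (dot d (X i) x - dot d (X i) c)\<^sup>2 / 2 + dsigm (dot d (X i) \<theta>s) * (dot d (X i) y - dot d (X i) c)\<^sup>2 / 2
      = dsigm (dot d (X i) \<theta>s) * ((dot d (X i) x + dot d (X i) y) / 2 - dot d (X i) c)\<^sup>2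
        + dsigm (dot d (X i) \<theta>s) * (dot d (X i) x - dot d (X i) y)\<^sup>2 / 4"
      using arg_cong[OF eq[of "dot d (X i) x" "dot d (X i) c" "dot d (X i) y"], of "\<lambda>z. dsigm (dot d (X i) \<theta>s) * z"]
      by (simp add: distrib_left)
  qed
qed

text \<open>\<open>A C\<close> collects the exponents per dimension: \<open>C\<close> bounds the
  prior in the tail, \<open>K + Lam / 8 + 1\<close> the decrease of the posterior on the ball of
  radius \<open>rho\<close> (the prior decreases there by at most \<open>\<delta> * rho\<close>,
  hence at most \<open>sqrt d\<close>), and \<open>Lam * (1 + t0)^2 / 8\<close> that of the Laplace
  kernel. The condition \<open>t \<ge> 2 * t0\<close> keeps the estimator within half the radius,
  the condition on \<open>\<tau>\<close> makes both tails small, and the one on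
  \<open>\<zeta>\<close> bounds the Prekopa--Leindler factor.\<close>

theorem tv_laplace_bound:
  fixes \<pi> :: "(nat \<Rightarrow> real) \<Rightarrow> real" and C t \<delta> \<tau> \<zeta> :: real
  defines "A \<equiv> \<lambda>C::real. C + K + Lam * (1 + t0)\<^sup>2 + 1"
  assumes prior: "positive_density d \<pi>" and C: "0 \<le> C"
    and sup: "\<And>\<theta>. \<theta> \<in> Rd d \<Longrightarrow> ln (\<pi> \<theta>) - ln (\<pi> \<theta>s) \<le> C * d"
    and lip: "\<And>p q. p \<in> Rd d \<Longrightarrow> q \<in> Rd d \<Longrightarrow> enorm d (\<lambda>j. p j - \<theta>s j) \<le> t * rho \<Longrightarrow>
      enorm d (\<lambda>j. q j - \<theta>s j) \<le> t * rho \<Longrightarrow> ln (\<pi> q) - ln (\<pi> p) \<le> \<delta> * enorm d (\<lambda>j. q j - p j)"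
    and t: "t \<ge> 2 * t0" "t \<ge> 1" and small: "T * (t * rho) \<le> 3 * lam / 4"
    and \<delta>: "0 \<le> \<delta>" "\<delta> \<le> sqrt n"
    and \<tau>: "exp (2 * A C) / (lam / 8 * t) \<le> \<tau>" "\<tau> \<le> 1"
    and \<zeta>: "0 < \<zeta>" "exp ((4 * T * t\<^sup>2 * d + \<delta>)\<^sup>2 / (n * lam)) \<le> 1 + \<zeta>"
  shows "TV (posterior n d \<pi> (X, Y)) (laplace n d \<theta>s (X, Y)) \<le> sqrt \<zeta> + 2 * \<tau>"
proof -
  have \<pi>m[measurable]: "\<pi> \<in> borel_measurable (leb d)" and \<pi>pos: "\<And>\<theta>. \<theta> \<in> Rd d \<Longrightarrow> \<pi> \<theta> > 0"
    and \<pi>int: "(\<integral>\<^sup>+\<theta>. ennreal (\<pi> \<theta>) \<partial>leb d) = 1"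
    using prior by (auto simp: positive_density_def)
  let ?R = "t * rho"
  have tt0: "t \<ge> t0" using t t0_pos by simp
  have tpos: "t > 0" using t by simp
  have Rpos: "?R > 0" using tpos rho_pos by simp
  have rhoR: "rho \<le> ?R" using t rho_pos by simp
  have t0R: "t0 * rho \<le> ?R / 2" using mult_right_mono[OF t(1), of rho] rho_pos by simp
  have small0: "T * (t0 * rho) \<le> 3 * lam / 4"
  proof -
    have "T * (t0 * rho) \<le> T * (t * rho)" using tt0 T rho_pos by (intro mult_left_mono mult_right_mono) auto
    then show ?thesis using small by linarith
  qed
  define \<theta>h where "\<theta>h = mle n d (X, Y)"
  have mle: "is_mle n d (X, Y) \<theta>h" and hR: "enorm d (\<lambda>j. \<theta>h j - \<theta>s j) \<le> t0 * rho"
    using mle_ex1[OF small0] by (auto simp: \<theta>h_def)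
  define U where "U = {\<theta> \<in> Rd d. enorm d (\<lambda>j. \<theta> j - \<theta>s j) \<le> ?R}"
  have Um[measurable]: "U \<in> sets (leb d)" unfolding U_def space_leb[symmetric] by measurable
  \<comment> \<open>\<open>f\<close> is the posterior density up to a constant, normalized to 1 at
    the truth; \<open>g\<close> below is the Laplace density up to a constant.\<close>
  define f where "f = (\<lambda>\<theta>. exp (ln (\<pi> \<theta>) - ln (\<pi> \<theta>s) - (L \<theta> - L \<theta>s)))"
  define g where "g = (\<lambda>\<theta>. exp (- Fq (\<lambda>j. \<theta> j - \<theta>h j) / 2))"
  have fm[measurable]: "f \<in> borel_measurable (leb d)" unfolding f_def by measurable
  have gm[measurable]: "g \<in> borel_measurable (leb d)" unfolding g_def Fq_def dot_diff by measurable
  have fpos: "f \<theta> > 0" and gpos: "g \<theta> > 0" for \<theta> by (auto simp: f_def g_def)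
  have spaceL: "space (leb d) = Rd d" by (rule space_leb)
  \<comment> \<open>The common tail rate is \<open>a * sqrt (n * d)\<close>. Growth of the
    likelihood provides twice this rate, the quadratic form of the Laplace kernel exactly this rate
    after the distance to the estimator is halved.\<close>
  define a where "a = lam / 8 * t"
  have apos: "a > 0" using lam tpos by (simp add: a_def)
  have nR: "n * ?R = t * sqrt (real n * real d)" unfolding sqrt_nd by simp
  have A1: "C \<le> A C" "K + Lam / 8 + 1 \<le> A C" "Lam * (1 + t0)\<^sup>2 / 8 \<le> A C"
  proof -
    have "1 \<le> (1 + t0)\<^sup>2" using t0_pos by (simp add: power2_eq_square algebra_simps add_increasing2)
    then have "Lam \<le> Lam * (1 + t0)\<^sup>2" using Lam by simp
    then show "C \<le> A C" "K + Lam / 8 + 1 \<le> A C" "Lam * (1 + t0)\<^sup>2 / 8 \<le> A C"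
      using C K Lam unfolding A_def by linarith+
  qed
  have d1: "1 \<le> real d" using d by simp
  have f_out: "f \<theta> \<le> exp (A C * d - a * sqrt (real n * real d) * enorm d (\<lambda>j. \<theta> j - \<theta>s j))"
    if \<theta>: "\<theta> \<in> Rd d" "\<not> enorm d (\<lambda>j. \<theta> j - \<theta>s j) \<le> ?R" for \<theta>
  proof -
    let ?w = "enorm d (\<lambda>j. \<theta> j - \<theta>s j)"
    have "lam / 4 * n * ?R * ?w \<le> L \<theta> - L \<theta>s" using L_growth[OF tt0 small, of "\<lambda>j. \<theta> j - \<theta>s j"] \<theta>(2) by simp
    moreover have "lam / 4 * n * ?R * ?w = 2 * (a * sqrt (real n * real d) * ?w)"
    proof -
      have "lam / 4 * n * ?R * ?w = lam / 4 * (n * ?R) * ?w" by (simp only: mult.assoc)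
      also have "\<dots> = 2 * (a * sqrt (real n * real d) * ?w)" unfolding nR by (simp add: a_def)
      finally show ?thesis .
    qed
    moreover have "0 \<le> a * sqrt (real n * real d) * ?w" using apos by simp
    moreover have "C * d \<le> A C * d" using A1(1) by (intro mult_right_mono) auto
    ultimately have "ln (\<pi> \<theta>) - ln (\<pi> \<theta>s) - (L \<theta> - L \<theta>s) \<le> A C * d - a * sqrt (real n * real d) * ?w"
      using sup[OF \<theta>(1)] by linarith
    then show ?thesis by (simp add: f_def)
  qed
  have f_in: "exp (- A C * d) \<le> f \<theta>" if \<theta>: "\<theta> \<in> Rd d" "enorm d (\<lambda>j. \<theta> j - \<theta>s j) \<le> sqrt (real d / real n)" for \<theta>
  proof -
    let ?w = "enorm d (\<lambda>j. \<theta> j - \<theta>s j)"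
    have w: "?w \<le> rho" using \<theta>(2) by (simp add: rho_def)
    have "L \<theta> - L \<theta>s \<le> K * (n * rho) * ?w + Lam * n / 8 * ?w\<^sup>2" using L_upper[of "\<lambda>j. \<theta> j - \<theta>s j"] by simp
    also have "\<dots> \<le> K * (n * rho) * rho + Lam * n / 8 * rho\<^sup>2"
      using w K Lam rho_pos by (intro add_mono mult_left_mono power_mono) auto
    also have "\<dots> = K * (n * rho\<^sup>2) + Lam / 8 * (n * rho\<^sup>2)" by (simp add: power2_eq_square)
    also have "\<dots> = (K + Lam / 8) * d" unfolding n_rho_sq by (simp add: algebra_simps)
    finally have l: "L \<theta> - L \<theta>s \<le> (K + Lam / 8) * d" .
    have "ln (\<pi> \<theta>s) - ln (\<pi> \<theta>) \<le> \<delta> * enorm d (\<lambda>j. \<theta>s j - \<theta> j)"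
      using \<theta> \<theta>s w rhoR Rpos by (intro lip) (auto simp: enorm_def L2_set_def)
    also have "\<dots> = \<delta> * ?w" by (simp only: enorm_minus_commute[of d \<theta>s \<theta>])
    also have "\<dots> \<le> sqrt n * rho" using w \<delta> by (intro mult_mono) auto
    also have "\<dots> = sqrt d" using n by (simp add: rho_def real_sqrt_divide)
    also have "\<dots> \<le> d" using d1 by (simp add: sqrt_le_D real_sqrt_le_iff' power2_eq_square)
    finally have p: "ln (\<pi> \<theta>s) - ln (\<pi> \<theta>) \<le> d" .
    have "(K + Lam / 8 + 1) * d \<le> A C * d" using A1(2) by (intro mult_right_mono) auto
    then show ?thesis using l p by (simp add: f_def algebra_simps)
  qed
  have g_out: "g \<theta> \<le> exp (A C * d - a * sqrt (real n * real d) * enorm d (\<lambda>j. \<theta> j - \<theta>s j))"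
    if \<theta>: "\<theta> \<in> Rd d" "\<not> enorm d (\<lambda>j. \<theta> j - \<theta>s j) \<le> ?R" for \<theta>
  proof -
    let ?w = "enorm d (\<lambda>j. \<theta> j - \<theta>s j)"
    have "?w \<le> enorm d (\<lambda>j. \<theta> j - \<theta>h j) + t0 * rho"
      using enorm_triangle[of d \<theta> \<theta>s \<theta>h] hR by linarith
    \<comment> \<open>Since the estimator is within \<open>?R / 2\<close> of the truth, distances to
      the two centres differ by at most a factor 2 outside the ball.\<close>
    then have half: "?w / 2 \<le> enorm d (\<lambda>j. \<theta> j - \<theta>h j)" using t0R \<theta>(2) by linarith
    have "a * sqrt (real n * real d) * ?w = lam / 8 * n * (?R * ?w)"
    proof -
      have "lam / 8 * n * (?R * ?w) = lam / 8 * (n * ?R) * ?w" by (simp only: mult.assoc)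
      also have "\<dots> = a * sqrt (real n * real d) * ?w" unfolding nR by (simp add: a_def)
      finally show ?thesis by (rule sym)
    qed
    also have "\<dots> \<le> lam / 8 * n * (?w * ?w)" using \<theta>(2) lam by (intro mult_left_mono mult_right_mono) auto
    also have "\<dots> = lam * n * (?w / 2)\<^sup>2 / 2" by (simp add: power2_eq_square)
    also have "\<dots> \<le> lam * n * (enorm d (\<lambda>j. \<theta> j - \<theta>h j))\<^sup>2 / 2"
      using half lam by (intro divide_right_mono mult_left_mono power_mono) auto
    also have "\<dots> \<le> Fq (\<lambda>j. \<theta> j - \<theta>h j) / 2" using Fq_lower by (intro divide_right_mono) auto
    finally have "a * sqrt (real n * real d) * ?w \<le> Fq (\<lambda>j. \<theta> j - \<theta>h j) / 2" .
    moreover have "0 \<le> A C * d" using A1(1) C by simp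
    ultimately show ?thesis by (simp add: g_def)
  qed
  have g_in: "exp (- A C * d) \<le> g \<theta>" if \<theta>: "\<theta> \<in> Rd d" "enorm d (\<lambda>j. \<theta> j - \<theta>s j) \<le> sqrt (real d / real n)" for \<theta>
  proof -
    have w: "enorm d (\<lambda>j. \<theta> j - \<theta>s j) \<le> rho" using \<theta>(2) by (simp add: rho_def)
    have "enorm d (\<lambda>j. \<theta> j - \<theta>h j) \<le> (1 + t0) * rho"
      using enorm_triangle[of d \<theta> \<theta>h \<theta>s] enorm_minus_commute[of d \<theta>s \<theta>h] hR w by (simp add: algebra_simps)
    then have "Lam * n / 4 * (enorm d (\<lambda>j. \<theta> j - \<theta>h j))\<^sup>2 \<le> Lam * n / 4 * ((1 + t0) * rho)\<^sup>2"
      using Lam by (intro mult_left_mono power_mono) auto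
    also have "\<dots> = Lam * (1 + t0)\<^sup>2 / 4 * (n * rho\<^sup>2)" by (simp add: power_mult_distrib)
    also have "\<dots> = 2 * (Lam * (1 + t0)\<^sup>2 / 8 * d)" unfolding n_rho_sq by simp
    finally have "Fq (\<lambda>j. \<theta> j - \<theta>h j) / 2 \<le> Lam * (1 + t0)\<^sup>2 / 8 * d" using Fq_upper[of "\<lambda>j. \<theta> j - \<theta>h j"] by linarith
    also have "\<dots> \<le> A C * d" using A1(3) by (intro mult_right_mono) auto
    finally show ?thesis by (simp add: g_def)
  qed
  have \<tau>0: "0 \<le> \<tau>" using \<tau>(1) apos by (intro order_trans[OF _ \<tau>(1)]) (simp add: a_def)
  \<comment> \<open>Powers of a number in [0, 1] decrease and \<open>d\<close> is positive, so a
    bound for one dimension is enough.\<close>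
  have ratio: "(exp (2 * A C) / a) ^ d \<le> \<tau>"
  proof -
    have "(exp (2 * A C) / a) ^ d \<le> \<tau> ^ d" using \<tau> apos by (intro power_mono) (auto simp: a_def)
    also have "\<dots> \<le> \<tau> ^ 1" using \<tau> \<tau>0 d by (intro power_decreasing) auto
    finally show ?thesis by simp
  qed
  have tails: "(\<integral>\<^sup>+\<theta>. ennreal (F \<theta>) * indicator (space (leb d) - U) \<theta> \<partial>leb d) \<le> ennreal \<tau> * (\<integral>\<^sup>+\<theta>. ennreal (F \<theta>) * indicator U \<theta> \<partial>leb d)
      \<and> (\<integral>\<^sup>+\<theta>. ennreal (F \<theta>) * indicator U \<theta> \<partial>leb d) > 0"
    if [measurable]: "F \<in> borel_measurable (leb d)"
      and o: "\<And>\<theta>. \<theta> \<in> Rd d \<Longrightarrow> \<not> enorm d (\<lambda>j. \<theta> j - \<theta>s j) \<le> ?R \<Longrightarrow> F \<theta> \<le> exp (A C * d - a * sqrt (real n * real d) * enorm d (\<lambda>j. \<theta> j - \<theta>s j))"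
      and i: "\<And>\<theta>. \<theta> \<in> Rd d \<Longrightarrow> enorm d (\<lambda>j. \<theta> j - \<theta>s j) \<le> sqrt (real d / real n) \<Longrightarrow> exp (- A C * d) \<le> F \<theta>" for F
  proof -
    have Fm: "(\<lambda>\<theta>. ennreal (F \<theta>)) \<in> borel_measurable (leb d)" by measurable
    have "sqrt (real d / real n) \<le> ?R" using rhoR by (simp add: rho_def)
    note tc = tail_comparison[OF n d apos Fm ennreal_leI[OF o] ennreal_leI[OF i] this, folded U_def]
    have "ennreal ((exp (2 * A C) / a) ^ d) * (\<integral>\<^sup>+\<theta>. ennreal (F \<theta>) * indicator U \<theta> \<partial>leb d)
        \<le> ennreal \<tau> * (\<integral>\<^sup>+\<theta>. ennreal (F \<theta>) * indicator U \<theta> \<partial>leb d)"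
      by (intro mult_right_mono ennreal_leI ratio) auto
    with tc show ?thesis unfolding spaceL by (auto intro: order_trans)
  qed
  \<comment> \<open>The Lipschitz constant of the log ratio of \<open>f\<close> and \<open>g\<close>
    on \<open>U\<close>: likelihood part plus prior part.\<close>
  define Lt where "Lt = 4 * T * t\<^sup>2 * d + \<delta>"
  have Lt: "Lt = 4 * T * n * ?R\<^sup>2 + \<delta>"
  proof -
    have "4 * T * n * ?R\<^sup>2 = 4 * T * t\<^sup>2 * (n * rho\<^sup>2)" by (simp add: power_mult_distrib)
    then show ?thesis unfolding n_rho_sq Lt_def by linarith
  qed
  define \<eta> where "\<eta> = Lt\<^sup>2 / (n * lam)"
  have pointwise: "f x * ((g y)\<^sup>2 / f y) \<le> exp \<eta> * (g (midpt d x y))\<^sup>2" and midU: "midpt d x y \<in> U"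
    if xy: "x \<in> U" "y \<in> U" for x y
  proof -
    have R: "enorm d (\<lambda>j. x j - \<theta>s j) \<le> ?R" "enorm d (\<lambda>j. y j - \<theta>s j) \<le> ?R" and Rd: "x \<in> Rd d" "y \<in> Rd d"
      using xy by (auto simp: U_def)
    have "enorm d (\<lambda>j. midpt d x y j - \<theta>s j) = enorm d (\<lambda>j. (x j + 1 / 2 * (y j - x j)) - \<theta>s j)"
      by (rule enorm_cong) (simp add: midpt_def field_simps)
    also have "\<dots> \<le> ?R" by (rule enorm_segment[OF R]) auto
    finally show "midpt d x y \<in> U" by (simp add: U_def midpt_in_Rd)
    let ?r = "enorm d (\<lambda>j. x j - y j)"
    define h where "h = (\<lambda>\<theta>. Fq (\<lambda>j. \<theta> j - \<theta>h j) / 2 - L \<theta>)"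
    have hR': "enorm d (\<lambda>j. \<theta>h j - \<theta>s j) \<le> ?R" using hR t0R Rpos by linarith
    have "h x - h y \<le> 4 * T * n * ?R\<^sup>2 * ?r"
      using laplace_error_lipschitz[OF mle hR' R(2) R(1)] unfolding h_def by (rule order_trans[OF abs_ge_self])
    moreover have "ln (\<pi> x) - ln (\<pi> y) \<le> \<delta> * ?r" by (rule lip[OF Rd(2,1) R(2,1)])
    ultimately have 1: "h x - h y + (ln (\<pi> x) - ln (\<pi> y)) \<le> Lt * ?r" unfolding Lt by (simp add: distrib_right)
    have 2: "lam * n * ?r\<^sup>2 \<le> Fq (\<lambda>j. x j - y j)" by (rule Fq_lower)
    \<comment> \<open>Completing the square: the left side is largest at
      \<open>?r = 2 * Lt / (n * lam)\<close>, where it equals \<open>\<eta>\<close>.\<close>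
    have 3: "Lt * ?r - lam * n * ?r\<^sup>2 / 4 \<le> \<eta>"
    proof -
      have nl: "real n * lam > 0" using n lam by simp
      have "0 \<le> (Lt - n * lam * ?r / 2)\<^sup>2" by simp
      then have "(Lt * ?r - lam * n * ?r\<^sup>2 / 4) * (n * lam) \<le> Lt\<^sup>2" by (simp add: power2_eq_square algebra_simps)
      then show ?thesis using nl by (simp add: \<eta>_def le_divide_eq)
    qed
    have "(ln (\<pi> x) - ln (\<pi> \<theta>s) - (L x - L \<theta>s)) + (- Fq (\<lambda>j. y j - \<theta>h j)) - (ln (\<pi> y) - ln (\<pi> \<theta>s) - (L y - L \<theta>s))
        \<le> \<eta> - Fq (\<lambda>j. midpt d x y j - \<theta>h j)"
      using 1 2 3 Fq_parallelogram[of x \<theta>h y] by (simp add: h_def)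
    then have "exp ((ln (\<pi> x) - ln (\<pi> \<theta>s) - (L x - L \<theta>s)) + (- Fq (\<lambda>j. y j - \<theta>h j)) - (ln (\<pi> y) - ln (\<pi> \<theta>s) - (L y - L \<theta>s)))
        \<le> exp (\<eta> - Fq (\<lambda>j. midpt d x y j - \<theta>h j))" by simp
    moreover have gsq: "(g z)\<^sup>2 = exp (- Fq (\<lambda>j. z j - \<theta>h j))" for z
      by (simp add: g_def exp_double[symmetric])
    ultimately show "f x * ((g y)\<^sup>2 / f y) \<le> exp \<eta> * (g (midpt d x y))\<^sup>2"
      unfolding gsq f_def by (simp only: exp_add exp_diff times_divide_eq_right) (simp add: exp_minus divide_inverse)
  qed
  have pl: "(\<integral>\<^sup>+x. ennreal (f x) * indicator U x \<partial>leb d) * (\<integral>\<^sup>+x. ennreal ((g x)\<^sup>2 / f x) * indicator U x \<partial>leb d)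
      \<le> ennreal (1 + \<zeta>) * (\<integral>\<^sup>+x. ennreal (g x) * indicator U x \<partial>leb d)\<^sup>2"
  proof -
    have "(\<integral>\<^sup>+x. ennreal (f x) * indicator U x \<partial>leb d) * (\<integral>\<^sup>+x. ennreal ((g x)\<^sup>2 / f x) * indicator U x \<partial>leb d)
      \<le> (\<integral>\<^sup>+x. ennreal (exp (\<eta> / 2)) * (ennreal (g x) * indicator U x) \<partial>leb d)\<^sup>2"
    \<comment> \<open>The midpoint function carries \<open>exp (\<eta> / 2)\<close> because it
      enters the hypothesis squared. Outside \<open>U\<close> the left side is zero, and
      \<open>U\<close> is convex, so midpoints of points of \<open>U\<close> stay in it.\<close>
    proof (rule prekopa_leindler_midpoint)
      fix x y assume "x \<in> Rd d" "y \<in> Rd d"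
      show "ennreal (f x) * indicator U x * (ennreal ((g y)\<^sup>2 / f y) * indicator U y)
        \<le> (ennreal (exp (\<eta> / 2)) * (ennreal (g (midpt d x y)) * indicator U (midpt d x y)))\<^sup>2"
      proof (cases "x \<in> U \<and> y \<in> U")
        case True
        then have xy: "x \<in> U" "y \<in> U" by auto
        have "ennreal (f x) * ennreal ((g y)\<^sup>2 / f y) = ennreal (f x * ((g y)\<^sup>2 / f y))"
          using fpos[of x] fpos[of y] by (intro ennreal_mult[symmetric]) auto
        also have "\<dots> \<le> ennreal (exp \<eta> * (g (midpt d x y))\<^sup>2)" by (rule ennreal_leI[OF pointwise[OF xy]])
        also have "exp \<eta> * (g (midpt d x y))\<^sup>2 = (exp (\<eta> / 2) * g (midpt d x y))\<^sup>2"
          by (simp add: power_mult_distrib exp_double[symmetric])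
        also have "ennreal \<dots> = (ennreal (exp (\<eta> / 2)) * ennreal (g (midpt d x y)))\<^sup>2"
          using gpos[of "midpt d x y"] by (simp add: ennreal_power[symmetric] ennreal_mult)
        finally show ?thesis using xy midU[OF xy] by simp
      qed auto
    qed measurable
    also have "\<dots> = ennreal (exp \<eta>) * (\<integral>\<^sup>+x. ennreal (g x) * indicator U x \<partial>leb d)\<^sup>2"
      by (subst nn_integral_cmult, measurable)
         (simp add: power_mult_distrib ennreal_power exp_double[symmetric])
    also have "\<dots> \<le> ennreal (1 + \<zeta>) * (\<integral>\<^sup>+x. ennreal (g x) * indicator U x \<partial>leb d)\<^sup>2"
      using \<zeta>(2) by (intro mult_right_mono ennreal_leI) (auto simp: \<eta>_def Lt_def)
    finally show ?thesis .
  qed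
  have h_eq: "exp (- real n * nll n d (X, Y) \<theta>) * \<pi> \<theta> = exp (- L \<theta>s) * \<pi> \<theta>s * f \<theta>" if "\<theta> \<in> Rd d" for \<theta>
    using n \<pi>pos[OF that] \<pi>pos[OF \<theta>s] by (simp add: nll_eq f_def exp_diff exp_add exp_minus field_simps)
  have \<kappa>: "exp (- L \<theta>s) * \<pi> \<theta>s > 0" using \<pi>pos[OF \<theta>s] by simp
  have \<pi>i: "integrable (leb d) \<pi>"
    using \<pi>int \<pi>pos by (intro integrableI_nonneg AE_I2) (auto simp: spaceL less_imp_le)
  have fint: "integrable (leb d) f"
  proof (rule Bochner_Integration.integrable_bound)
    show "integrable (leb d) (\<lambda>\<theta>. exp (L \<theta>s) / \<pi> \<theta>s * \<pi> \<theta>)" using \<pi>i by simp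
    show "AE \<theta> in leb d. norm (f \<theta>) \<le> norm (exp (L \<theta>s) / \<pi> \<theta>s * \<pi> \<theta>)"
    proof (intro AE_I2)
      fix \<theta> assume "\<theta> \<in> space (leb d)"
      then have p: "\<pi> \<theta> > 0" "\<pi> \<theta>s > 0" using \<pi>pos \<theta>s spaceL by auto
      have "f \<theta> = \<pi> \<theta> / \<pi> \<theta>s * exp (L \<theta>s) * exp (- L \<theta>)"
        using p by (simp add: f_def exp_diff exp_add exp_minus field_simps)
      also have "\<dots> \<le> \<pi> \<theta> / \<pi> \<theta>s * exp (L \<theta>s) * 1"
        using p neg_loglik_nonneg[of n d X Y \<theta>] by (intro mult_left_mono) auto
      finally show "norm (f \<theta>) \<le> norm (exp (L \<theta>s) / \<pi> \<theta>s * \<pi> \<theta>)"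
        using fpos[of \<theta>] p by (simp add: mult_ac)
    qed
  qed measurable
  define Q where "Q = real n \<cdot>\<^sub>m fisher n d \<theta>s (X, Y)"
  have Qpd: "pos_def_mat d Q" unfolding Q_def by (rule fisher_pos_def[OF n spanning])
  have Qq: "quad_form d Q u = Fq u" for u unfolding Q_def fisher_quad_form[OF n] Fq_def ..
  define c where "c = sqrt (Determinant.det Q / (2 * pi) ^ d)"
  have c: "c > 0" using nn_integral_gaussian[OF Qpd] by (simp add: c_def)
  have lap: "laplace n d \<theta>s (X, Y) = density (leb d) (\<lambda>\<theta>. ennreal (c * g \<theta>))"
    unfolding laplace_def Q_def[symmetric] gaussian_precision[OF Qpd] Qq g_def c_def \<theta>h_def ..
  have cg1: "(\<integral>\<^sup>+\<theta>. ennreal (c * g \<theta>) \<partial>leb d) = 1"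
    using prob_space_gaussian_precision[OF Qpd, of \<theta>h] unfolding Qq g_def c_def .
  have cgi: "integrable (leb d) (\<lambda>\<theta>. c * g \<theta>)"
    using cg1 c gpos by (intro integrableI_nonneg AE_I2) (auto simp: less_imp_le)
  then have gint: "integrable (leb d) g" using c by simp
  have Zf: "(\<integral>\<theta>. f \<theta> \<partial>leb d) > 0" and Zg: "(\<integral>\<theta>. g \<theta> \<partial>leb d) > 0"
  proof -
    have Zpos: "(\<integral>\<theta>. F \<theta> \<partial>leb d) > 0"
      if F: "integrable (leb d) F" "\<And>\<theta>. F \<theta> > 0" and u: "(\<integral>\<^sup>+\<theta>. ennreal (F \<theta>) * indicator U \<theta> \<partial>leb d) > 0" for F
    proof -
      have "(\<integral>\<^sup>+\<theta>. ennreal (F \<theta>) * indicator U \<theta> \<partial>leb d) \<le> (\<integral>\<^sup>+\<theta>. ennreal (F \<theta>) \<partial>leb d)"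
        by (intro nn_integral_mono) (auto simp: indicator_def)
      with u have "0 < (\<integral>\<^sup>+\<theta>. ennreal (F \<theta>) \<partial>leb d)" by (rule less_le_trans)
      then show ?thesis using F by (subst (asm) nn_integral_eq_integral) (auto simp: less_imp_le)
    qed
    show "(\<integral>\<theta>. f \<theta> \<partial>leb d) > 0" using tails[OF fm f_out f_in] by (intro Zpos fint fpos) auto
    show "(\<integral>\<theta>. g \<theta> \<partial>leb d) > 0" using tails[OF gm g_out g_in] by (intro Zpos gint gpos) auto
  qed
  show ?thesis
    unfolding TV_def
  proof (rule cSUP_least)
    show "sets (posterior n d \<pi> (X, Y)) \<noteq> {}" by auto
    fix B assume "B \<in> sets (posterior n d \<pi> (X, Y))"
    then have B[measurable]: "B \<in> sets (leb d)" by (simp add: posterior_def)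
    have "posterior n d \<pi> (X, Y) = density (leb d) (\<lambda>\<theta>. ennreal (exp (- L \<theta>s) * \<pi> \<theta>s * f \<theta>) / (\<integral>\<^sup>+\<theta>. ennreal (exp (- L \<theta>s) * \<pi> \<theta>s * f \<theta>) \<partial>leb d))"
    proof -
      have Z: "(\<integral>\<^sup>+\<theta>. ennreal (exp (- real n * nll n d (X, Y) \<theta>) * \<pi> \<theta>) \<partial>leb d) = (\<integral>\<^sup>+\<theta>. ennreal (exp (- L \<theta>s) * \<pi> \<theta>s * f \<theta>) \<partial>leb d)"
        by (intro nn_integral_cong) (simp only: h_eq spaceL)
      have [measurable]: "(\<lambda>\<theta>. exp (- real n * nll n d (X, Y) \<theta>) * \<pi> \<theta>) \<in> borel_measurable (leb d)"
        unfolding nll_eq[OF n] by measurable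
      show ?thesis
        unfolding posterior_def Z
      proof (rule density_cong)
        show "AE \<theta> in leb d. ennreal (exp (- real n * nll n d (X, Y) \<theta>) * \<pi> \<theta>) / (\<integral>\<^sup>+\<theta>. ennreal (exp (- L \<theta>s) * \<pi> \<theta>s * f \<theta>) \<partial>leb d)
          = ennreal (exp (- L \<theta>s) * \<pi> \<theta>s * f \<theta>) / (\<integral>\<^sup>+\<theta>. ennreal (exp (- L \<theta>s) * \<pi> \<theta>s * f \<theta>) \<partial>leb d)"
          by (intro AE_I2) (simp only: h_eq spaceL)
      qed measurable
    qed
    then have "measure (posterior n d \<pi> (X, Y)) B
        = (\<integral>\<theta>. indicator B \<theta> * (exp (- L \<theta>s) * \<pi> \<theta>s * f \<theta>) \<partial>leb d) / (\<integral>\<theta>. exp (- L \<theta>s) * \<pi> \<theta>s * f \<theta> \<partial>leb d)"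
      using fint Zf \<kappa> fpos B by (simp only:) (rule measure_density_normalized, auto simp: less_imp_le)
    also have "\<dots> = (\<integral>\<theta>. indicator B \<theta> * f \<theta> \<partial>leb d) / (\<integral>\<theta>. f \<theta> \<partial>leb d)"
    proof -
      have "(\<integral>\<theta>. indicator B \<theta> * (exp (- L \<theta>s) * \<pi> \<theta>s * f \<theta>) \<partial>leb d) = (\<integral>\<theta>. exp (- L \<theta>s) * \<pi> \<theta>s * (indicator B \<theta> * f \<theta>) \<partial>leb d)"
        by (intro Bochner_Integration.integral_cong) auto
      then show ?thesis using \<pi>pos[OF \<theta>s] by simp
    qed
    finally have mp: "measure (posterior n d \<pi> (X, Y)) B = (\<integral>\<theta>. indicator B \<theta> * f \<theta> \<partial>leb d) / (\<integral>\<theta>. f \<theta> \<partial>leb d)" .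
    have "laplace n d \<theta>s (X, Y) = density (leb d) (\<lambda>\<theta>. ennreal (c * g \<theta>) / (\<integral>\<^sup>+\<theta>. ennreal (c * g \<theta>) \<partial>leb d))"
      unfolding lap cg1 by (simp add: divide_ennreal_def)
    then have "measure (laplace n d \<theta>s (X, Y)) B = (\<integral>\<theta>. indicator B \<theta> * (c * g \<theta>) \<partial>leb d) / (\<integral>\<theta>. c * g \<theta> \<partial>leb d)"
      using cgi Zg c gpos B by (simp only:) (rule measure_density_normalized, auto simp: less_imp_le)
    also have "\<dots> = (\<integral>\<theta>. indicator B \<theta> * g \<theta> \<partial>leb d) / (\<integral>\<theta>. g \<theta> \<partial>leb d)"
    proof -
      have "(\<integral>\<theta>. indicator B \<theta> * (c * g \<theta>) \<partial>leb d) = (\<integral>\<theta>. c * (indicator B \<theta> * g \<theta>) \<partial>leb d)"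
        by (intro Bochner_Integration.integral_cong) auto
      then show ?thesis using c by simp
    qed
    finally have ml: "measure (laplace n d \<theta>s (X, Y)) B = (\<integral>\<theta>. indicator B \<theta> * g \<theta> \<partial>leb d) / (\<integral>\<theta>. g \<theta> \<partial>leb d)" .
    show "\<bar>measure (posterior n d \<pi> (X, Y)) B - measure (laplace n d \<theta>s (X, Y)) B\<bar> \<le> sqrt \<zeta> + 2 * \<tau>"
      unfolding mp ml
      using tails[OF fm f_out f_in] tails[OF gm g_out g_in]
      by (intro normalized_measure_close[OF fm gm Um B fpos gpos fint gint \<zeta>(1) \<tau>0 _ _ _ _ pl]) auto
  qed
qed

end

section \<open>Measurability\<close>

definition rational_points :: "nat \<Rightarrow> (nat \<Rightarrow> real) set" where
  "rational_points d = (\<Pi>\<^sub>E j\<in>{..<d}. \<rat>)"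

lemma countable_rational_points: "countable (rational_points d)"
  unfolding rational_points_def by (intro countable_PiE countable_rat) auto

lemma rational_points_Rd: "rational_points d \<subseteq> Rd d"
  by (auto simp: rational_points_def Rd_def)

lemma rational_points_nonempty: "rational_points d \<noteq> {}"
  by (auto simp: rational_points_def PiE_eq_empty_iff intro: Rats_0)

text \<open>Open sets here refer to functions on all naturals. From index \<open>d\<close> on, both
  \<open>x\<close> and the rational point are \<open>undefined\<close>, so the conditions on those
  coordinates hold by membership of \<open>x\<close>.\<close>

lemma rational_points_dense:
  assumes W: "open W" and x: "x \<in> W" "x \<in> Rd d"
  obtains q where "q \<in> rational_points d" "q \<in> W"
proof -
  have "openin (product_topology (\<lambda>_. euclidean) UNIV) W"
    using W by (simp add: euclidean_product_topology)
  then obtain S where S: "\<And>i. open (S i)" "x \<in> PiE UNIV S" "PiE UNIV S \<subseteq> W"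
  proof -
    assume "openin (product_topology (\<lambda>_. euclidean) UNIV) W"
    then have "\<forall>x\<in>W. \<exists>S. finite {i. S i \<noteq> UNIV} \<and> (\<forall>i. open (S i)) \<and> x \<in> PiE UNIV S \<and> PiE UNIV S \<subseteq> W"
      unfolding openin_product_topology_alt by simp
    then have "\<exists>S. finite {i. S i \<noteq> UNIV} \<and> (\<forall>i. open (S i)) \<and> x \<in> PiE UNIV S \<and> PiE UNIV S \<subseteq> W" using x(1) by blast
    then show ?thesis using that by blast
  qed
  have "\<exists>r. r \<in> \<rat> \<and> r \<in> S j" for j
  proof -
    have "x j \<in> S j" using S(2) by (auto simp: PiE_iff)
    then obtain e where e: "e > 0" "\<And>z. \<bar>z - x j\<bar> < e \<Longrightarrow> z \<in> S j"
      using S(1)[of j] unfolding open_dist dist_real_def by blast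
    obtain r where "r \<in> \<rat>" "x j < r" "r < x j + e" using Rats_dense_in_real[of "x j" "x j + e"] e(1) by auto
    then show ?thesis using e(2)[of r] by auto
  qed
  then obtain r where r: "\<And>j. r j \<in> \<rat>" "\<And>j. r j \<in> S j" by metis
  let ?q = "\<lambda>j. if j < d then r j else undefined"
  have "?q \<in> rational_points d" using r(1) by (auto simp: rational_points_def PiE_iff extensional_def)
  moreover have "?q j \<in> S j" for j
  proof (cases "j < d")
    case False
    then have "x j = undefined" using x(2) by (auto simp: Rd_def PiE_iff extensional_def)
    then show ?thesis using S(2) False by (auto simp: PiE_iff) metis
  qed (use r(2) in simp)
  then have "?q \<in> W" using S(3) by (auto simp: PiE_iff)
  ultimately show ?thesis using that by blast
qed

text \<open>On the sphere of radius \<open>e\<close> the likelihood attains its minimum by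
  compactness, and uniqueness makes it exceed the global minimum strictly. Convexity along rays
  turns this excess into linear growth outside.\<close>

lemma mle_gap:
  assumes n: "n > 0" and uniq: "\<exists>!\<theta>. is_mle n d (X, Y) \<theta>" and h: "is_mle n d (X, Y) \<theta>h" and e: "e > 0"
  obtains c where "c > 0" "\<And>\<theta>. \<theta> \<in> Rd d \<Longrightarrow> enorm d (\<lambda>j. \<theta> j - \<theta>h j) \<ge> e \<Longrightarrow>
    neg_loglik n d X Y \<theta>h + c * enorm d (\<lambda>j. \<theta> j - \<theta>h j) \<le> neg_loglik n d X Y \<theta>"
proof -
  let ?L = "neg_loglik n d X Y"
  define S where "S = Rd d \<inter> {\<theta>. enorm d (\<lambda>j. \<theta> j - \<theta>h j) = e}"
  have "closed {\<theta>. enorm d (\<lambda>j. \<theta> j - \<theta>h j) = e}"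
    by (intro closed_Collect_eq continuous_on_enorm_diff continuous_on_const)
  moreover have "S = (Rd d \<inter> {\<theta>. enorm d (\<lambda>j. \<theta> j - \<theta>h j) \<le> e}) \<inter> {\<theta>. enorm d (\<lambda>j. \<theta> j - \<theta>h j) = e}"
    by (auto simp: S_def)
  ultimately have cS: "compact S" using compact_Int_closed[OF compact_Rd_cball] by simp
  have proj: "restrict (\<lambda>j. \<theta>h j + (e / enorm d (\<lambda>j. \<theta> j - \<theta>h j)) * (\<theta> j - \<theta>h j)) {..<d} \<in> S"
    if "enorm d (\<lambda>j. \<theta> j - \<theta>h j) \<ge> e" for \<theta>
  proof -
    let ?w = "enorm d (\<lambda>j. \<theta> j - \<theta>h j)"
    have "enorm d (\<lambda>j. restrict (\<lambda>j. \<theta>h j + (e / ?w) * (\<theta> j - \<theta>h j)) {..<d} j - \<theta>h j) = enorm d (\<lambda>j. (e / ?w) * (\<theta> j - \<theta>h j))"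
      by (rule enorm_cong) simp
    also have "\<dots> = \<bar>e / ?w\<bar> * ?w" by (rule enorm_scale)
    also have "\<dots> = e" using e that by (simp add: abs_of_pos)
    finally show ?thesis using restrict_in_Rd by (simp add: S_def)
  qed
  show ?thesis
  proof (cases "S = {}")
    case True
    then have "\<not> enorm d (\<lambda>j. \<theta> j - \<theta>h j) \<ge> e" for \<theta> using proj by blast
    then show ?thesis by (intro that[of 1]) auto
  next
    case False
    then obtain \<theta>0 where z: "\<theta>0 \<in> S" "\<And>\<theta>. \<theta> \<in> S \<Longrightarrow> ?L \<theta>0 \<le> ?L \<theta>"
      using continuous_attains_inf[OF cS _ continuous_on_neg_loglik[of _ n d X Y]] by blast
    have "?L \<theta>h < ?L \<theta>0"
    proof (rule ccontr)
      assume "\<not> ?thesis"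
      then have "is_mle n d (X, Y) \<theta>0" using h z(1) by (auto simp: is_mle_iff[OF n] S_def intro: order_trans)
      then have "\<theta>0 = \<theta>h" using uniq h by blast
      then show False using z(1) e by (auto simp: S_def enorm_def L2_set_def)
    qed
    define c where "c = (?L \<theta>0 - ?L \<theta>h) / e"
    have c: "c > 0" using \<open>?L \<theta>h < ?L \<theta>0\<close> e by (simp add: c_def)
    show ?thesis
    proof (rule that[OF c])
      fix \<theta> assume w: "enorm d (\<lambda>j. \<theta> j - \<theta>h j) \<ge> e"
      let ?w = "enorm d (\<lambda>j. \<theta> j - \<theta>h j)"
      define s where "s = e / ?w"
      have s: "0 < s" "s \<le> 1" using e w by (auto simp: s_def)
      have "?L \<theta>0 \<le> ?L (restrict (\<lambda>j. \<theta>h j + s * (\<theta> j - \<theta>h j)) {..<d})"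
        unfolding s_def by (intro z(2) proj w)
      also have "\<dots> = ?L (\<lambda>j. \<theta>h j + s * (\<theta> j - \<theta>h j))" by (rule neg_loglik_cong) simp
      also have "\<dots> \<le> (1 - s) * ?L \<theta>h + s * ?L (\<lambda>j. \<theta>h j + (\<theta> j - \<theta>h j))"
        using s by (intro neg_loglik_convex) auto
      finally have "?L \<theta>0 - ?L \<theta>h \<le> s * (?L \<theta> - ?L \<theta>h)" by (simp add: algebra_simps)
      then have "c * e \<le> e / ?w * (?L \<theta> - ?L \<theta>h)" using e by (simp add: c_def s_def)
      then have "e * (c * ?w) \<le> e * (?L \<theta> - ?L \<theta>h)" using e w by (simp add: field_simps)
      then have "c * ?w \<le> ?L \<theta> - ?L \<theta>h" using e by (simp only: mult_le_cancel_left_pos)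
      then show "?L \<theta>h + c * ?w \<le> ?L \<theta>" by simp
    qed
  qed
qed

text \<open>A countable form of existence and uniqueness. Forwards, \<open>mle_gap\<close> gives
  coercivity. Backwards, density and continuity extend the margin to all distant points; the margin
  1 excludes a nonzero direction orthogonal to all rows, along which the likelihood would be
  constant, so the rows span and the minimizer is unique, while compactness yields its
  existence.\<close>

lemma ex1_mle_iff:
  assumes n: "n > 0"
  shows "(\<exists>!\<theta>. is_mle n d (X, Y) \<theta>) \<longleftrightarrow>
    (\<exists>R::nat. \<forall>q\<in>rational_points d. real R \<le> enorm d q \<longrightarrow> neg_loglik n d X Y (\<lambda>_. 0) + 1 \<le> neg_loglik n d X Y q)"
    (is "?lhs \<longleftrightarrow> ?rhs")
proof
  let ?L = "neg_loglik n d X Y"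
  assume u: ?lhs
  then obtain \<theta>h where h: "is_mle n d (X, Y) \<theta>h" by blast
  obtain c where c: "c > 0" "\<And>\<theta>. \<theta> \<in> Rd d \<Longrightarrow> enorm d (\<lambda>j. \<theta> j - \<theta>h j) \<ge> 1 \<Longrightarrow> ?L \<theta>h + c * enorm d (\<lambda>j. \<theta> j - \<theta>h j) \<le> ?L \<theta>"
    using mle_gap[OF n u h, of 1] by auto
  define B where "B = max 1 ((?L (\<lambda>_. 0) + 1 - ?L \<theta>h) / c)"
  obtain R :: nat where R: "enorm d \<theta>h + B \<le> real R" using real_arch_simple by blast
  show ?rhs
  proof (intro exI[of _ R] ballI impI)
    fix q assume q: "q \<in> rational_points d" "real R \<le> enorm d q"
    have "enorm d q \<le> enorm d (\<lambda>j. q j - \<theta>h j) + enorm d \<theta>h" using enorm_triangle[of d q "\<lambda>_. 0" \<theta>h] by simp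
    then have B: "B \<le> enorm d (\<lambda>j. q j - \<theta>h j)" using q R by linarith
    then have "?L \<theta>h + c * enorm d (\<lambda>j. q j - \<theta>h j) \<le> ?L q"
      using q rational_points_Rd by (intro c(2)) (auto simp: B_def)
    moreover have "?L (\<lambda>_. 0) + 1 - ?L \<theta>h \<le> c * B"
    proof -
      have "(?L (\<lambda>_. 0) + 1 - ?L \<theta>h) / c \<le> B" by (simp add: B_def)
      then show ?thesis using c(1) by (simp add: divide_le_eq mult.commute)
    qed
    moreover have "c * B \<le> c * enorm d (\<lambda>j. q j - \<theta>h j)" using B c(1) by (intro mult_left_mono) auto
    ultimately show "?L (\<lambda>_. 0) + 1 \<le> ?L q" by linarith
  qed
next
  let ?L = "neg_loglik n d X Y"
  assume ?rhs
  then obtain R :: nat where R: "\<And>q. q \<in> rational_points d \<Longrightarrow> real R \<le> enorm d q \<Longrightarrow> ?L (\<lambda>_. 0) + 1 \<le> ?L q" by blast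
  have cont_norm: "continuous_on UNIV (enorm d)"
    using continuous_on_enorm_diff[of UNIV d "\<lambda>_. 0"] by simp
  have far: "?L (\<lambda>_. 0) + 1 \<le> ?L \<theta>" if \<theta>: "real R < enorm d \<theta>" for \<theta>
  proof (rule ccontr)
    assume lt: "\<not> ?L (\<lambda>_. 0) + 1 \<le> ?L \<theta>"
    let ?W = "{x. real R < enorm d x} \<inter> {x. ?L x < ?L (\<lambda>_. 0) + 1}"
    have "open ?W"
      by (intro open_Int open_Collect_less continuous_on_const continuous_on_neg_loglik cont_norm)
    moreover have "restrict \<theta> {..<d} \<in> ?W"
      using lt \<theta> enorm_cong[of d "restrict \<theta> {..<d}" \<theta>] neg_loglik_cong[of d "restrict \<theta> {..<d}" \<theta>] by simp
    ultimately obtain q where "q \<in> rational_points d" "q \<in> ?W"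
      using rational_points_dense[OF _ _ restrict_in_Rd] by metis
    then show False using R[of q] by auto
  qed
  have span: "enorm d u = 0" if u: "\<And>i. i < n \<Longrightarrow> dot d (X i) u = 0" for u
  proof (rule ccontr)
    assume ne: "enorm d u \<noteq> 0"
    then have pos: "enorm d u > 0" by (simp add: less_le)
    let ?s = "(real R + 1) / enorm d u"
    have "enorm d (\<lambda>j. ?s * u j) = real R + 1" unfolding enorm_scale using pos by simp
    then have "?L (\<lambda>_. 0) + 1 \<le> ?L (\<lambda>j. ?s * u j)" by (intro far) simp
    moreover have "?L (\<lambda>j. ?s * u j) = ?L (\<lambda>_. 0)"
      unfolding neg_loglik_def dot_scale using u by (intro sum.cong refl) (simp add: dot_def)
    ultimately show False by simp
  qed
  let ?S = "Rd d \<inter> {\<theta>. enorm d (\<lambda>j. \<theta> j - 0) \<le> real R}"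
  have z: "restrict (\<lambda>_. 0) {..<d} \<in> ?S"
    using restrict_in_Rd enorm_cong[of d "restrict (\<lambda>_. 0) {..<d}" "\<lambda>_. 0"] by (simp add: enorm_def L2_set_def)
  have "compact ?S" by (rule compact_Rd_cball)
  then have "\<exists>x\<in>?S. \<forall>y\<in>?S. ?L x \<le> ?L y"
    by (rule continuous_attains_inf[OF _ _ continuous_on_neg_loglik]) (use z in blast)
  then obtain \<theta>h where h: "\<theta>h \<in> ?S" "\<And>\<theta>. \<theta> \<in> ?S \<Longrightarrow> ?L \<theta>h \<le> ?L \<theta>" by blast
  have h0: "?L \<theta>h \<le> ?L (\<lambda>_. 0)"
    using h(2)[OF z] neg_loglik_cong[of d "restrict (\<lambda>_. 0) {..<d}" "\<lambda>_. 0"] by simp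
  have "is_mle n d (X, Y) \<theta>h"
    unfolding is_mle_iff[OF n]
  proof (intro conjI ballI)
    show "\<theta>h \<in> Rd d" using h by simp
    fix \<theta> assume "\<theta> \<in> Rd d"
    then show "?L \<theta>h \<le> ?L \<theta>" using h(2)[of \<theta>] h0 far[of \<theta>] by (cases "\<theta> \<in> ?S") auto
  qed
  then show ?lhs using mle_unique_of_spanning[OF n span] by blast
qed

text \<open>Shifting the minimizer by a vector orthogonal to all rows leaves the likelihood
  unchanged, so uniqueness forces the shift to vanish.\<close>

lemma spanning_of_ex1_mle:
  assumes n: "n > 0" and u: "\<exists>!\<theta>. is_mle n d (X, Y) \<theta>" and v: "\<And>i. i < n \<Longrightarrow> dot d (X i) v = 0"
  shows "enorm d v = 0"
proof -
  obtain \<theta>h where h: "is_mle n d (X, Y) \<theta>h" using u by blast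
  let ?p = "restrict (\<lambda>j. \<theta>h j + v j) {..<d}"
  have "neg_loglik n d X Y ?p = neg_loglik n d X Y (\<lambda>j. \<theta>h j + v j)" by (rule neg_loglik_cong) simp
  also have "\<dots> = neg_loglik n d X Y \<theta>h"
    unfolding neg_loglik_def dot_add using v by (intro sum.cong refl) simp
  finally have "is_mle n d (X, Y) ?p" using h restrict_in_Rd by (simp add: is_mle_iff[OF n])
  then have "?p = \<theta>h" using u h by blast
  then have "?p j = \<theta>h j" for j by simp
  then have "v j = 0" if "j < d" for j using that by (metis add_cancel_left_right lessThan_iff restrict_apply')
  then show ?thesis by (simp add: enorm_eq_0_iff)
qed

text \<open>The index of a minimizer of the likelihood among the first \<open>m + 1\<close> points
  of the enumeration. Its values are natural numbers, so measurability in the data follows by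
  recursion from countably many comparisons.\<close>

definition best_index :: "nat \<Rightarrow> nat \<Rightarrow> nat \<Rightarrow> (nat \<Rightarrow> nat \<Rightarrow> real) \<times> (nat \<Rightarrow> bool) \<Rightarrow> nat" where
  "best_index n d m D = rec_nat 0 (\<lambda>m k. if neg_loglik n d (fst D) (snd D) (from_nat_into (rational_points d) (Suc m))
      < neg_loglik n d (fst D) (snd D) (from_nat_into (rational_points d) k) then Suc m else k) m"

lemma best_index_le:
  "i \<le> m \<Longrightarrow> neg_loglik n d X Y (from_nat_into (rational_points d) (best_index n d m (X, Y)))
     \<le> neg_loglik n d X Y (from_nat_into (rational_points d) i)"
proof (induction m)
  case 0 then show ?case by (simp add: best_index_def)
next
  case (Suc m)
  have rec: "best_index n d (Suc m) (X, Y) = (if neg_loglik n d X Y (from_nat_into (rational_points d) (Suc m))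
      < neg_loglik n d X Y (from_nat_into (rational_points d) (best_index n d m (X, Y))) then Suc m else best_index n d m (X, Y))"
    by (simp add: best_index_def)
  show ?case
  proof (cases "i \<le> m")
    case True
    then show ?thesis using Suc.IH[OF True] unfolding rec by auto
  next
    case False
    then have "i = Suc m" using Suc.prems by simp
    then show ?thesis unfolding rec by auto
  qed
qed

text \<open>Some enumerated point lies below the level that \<open>mle_gap\<close> assigns to
  distance \<open>e\<close>. Once it has been reached, the best point is below that level too and
  hence within \<open>e\<close> of the estimator.\<close>

lemma best_index_tendsto_mle:
  assumes n: "n > 0" and u: "\<exists>!\<theta>. is_mle n d (X, Y) \<theta>" and j: "j < d"
  shows "(\<lambda>m. from_nat_into (rational_points d) (best_index n d m (X, Y)) j) \<longlonglongrightarrow> mle n d (X, Y) j"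
proof (rule LIMSEQ_I)
  fix e :: real assume e: "e > 0"
  let ?L = "neg_loglik n d X Y" and ?q = "\<lambda>m. from_nat_into (rational_points d) (best_index n d m (X, Y))"
  define \<theta>h where "\<theta>h = mle n d (X, Y)"
  have h: "is_mle n d (X, Y) \<theta>h" unfolding \<theta>h_def mle_def by (rule theI'[OF u])
  obtain c where c: "c > 0" "\<And>\<theta>. \<theta> \<in> Rd d \<Longrightarrow> enorm d (\<lambda>j. \<theta> j - \<theta>h j) \<ge> e \<Longrightarrow> ?L \<theta>h + c * enorm d (\<lambda>j. \<theta> j - \<theta>h j) \<le> ?L \<theta>"
    using mle_gap[OF n u h e] by blast
  have "open {x. ?L x < ?L \<theta>h + c * e}"
    by (intro open_Collect_less continuous_on_const continuous_on_neg_loglik)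
  moreover have "\<theta>h \<in> {x. ?L x < ?L \<theta>h + c * e}" using c(1) e by simp
  moreover have "\<theta>h \<in> Rd d" using h by (simp add: is_mle_iff[OF n])
  ultimately obtain q where q: "q \<in> rational_points d" "?L q < ?L \<theta>h + c * e"
    using rational_points_dense by blast
  obtain i where i: "from_nat_into (rational_points d) i = q"
    using from_nat_into_surj[OF countable_rational_points q(1)] by blast
  show "\<exists>M. \<forall>m\<ge>M. norm (?q m j - mle n d (X, Y) j) < e"
  proof (intro exI[of _ i] allI impI)
    fix m assume "i \<le> m"
    then have "?L (?q m) < ?L \<theta>h + c * e" using best_index_le[of i m n d X Y] q(2) i by simp
    moreover have "?q m \<in> Rd d" using from_nat_into[OF rational_points_nonempty] rational_points_Rd by blast
    ultimately have "enorm d (\<lambda>j. ?q m j - \<theta>h j) < e"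
      using c(2)[of "?q m"] mult_left_mono[of e "enorm d (\<lambda>j. ?q m j - \<theta>h j)" c] c(1) by linarith
    then show "norm (?q m j - mle n d (X, Y) j) < e"
      using abs_component_le_enorm[OF j, of "\<lambda>j. ?q m j - \<theta>h j"] by (simp add: \<theta>h_def)
  qed
qed

lemma measurable_neg_loglik_data:
  "(\<lambda>D. neg_loglik n d (fst D) (snd D) \<theta>) \<in> borel_measurable (design n d \<Otimes>\<^sub>M labels n)"
  unfolding neg_loglik_def
proof (intro borel_measurable_sum borel_measurable_diff borel_measurable_times)
  fix i assume "i \<in> {..<n}"
  then have i: "i < n" by simp
  show "(\<lambda>D. psi (dot d (fst D i) \<theta>)) \<in> borel_measurable (design n d \<Otimes>\<^sub>M labels n)"
    by (rule measurable_compose[OF measurable_feature_dot[OF i] measurable_psi])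
  show "(\<lambda>D. dot d (fst D i) \<theta>) \<in> borel_measurable (design n d \<Otimes>\<^sub>M labels n)" by (rule measurable_feature_dot[OF i])
  show "(\<lambda>D. of_bool (snd D i)) \<in> borel_measurable (design n d \<Otimes>\<^sub>M labels n)"
    by (rule measurable_compose[OF measurable_label_snd[OF i]]) simp
qed

lemma measurable_best_index: "best_index n d m \<in> measurable (design n d \<Otimes>\<^sub>M labels n) (count_space UNIV)"
proof (induction m)
  case 0
  then show ?case by (simp add: best_index_def[abs_def])
next
  case (Suc m)
  let ?q = "from_nat_into (rational_points d)"
  have "(\<lambda>D. neg_loglik n d (fst D) (snd D) (?q (best_index n d m D))) \<in> borel_measurable (design n d \<Otimes>\<^sub>M labels n)"
    by (rule measurable_compose_countable[OF measurable_neg_loglik_data Suc.IH])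
  then have p: "Measurable.pred (design n d \<Otimes>\<^sub>M labels n)
      (\<lambda>D. neg_loglik n d (fst D) (snd D) (?q (Suc m)) < neg_loglik n d (fst D) (snd D) (?q (best_index n d m D)))"
    using measurable_neg_loglik_data[of n d "?q (Suc m)"] by (intro borel_measurable_pred_less)
  have "best_index n d (Suc m) = (\<lambda>D. if neg_loglik n d (fst D) (snd D) (?q (Suc m)) < neg_loglik n d (fst D) (snd D) (?q (best_index n d m D))
      then Suc m else best_index n d m D)"
    by (auto simp: best_index_def[abs_def] fun_eq_iff)
  also have "\<dots> \<in> measurable (design n d \<Otimes>\<^sub>M labels n) (count_space UNIV)"
  proof (rule measurable_If)
    show "{D \<in> space (design n d \<Otimes>\<^sub>M labels n). neg_loglik n d (fst D) (snd D) (?q (Suc m)) < neg_loglik n d (fst D) (snd D) (?q (best_index n d m D))}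
        \<in> sets (design n d \<Otimes>\<^sub>M labels n)"
      using p by (simp only: pred_def)
  qed (rule measurable_const, simp, rule Suc.IH)
  finally show ?case .
qed

definition mle_event :: "nat \<Rightarrow> nat \<Rightarrow> ((nat \<Rightarrow> nat \<Rightarrow> real) \<times> (nat \<Rightarrow> bool)) set" where
  "mle_event n d = {D \<in> space (design n d \<Otimes>\<^sub>M labels n). \<exists>!\<theta>. is_mle n d D \<theta>}"

lemma mle_event_measurable:
  assumes n: "n > 0" shows "mle_event n d \<in> sets (design n d \<Otimes>\<^sub>M labels n)"
proof -
  let ?P = "\<lambda>R q D. real R \<le> enorm d q \<longrightarrow>
      neg_loglik n d (fst D) (snd D) (\<lambda>_. 0) + 1 \<le> neg_loglik n d (fst D) (snd D) q"
  have "(\<forall>q\<in>rational_points d. Q q) \<longleftrightarrow> (\<forall>k. Q (from_nat_into (rational_points d) k))" for Q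
    using range_from_nat_into[OF rational_points_nonempty countable_rational_points, of d] by (metis rangeE rangeI)
  then have "mle_event n d = {D \<in> space (design n d \<Otimes>\<^sub>M labels n). \<exists>R. \<forall>k. ?P R (from_nat_into (rational_points d) k) D}"
    unfolding mle_event_def using ex1_mle_iff[OF n] by (intro Collect_cong conj_cong refl) (auto simp: split_paired_all)
  also have "\<dots> \<in> sets (design n d \<Otimes>\<^sub>M labels n)"
  proof -
    have "Measurable.pred (design n d \<Otimes>\<^sub>M labels n) (?P R q)" for R q
    proof (cases "real R \<le> enorm d q")
      case True
      note [measurable] = measurable_neg_loglik_data[of n d q] measurable_neg_loglik_data[of n d "\<lambda>_. 0"]
      have "{D \<in> space (design n d \<Otimes>\<^sub>M labels n). neg_loglik n d (fst D) (snd D) (\<lambda>_. 0) + 1 \<le> neg_loglik n d (fst D) (snd D) q}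
          \<in> sets (design n d \<Otimes>\<^sub>M labels n)"
        by (intro borel_measurable_le borel_measurable_add measurable_neg_loglik_data borel_measurable_const)
      then show ?thesis using True by (simp add: pred_def)
    qed simp
    then have "Measurable.pred (design n d \<Otimes>\<^sub>M labels n) (\<lambda>D. \<exists>R. \<forall>k. ?P R (from_nat_into (rational_points d) k) D)"
      by (intro pred_intros_countable)
    then show ?thesis by (simp only: pred_def)
  qed
  finally show ?thesis .
qed

lemma measurable_mle_on_event:
  assumes n: "n > 0" and j: "j < d"
  shows "(\<lambda>D. if D \<in> mle_event n d then mle n d D j else 0) \<in> borel_measurable (design n d \<Otimes>\<^sub>M labels n)"
proof (rule borel_measurable_LIMSEQ_real)
  let ?u = "\<lambda>m D. if D \<in> mle_event n d then from_nat_into (rational_points d) (best_index n d m D) j else 0"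
  show "?u m \<in> borel_measurable (design n d \<Otimes>\<^sub>M labels n)" for m
  proof -
    have "(\<lambda>D. from_nat_into (rational_points d) (best_index n d m D) j) \<in> borel_measurable (design n d \<Otimes>\<^sub>M labels n)"
      by (rule measurable_compose[OF measurable_best_index]) simp
    then show ?thesis using mle_event_measurable[OF n, of d] by (intro measurable_If_set) auto
  qed
  fix D assume "D \<in> space (design n d \<Otimes>\<^sub>M labels n)"
  show "(\<lambda>m. ?u m D) \<longlonglongrightarrow> (if D \<in> mle_event n d then mle n d D j else 0)"
  proof (cases "D \<in> mle_event n d")
    case True
    obtain X Y where D: "D = (X, Y)" by (cases D)
    have "\<exists>!\<theta>. is_mle n d (X, Y) \<theta>" using True D by (simp add: mle_event_def)
    from best_index_tendsto_mle[OF n this j] show ?thesis using True D by simp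
  qed simp
qed

text \<open>This replaces the uncountable supremum in \<open>TV\<close> by an integral that depends
  measurably on parameters. As the difference \<open>p - q\<close> integrates to 0, a set and its
  complement carry opposite amounts, which gives the factor 1/2; the set where \<open>q < p\<close>
  attains the bound.\<close>

lemma TV_density:
  fixes p q :: "'a \<Rightarrow> real"
  assumes p: "integrable M p" "\<And>x. x \<in> space M \<Longrightarrow> 0 \<le> p x" "(\<integral>x. p x \<partial>M) = 1"
    and q: "integrable M q" "\<And>x. x \<in> space M \<Longrightarrow> 0 \<le> q x" "(\<integral>x. q x \<partial>M) = 1"
  shows "TV (density M (\<lambda>x. ennreal (p x))) (density M (\<lambda>x. ennreal (q x))) = (\<integral>x. \<bar>p x - q x\<bar> \<partial>M) / 2"
proof -
  have restr: "integrable M (\<lambda>x. indicator B x * h x)" if "integrable M h" "B \<in> sets M" for h :: "'a \<Rightarrow> real" and B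
    using integrable_mult_indicator[OF that(2,1)] by simp
  have meas: "measure (density M (\<lambda>x. ennreal (h x))) B = (\<integral>x. indicator B x * h x \<partial>M)"
    if h: "integrable M h" "\<And>x. x \<in> space M \<Longrightarrow> 0 \<le> h x" and B: "B \<in> sets M" for h :: "'a \<Rightarrow> real" and B
  proof -
    have "emeasure (density M (\<lambda>x. ennreal (h x))) B = (\<integral>\<^sup>+x. ennreal (indicator B x * h x) \<partial>M)"
      using h B by (subst emeasure_density) (auto intro!: nn_integral_cong simp: indicator_def)
    also have "\<dots> = ennreal (\<integral>x. indicator B x * h x \<partial>M)"
      using h B by (intro nn_integral_eq_integral restr AE_I2) auto
    finally show ?thesis
      using h by (simp add: measure_def Bochner_Integration.integral_nonneg)
  qed
  have pq: "integrable M (\<lambda>x. p x - q x)" using p q by auto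
  have diff: "measure (density M (\<lambda>x. ennreal (p x))) B - measure (density M (\<lambda>x. ennreal (q x))) B
      = (\<integral>x. indicator B x * (p x - q x) \<partial>M)" if B: "B \<in> sets M" for B
  proof -
    have "measure (density M (\<lambda>x. ennreal (p x))) B = (\<integral>x. indicator B x * p x \<partial>M)" by (rule meas[OF p(1,2) B])
    moreover have "measure (density M (\<lambda>x. ennreal (q x))) B = (\<integral>x. indicator B x * q x \<partial>M)" by (rule meas[OF q(1,2) B])
    ultimately show ?thesis
      using restr[OF p(1) B] restr[OF q(1) B] by (simp add: right_diff_distrib)
  qed
  have tot: "(\<integral>x. p x - q x \<partial>M) = 0" using p q by simp
  have le: "\<bar>\<integral>x. indicator B x * (p x - q x) \<partial>M\<bar> \<le> (\<integral>x. \<bar>p x - q x\<bar> \<partial>M) / 2" if B: "B \<in> sets M" for B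
  proof -
    let ?I = "\<lambda>B. \<integral>x. indicator B x * (p x - q x) \<partial>M"
    have cB: "space M - B \<in> sets M" using B by auto
    have "?I B + ?I (space M - B) = (\<integral>x. indicator B x * (p x - q x) + indicator (space M - B) x * (p x - q x) \<partial>M)"
      by (rule Bochner_Integration.integral_add[OF restr[OF pq B] restr[OF pq cB], symmetric])
    also have "\<dots> = (\<integral>x. p x - q x \<partial>M)"
      by (intro Bochner_Integration.integral_cong refl) (simp add: indicator_def)
    finally have "?I B + ?I (space M - B) = (\<integral>x. p x - q x \<partial>M)" .
    then have c: "?I (space M - B) = - ?I B" using tot by simp
    have "\<bar>?I B\<bar> + \<bar>?I (space M - B)\<bar> \<le> (\<integral>x. \<bar>indicator B x * (p x - q x)\<bar> \<partial>M) + (\<integral>x. \<bar>indicator (space M - B) x * (p x - q x)\<bar> \<partial>M)"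
      by (intro add_mono integral_abs_bound)
    also have "\<dots> = (\<integral>x. \<bar>indicator B x * (p x - q x)\<bar> + \<bar>indicator (space M - B) x * (p x - q x)\<bar> \<partial>M)"
      by (rule Bochner_Integration.integral_add[OF integrable_abs[OF restr[OF pq B]] integrable_abs[OF restr[OF pq cB]], symmetric])
    also have "\<dots> = (\<integral>x. \<bar>p x - q x\<bar> \<partial>M)"
      by (intro Bochner_Integration.integral_cong refl) (simp add: indicator_def)
    finally show ?thesis unfolding c by simp
  qed
  have le2: "\<bar>measure (density M (\<lambda>x. ennreal (p x))) B - measure (density M (\<lambda>x. ennreal (q x))) B\<bar> \<le> (\<integral>x. \<bar>p x - q x\<bar> \<partial>M) / 2"
    if "B \<in> sets (density M (\<lambda>x. ennreal (p x)))" for B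
  proof -
    have B: "B \<in> sets M" using that by simp
    show ?thesis unfolding diff[OF B] by (rule le[OF B])
  qed
  have ne: "sets (density M (\<lambda>x. ennreal (p x))) \<noteq> {}" by auto
  show ?thesis
    unfolding TV_def
  proof (rule antisym)
    show "(SUP B\<in>sets (density M (\<lambda>x. ennreal (p x))). \<bar>measure (density M (\<lambda>x. ennreal (p x))) B - measure (density M (\<lambda>x. ennreal (q x))) B\<bar>) \<le> (\<integral>x. \<bar>p x - q x\<bar> \<partial>M) / 2"
      by (rule cSUP_least[OF ne le2])
    let ?B = "{x \<in> space M. q x < p x}"
    have [measurable]: "p \<in> borel_measurable M" "q \<in> borel_measurable M" using p q by auto
    have B: "?B \<in> sets M" by measurable
    have "(\<integral>x. \<bar>p x - q x\<bar> \<partial>M) = (\<integral>x. 2 * (indicator ?B x * (p x - q x)) - (p x - q x) \<partial>M)"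
      by (intro Bochner_Integration.integral_cong) (auto simp: indicator_def)
    also have "\<dots> = 2 * (\<integral>x. indicator ?B x * (p x - q x) \<partial>M) - (\<integral>x. p x - q x \<partial>M)"
      using restr[OF pq B] pq by (subst Bochner_Integration.integral_diff) auto
    finally have "(\<integral>x. \<bar>p x - q x\<bar> \<partial>M) / 2 = (\<integral>x. indicator ?B x * (p x - q x) \<partial>M)" using tot by simp
    also have "\<dots> \<le> \<bar>measure (density M (\<lambda>x. ennreal (p x))) ?B - measure (density M (\<lambda>x. ennreal (q x))) ?B\<bar>"
      unfolding diff[OF B] by simp
    also have "\<dots> \<le> (SUP B\<in>sets (density M (\<lambda>x. ennreal (p x))). \<bar>measure (density M (\<lambda>x. ennreal (p x))) B - measure (density M (\<lambda>x. ennreal (q x))) B\<bar>)"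
    proof (rule cSUP_upper)
      show "bdd_above ((\<lambda>B. \<bar>measure (density M (\<lambda>x. ennreal (p x))) B - measure (density M (\<lambda>x. ennreal (q x))) B\<bar>) ` sets (density M (\<lambda>x. ennreal (p x))))"
        by (rule bdd_aboveI2[OF le2])
    qed (use B in simp)
    finally show "(\<integral>x. \<bar>p x - q x\<bar> \<partial>M) / 2 \<le> (SUP B\<in>sets (density M (\<lambda>x. ennreal (p x))). \<bar>measure (density M (\<lambda>x. ennreal (p x))) B - measure (density M (\<lambda>x. ennreal (q x))) B\<bar>)" .
  qed
qed

section \<open>Both densities as jointly measurable functions of data and parameter\<close>

definition post_weight :: "nat \<Rightarrow> nat \<Rightarrow> ((nat \<Rightarrow> real) \<Rightarrow> real) \<Rightarrow> (nat \<Rightarrow> nat \<Rightarrow> real) \<times> (nat \<Rightarrow> bool) \<Rightarrow> (nat \<Rightarrow> real) \<Rightarrow> real" where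
  "post_weight n d \<pi> D \<theta> = exp (- neg_loglik n d (fst D) (snd D) \<theta>) * \<pi> \<theta>"

lemma posterior_density:
  assumes n: "n > 0" and \<pi>: "positive_density d \<pi>"
  shows "integrable (leb d) (post_weight n d \<pi> D)" "(\<integral>\<theta>. post_weight n d \<pi> D \<theta> \<partial>leb d) > 0"
    "posterior n d \<pi> D = density (leb d) (\<lambda>\<theta>. ennreal (post_weight n d \<pi> D \<theta> / (\<integral>\<theta>. post_weight n d \<pi> D \<theta> \<partial>leb d)))"
proof -
  have \<pi>m[measurable]: "\<pi> \<in> borel_measurable (leb d)" and \<pi>pos: "\<And>\<theta>. \<theta> \<in> Rd d \<Longrightarrow> \<pi> \<theta> > 0"
    and \<pi>int: "(\<integral>\<^sup>+\<theta>. ennreal (\<pi> \<theta>) \<partial>leb d) = 1"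
    using \<pi> by (auto simp: positive_density_def)
  let ?h = "post_weight n d \<pi> D"
  have [measurable]: "?h \<in> borel_measurable (leb d)" unfolding post_weight_def by measurable
  have hpos: "?h \<theta> > 0" if "\<theta> \<in> space (leb d)" for \<theta> using \<pi>pos that by (simp add: post_weight_def space_leb)
  have \<pi>i: "integrable (leb d) \<pi>"
    using \<pi>int \<pi>pos by (intro integrableI_nonneg AE_I2) (auto simp: space_leb less_imp_le)
  show hi: "integrable (leb d) ?h"
  proof (rule Bochner_Integration.integrable_bound[OF \<pi>i])
    show "AE \<theta> in leb d. norm (?h \<theta>) \<le> norm (\<pi> \<theta>)"
      using neg_loglik_nonneg by (intro AE_I2) (simp add: post_weight_def abs_mult mult_left_le_one_le)
  qed measurable
  have nn: "(\<integral>\<^sup>+\<theta>. ennreal (?h \<theta>) \<partial>leb d) = ennreal (\<integral>\<theta>. ?h \<theta> \<partial>leb d)"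
    using hpos by (intro nn_integral_eq_integral[OF hi] AE_I2) (simp add: less_imp_le)
  have "(\<integral>\<^sup>+\<theta>. ennreal (?h \<theta>) \<partial>leb d) \<noteq> 0"
  proof
    assume "(\<integral>\<^sup>+\<theta>. ennreal (?h \<theta>) \<partial>leb d) = 0"
    then have "AE \<theta> in leb d. ennreal (?h \<theta>) = 0" by (subst (asm) nn_integral_0_iff_AE) auto
    then have "AE \<theta> in leb d. ennreal (\<pi> \<theta>) = 0"
      using AE_space by eventually_elim (use hpos in \<open>auto simp: ennreal_eq_0_iff not_le[symmetric]\<close>)
    then have "(\<integral>\<^sup>+\<theta>. ennreal (\<pi> \<theta>) \<partial>leb d) = 0" by (subst nn_integral_0_iff_AE) auto
    then show False using \<pi>int by simp
  qed
  then show Z: "(\<integral>\<theta>. ?h \<theta> \<partial>leb d) > 0" unfolding nn by (simp add: ennreal_eq_0_iff)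
  obtain X Y where D: "D = (X, Y)" by (cases D)
  have e: "exp (- real n * nll n d D \<theta>) * \<pi> \<theta> = ?h \<theta>" for \<theta>
    using n by (simp add: D nll_eq post_weight_def)
  show "posterior n d \<pi> D = density (leb d) (\<lambda>\<theta>. ennreal (?h \<theta> / (\<integral>\<theta>. ?h \<theta> \<partial>leb d)))"
    unfolding posterior_def e nn
  proof (rule density_cong)
    show "AE \<theta> in leb d. ennreal (?h \<theta>) / ennreal (\<integral>\<theta>. ?h \<theta> \<partial>leb d) = ennreal (?h \<theta> / (\<integral>\<theta>. ?h \<theta> \<partial>leb d))"
      using hpos Z by (intro AE_I2 divide_ennreal) (simp_all add: less_imp_le)
  qed measurable
qed

text \<open>Off the event \<open>mle\<close> is an unspecified \<open>THE\<close>; the value 0 there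
  gives a function measurable on the whole data space.\<close>

definition mle0 :: "nat \<Rightarrow> nat \<Rightarrow> (nat \<Rightarrow> nat \<Rightarrow> real) \<times> (nat \<Rightarrow> bool) \<Rightarrow> nat \<Rightarrow> real" where
  "mle0 n d D = (\<lambda>j. if D \<in> mle_event n d then mle n d D j else 0)"

text \<open>On \<open>mle_event\<close> this is the density of \<open>laplace\<close>. Writing the
  exponent as finite sums of coordinates, with \<open>mle0\<close> for the estimator, makes joint
  measurability in data and parameter visible.\<close>

definition laplace_weight :: "nat \<Rightarrow> nat \<Rightarrow> (nat \<Rightarrow> real) \<Rightarrow> (nat \<Rightarrow> nat \<Rightarrow> real) \<times> (nat \<Rightarrow> bool) \<Rightarrow> (nat \<Rightarrow> real) \<Rightarrow> real" where
  "laplace_weight n d \<theta>s D \<theta> = sqrt (Determinant.det (real n \<cdot>\<^sub>m fisher n d \<theta>s D) / (2 * pi) ^ d) *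
     exp (- (\<Sum>i<n. dsigm (dot d (fst D i) \<theta>s) * (\<Sum>j<d. fst D i j * (\<theta> j - mle0 n d D j))\<^sup>2) / 2)"

lemma laplace_density:
  assumes n: "n > 0" and D: "D \<in> mle_event n d"
  shows "integrable (leb d) (laplace_weight n d \<theta>s D)" "(\<integral>\<theta>. laplace_weight n d \<theta>s D \<theta> \<partial>leb d) = 1"
    "\<And>\<theta>. 0 \<le> laplace_weight n d \<theta>s D \<theta>"
    "laplace n d \<theta>s D = density (leb d) (\<lambda>\<theta>. ennreal (laplace_weight n d \<theta>s D \<theta>))"
proof -
  obtain X Y where XY: "D = (X, Y)" by (cases D)
  have u: "\<exists>!\<theta>. is_mle n d (X, Y) \<theta>" using D XY by (simp add: mle_event_def)
  let ?Q = "real n \<cdot>\<^sub>m fisher n d \<theta>s (X, Y)"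
  have pd: "pos_def_mat d ?Q" by (rule fisher_pos_def[OF n spanning_of_ex1_mle[OF n u]])
  have w: "laplace_weight n d \<theta>s D \<theta> = sqrt (Determinant.det ?Q / (2 * pi) ^ d) * exp (- quad_form d ?Q (\<lambda>j. \<theta> j - mle n d D j) / 2)" for \<theta>
    unfolding laplace_weight_def fisher_quad_form[OF n] using D by (simp add: XY mle0_def dot_def)
  show nonneg: "0 \<le> laplace_weight n d \<theta>s D \<theta>" for \<theta>
    unfolding w using conjunct1[OF nn_integral_gaussian[OF pd]]
    by (intro mult_nonneg_nonneg real_sqrt_ge_zero divide_nonneg_nonneg less_imp_le) auto
  have m: "laplace_weight n d \<theta>s D \<in> borel_measurable (leb d)"
    unfolding laplace_weight_def
    by (intro borel_measurable_times borel_measurable_const measurable_compose[OF _ borel_measurable_exp] borel_measurable_divide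
      borel_measurable_uminus borel_measurable_sum borel_measurable_power borel_measurable_diff measurable_leb_component) auto
  have one: "(\<integral>\<^sup>+\<theta>. ennreal (laplace_weight n d \<theta>s D \<theta>) \<partial>leb d) = 1"
    unfolding w by (rule prob_space_gaussian_precision[OF pd])
  show i: "integrable (leb d) (laplace_weight n d \<theta>s D)"
    by (rule integrableI_nonneg[OF m]) (use nonneg one in auto)
  show "(\<integral>\<theta>. laplace_weight n d \<theta>s D \<theta> \<partial>leb d) = 1"
    using one nonneg by (subst (asm) nn_integral_eq_integral[OF i]) (auto simp: Bochner_Integration.integral_nonneg)
  show "laplace n d \<theta>s D = density (leb d) (\<lambda>\<theta>. ennreal (laplace_weight n d \<theta>s D \<theta>))"
    unfolding laplace_def w using gaussian_precision[OF pd] by (simp add: XY)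
qed

lemma measurable_post_weight:
  assumes \<pi>: "positive_density d \<pi>"
  shows "(\<lambda>(D, \<theta>). post_weight n d \<pi> D \<theta>) \<in> borel_measurable ((design n d \<Otimes>\<^sub>M labels n) \<Otimes>\<^sub>M leb d)"
  unfolding post_weight_def neg_loglik_def dot_def case_prod_beta
proof (intro borel_measurable_times measurable_compose[OF _ borel_measurable_exp] borel_measurable_uminus borel_measurable_sum
    borel_measurable_diff measurable_compose[OF _ measurable_psi])
  let ?P = "(design n d \<Otimes>\<^sub>M labels n) \<Otimes>\<^sub>M leb d"
  show "(\<lambda>x. fst (fst x) i j) \<in> borel_measurable ?P" if "i \<in> {..<n}" "j \<in> {..<d}" for i j
    using that by (intro measurable_compose[OF measurable_fst measurable_feature_component]) auto
  show "(\<lambda>x. fst (fst x) i j) \<in> borel_measurable ?P" if "i \<in> {..<n}" "j \<in> {..<d}" for i j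
    using that by (intro measurable_compose[OF measurable_fst measurable_feature_component]) auto
  show "(\<lambda>x. snd x j) \<in> borel_measurable ?P" if "j \<in> {..<d}" for j
    using that by (intro measurable_compose[OF measurable_snd measurable_leb_component]) auto
  show "(\<lambda>x. snd x j) \<in> borel_measurable ?P" if "j \<in> {..<d}" for j
    using that by (intro measurable_compose[OF measurable_snd measurable_leb_component]) auto
  show "(\<lambda>x. of_bool (snd (fst x) i)) \<in> borel_measurable ?P" if "i \<in> {..<n}" for i
  proof -
    have "(\<lambda>D. snd D i) \<in> measurable (design n d \<Otimes>\<^sub>M labels n) (count_space UNIV)" using that by (intro measurable_label_snd) auto
    then show ?thesis by (intro measurable_compose[OF measurable_compose[OF measurable_fst]]) auto
  qed
  show "(\<lambda>x. \<pi> (snd x)) \<in> borel_measurable ?P"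
    using \<pi> by (intro measurable_compose[OF measurable_snd]) (simp add: positive_density_def)
qed

text \<open>By the Leibniz formula the determinant is a polynomial in the entries, which are
  measurable in the data.\<close>

lemma measurable_fisher_det:
  assumes n: "n > 0"
  shows "(\<lambda>D. Determinant.det (real n \<cdot>\<^sub>m fisher n d \<theta>s D)) \<in> borel_measurable (design n d \<Otimes>\<^sub>M labels n)"
proof -
  let ?e = "\<lambda>D j k. \<Sum>i<n. dsigm (dot d (fst D i) \<theta>s) * fst D i j * fst D i k"
  have eq: "Determinant.det (real n \<cdot>\<^sub>m fisher n d \<theta>s D) = (\<Sum>p | p permutes {0..<d}. signof p * (\<Prod>i = 0..<d. ?e D i (p i)))" for D
  proof -
    have car: "real n \<cdot>\<^sub>m fisher n d \<theta>s D \<in> carrier_mat d d" by (cases D) (simp add: fisher_def)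
    have "(real n \<cdot>\<^sub>m fisher n d \<theta>s D) $$ (j, k) = ?e D j k" if "j < d" "k < d" for j k
      using that n by (cases D) (simp add: fisher_def deriv_deriv_psi)
    then show ?thesis unfolding det_def'[OF car]
      by (intro sum.cong refl arg_cong2[of _ _ _ _ "(*)"] prod.cong) (auto dest: permutes_in_image)
  qed
  show ?thesis
    unfolding eq
  proof (intro borel_measurable_sum borel_measurable_times borel_measurable_const borel_measurable_prod)
    fix p i j assume p: "p \<in> {p. p permutes {0..<d}}" and i: "i \<in> {0..<d}" and j: "j \<in> {..<n}"
    have "p i < d" using p i permutes_in_image[of p "{0..<d}" i] by auto
    then show "(\<lambda>D. fst D j (p i)) \<in> borel_measurable (design n d \<Otimes>\<^sub>M labels n)"
      using j by (intro measurable_feature_component) auto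
    show "(\<lambda>D. fst D j i) \<in> borel_measurable (design n d \<Otimes>\<^sub>M labels n)"
      using i j by (intro measurable_feature_component) auto
    show "(\<lambda>D. dsigm (dot d (fst D j) \<theta>s)) \<in> borel_measurable (design n d \<Otimes>\<^sub>M labels n)"
      using j by (intro measurable_compose[OF measurable_feature_dot measurable_dsigm]) auto
  qed
qed

lemma measurable_laplace_weight:
  assumes n: "n > 0"
  shows "(\<lambda>(D, \<theta>). laplace_weight n d \<theta>s D \<theta>) \<in> borel_measurable ((design n d \<Otimes>\<^sub>M labels n) \<Otimes>\<^sub>M leb d)"
  unfolding laplace_weight_def case_prod_beta
proof (intro borel_measurable_times measurable_compose[OF _ borel_measurable_exp] borel_measurable_uminus borel_measurable_sum
    borel_measurable_divide borel_measurable_power borel_measurable_diff borel_measurable_const)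
  let ?P = "(design n d \<Otimes>\<^sub>M labels n) \<Otimes>\<^sub>M leb d"
  show "(\<lambda>x. sqrt (Determinant.det (real n \<cdot>\<^sub>m fisher n d \<theta>s (fst x)) / (2 * pi) ^ d)) \<in> borel_measurable ?P"
  proof (rule measurable_compose[OF measurable_fst])
    have [measurable]: "(\<lambda>D. Determinant.det (real n \<cdot>\<^sub>m fisher n d \<theta>s D)) \<in> borel_measurable (design n d \<Otimes>\<^sub>M labels n)"
      by (rule measurable_fisher_det[OF n])
    show "(\<lambda>D. sqrt (Determinant.det (real n \<cdot>\<^sub>m fisher n d \<theta>s D) / (2 * pi) ^ d)) \<in> borel_measurable (design n d \<Otimes>\<^sub>M labels n)"
      by measurable
  qed
  show "(\<lambda>x. dsigm (dot d (fst (fst x) i) \<theta>s)) \<in> borel_measurable ?P" if "i \<in> {..<n}" for i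
    using that by (intro measurable_compose[OF measurable_fst measurable_compose[OF measurable_feature_dot measurable_dsigm]]) auto
  show "(\<lambda>x. fst (fst x) i j) \<in> borel_measurable ?P" if "i \<in> {..<n}" "j \<in> {..<d}" for i j
    using that by (intro measurable_compose[OF measurable_fst measurable_feature_component]) auto
  show "(\<lambda>x. snd x j) \<in> borel_measurable ?P" if "j \<in> {..<d}" for j
    using that by (intro measurable_compose[OF measurable_snd measurable_leb_component]) auto
  show "(\<lambda>x. mle0 n d (fst x) j) \<in> borel_measurable ?P" if "j \<in> {..<d}" for j
    unfolding mle0_def using that by (intro measurable_compose[OF measurable_fst measurable_mle_on_event[OF n]]) auto
qed

text \<open>The probability of the event is bounded below by that of a subset, and monotonicity of
  \<open>measure\<close> needs the larger set to be measurable; a set outside the sigma-algebra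
  would have measure 0 by convention.\<close>

lemma good_event_measurable:
  assumes n: "n > 0" and \<pi>: "positive_density d \<pi>"
  shows "{D \<in> space (data_law n d \<theta>s). (\<exists>!\<theta>. is_mle n d D \<theta>) \<and> TV (posterior n d \<pi> D) (laplace n d \<theta>s D) \<le> \<epsilon>} \<in> sets (data_law n d \<theta>s)"
proof -
  let ?M = "design n d \<Otimes>\<^sub>M labels n"
  interpret L: sigma_finite_measure "leb d" by (rule sigma_finite_leb)
  let ?Z = "\<lambda>D. \<integral>\<theta>. post_weight n d \<pi> D \<theta> \<partial>leb d"
  define \<Delta> where "\<Delta> = (\<lambda>D. (\<integral>\<theta>. \<bar>post_weight n d \<pi> D \<theta> / ?Z D - laplace_weight n d \<theta>s D \<theta>\<bar> \<partial>leb d) / 2)"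
  have TV: "TV (posterior n d \<pi> D) (laplace n d \<theta>s D) = \<Delta> D" if D: "D \<in> mle_event n d" for D
    unfolding posterior_density(3)[OF n \<pi>] laplace_density(4)[OF n D] \<Delta>_def
  proof (rule TV_density)
    show "integrable (leb d) (\<lambda>\<theta>. post_weight n d \<pi> D \<theta> / ?Z D)" using posterior_density(1)[OF n \<pi>] by simp
    show "(\<integral>\<theta>. post_weight n d \<pi> D \<theta> / ?Z D \<partial>leb d) = 1" using posterior_density(2)[OF n \<pi>, of D] by simp
    show "0 \<le> post_weight n d \<pi> D x / ?Z D" if "x \<in> space (leb d)" for x
      using \<pi> that posterior_density(2)[OF n \<pi>, of D] by (simp add: post_weight_def positive_density_def space_leb less_imp_le)
  qed (use laplace_density[OF n D] in auto)
  have Zm: "?Z \<in> borel_measurable ?M"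
    by (rule L.borel_measurable_lebesgue_integral[OF measurable_post_weight[OF \<pi>]])
  have "(\<lambda>P. \<bar>post_weight n d \<pi> (fst P) (snd P) / ?Z (fst P) - laplace_weight n d \<theta>s (fst P) (snd P)\<bar>) \<in> borel_measurable (?M \<Otimes>\<^sub>M leb d)"
    using measurable_post_weight[OF \<pi>, of n] measurable_laplace_weight[OF n, of d \<theta>s] measurable_compose[OF measurable_fst Zm, of "leb d"]
    unfolding case_prod_beta by (intro borel_measurable_abs borel_measurable_diff borel_measurable_divide)
  then have "(\<lambda>D. \<integral>\<theta>. \<bar>post_weight n d \<pi> D \<theta> / ?Z D - laplace_weight n d \<theta>s D \<theta>\<bar> \<partial>leb d) \<in> borel_measurable ?M"
    by (intro L.borel_measurable_lebesgue_integral) (simp add: case_prod_beta)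
  then have \<Delta>m[measurable]: "\<Delta> \<in> borel_measurable ?M" unfolding \<Delta>_def by measurable
  have "{D \<in> space (data_law n d \<theta>s). (\<exists>!\<theta>. is_mle n d D \<theta>) \<and> TV (posterior n d \<pi> D) (laplace n d \<theta>s D) \<le> \<epsilon>}
      = {D. D \<in> mle_event n d \<and> TV (posterior n d \<pi> D) (laplace n d \<theta>s D) \<le> \<epsilon>}"
    unfolding mle_event_def sets_eq_imp_space_eq[OF sets_data_law] mem_Collect_eq conj_assoc ..
  also have "\<dots> = {D. D \<in> mle_event n d \<and> \<Delta> D \<le> \<epsilon>}"
    by (intro Collect_cong conj_cong refl) (simp only: TV)
  also have "\<dots> = mle_event n d \<inter> {D \<in> space ?M. \<Delta> D \<le> \<epsilon>}"
    using sets.sets_into_space[OF mle_event_measurable[OF n, of d]] by blast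
  also have "\<dots> \<in> sets ?M"
    by (intro sets.Int mle_event_measurable[OF n] borel_measurable_le \<Delta>m borel_measurable_const)
  finally show ?thesis by (simp add: sets_data_law)
qed

section \<open>Asymptotics\<close>

text \<open>The population curvature is at least \<open>dsigm R / 2\<close>; a deviation of half of
  it leaves \<open>dsigm R / 4\<close>. The Gram matrix has mean the identity and deviation 1, hence
  the constant 2. In the probability bound \<open>3 / (dsigm R / 4)^2\<close> belongs to the Fisher
  matrix, and 6 is 3 for the Gram matrix plus 3 for the row norms used by the cubic form.\<close>

lemma sample_conditions:
  assumes n: "n > 0" and d: "d > 0" and K: "K > 0" and R: "R > 0" "6 * (enorm d \<theta>s)\<^sup>2 \<le> R\<^sup>2" and \<theta>s: "\<theta>s \<in> Rd d"
  obtains A where "A \<in> sets (data_law n d \<theta>s)"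
    "measure (data_law n d \<theta>s) A \<le> 1 / (4 * K\<^sup>2) + (3 / (dsigm R / 4)\<^sup>2 + 6) * ((real d)\<^sup>2 / n) + exp (5 * real d - sqrt n)"
    "\<And>X Y. (X, Y) \<in> space (data_law n d \<theta>s) - A \<Longrightarrow> logistic_sample n d X Y \<theta>s K (dsigm R / 4) 2 16768"
proof -
  let ?M = "data_law n d \<theta>s"
  interpret D: prob_space ?M by (rule prob_space_data_law)
  define lam where "lam = dsigm R / 4"
  have lam: "lam > 0" using dsigm_range[of R] by (simp add: lam_def)
  have wm: "(\<lambda>x. dsigm (dot d x \<theta>s)) \<in> borel_measurable (leb d)"
    by (rule measurable_compose[OF measurable_dot measurable_dsigm])
  have w1: "0 \<le> dsigm (dot d x \<theta>s)" "dsigm (dot d x \<theta>s) \<le> 1" for x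
    using dsigm_range[of "dot d x \<theta>s"] by auto
  obtain A1 where A1: "A1 \<in> sets ?M" "measure ?M A1 \<le> 1 / (4 * K\<^sup>2)"
    "\<And>X Y u. (X, Y) \<in> space ?M - A1 \<Longrightarrow>
       \<bar>\<Sum>i<n. (sigm (dot d (X i) \<theta>s) - of_bool (Y i)) * dot d (X i) u\<bar> \<le> K * sqrt (real n * real d) * enorm d u"
    using score_bound[OF n d K] by blast
  obtain A2 where A2: "A2 \<in> sets (design n d)" "measure (design n d) A2 \<le> 3 * (real d)\<^sup>2 / (real n * lam\<^sup>2)"
    "\<And>X u. X \<in> space (design n d) - A2 \<Longrightarrow>
       \<bar>(\<Sum>i<n. dsigm (dot d (X i) \<theta>s) * (dot d (X i) u)\<^sup>2) / n - (\<integral>x. dsigm (dot d x \<theta>s) * (dot d x u)\<^sup>2 \<partial>std_gauss d)\<bar> \<le> lam * (enorm d u)\<^sup>2"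
    using weighted_gram_concentration[OF wm w1 lam n] by blast
  obtain A3 where A3: "A3 \<in> sets (design n d)" "measure (design n d) A3 \<le> 3 * (real d)\<^sup>2 / (real n * 1\<^sup>2)"
    "\<And>X u. X \<in> space (design n d) - A3 \<Longrightarrow>
       \<bar>(\<Sum>i<n. 1 * (dot d (X i) u)\<^sup>2) / n - (\<integral>x. 1 * (dot d x u)\<^sup>2 \<partial>std_gauss d)\<bar> \<le> 1 * (enorm d u)\<^sup>2"
    using weighted_gram_concentration[of "\<lambda>_. 1" d 1 n] n by auto
  obtain A4 where A4: "A4 \<in> sets (design n d)" "measure (design n d) A4 \<le> 3 * (real d)\<^sup>2 / n + exp (5 * real d - sqrt n)"
    "\<And>X u. X \<in> space (design n d) - A4 \<Longrightarrow> (\<Sum>i<n. \<bar>dot d (X i) u\<bar> ^ 3) \<le> 16768 * real n * enorm d u ^ 3"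
    using cubic_bound[OF n d] by blast
  let ?S = "space (labels n)"
  note E = design_event[of _ n d \<theta>s]
  let ?A = "A1 \<union> (A2 \<times> ?S \<union> (A3 \<times> ?S \<union> A4 \<times> ?S))"
  show ?thesis
  proof (rule that[of ?A])
    note s = E(1)[OF A2(1)] E(1)[OF A3(1)] E(1)[OF A4(1)]
    show "?A \<in> sets ?M" using A1(1) s by auto
    have "measure ?M ?A \<le> measure ?M A1 + (measure ?M (A2 \<times> ?S) + (measure ?M (A3 \<times> ?S) + measure ?M (A4 \<times> ?S)))"
      using s A1(1) measure_Un_le[of A1 ?M "A2 \<times> ?S \<union> (A3 \<times> ?S \<union> A4 \<times> ?S)"] measure_Un_le[of "A2 \<times> ?S" ?M "A3 \<times> ?S \<union> A4 \<times> ?S"]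
        measure_Un_le[of "A3 \<times> ?S" ?M "A4 \<times> ?S"] by (simp add: sets.Un)
    also have "\<dots> \<le> 1 / (4 * K\<^sup>2) + (3 * (real d)\<^sup>2 / (real n * lam\<^sup>2) + (3 * (real d)\<^sup>2 / (real n * 1\<^sup>2)
        + (3 * (real d)\<^sup>2 / n + exp (5 * real d - sqrt n))))"
      unfolding E(2)[OF A2(1)] E(2)[OF A3(1)] E(2)[OF A4(1)] by (intro add_mono A1(2) A2(2) A3(2) A4(2))
    also have "\<dots> = 1 / (4 * K\<^sup>2) + (3 / lam\<^sup>2 + 6) * ((real d)\<^sup>2 / n) + exp (5 * real d - sqrt n)"
      using n lam by (simp add: field_simps)
    finally show "measure ?M ?A \<le> 1 / (4 * K\<^sup>2) + (3 / (dsigm R / 4)\<^sup>2 + 6) * ((real d)\<^sup>2 / n) + exp (5 * real d - sqrt n)"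
      by (simp only: lam_def)
    fix X Y assume XY: "(X, Y) \<in> space ?M - ?A"
    then have X: "X \<in> space (design n d)" "X \<notin> A2" "X \<notin> A3" "X \<notin> A4" and XY1: "(X, Y) \<in> space ?M - A1"
      by (auto simp: space_data_law)
    have "logistic_sample n d X Y \<theta>s K lam 2 16768"
    proof
      fix u
      show "\<bar>\<Sum>i<n. (sigm (dot d (X i) \<theta>s) - of_bool (Y i)) * dot d (X i) u\<bar> \<le> K * sqrt (real n * real d) * enorm d u"
        by (rule A1(3)[OF XY1])
      show "(\<Sum>i<n. \<bar>dot d (X i) u\<bar> ^ 3) \<le> 16768 * real n * enorm d u ^ 3" using A4(3) X by auto
      have "(\<Sum>i<n. (dot d (X i) u)\<^sup>2) / n \<le> 2 * (enorm d u)\<^sup>2"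
        using A3(3)[of X u] X dot_moment2(2)[of d u] by (simp add: abs_le_iff)
      then show "(\<Sum>i<n. (dot d (X i) u)\<^sup>2) \<le> 2 * real n * (enorm d u)\<^sup>2" using n by (simp add: divide_le_eq mult_ac)
      have "2 * lam * (enorm d u)\<^sup>2 \<le> (\<integral>x. dsigm (dot d x \<theta>s) * (dot d x u)\<^sup>2 \<partial>std_gauss d)"
        using population_fisher_lower[OF R, of u] by (simp add: lam_def)
      then have "lam * (enorm d u)\<^sup>2 \<le> (\<Sum>i<n. dsigm (dot d (X i) \<theta>s) * (dot d (X i) u)\<^sup>2) / n"
        using A2(3)[of X u] X by (simp add: abs_le_iff)
      then show "lam * real n * (enorm d u)\<^sup>2 \<le> (\<Sum>i<n. dsigm (dot d (X i) \<theta>s) * (dot d (X i) u)\<^sup>2)"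
        using n by (simp add: le_divide_eq mult_ac)
    qed (use n d K lam \<theta>s in auto)
    then show "logistic_sample n d X Y \<theta>s K (dsigm R / 4) 2 16768" by (simp only: lam_def)
  qed
qed

lemma M0_bound:
  assumes C: "\<bar>M0 d \<theta>s \<pi>\<bar> \<le> ereal C" and d: "d > 0" and pos: "\<And>\<theta>. \<theta> \<in> Rd d \<Longrightarrow> \<pi> \<theta> > 0"
    and \<theta>s: "\<theta>s \<in> Rd d" and \<theta>: "\<theta> \<in> Rd d"
  shows "ln (\<pi> \<theta>) - ln (\<pi> \<theta>s) \<le> C * d"
proof -
  have b: "bdd_above (\<pi> ` Rd d)" using C by (auto simp: M0_def split: if_splits)
  have "\<bar>1 / real d * ln ((SUP \<theta>\<in>Rd d. \<pi> \<theta>) / \<pi> \<theta>s)\<bar> \<le> C" using C b by (auto simp: M0_def)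
  then have "1 / real d * ln ((SUP \<theta>\<in>Rd d. \<pi> \<theta>) / \<pi> \<theta>s) \<le> C" by linarith
  then have "ln ((SUP \<theta>\<in>Rd d. \<pi> \<theta>) / \<pi> \<theta>s) \<le> C * d" using d by (simp add: divide_le_eq)
  moreover have "\<pi> \<theta> \<le> (SUP \<theta>\<in>Rd d. \<pi> \<theta>)" by (rule cSUP_upper[OF \<theta> b])
  then have "ln (\<pi> \<theta> / \<pi> \<theta>s) \<le> ln ((SUP \<theta>\<in>Rd d. \<pi> \<theta>) / \<pi> \<theta>s)"
    using pos[OF \<theta>] pos[OF \<theta>s] by (intro ln_mono divide_right_mono divide_pos_pos) auto
  moreover have "ln (\<pi> \<theta> / \<pi> \<theta>s) = ln (\<pi> \<theta>) - ln (\<pi> \<theta>s)" using pos[OF \<theta>] pos[OF \<theta>s] by (simp add: ln_div)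
  ultimately show ?thesis by simp
qed

lemma ereal_le_of_divide_less:
  fixes x :: ereal
  assumes "c > 0" "x / ereal c < ereal k" shows "x \<le> ereal (k * c)"
  using assms by (cases x) (auto simp: field_simps)

theorem corollary4p14:
  fixes d :: "nat \<Rightarrow> nat"
    and \<theta>s :: "nat \<Rightarrow> nat \<Rightarrow> real"
    and \<pi>0 :: "nat \<Rightarrow> (nat \<Rightarrow> real) \<Rightarrow> real"
  assumes dim: "\<And>n. d n \<ge> 1"
    and truth: "\<And>n. \<theta>s n \<in> Rd (d n)"
    and prior: "\<And>n. positive_density (d n) (\<pi>0 n)"
    and truth_bounded: "(\<lambda>n. enorm (d n) (\<theta>s n)) \<in> O(\<lambda>_. 1)"
    and M0_bounded: "\<exists>C::real. eventually (\<lambda>n. \<bar>M0 (d n) (\<theta>s n) (\<pi>0 n)\<bar> \<le> ereal C) sequentially"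
    and delta_small: "\<And>s. s \<ge> 0 \<Longrightarrow>
      (\<lambda>n. delta01 n (d n) (\<theta>s n) (\<pi>0 n) s / ereal (sqrt (real n))) \<longlonglongrightarrow> 0"
    and dim_growth: "(\<lambda>n. real (d n) ^ 2 / real n) \<in> o(\<lambda>_. 1)"
  shows "\<forall>\<epsilon>>0. (\<lambda>n. measure (data_law n (d n) (\<theta>s n))
      {D \<in> space (data_law n (d n) (\<theta>s n)).
         (\<exists>!\<theta>. is_mle n (d n) D \<theta>) \<and>
         TV (posterior n (d n) (\<pi>0 n) D) (laplace n (d n) (\<theta>s n) D) \<le> \<epsilon>}) \<longlonglongrightarrow> 1"
proof (intro allI impI)
  fix \<epsilon> :: real assume \<epsilon>: "\<epsilon> > 0"
  let ?r = "\<lambda>n. real (d n) ^ 2 / real n"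
  let ?G = "\<lambda>n. {D \<in> space (data_law n (d n) (\<theta>s n)). (\<exists>!\<theta>. is_mle n (d n) D \<theta>) \<and>
         TV (posterior n (d n) (\<pi>0 n) D) (laplace n (d n) (\<theta>s n) D) \<le> \<epsilon>}"
  have r0: "?r \<longlonglongrightarrow> 0" using smalloD_tendsto[OF dim_growth] by simp
  have r_small: "\<forall>\<^sub>F n in sequentially. ?r n < c" if "c > 0" for c
    using order_tendstoD(2)[OF r0 that] .
  obtain c\<theta> where c\<theta>: "c\<theta> > 0" "\<forall>\<^sub>F n in sequentially. enorm (d n) (\<theta>s n) \<le> c\<theta>"
    using truth_bounded by (elim landau_o.bigE) auto
  obtain C0 where C0: "\<forall>\<^sub>F n in sequentially. \<bar>M0 (d n) (\<theta>s n) (\<pi>0 n)\<bar> \<le> ereal C0"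
    using M0_bounded by blast
  \<comment> \<open>All constants below depend on \<open>\<epsilon>\<close>, \<open>\<rho>\<close>
    and the bounds \<open>c\<theta>\<close>, \<open>C0\<close> only. They are fixed before
    \<open>n\<close> is taken large, in an order in which none depends on a later one.\<close>
  have main: "\<forall>\<^sub>F n in sequentially. 1 - \<rho> \<le> measure (data_law n (d n) (\<theta>s n)) (?G n)" if \<rho>: "\<rho> > 0" for \<rho> :: real
  proof -
    define C where "C = max C0 0"
    \<comment> \<open>Any multiple of \<open>c\<theta>\<close> whose square is at least 6 would do
      here.\<close>
    define R where "R = 3 * c\<theta>"
    have R: "R > 0" using c\<theta> by (simp add: R_def)
    define lam where "lam = dsigm R / 4"
    have lam: "lam > 0" using dsigm_range[of R] by (simp add: lam_def)
    \<comment> \<open>This makes the failure probability of the score bound equal to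
      \<open>\<rho> / 4\<close>. Two further quarters are spent on \<open>c3\<close> and on the
      exponential term.\<close>
    define K where "K = sqrt (1 / \<rho>)"
    have K: "K > 0" "1 / (4 * K\<^sup>2) = \<rho> / 4" using \<rho> by (auto simp: K_def)
    define t0 where "t0 = 8 * K / lam"
    define A where "A = C + K + 2 * (1 + t0)\<^sup>2 + 1"
    define \<zeta> where "\<zeta> = (\<epsilon> / 2)\<^sup>2"
    have \<zeta>: "\<zeta> > 0" using \<epsilon> by (simp add: \<zeta>_def)
    define \<tau> where "\<tau> = min 1 (\<epsilon> / 4)"
    have \<tau>: "\<tau> > 0" "\<tau> \<le> 1" "sqrt \<zeta> + 2 * \<tau> \<le> \<epsilon>" using \<epsilon> by (auto simp: \<tau>_def \<zeta>_def)
    \<comment> \<open>\<open>A\<close> involves \<open>K\<close> and \<open>t0\<close> but not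
      \<open>t\<close>, so \<open>t\<close> may be chosen after it; the last entry makes the tail
      ratio at most \<open>\<tau>\<close>.\<close>
    define t where "t = max (max (2 * t0) 1) (8 * exp (2 * A) / (lam * \<tau>))"
    have t: "t \<ge> 2 * t0" "t \<ge> 1" "8 * exp (2 * A) / (lam * \<tau>) \<le> t" by (auto simp: t_def)
    have tpos: "t > 0" using t(2) by simp
    have \<tau>t: "exp (2 * A) / (lam / 8 * t) \<le> \<tau>"
      using t(3) lam \<tau>(1) tpos by (simp add: field_simps)
    define l where "l = ln (1 + \<zeta>)"
    have l: "l > 0" using \<zeta> by (simp add: l_def)
    \<comment> \<open>The bound for the prior gradient in units of \<open>sqrt n\<close>. It is
      allotted half of the exponent \<open>l\<close>; the likelihood part receives the other half
      through \<open>c1\<close>.\<close>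
    define \<kappa> where "\<kappa> = min 1 (sqrt (lam * l / 4))"
    have \<kappa>: "\<kappa> > 0" "\<kappa> \<le> 1" using lam l by (auto simp: \<kappa>_def)
    have \<kappa>2: "2 * \<kappa>\<^sup>2 \<le> lam * l / 2"
    proof -
      have "\<kappa>\<^sup>2 \<le> (sqrt (lam * l / 4))\<^sup>2" using \<kappa> by (intro power_mono) (auto simp: \<kappa>_def)
      then show ?thesis using lam l by simp
    qed
    define B where "B = 4 * 16768 * t\<^sup>2"
    have B: "B > 0" using tpos by (simp add: B_def)
    \<comment> \<open>Thresholds for d^2/n: \<open>c1\<close> controls the Lipschitz constant of the
      likelihood part, \<open>c2\<close> the cubic remainder (through d/n \<le> d^2/n), and
      \<open>c3\<close> the failure of the quadratic and row-norm bounds. The further threshold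
      1/100 gives 10 d \<le> sqrt n, so that exp (5 d - sqrt n) is at most exp (- sqrt n /
      2).\<close>
    define c1 where "c1 = lam * l / (4 * B\<^sup>2)"
    define c2 where "c2 = (3 * lam / (4 * 16768 * t))\<^sup>2"
    define c3 where "c3 = \<rho> / (4 * (3 / lam\<^sup>2 + 6))"
    have c: "c1 > 0" "c2 > 0" "c3 > 0" using lam l B tpos \<rho> by (auto simp: c1_def c2_def c3_def add_pos_pos)
    have "(\<lambda>n. exp (- sqrt (real n) / 2)) \<longlonglongrightarrow> 0" by real_asymp
    then have exp_small: "\<forall>\<^sub>F n in sequentially. exp (- sqrt (real n) / 2) < \<rho> / 4"
      using \<rho> by (intro order_tendstoD(2)) auto
    have delta: "\<forall>\<^sub>F n in sequentially. delta01 n (d n) (\<theta>s n) (\<pi>0 n) t / ereal (sqrt (real n)) < ereal \<kappa>"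
      using delta_small[of t] tpos \<kappa> by (intro order_tendstoD(2)) auto
    show ?thesis
      using c\<theta>(2) C0 delta exp_small r_small[OF c(1)] r_small[OF c(2)] r_small[OF c(3)] r_small[of "1 / 100", simplified]
        eventually_gt_at_top[of "0::nat"]
    proof eventually_elim
      case (elim n)
      let ?d = "d n" and ?\<theta> = "\<theta>s n" and ?\<pi> = "\<pi>0 n"
      have n: "n > 0" and d: "?d > 0" using elim dim[of n] by auto
      have \<pi>pos: "\<And>\<theta>. \<theta> \<in> Rd ?d \<Longrightarrow> ?\<pi> \<theta> > 0" using prior[of n] by (simp add: positive_density_def)
      have R6: "6 * (enorm ?d ?\<theta>)\<^sup>2 \<le> R\<^sup>2"
      proof -
        have "(enorm ?d ?\<theta>)\<^sup>2 \<le> c\<theta>\<^sup>2" using elim(1) by (intro power_mono) auto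
        then have "6 * (enorm ?d ?\<theta>)\<^sup>2 \<le> 9 * c\<theta>\<^sup>2" using zero_le_power2[of c\<theta>] by linarith
        then show ?thesis by (simp add: R_def power_mult_distrib)
      qed
      obtain Bad where Bad: "Bad \<in> sets (data_law n ?d ?\<theta>)"
        "measure (data_law n ?d ?\<theta>) Bad \<le> 1 / (4 * K\<^sup>2) + (3 / (dsigm R / 4)\<^sup>2 + 6) * ((real ?d)\<^sup>2 / n) + exp (5 * real ?d - sqrt n)"
        "\<And>X Y. (X, Y) \<in> space (data_law n ?d ?\<theta>) - Bad \<Longrightarrow> logistic_sample n ?d X Y ?\<theta> K (dsigm R / 4) 2 16768"
        using sample_conditions[OF n d K(1) R R6 truth] by blast
      have bad_small: "measure (data_law n ?d ?\<theta>) Bad \<le> \<rho>"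
      proof -
        have "(3 / lam\<^sup>2 + 6) * ?r n \<le> (3 / lam\<^sup>2 + 6) * c3" using elim lam by (intro mult_left_mono) auto
        also have "\<dots> = \<rho> / 4"
        proof -
          have "w * (\<rho> / (4 * w)) = \<rho> / 4" if "w > 0" for w :: real using that by simp
          from this[of "3 / lam\<^sup>2 + 6"] show ?thesis using lam by (simp only: c3_def) (simp add: add_pos_pos)
        qed
        finally have 1: "(3 / lam\<^sup>2 + 6) * ?r n \<le> \<rho> / 4" .
        have "100 * (real ?d)\<^sup>2 \<le> real n" using elim n by (simp add: field_simps)
        then have "(10 * real ?d)\<^sup>2 \<le> real n" by (simp add: power_mult_distrib)
        then have "10 * real ?d \<le> sqrt n" by (rule real_le_rsqrt)
        then have "exp (5 * real ?d - sqrt n) \<le> exp (- sqrt n / 2)" by simp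
        then have "exp (5 * real ?d - sqrt n) \<le> \<rho> / 4" using elim by linarith
        with 1 Bad(2) K(2) \<rho> show ?thesis by (simp add: lam_def)
      qed
      define \<delta> where "\<delta> = \<kappa> * sqrt n"
      have \<delta>: "0 \<le> \<delta>" "\<delta> \<le> sqrt n" using \<kappa> by (auto simp: \<delta>_def mult_left_le_one_le)
      have \<delta>le: "delta01 n ?d ?\<theta> ?\<pi> t \<le> ereal \<delta>"
        unfolding \<delta>_def using elim n by (intro ereal_le_of_divide_less) auto
      have expb: "exp ((4 * 16768 * t\<^sup>2 * real ?d + \<delta>)\<^sup>2 / (real n * lam)) \<le> 1 + \<zeta>"
      proof -
        have "(B * real ?d + \<delta>)\<^sup>2 \<le> 2 * (B * real ?d)\<^sup>2 + 2 * \<delta>\<^sup>2"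
          using zero_le_power2[of "B * real ?d - \<delta>"] by (simp add: power2_eq_square algebra_simps)
        also have "\<dots> = real n * (2 * B\<^sup>2 * ?r n + 2 * \<kappa>\<^sup>2)"
          using n by (simp add: \<delta>_def power_mult_distrib field_simps)
        also have "\<dots> \<le> real n * (2 * B\<^sup>2 * c1 + lam * l / 2)"
          using elim \<kappa>2 by (intro mult_left_mono add_mono) auto
        also have "2 * B\<^sup>2 * c1 = lam * l / 2" using B by (simp add: c1_def)
        finally have "(B * real ?d + \<delta>)\<^sup>2 \<le> l * (real n * lam)" by (simp add: algebra_simps)
        then have "(B * real ?d + \<delta>)\<^sup>2 / (real n * lam) \<le> l" using n lam by (simp add: divide_le_eq)
        then have "exp ((B * real ?d + \<delta>)\<^sup>2 / (real n * lam)) \<le> exp l" by simp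
        then show ?thesis using \<zeta> by (simp add: l_def B_def)
      qed
      have small: "16768 * (t * sqrt (real ?d / real n)) \<le> 3 * lam / 4"
      proof -
        have "real ?d \<le> (real ?d)\<^sup>2" using dim[of n] by (simp add: power2_eq_square)
        then have "real ?d / real n \<le> ?r n" by (intro divide_right_mono) auto
        then have "sqrt (real ?d / real n) \<le> sqrt c2" using elim by (intro real_sqrt_le_mono) linarith
        also have "\<dots> = 3 * lam / (4 * 16768 * t)" using lam tpos by (simp add: c2_def)
        finally have "16768 * t * sqrt (real ?d / real n) \<le> 16768 * t * (3 * lam / (4 * 16768 * t))"
          using tpos by (intro mult_left_mono) auto
        also have "\<dots> = 3 * lam / 4" using tpos by simp
        finally show ?thesis by (simp add: mult_ac)
      qed
      have sub: "space (data_law n ?d ?\<theta>) - Bad \<subseteq> ?G n"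
      proof
        fix D assume D: "D \<in> space (data_law n ?d ?\<theta>) - Bad"
        obtain X Y where XY: "D = (X, Y)" by (cases D)
        interpret S: logistic_sample n ?d X Y ?\<theta> K lam 2 16768
          unfolding lam_def by (rule Bad(3)) (use D XY in simp)
        have t0: "S.t0 = t0" by (simp add: S.t0_def t0_def)
        have rho: "S.rho = sqrt (real ?d / real n)" by (simp add: S.rho_def)
        have rpos: "0 \<le> sqrt (real ?d / real n)" by simp
        have t0pos: "0 < t0" using S.t0_pos t0 by simp
        have small0: "16768 * (S.t0 * S.rho) \<le> 3 * lam / 4"
        proof -
          have "t0 * sqrt (real ?d / real n) \<le> t * sqrt (real ?d / real n)"
            using t(1) t0pos rpos by (intro mult_right_mono) auto
          then show ?thesis using small unfolding t0 rho by linarith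
        qed
        have "TV (posterior n ?d ?\<pi> (X, Y)) (laplace n ?d ?\<theta> (X, Y)) \<le> sqrt \<zeta> + 2 * \<tau>"
        proof (rule S.tv_laplace_bound[where C=C and t=t and \<delta>=\<delta>])
          show "positive_density ?d ?\<pi>" by (rule prior)
          show "0 \<le> C" by (simp add: C_def)
          show "ln (?\<pi> \<theta>) - ln (?\<pi> ?\<theta>) \<le> C * real ?d" if "\<theta> \<in> Rd ?d" for \<theta>
          proof -
            have "ln (?\<pi> \<theta>) - ln (?\<pi> ?\<theta>) \<le> C0 * real ?d"
              using elim by (intro M0_bound d \<pi>pos truth that) auto
            also have "\<dots> \<le> C * real ?d" by (intro mult_right_mono) (auto simp: C_def)
            finally show ?thesis .
          qed
          show "ln (?\<pi> q) - ln (?\<pi> p) \<le> \<delta> * enorm ?d (\<lambda>j. q j - p j)"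
            if "p \<in> Rd ?d" "q \<in> Rd ?d" "enorm ?d (\<lambda>j. p j - ?\<theta> j) \<le> t * S.rho" "enorm ?d (\<lambda>j. q j - ?\<theta> j) \<le> t * S.rho" for p q
            using that by (intro log_prior_lipschitz[OF \<delta>le \<pi>pos]) (auto simp: loc_ball_def rho)
          show "exp (2 * (C + K + 2 * (1 + S.t0)\<^sup>2 + 1)) / (lam / 8 * t) \<le> \<tau>" using \<tau>t by (simp only: t0 A_def)
        qed (use t \<tau> \<zeta> \<delta> small expb in \<open>simp_all add: t0 rho\<close>)
        then have "TV (posterior n ?d ?\<pi> D) (laplace n ?d ?\<theta> D) \<le> \<epsilon>" using \<tau>(3) XY by simp
        moreover have "\<exists>!\<theta>. is_mle n ?d D \<theta>" using S.mle_ex1(1)[OF small0] XY by simp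
        ultimately show "D \<in> ?G n" using D by simp
      qed
      interpret P: prob_space "data_law n ?d ?\<theta>" by (rule prob_space_data_law)
      have "1 - \<rho> \<le> measure (data_law n ?d ?\<theta>) (space (data_law n ?d ?\<theta>) - Bad)"
        using P.prob_compl[OF Bad(1)] bad_small by simp
      also have "\<dots> \<le> measure (data_law n ?d ?\<theta>) (?G n)"
        by (rule P.finite_measure_mono[OF sub good_event_measurable[OF n prior]])
      finally show ?case .
    qed
  qed
  show "(\<lambda>n. measure (data_law n (d n) (\<theta>s n)) (?G n)) \<longlonglongrightarrow> 1"
  proof (rule LIMSEQ_I)
    fix \<rho> :: real assume "\<rho> > 0"
    then have "\<forall>\<^sub>F n in sequentially. 1 - \<rho> / 2 \<le> measure (data_law n (d n) (\<theta>s n)) (?G n)" by (intro main) simp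
    then obtain N where N: "\<And>n. n \<ge> N \<Longrightarrow> 1 - \<rho> / 2 \<le> measure (data_law n (d n) (\<theta>s n)) (?G n)"
      by (auto simp: eventually_sequentially)
    show "\<exists>N. \<forall>n\<ge>N. norm (measure (data_law n (d n) (\<theta>s n)) (?G n) - 1) < \<rho>"
    proof (intro exI[of _ N] allI impI)
      fix n assume "N \<le> n"
      then have "1 - \<rho> / 2 \<le> measure (data_law n (d n) (\<theta>s n)) (?G n)" by (rule N)
      moreover have "measure (data_law n (d n) (\<theta>s n)) (?G n) \<le> 1"
        by (rule prob_space.prob_le_1[OF prob_space_data_law])
      ultimately show "norm (measure (data_law n (d n) (\<theta>s n)) (?G n) - 1) < \<rho>" using \<open>\<rho> > 0\<close> by simp
    qed
  qed
qed

end
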